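(* The constrained SPE existence problem for RP games is $\mathsf{EXPTIME}$-complete, already for three payoffs per player. That is, the problem (for arbitrary RP games) belongs to $\mathsf{EXPTIME}$, and it is $\mathsf{EXPTIME}$-hard even when restricted to RP games in which each player $i$ has a payoff set $P_i$ with three elements (the number of players being unrestricted).
   Context: **Arenas.** An arena is $A=(V,E,\mathcal P,(V_i)_{i\in\mathcal P})$ with $V$ a finite set of vertices, $E\subseteq V\times V$ such that every vertex has at least one successor, $\mathcal P$ a finite set of players, and $(V_i)_{i\in\mathcal P}$ a partition of $V$ ($V_i$ is the set of vertices owned by player $i$). A play (resp. history) is an infinite (resp. finite) sequence of vertices following edges. $\mathsf{Hist}(v)$ denotes the set of histories starting with $v$. **Games.** A game $\mathcal G=(A,(\mathsf{pay}_i)_{i\in\mathcal P})$ consists of an arena and, for each player $i$, a payoff function $\mathsf{pay}_i:V^\omega\to P_i$, where $P_i$ is a set equipped with a binary relation $\ltimes_i\subseteq P_i\times P_i$ (the preference relation; $p\ltimes_i p'$ means $p'$ is preferred to $p$). It is a *regular-payoff game* (RP game) if, for each $i$, $P_i$ is finite and $\mathsf{pay}_i^{-1}(p)$ is $\omega$-regular for each $p\in P_i$. No condition is imposed on $\ltimes_i$. As an input to a decision problem, an RP game is given by its arena, the finite sets $P_i$ and relations $\ltimes_i$ listed explicitly, and, for each $i$ and each $p\in P_i$, a deterministic parity automaton over the alphabet $V$ accepting $\mathsf{pay}_i^{-1}(p)$. **Strategies and equilibria.** A strategy $\sigma_i$ of player $i$ maps each history $hv$ with $v\in V_i$ to a successor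 of $v$. A strategy profile is $\bar\sigma=(\sigma_i)_{i\in\mathcal P}$; its outcome $\langle\bar\sigma\rangle_v$ is the unique play from $v$ consistent with all $\sigma_i$; $\bar\sigma_{-i}=(\sigma_j)_{j\neq i}$. A profile $\bar\sigma$ is a Nash equilibrium (NE) from $v$ if for every player $i$ and every strategy $\tau_i$ of player $i$, it is not the case that $\mathsf{pay}_i(\langle\bar\sigma\rangle_v)\ltimes_i\mathsf{pay}_i(\langle(\tau_i,\bar\sigma_{-i})\rangle_v)$. For a history $h$, the subgame $\mathcal G_{\restriction h}$ has the same arena and payoff functions $\pi\mapsto\mathsf{pay}_i(h\pi)$, and $\sigma_{i\upharpoonright h}(h')=\sigma_i(hh')$. A profile $\bar\sigma$ is a subgame perfect equilibrium (SPE) from $v_0$ if for all $hv\in\mathsf{Hist}(v_0)$ ($h$ possibly empty), $\bar\sigma_{\upharpoonright h}$ is an NE from $v$ in $\mathcal G_{\restriction h}$. **Problem.** The constrained SPE existence problem: given an RP game, a vertex $v$ and a payoff $p_i\in P_i$ for each player $i$, decide whether there exists an SPE $\bar\sigma$ from $v$ such that for all $i\in\mathcal P$, $p_i=\mathsf{pay}_i(\langle\bar\sigma\rangle_v)$ or $p_i\ltimes_i\mathsf{pay}_i(\langle\bar\sigma\rangle_v)$. *)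

theory Defs
  imports
    "HOL-Library.Omega_Words_Fun"
    "HOL-Library.Disjoint_Sets"
    "HOL-Computational_Algebra.Polynomial"
begin

section \<open>Deterministic parity automata and omega-regular languages\<close>

record ('q, 'v) dpa =
  dpa_states :: "'q set"
  dpa_init :: 'q
  dpa_trans :: "'q \<Rightarrow> 'v \<Rightarrow> 'q"
  dpa_prio :: "'q \<Rightarrow> nat"

definition is_dpa :: "'v set \<Rightarrow> ('q, 'v) dpa \<Rightarrow> bool" where
  "is_dpa \<Sigma> A \<longleftrightarrow> finite (dpa_states A) \<and> dpa_init A \<in> dpa_states A \<and>
     (\<forall>q\<in>dpa_states A. \<forall>a\<in>\<Sigma>. dpa_trans A q a \<in> dpa_states A)"

primrec dpa_run :: "('q, 'v) dpa \<Rightarrow> 'v word \<Rightarrow> 'q word" where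
  "dpa_run A w 0 = dpa_init A"
| "dpa_run A w (Suc n) = dpa_trans A (dpa_run A w n) (w n)"

definition omega_words :: "'v set \<Rightarrow> 'v word set" where
  "omega_words \<Sigma> = {w. range w \<subseteq> \<Sigma>}"

text \<open>A run is accepting iff the largest priority occurring infinitely often is even.\<close>

definition dpa_lang :: "'v set \<Rightarrow> ('q, 'v) dpa \<Rightarrow> 'v word set" where
  "dpa_lang \<Sigma> A = {w \<in> omega_words \<Sigma>. even (Max (limit (dpa_prio A \<circ> dpa_run A w)))}"

definition omega_regular :: "'v set \<Rightarrow> 'v word set \<Rightarrow> bool" where
  "omega_regular \<Sigma> L \<longleftrightarrow> (\<exists>A :: (nat, 'v) dpa. is_dpa \<Sigma> A \<and> dpa_lang \<Sigma> A = L)"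


section \<open>Games\<close>

record ('v, 'i) arena =
  verts :: "'v set"
  edges :: "('v \<times> 'v) set"
  players :: "'i set"
  owned :: "'i \<Rightarrow> 'v set"

record ('v, 'i, 'p) game = "('v, 'i) arena" +
  payoffs :: "'i \<Rightarrow> 'p set"
  pref :: "'i \<Rightarrow> 'p rel"
  pay :: "'i \<Rightarrow> 'v word \<Rightarrow> 'p"

text \<open>\<open>owned\<close> is a partition in the indexed sense: a player may own no vertex.\<close>

definition is_arena :: "('v, 'i, 'z) arena_scheme \<Rightarrow> bool" where
  "is_arena A \<longleftrightarrow>
     finite (verts A) \<and> edges A \<subseteq> verts A \<times> verts A \<and>
     (\<forall>u\<in>verts A. \<exists>v. (u, v) \<in> edges A) \<and>
     finite (players A) \<and>
     disjoint_family_on (owned A) (players A) \<and> (\<Union>i\<in>players A. owned A i) = verts A"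

definition is_game :: "('v, 'i, 'p) game \<Rightarrow> bool" where
  "is_game G \<longleftrightarrow> is_arena G \<and>
     (\<forall>i\<in>players G. pref G i \<subseteq> payoffs G i \<times> payoffs G i \<and>
        (\<forall>w\<in>omega_words (verts G). pay G i w \<in> payoffs G i))"

definition pay_preimage :: "('v, 'i, 'p) game \<Rightarrow> 'i \<Rightarrow> 'p \<Rightarrow> 'v word set" where
  "pay_preimage G i p = {w \<in> omega_words (verts G). pay G i w = p}"

definition rp_game :: "('v, 'i, 'p) game \<Rightarrow> bool" where
  "rp_game G \<longleftrightarrow> is_game G \<and>
     (\<forall>i\<in>players G. finite (payoffs G i) \<and>
        (\<forall>p\<in>payoffs G i. omega_regular (verts G) (pay_preimage G i p)))"

definition play :: "('v, 'i, 'z) arena_scheme \<Rightarrow> 'v word \<Rightarrow> bool" where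
  "play A \<pi> \<longleftrightarrow> \<pi> \<in> omega_words (verts A) \<and> (\<forall>n. (\<pi> n, \<pi> (Suc n)) \<in> edges A)"

definition history :: "('v, 'i, 'z) arena_scheme \<Rightarrow> 'v list \<Rightarrow> bool" where
  "history A h \<longleftrightarrow> set h \<subseteq> verts A \<and> successively (\<lambda>u v. (u, v) \<in> edges A) h"

definition Hist :: "('v, 'i, 'z) arena_scheme \<Rightarrow> 'v \<Rightarrow> 'v list set" where
  "Hist A v = {h. history A h \<and> h \<noteq> [] \<and> hd h = v}"


section \<open>Strategies and equilibria\<close>

type_synonym 'v strategy = "'v list \<Rightarrow> 'v"

definition is_strategy :: "('v, 'i, 'z) arena_scheme \<Rightarrow> 'i \<Rightarrow> 'v strategy \<Rightarrow> bool" where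
  "is_strategy A i \<sigma> \<longleftrightarrow>
     (\<forall>h. \<forall>v\<in>owned A i. history A (h @ [v]) \<longrightarrow> (v, \<sigma> (h @ [v])) \<in> edges A)"

definition is_profile :: "('v, 'i, 'z) arena_scheme \<Rightarrow> ('i \<Rightarrow> 'v strategy) \<Rightarrow> bool" where
  "is_profile A \<sigma> \<longleftrightarrow> (\<forall>i\<in>players A. is_strategy A i (\<sigma> i))"

definition consistent ::
  "('v, 'i, 'z) arena_scheme \<Rightarrow> 'i \<Rightarrow> 'v strategy \<Rightarrow> 'v word \<Rightarrow> bool" where
  "consistent A i \<sigma> \<pi> \<longleftrightarrow> (\<forall>n. \<pi> n \<in> owned A i \<longrightarrow> \<pi> (Suc n) = \<sigma> (\<pi> [0 \<rightarrow> Suc n]))"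

definition outcome ::
  "('v, 'i, 'z) arena_scheme \<Rightarrow> ('i \<Rightarrow> 'v strategy) \<Rightarrow> 'v \<Rightarrow> 'v word" where
  "outcome A \<sigma> v =
     (THE \<pi>. play A \<pi> \<and> \<pi> 0 = v \<and> (\<forall>i\<in>players A. consistent A i (\<sigma> i) \<pi>))"

text \<open>
  The play in \<open>outcome\<close> exists and is unique as soon as the strategies prescribe successors on
  \<open>Hist A v\<close>, which covers the restrictions of profiles to subgames.
\<close>

primrec outcome_prefix ::
  "('v, 'i, 'z) arena_scheme \<Rightarrow> ('i \<Rightarrow> 'v strategy) \<Rightarrow> 'v \<Rightarrow> nat \<Rightarrow> 'v list" where
  "outcome_prefix A \<sigma> v 0 = [v]"
| "outcome_prefix A \<sigma> v (Suc n) =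
     (let h = outcome_prefix A \<sigma> v n in h @ [\<sigma> (THE i. i \<in> players A \<and> last h \<in> owned A i) h])"

lemma outcome_unique:
  assumes A: "is_arena A" and
    s: "\<And>i h x. i \<in> players A \<Longrightarrow> x \<in> owned A i \<Longrightarrow> h @ [x] \<in> Hist A v \<Longrightarrow> (x, \<sigma> i (h @ [x])) \<in> edges A"
    and v: "v \<in> verts A"
  shows "\<exists>!\<pi>. play A \<pi> \<and> \<pi> 0 = v \<and> (\<forall>i\<in>players A. consistent A i (\<sigma> i) \<pi>)"
proof
  define ow where "ow x = (THE i. i \<in> players A \<and> x \<in> owned A i)" for x
  have ow: "ow x = i" if "i \<in> players A" "x \<in> owned A i" for x i
    unfolding ow_def using that A by (intro the_equality) (auto simp: is_arena_def disjoint_family_on_def, blast)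
  have ow2: "ow x \<in> players A \<and> x \<in> owned A (ow x)" if "x \<in> verts A" for x
  proof -
    have "x \<in> (\<Union>i\<in>players A. owned A i)" using that A by (simp add: is_arena_def)
    then obtain i where "i \<in> players A" "x \<in> owned A i" by blast
    then show ?thesis using ow by auto
  qed
  define H where "H = outcome_prefix A \<sigma> v"
  have H0: "H 0 = [v]" and HS: "H (Suc n) = H n @ [\<sigma> (ow (last (H n))) (H n)]" for n
    by (auto simp: H_def Let_def ow_def)
  define \<pi> where "\<pi> n = last (H n)" for n
  have hist: "H n \<in> Hist A v \<and> H n \<noteq> [] \<and> last (H n) \<in> verts A \<and> H n = \<pi> [0 \<rightarrow> Suc n]" for n
  proof (induction n)
    case 0 then show ?case using v by (auto simp: H0 Hist_def history_def \<pi>_def)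
  next
    case (Suc n)
    let ?x = "last (H n)"
    have Hn: "H n \<in> Hist A v" and ne: "H n \<noteq> []" and x: "?x \<in> verts A"
      and eq: "H n = \<pi> [0 \<rightarrow> Suc n]"
      using Suc by iprover+
    have bl: "butlast (H n) @ [?x] = H n" using ne by simp
    have "(?x, \<sigma> (ow ?x) (butlast (H n) @ [?x])) \<in> edges A"
      using ow2[OF x] Hn by (intro s) (simp_all only: bl)
    then have e: "(?x, \<sigma> (ow ?x) (H n)) \<in> edges A" by (simp only: bl)
    then have xv: "\<sigma> (ow ?x) (H n) \<in> verts A" using A by (auto simp: is_arena_def)
    have \<pi>S: "H (Suc n) = H n @ [\<pi> (Suc n)]" "\<pi> (Suc n) = \<sigma> (ow ?x) (H n)"
      by (simp_all add: \<pi>_def HS)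
    have "H (Suc n) = \<pi> [0 \<rightarrow> Suc (Suc n)]"
      unfolding \<pi>S(1) eq by simp
    moreover have "H (Suc n) \<in> Hist A v"
      using e xv Hn ne by (simp add: HS Hist_def history_def successively_append_iff)
    moreover have "H (Suc n) \<noteq> []" "last (H (Suc n)) \<in> verts A"
      using xv by (simp_all add: HS)
    ultimately show ?case by iprover
  qed
  have Hin: "H n \<in> Hist A v" and Hne: "H n \<noteq> []" and Hv: "last (H n) \<in> verts A"
    and Heq: "H n = \<pi> [0 \<rightarrow> Suc n]" for n
    using hist[of n] by iprover+
  have step: "\<pi> (Suc n) = \<sigma> (ow (\<pi> n)) (H n)" for n
    by (simp add: \<pi>_def HS)
  have st: "\<pi> (Suc n) = \<sigma> (ow (\<pi> n)) (\<pi> [0 \<rightarrow> Suc n])" for n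
    unfolding Heq[symmetric] by (rule step)
  have ed: "(\<pi> n, \<pi> (Suc n)) \<in> edges A" for n
    using Hin[of "Suc n"] Hne[of n] unfolding \<pi>_def
    by (simp add: Hist_def history_def HS successively_append_iff)
  show "play A \<pi> \<and> \<pi> 0 = v \<and> (\<forall>i\<in>players A. consistent A i (\<sigma> i) \<pi>)"
  proof -
    have "\<pi> n \<in> verts A" for n unfolding \<pi>_def by (rule Hv)
    moreover have "\<pi> 0 = v" by (simp add: \<pi>_def H0)
    ultimately show ?thesis using ed st ow by (auto simp: play_def omega_words_def consistent_def)
  qed
  fix \<rho> assume r: "play A \<rho> \<and> \<rho> 0 = v \<and> (\<forall>i\<in>players A. consistent A i (\<sigma> i) \<rho>)"
  have rs: "\<rho> (Suc n) = \<sigma> (ow (\<rho> n)) (\<rho> [0 \<rightarrow> Suc n])" for n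
    using r ow2[of "\<rho> n"] by (auto simp: play_def omega_words_def consistent_def)
  have "\<rho> [0 \<rightarrow> Suc n] = \<pi> [0 \<rightarrow> Suc n] \<and> \<rho> n = \<pi> n" for n
  proof (induction n)
    case 0 then show ?case using r by (simp add: \<pi>_def H0)
  next
    case (Suc n)
    then have "\<rho> (Suc n) = \<pi> (Suc n)" using rs[of n] st[of n] by simp
    then show ?case using Suc by simp
  qed
  then show "\<rho> = \<pi>" by blast
qed

definition nash_equilibrium ::
  "('v, 'i, 'p) game \<Rightarrow> ('i \<Rightarrow> 'v strategy) \<Rightarrow> 'v \<Rightarrow> bool" where
  "nash_equilibrium G \<sigma> v \<longleftrightarrow>
     (\<forall>i\<in>players G. \<forall>\<tau>. is_strategy G i \<tau> \<longrightarrow>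
        (pay G i (outcome G \<sigma> v), pay G i (outcome G (\<sigma>(i := \<tau>)) v)) \<notin> pref G i)"

definition subgame :: "('v, 'i, 'p) game \<Rightarrow> 'v list \<Rightarrow> ('v, 'i, 'p) game" where
  "subgame G h = G\<lparr>pay := \<lambda>i \<pi>. pay G i (h \<frown> \<pi>)\<rparr>"

definition sub_profile :: "('i \<Rightarrow> 'v strategy) \<Rightarrow> 'v list \<Rightarrow> 'i \<Rightarrow> 'v strategy" where
  "sub_profile \<sigma> h = (\<lambda>i h'. \<sigma> i (h @ h'))"

definition subgame_perfect_equilibrium ::
  "('v, 'i, 'p) game \<Rightarrow> ('i \<Rightarrow> 'v strategy) \<Rightarrow> 'v \<Rightarrow> bool" where
  "subgame_perfect_equilibrium G \<sigma> v0 \<longleftrightarrow> is_profile G \<sigma> \<and>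
     (\<forall>h v. h @ [v] \<in> Hist G v0 \<longrightarrow> nash_equilibrium (subgame G h) (sub_profile \<sigma> h) v)"

definition constrained_SPE_exists ::
  "('v, 'i, 'p) game \<Rightarrow> 'v \<Rightarrow> ('i \<Rightarrow> 'p) \<Rightarrow> bool" where
  "constrained_SPE_exists G v p \<longleftrightarrow>
     (\<exists>\<sigma>. subgame_perfect_equilibrium G \<sigma> v \<and>
        (\<forall>i\<in>players G. p i = pay G i (outcome G \<sigma> v) \<or>
                        (p i, pay G i (outcome G \<sigma> v)) \<in> pref G i))"


section \<open>Explicit inputs and their binary encoding\<close>

text \<open>
  An automaton over the alphabet \<open>{..<n}\<close> with states \<open>{..<length (tab_prio T)}\<close> is given by its
  initial state, the list of the priorities of its states, and its transition table (one row per
  state, one column per letter).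
\<close>

record dpa_table =
  tab_init :: nat
  tab_prio :: "nat list"
  tab_trans :: "nat list list"

definition dpa_of_table :: "dpa_table \<Rightarrow> (nat, nat) dpa" where
  "dpa_of_table T =
     \<lparr>dpa_states = {..<length (tab_prio T)}, dpa_init = tab_init T,
      dpa_trans = (\<lambda>q a. tab_trans T ! q ! a), dpa_prio = (\<lambda>q. tab_prio T ! q)\<rparr>"

definition wf_table :: "nat \<Rightarrow> dpa_table \<Rightarrow> bool" where
  "wf_table n T \<longleftrightarrow> length (tab_trans T) = length (tab_prio T) \<and>
     (\<forall>row\<in>set (tab_trans T). length row = n) \<and> is_dpa {..<n} (dpa_of_table T)"

text \<open>
  Vertices, players and payoffs are numbered consecutively from 0. The number of vertices is the
  length of \<open>inp_owner\<close>, the number of players the length of \<open>inp_auts\<close>, and the number of payoffs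
  of player \<open>i\<close> the length of \<open>inp_auts ! i\<close>, whose entry \<open>p\<close> accepts the preimage of payoff \<open>p\<close>.
  \<open>inp_start\<close> and \<open>inp_constr\<close> are the vertex and the payoff constraints.
\<close>

record rp_input =
  inp_edges :: "(nat \<times> nat) list"
  inp_owner :: "nat list"
  inp_prefs :: "(nat \<times> nat) list list"
  inp_auts :: "dpa_table list list"
  inp_start :: nat
  inp_constr :: "nat list"

definition represents :: "rp_input \<Rightarrow> (nat, nat, nat) game \<Rightarrow> bool" where
  "represents I G \<longleftrightarrow>
     verts G = {..<length (inp_owner I)} \<and>
     edges G = set (inp_edges I) \<and>
     players G = {..<length (inp_auts I)} \<and>
     length (inp_prefs I) = length (inp_auts I) \<and>
     (\<forall>i\<in>players G.
        owned G i = {v \<in> verts G. inp_owner I ! v = i} \<and>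
        payoffs G i = {..<length (inp_auts I ! i)} \<and>
        pref G i = set (inp_prefs I ! i) \<and>
        (\<forall>p\<in>payoffs G i. wf_table (length (inp_owner I)) (inp_auts I ! i ! p) \<and>
           dpa_lang (verts G) (dpa_of_table (inp_auts I ! i ! p)) = pay_preimage G i p))"

definition is_instance :: "rp_input \<Rightarrow> (nat, nat, nat) game \<Rightarrow> bool" where
  "is_instance I G \<longleftrightarrow> rp_game G \<and> represents I G \<and>
     inp_start I \<in> verts G \<and> length (inp_constr I) = length (inp_auts I) \<and>
     (\<forall>i\<in>players G. inp_constr I ! i \<in> payoffs G i)"

text \<open>
  Two-bit codes: the digits \<open>b\<close> are \<open>0b\<close>, the opening and closing brackets are \<open>10\<close> and \<open>11\<close>.
  Numbers are written in binary, least significant digit first.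
\<close>

fun enc_digits :: "nat \<Rightarrow> bool list" where
  "enc_digits n = (if n = 0 then [] else [False, odd n] @ enc_digits (n div 2))"

declare enc_digits.simps [simp del]

definition enc_group :: "bool list \<Rightarrow> bool list" where
  "enc_group x = [True, False] @ x @ [True, True]"

definition enc_nat :: "nat \<Rightarrow> bool list" where
  "enc_nat n = enc_group (enc_digits n)"

definition enc_list :: "('a \<Rightarrow> bool list) \<Rightarrow> 'a list \<Rightarrow> bool list" where
  "enc_list f xs = enc_group (concat (map f xs))"

definition enc_pair :: "nat \<times> nat \<Rightarrow> bool list" where
  "enc_pair e = enc_group (enc_nat (fst e) @ enc_nat (snd e))"

definition enc_table :: "dpa_table \<Rightarrow> bool list" where
  "enc_table T = enc_group
     (enc_nat (tab_init T) @ enc_list enc_nat (tab_prio T) @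
      enc_list (enc_list enc_nat) (tab_trans T))"

definition enc_input :: "rp_input \<Rightarrow> bool list" where
  "enc_input I = enc_group
     (enc_list enc_pair (inp_edges I) @ enc_list enc_nat (inp_owner I) @
      enc_list (enc_list enc_pair) (inp_prefs I) @ enc_list (enc_list enc_table) (inp_auts I) @
      enc_nat (inp_start I) @ enc_list enc_nat (inp_constr I))"

definition prefix_free :: "('a \<Rightarrow> bool list) \<Rightarrow> bool" where
  "prefix_free f \<longleftrightarrow> (\<forall>a b u v. f a @ u = f b @ v \<longrightarrow> a = b \<and> u = v) \<and> (\<forall>a. \<exists>z. f a = True # False # z)"

lemma prefix_freeD: "prefix_free f \<Longrightarrow> f a @ u = f b @ v \<longleftrightarrow> a = b \<and> u = v"
  unfolding prefix_free_def by iprover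

lemma prefix_freeI:
  assumes "\<And>a b u v. f a @ u = f b @ v \<Longrightarrow> a = b \<and> u = v" "\<And>a. f a = enc_group (g a)"
  shows "prefix_free f"
proof -
  have "\<forall>a b u v. f a @ u = f b @ v \<longrightarrow> a = b \<and> u = v" using assms(1) by iprover
  moreover have "\<forall>a. \<exists>z. f a = True # False # z" unfolding assms(2) enc_group_def by simp
  ultimately show ?thesis unfolding prefix_free_def by iprover
qed

lemma prefix_free_inject:
  assumes "prefix_free f"
  shows "f a = f b \<longleftrightarrow> a = b"
  using prefix_freeD[OF assms, of a "[]" b "[]"] by simp

lemma prefix_free_start: "prefix_free f \<Longrightarrow> \<exists>z. f a = True # False # z"
  unfolding prefix_free_def by iprover

lemma enc_digits_pf: "enc_digits a @ [True,True] @ u = enc_digits b @ [True,True] @ v \<Longrightarrow> a = b \<and> u = v"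
proof (induction a arbitrary: b rule: less_induct)
  case (less a)
  show ?case
  proof (cases "a = 0 \<or> b = 0")
    case True
    then show ?thesis using less.prems
      by (auto simp: enc_digits.simps[of a] enc_digits.simps[of b] split: if_splits)
  next
    case False
    then have *: "odd a = odd b" "enc_digits (a div 2) @ [True,True] @ u = enc_digits (b div 2) @ [True,True] @ v"
      using less.prems by (auto simp: enc_digits.simps[of a] enc_digits.simps[of b])
    then have "a div 2 = b div 2" "u = v" using less.IH[OF _ *(2)] False by auto
    then show ?thesis using *(1) by (metis dvd_mult_div_cancel odd_two_times_div_two_succ)
  qed
qed

lemma enc_pf_nat: "prefix_free enc_nat"
proof (rule prefix_freeI)
  fix a b u v assume "enc_nat a @ u = enc_nat b @ v"
  then have "enc_digits a @ [True, True] @ u = enc_digits b @ [True, True] @ v"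
    by (simp add: enc_nat_def enc_group_def)
  then show "a = b \<and> u = v" by (rule enc_digits_pf)
qed (rule enc_nat_def)

lemma enc_pf_list_aux:
  assumes f: "prefix_free f"
  shows "concat (map f xs) @ [True, True] @ u = concat (map f ys) @ [True, True] @ v \<Longrightarrow>
    xs = ys \<and> u = v"
proof (induction xs arbitrary: ys)
  case Nil
  show ?case
  proof (cases ys)
    case (Cons b ys')
    obtain z where "f b = True # False # z" using prefix_free_start[OF f] by iprover
    then show ?thesis using Nil.prems Cons by simp
  qed (use Nil.prems in simp)
next
  case (Cons a xs)
  show ?case
  proof (cases ys)
    case Nil
    obtain z where "f a = True # False # z" using prefix_free_start[OF f] by iprover
    then show ?thesis using Cons.prems Nil by simp
  next
    case ys: (Cons b ys')
    then have "f a @ (concat (map f xs) @ [True, True] @ u) =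
        f b @ (concat (map f ys') @ [True, True] @ v)"
      using Cons.prems by simp
    then have "a = b" "concat (map f xs) @ [True, True] @ u = concat (map f ys') @ [True, True] @ v"
      using prefix_freeD[OF f] by iprover+
    then show ?thesis using Cons.IH[of ys'] ys by simp
  qed
qed

lemma enc_pf_list:
  assumes "prefix_free f"
  shows "prefix_free (enc_list f)"
proof (rule prefix_freeI)
  fix xs ys u v assume "enc_list f xs @ u = enc_list f ys @ v"
  then have "concat (map f xs) @ [True, True] @ u = concat (map f ys) @ [True, True] @ v"
    by (simp add: enc_list_def enc_group_def)
  then show "xs = ys \<and> u = v" by (rule enc_pf_list_aux[OF assms])
qed (rule enc_list_def)

lemmas enc_pf_simps =
  prefix_freeD[OF enc_pf_nat]
  prefix_freeD[OF enc_pf_list[OF enc_pf_nat]]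
  prefix_freeD[OF enc_pf_list[OF enc_pf_list[OF enc_pf_nat]]]

lemma enc_pf_pair: "prefix_free enc_pair"
  by (simp add: prefix_free_def enc_pair_def enc_group_def enc_pf_simps prod_eq_iff)

lemma enc_pf_table: "prefix_free enc_table"
  by (simp add: prefix_free_def enc_table_def enc_group_def enc_pf_simps)

lemma inj_enc_input: "inj enc_input"
proof (rule injI)
  fix I J assume "enc_input I = enc_input J"
  then have
    "inp_edges I = inp_edges J \<and> inp_owner I = inp_owner J \<and> inp_prefs I = inp_prefs J \<and>
     inp_auts I = inp_auts J \<and> inp_start I = inp_start J \<and>
     enc_list enc_nat (inp_constr I) = enc_list enc_nat (inp_constr J)"
    by (simp add: enc_input_def enc_group_def enc_pf_simps
      prefix_freeD[OF enc_pf_list[OF enc_pf_pair]]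
      prefix_freeD[OF enc_pf_list[OF enc_pf_list[OF enc_pf_pair]]]
      prefix_freeD[OF enc_pf_list[OF enc_pf_list[OF enc_pf_table]]])
  then show "I = J"
    using prefix_free_inject[OF enc_pf_list[OF enc_pf_nat]]
    by (intro rp_input.equality) simp_all
qed

definition constrained_SPE_problem :: "bool list set" where
  "constrained_SPE_problem =
     {enc_input I | I G. is_instance I G \<and>
        constrained_SPE_exists G (inp_start I) (\<lambda>i. inp_constr I ! i)}"

definition three_payoff_instances :: "bool list set" where
  "three_payoff_instances =
     {enc_input I | I G. is_instance I G \<and> (\<forall>i\<in>players G. card (payoffs G i) = 3)}"


section \<open>Deterministic multitape Turing machines\<close>

datatype move = MoveL | Stay | MoveR

fun offset :: "move \<Rightarrow> int" where
  "offset MoveL = - 1"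
| "offset Stay = 0"
| "offset MoveR = 1"

text \<open>
  States and symbols are initial segments of the naturals. State 0 is initial and state 1 is
  halting; symbol 0 is the blank and symbols 1 and 2 stand for the bits. The transition function
  is relevant only for the finitely many arguments constrained by \<open>wf_tm\<close>. Tapes are two-way
  infinite; the input is on the first tape, and the output is read off the last one.
\<close>

record tm =
  tm_tapes :: nat
  tm_states :: nat
  tm_symbols :: nat
  tm_delta :: "nat \<Rightarrow> nat list \<Rightarrow> nat \<times> (nat \<times> move) list"

definition wf_tm :: "tm \<Rightarrow> bool" where
  "wf_tm M \<longleftrightarrow> tm_tapes M \<ge> 1 \<and> tm_states M \<ge> 2 \<and> tm_symbols M \<ge> 3 \<and>
     (\<forall>q<tm_states M. \<forall>s. length s = tm_tapes M \<and> set s \<subseteq> {..<tm_symbols M} \<longrightarrow>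
        (case tm_delta M q s of (q', as) \<Rightarrow>
           q' < tm_states M \<and> length as = tm_tapes M \<and> fst ` set as \<subseteq> {..<tm_symbols M}))"

type_synonym tape = "int \<times> (int \<Rightarrow> nat)" \<comment> \<open>head position and contents\<close>
type_synonym config = "nat \<times> tape list"

fun tape_read :: "tape \<Rightarrow> nat" where
  "tape_read (pos, c) = c pos"

fun tape_act :: "tape \<Rightarrow> nat \<times> move \<Rightarrow> tape" where
  "tape_act (pos, c) (a, m) = (pos + offset m, c(pos := a))"

fun tm_step :: "tm \<Rightarrow> config \<Rightarrow> config" where
  "tm_step M (q, ts) =
     (if q = 1 then (q, ts)
      else (case tm_delta M q (map tape_read ts) of (q', as) \<Rightarrow> (q', map2 tape_act ts as)))"

definition bit_symbol :: "bool \<Rightarrow> nat" where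
  "bit_symbol b = (if b then 2 else 1)"

definition input_tape :: "bool list \<Rightarrow> tape" where
  "input_tape x =
     (0, \<lambda>z. if 0 \<le> z \<and> nat z < length x then bit_symbol (x ! nat z) else 0)"

definition blank_tape :: tape where
  "blank_tape = (0, \<lambda>_. 0)"

definition tm_init :: "tm \<Rightarrow> bool list \<Rightarrow> config" where
  "tm_init M x = (0, input_tape x # replicate (tm_tapes M - 1) blank_tape)"

definition tape_output :: "tape \<Rightarrow> bool list \<Rightarrow> bool" where
  "tape_output t y \<longleftrightarrow>
     (\<forall>j<length y. snd t (int j) = bit_symbol (y ! j)) \<and> snd t (int (length y)) = 0"

definition tm_computes :: "tm \<Rightarrow> (bool list \<Rightarrow> bool list) \<Rightarrow> (nat \<Rightarrow> nat) \<Rightarrow> bool" where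
  "tm_computes M f T \<longleftrightarrow>
     (\<forall>x. \<exists>t\<le>T (length x). case (tm_step M ^^ t) (tm_init M x) of (q, ts) \<Rightarrow>
        q = 1 \<and> tape_output (last ts) (f x))"


section \<open>Exponential time\<close>

definition EXPTIME :: "bool list set set" where
  "EXPTIME =
     {L. \<exists>M. \<exists>p :: nat poly. wf_tm M \<and> tm_computes M (\<lambda>x. [x \<in> L]) (\<lambda>n. 2 ^ poly p n)}"

definition polytime_computable :: "(bool list \<Rightarrow> bool list) \<Rightarrow> bool" where
  "polytime_computable f \<longleftrightarrow> (\<exists>M. \<exists>p :: nat poly. wf_tm M \<and> tm_computes M f (poly p))"

text \<open>
  Hardness under polynomial-time many-one reductions; the first argument is the set of instances
  to which the problem is restricted, and in which the values of the reductions must lie.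
\<close>

definition EXPTIME_hard_on :: "bool list set \<Rightarrow> bool list set \<Rightarrow> bool" where
  "EXPTIME_hard_on X L \<longleftrightarrow>
     (\<forall>K\<in>EXPTIME. \<exists>f. polytime_computable f \<and> (\<forall>x. f x \<in> X \<and> (x \<in> K \<longleftrightarrow> f x \<in> L)))"

definition EXPTIME_complete :: "bool list set \<Rightarrow> bool" where
  "EXPTIME_complete L \<longleftrightarrow> L \<in> EXPTIME \<and> EXPTIME_hard_on UNIV L"

end

theory Submission
  imports Defs "HOL-Library.More_List"
begin

text \<open>
  Membership: labelling every history with the payoffs of its continuation turns the existence of an
  equilibrium into a game between Prover, who announces labels and successors, and Challenger, who
  picks the moves. Prover must ensure that no payoff accepted by the automata improves on a label
  from which only one player has deviated since; this is a conjunction of Streett conditions. By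
  positional determinacy of the parity game obtained with an index appearance record, Prover wins
  iff she wins with all waiting counters bounded by an exponential, which is a safety game of
  exponential size. A one-player game of the same kind detects whether some word has no payoff or
  several.

  Hardness: two players move through the backward computation of an exponential-time machine; one
  claims the local contents of configurations, the other selects the predecessor cell to inspect.
  The positions in time and space are binary counters whose bits are kept in the automata of
  additional checking players. A checker rejects its own error payoff reflexively, so in no subgame
  can an error occur, and equilibria amount to error-free ways of playing forever.
\<close>

text \<open>Membership in a time class must be witnessed by concrete machines. Both halves therefore
  rest on a calculus of time-bounded functions on trees in which numbers are unary: a
  polynomial-time function that receives the number \<open>2 ^ p\<close> as an argument runs in
  exponential time. In the hardness part, an automaton is given by a table of its states, so a
  counter with polynomially many bits cannot live in one automaton; one bit per automaton is
  affordable, which explains the many checking players. They own no vertex, so an error must hurt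
  although they cannot act: under a reflexive preference, staying with one's own strategy already
  counts as a profitable deviation. This condemns errors even in subgames that nobody intends to
  enter; a sink to which one player can always retreat, and which clears all errors, makes such
  subgames harmless. In the membership part, the parity game serves only as a proof that bounded
  counters suffice. What is computed is a greatest fixpoint over explicitly listed positions, so no
  solver for parity games has to be programmed.\<close>

abbreviation (input) iff_ascii (infixr "<->" 25) where "iff_ascii P Q == (P :: bool) = Q"

section \<open>Programming Turing machines: polynomial and exponential time\<close>

section \<open>Structured stack programs and their compilation\<close>

text \<open>Every stack command is a single machine step. \<open>CLeft\<close> exposes the blank
  cell next to the top and \<open>CWrite\<close> overwrites the top, so a push needs both.\<close>

datatype com =
    CLeft nat
  | CWrite nat nat
  | CPop nat
  | CEmit nat
  | CSeq com com (infixr ";;" 60)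
  | CIf nat nat com com
  | CWhile nat nat com

type_synonym mem = "(nat => nat list) \<times> nat list"

text \<open>The default 0 is the blank that the head reads when the stack is exhausted. Stored data
  use only the symbols 1 and 2, so comparing with 0 is the test for emptiness.\<close>

definition hdd :: "nat list => nat" where
  "hdd xs = (case xs of [] => 0 | a # _ => a)"

lemma hdd_simps [simp]: "hdd [] = 0" "hdd (a # xs) = a"
  by (simp_all add: hdd_def)

text \<open>The index is the number of machine steps of the compiled program.\<close>

inductive exec :: "com => mem => nat => mem => bool" where
  eLeft: "exec (CLeft t) (S, out) 1 (S(t := 0 # S t), out)"
| eWrite: "exec (CWrite t a) (S, out) 1 (S(t := a # tl (S t)), out)"
| ePop: "exec (CPop t) (S, out) 1 (S(t := tl (S t)), out)"
| eEmit: "exec (CEmit a) (S, out) 1 (S, out @ [a])"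
| eSeq: "exec c1 s n1 s1 ==> exec c2 s1 n2 s2 ==> exec (c1 ;; c2) s (n1 + n2) s2"
| eIfT: "hdd (S t) = a ==> exec c1 (S, out) n s' ==> exec (CIf t a c1 c2) (S, out) (Suc n) s'"
| eIfF: "hdd (S t) ~= a ==> exec c2 (S, out) n s' ==> exec (CIf t a c1 c2) (S, out) (Suc (Suc n)) s'"
| eWhileE: "hdd (S t) = a ==> exec (CWhile t a c) (S, out) 1 (S, out)"
| eWhileL: "hdd (S t) ~= a ==> exec c (S, out) n s1 ==> exec (CWhile t a c) s1 m s2 ==>
    exec (CWhile t a c) (S, out) (Suc (n + Suc m)) s2"

fun wf_com :: "com => bool" where
  "wf_com (CLeft t) <-> t < 4"
| "wf_com (CWrite t a) <-> t < 4 & a < 3"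
| "wf_com (CPop t) <-> t < 4"
| "wf_com (CEmit a) <-> a < 3"
| "wf_com (CSeq c1 c2) <-> wf_com c1 & wf_com c2"
| "wf_com (CIf t a c1 c2) <-> t < 4 & wf_com c1 & wf_com c2"
| "wf_com (CWhile t a c) <-> t < 4 & wf_com c"

datatype ins = ILeft nat | IWrite nat nat | IPop nat | IEmit nat | IJmp nat | IJeq nat nat nat

fun clen :: "com => nat" where
  "clen (CLeft t) = 1"
| "clen (CWrite t a) = 1"
| "clen (CPop t) = 1"
| "clen (CEmit a) = 1"
| "clen (CSeq c1 c2) = clen c1 + clen c2"
| "clen (CIf t a c1 c2) = clen c1 + clen c2 + 2"
| "clen (CWhile t a c) = clen c + 2"

text \<open>The else-branch directly follows the test: a true test costs one jump, a false one also
  pays for the jump over the then-branch. This is the difference between the step counts of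
  \<open>eIfT\<close> and \<open>eIfF\<close>. Jump targets are absolute, hence the start address as
  an argument.\<close>

fun ccomp :: "com => nat => ins list" where
  "ccomp (CLeft t) n = [ILeft t]"
| "ccomp (CWrite t a) n = [IWrite t a]"
| "ccomp (CPop t) n = [IPop t]"
| "ccomp (CEmit a) n = [IEmit a]"
| "ccomp (CSeq c1 c2) n = ccomp c1 n @ ccomp c2 (n + clen c1)"
| "ccomp (CIf t a c1 c2) n =
     IJeq t a (n + clen c2 + 2) # ccomp c2 (n + 1) @ IJmp (n + clen c1 + clen c2 + 2) #
     ccomp c1 (n + clen c2 + 2)"
| "ccomp (CWhile t a c) n = IJeq t a (n + clen c + 2) # ccomp c (n + 1) @ [IJmp n]"

lemma length_ccomp [simp]: "length (ccomp c n) = clen c"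
  by (induction c arbitrary: n) auto

lemma clen_pos: "clen c > 0"
  by (induction c) auto

fun istep1 :: "ins => nat => mem => nat \<times> mem" where
  "istep1 (ILeft t) pc (S, out) = (Suc pc, S(t := 0 # S t), out)"
| "istep1 (IWrite t a) pc (S, out) = (Suc pc, S(t := a # tl (S t)), out)"
| "istep1 (IPop t) pc (S, out) = (Suc pc, S(t := tl (S t)), out)"
| "istep1 (IEmit a) pc (S, out) = (Suc pc, S, out @ [a])"
| "istep1 (IJmp p) pc (S, out) = (p, S, out)"
| "istep1 (IJeq t a p) pc (S, out) = (if hdd (S t) = a then p else Suc pc, S, out)"

definition istep :: "ins list => nat \<times> mem => nat \<times> mem" where
  "istep P = (%(pc, s). if pc < length P then istep1 (P ! pc) pc s else (pc, s))"

definition code_at :: "ins list => nat => ins list => bool" where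
  "code_at P n xs <-> (EX pre post. P = pre @ xs @ post & length pre = n)"

lemma code_at_append: "code_at P n (xs @ ys) ==> code_at P n xs & code_at P (n + length xs) ys"
  unfolding code_at_def by (metis append.assoc length_append)

lemma code_at_Cons: "code_at P n (x # xs) ==> n < length P & P ! n = x & code_at P (Suc n) xs"
proof -
  assume "code_at P n (x # xs)"
  then obtain pre post where "P = pre @ (x # xs) @ post" "length pre = n"
    unfolding code_at_def by blast
  then have "P = (pre @ [x]) @ xs @ post" "length (pre @ [x]) = Suc n" "n < length P" "P ! n = x"
    by auto
  then show ?thesis unfolding code_at_def by blast
qed

lemma istep_code: "code_at P n (x # xs) ==> istep P (n, s) = istep1 x n s"
  by (auto simp: istep_def dest: code_at_Cons)

lemma funpow_add_apply: "(f ^^ (m + n)) x = (f ^^ n) ((f ^^ m) x)"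
  by (metis add.commute comp_apply funpow_add)

lemma funpow_Suc_apply: "(f ^^ Suc n) x = (f ^^ n) (f x)"
  by (simp add: funpow_swap1)

lemma ccomp_correct:
  "exec c s k s' ==> code_at P n (ccomp c n) ==> (istep P ^^ k) (n, s) = (n + clen c, s')"
proof (induction arbitrary: n rule: exec.induct)
  case (eSeq c1 s n1 s1 c2 n2 s2)
  then show ?case using code_at_append[of P n "ccomp c1 n"]
    by (simp add: funpow_add_apply add.assoc)
next
  case (eIfT S t a c1 out k s' c2)
  let ?m = "n + clen c2 + 2"
  have c: "code_at P n (ccomp (CIf t a c1 c2) n)" by fact
  then have "code_at P ?m (ccomp c1 ?m)"
    using code_at_append[of P "Suc n" "ccomp c2 (n + 1)"]
    by (auto dest!: code_at_Cons)
  then have "(istep P ^^ k) (?m, (S, out)) = (?m + clen c1, s')" by (rule eIfT.IH)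
  moreover have "istep P (n, (S, out)) = (?m, (S, out))"
    using istep_code[OF c[unfolded ccomp.simps]] eIfT.hyps by simp
  ultimately show ?case by (simp del: funpow.simps add: funpow_Suc_apply)
next
  case (eIfF S t a c2 out k s' c1)
  let ?m = "n + clen c2 + 2"
  have c: "code_at P n (ccomp (CIf t a c1 c2) n)" by fact
  then have *: "code_at P (n + 1) (ccomp c2 (n + 1))"
      "code_at P (n + 1 + clen c2) (IJmp (n + clen c1 + clen c2 + 2) # ccomp c1 (n + clen c2 + 2))"
    using code_at_append[of P "n + 1" "ccomp c2 (n + 1)"]
    by (auto dest!: code_at_Cons)
  then have "(istep P ^^ k) (n + 1, (S, out)) = (n + 1 + clen c2, s')" by (intro eIfF.IH)
  moreover have "istep P (n, (S, out)) = (n + 1, (S, out))"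
    using istep_code[OF c[unfolded ccomp.simps]] eIfF.hyps by simp
  moreover have "istep P (n + 1 + clen c2, s') = (n + clen (CIf t a c1 c2), s')"
    using istep_code[OF *(2), of s'] by (cases s') simp
  ultimately have "(istep P ^^ (Suc (k + 1))) (n, (S, out)) = (n + clen (CIf t a c1 c2), s')"
    unfolding funpow_Suc_apply funpow_add_apply by simp
  then show ?case by simp
next
  case (eWhileE S t a c out)
  then show ?case using istep_code[OF eWhileE.prems[unfolded ccomp.simps]] by simp
next
  case (eWhileL S t a c out k s1 m s2)
  have c: "code_at P n (ccomp (CWhile t a c) n)" by fact
  then have *: "code_at P (n + 1) (ccomp c (n + 1))" "code_at P (n + 1 + clen c) [IJmp n]"
    using code_at_append[of P "n + 1" "ccomp c (n + 1)"]
    by (auto dest!: code_at_Cons)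
  then have "(istep P ^^ k) (n + 1, (S, out)) = (n + 1 + clen c, s1)" by (intro eWhileL.IH)
  moreover have "istep P (n, (S, out)) = (n + 1, (S, out))"
    using istep_code[OF c[unfolded ccomp.simps]] eWhileL.hyps by simp
  moreover have "istep P (n + 1 + clen c, s1) = (n, s1)"
    using istep_code[OF *(2), of s1] by (cases s1) simp
  moreover have "(istep P ^^ m) (n, s1) = (n + clen (CWhile t a c), s2)"
    using c by (rule eWhileL.IH)
  ultimately have "(istep P ^^ (Suc (k + Suc m))) (n, (S, out)) = (n + clen (CWhile t a c), s2)"
    by (simp only: funpow_Suc_apply funpow_add_apply)
  then show ?case .
qed (auto simp: istep_code)

text \<open>The machine model fixes 0 as the initial and 1 as the halting state. Address 0 keeps its
  number, later addresses move past state 1, and every address beyond the program halts. The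
  truncated \<open>q - 1\<close> in \<open>prog_tm\<close> inverts this.\<close>

definition st_of_pc :: "ins list => nat => nat" where
  "st_of_pc P pc = (if pc = 0 then 0 else if pc >= length P then 1 else Suc pc)"

definition only_act :: "nat list => nat => nat => move => (nat \<times> move) list" where
  "only_act s t a m = (map (%b. (b, Stay)) s)[t := (a, m)]"

fun ins_delta :: "ins list => ins => nat => nat list => nat \<times> (nat \<times> move) list" where
  "ins_delta P (ILeft t) pc s = (st_of_pc P (Suc pc), only_act s t (s ! t) MoveL)"
| "ins_delta P (IWrite t a) pc s = (st_of_pc P (Suc pc), only_act s t a Stay)"
| "ins_delta P (IPop t) pc s = (st_of_pc P (Suc pc), only_act s t 0 MoveR)"
| "ins_delta P (IEmit a) pc s = (st_of_pc P (Suc pc), only_act s 4 a MoveR)"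
| "ins_delta P (IJmp p) pc s = (st_of_pc P p, map (%b. (b, Stay)) s)"
| "ins_delta P (IJeq t a p) pc s =
     (st_of_pc P (if s ! t = a then p else Suc pc), map (%b. (b, Stay)) s)"

definition prog_tm :: "ins list => tm" where
  "prog_tm P = \<lparr>tm_tapes = 5, tm_states = length P + 2, tm_symbols = 3,
     tm_delta = (%q s. let pc = q - 1 in
       if q ~= 1 & pc < length P then ins_delta P (P ! pc) pc s else (1, map (%b. (b, Stay)) s))\<rparr>"

fun wf_ins :: "ins => bool" where
  "wf_ins (ILeft t) <-> t < 4"
| "wf_ins (IWrite t a) <-> t < 4 & a < 3"
| "wf_ins (IPop t) <-> t < 4"
| "wf_ins (IEmit a) <-> a < 3"
| "wf_ins (IJmp p) <-> True"
| "wf_ins (IJeq t a p) <-> t < 4"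

lemma wf_ins_ccomp: "wf_com c ==> x \<in> set (ccomp c n) ==> wf_ins x"
  by (induction c arbitrary: n) auto

lemma st_of_pc_less [simp]: "st_of_pc P pc < Suc (Suc (length P))"
  by (auto simp: st_of_pc_def)

lemma only_act_bound:
  assumes "set s \<subseteq> {..<3}" "a < 3"
  shows "fst ` set (only_act s t a m) \<subseteq> {..<(3::nat)}"
proof -
  have "set (only_act s t a m) \<subseteq> insert (a, m) ((%b. (b, Stay)) ` set s)"
    unfolding only_act_def using set_update_subset_insert by fastforce
  then show ?thesis using assms by fastforce
qed

lemma wf_prog_tm:
  assumes "\<forall>x\<in>set P. wf_ins x"
  shows "wf_tm (prog_tm P)"
proof -
  have "case ins_delta P x pc s of (q', as) =>
      q' < length P + 2 & length as = 5 & fst ` set as \<subseteq> {..<3}"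
    if "wf_ins x" "length s = 5" "set s \<subseteq> {..<3}" for x pc s
  proof (cases x)
    case (ILeft t)
    then have "s ! t \<in> set s" using that by simp
    then have "s ! t < 3" using that by blast
    then show ?thesis using that ILeft
      by (auto simp: only_act_bound simp del: set_map) (auto simp: only_act_def)
  qed (use that in \<open>auto simp: st_of_pc_less only_act_bound simp del: set_map\<close>, auto simp: only_act_def)
  note * = this
  have "case tm_delta (prog_tm P) q s of (q', as) =>
      q' < length P + 2 & length as = 5 & fst ` set as \<subseteq> {..<3}"
    if "length s = 5" "set s \<subseteq> {..<3}" for q s
  proof (cases "q ~= 1 & q - 1 < length P")
    case True
    then show ?thesis using *[OF _ that, of "P ! (q - 1)" "q - 1"] assms by (simp add: prog_tm_def Let_def)
  next
    case False
    then show ?thesis using that by (auto simp: prog_tm_def)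
  qed
  then show ?thesis unfolding wf_tm_def by (auto simp: prog_tm_def)
qed

definition nthd :: "nat list => nat => nat" where
  "nthd xs n = (if n < length xs then xs ! n else 0)"

text \<open>The stack grows to the left, with its top under the head. All cells left of the head are
  required to be blank, so that a move to the left exposes a fresh 0; for this reason popping erases
  the cell before moving right.\<close>

definition stack_tape :: "nat list => tape => bool" where
  "stack_tape xs tp <-> (EX pos. tp = (pos, %z. if z < pos then 0 else nthd xs (nat (z - pos))))"

definition out_tape :: "nat list => tape" where
  "out_tape xs = (int (length xs), %z. if 0 <= z then nthd xs (nat z) else 0)"

lemma stack_tape_read: "stack_tape xs tp ==> tape_read tp = hdd xs"
  by (auto simp: stack_tape_def nthd_def hdd_def split: list.splits)

lemma stack_tape_left:
  assumes "stack_tape xs tp"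
  shows "stack_tape (0 # xs) (tape_act tp (tape_read tp, MoveL))"
proof -
  obtain pos where tp: "tp = (pos, %z. if z < pos then 0 else nthd xs (nat (z - pos)))"
    using assms by (auto simp: stack_tape_def)
  have "(if z < pos then 0 else nthd xs (nat (z - pos))) =
      (if z < pos - 1 then 0 else nthd (0 # xs) (nat (z - (pos - 1))))" for z
  proof -
    consider "z < pos - 1" | "z = pos - 1" | "z >= pos" by linarith
    then show ?thesis
    proof cases
      case 3
      then have "nat (z - (pos - 1)) = Suc (nat (z - pos))" by simp
      then show ?thesis using 3 by (simp add: nthd_def)
    qed (auto simp: nthd_def)
  qed
  then show ?thesis unfolding stack_tape_def tp by (auto intro!: exI[of _ "pos - 1"] ext)
qed

lemma stack_tape_write:
  assumes "stack_tape xs tp"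
  shows "stack_tape (a # tl xs) (tape_act tp (a, Stay))"
proof -
  obtain pos where tp: "tp = (pos, %z. if z < pos then 0 else nthd xs (nat (z - pos)))"
    using assms by (auto simp: stack_tape_def)
  have "nthd (a # tl xs) (Suc k) = nthd xs (Suc k)" for k
    by (cases xs) (auto simp: nthd_def)
  then have "nthd (a # tl xs) n = nthd xs n" if "n > 0" for n using that by (cases n) auto
  then have "((%z. if z < pos then 0 else nthd xs (nat (z - pos)))(pos := a)) z =
      (if z < pos then 0 else nthd (a # tl xs) (nat (z - pos)))" for z
    by (cases z pos rule: linorder_cases) (simp_all add: nthd_def[of "a # tl xs" 0])
  then show ?thesis unfolding stack_tape_def tp by (auto intro!: exI[of _ pos] ext)
qed

lemma stack_tape_pop:
  assumes "stack_tape xs tp"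
  shows "stack_tape (tl xs) (tape_act tp (0, MoveR))"
proof -
  obtain pos where tp: "tp = (pos, %z. if z < pos then 0 else nthd xs (nat (z - pos)))"
    using assms by (auto simp: stack_tape_def)
  have "((%z. if z < pos then 0 else nthd xs (nat (z - pos)))(pos := 0)) z =
      (if z < pos + 1 then 0 else nthd (tl xs) (nat (z - (pos + 1))))" for z
  proof (cases "z <= pos")
    case False
    then have "nat (z - pos) = Suc (nat (z - (pos + 1)))" by simp
    then show ?thesis using False by (cases xs) (auto simp: nthd_def)
  qed auto
  then show ?thesis unfolding stack_tape_def tp by (auto intro!: exI[of _ "pos + 1"] ext)
qed

lemma out_tape_emit: "tape_act (out_tape xs) (a, MoveR) = out_tape (xs @ [a])"
  by (auto simp: out_tape_def nthd_def nth_append fun_eq_iff nat_less_iff)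

definition rep_conf :: "ins list => nat \<times> mem => config => bool" where
  "rep_conf P = (%(pc, S, out) (q, ts). q = st_of_pc P pc & length ts = 5 &
     (\<forall>t<4. stack_tape (S t) (ts ! t)) & ts ! 4 = out_tape out)"

lemma rep_conf_step:
  assumes "rep_conf P (pc, S, out) (q, ts)" "\<forall>x\<in>set P. wf_ins x" "P ~= []"
  shows "rep_conf P (istep P (pc, S, out)) (tm_step (prog_tm P) (q, ts))"
proof (cases "pc < length P")
  case False
  then have "length P <= pc" "pc ~= 0" using assms(3) by (simp, metis length_greater_0_conv)
  then have i: "istep P (pc, S, out) = (pc, S, out)" "q = 1"
    using assms by (auto simp: istep_def rep_conf_def st_of_pc_def)
  then show ?thesis using assms by simp
next
  case True
  let ?s = "map tape_read ts"
  have ts: "length ts = 5" "!!t. t < 4 ==> stack_tape (S t) (ts ! t)" "ts ! 4 = out_tape out"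
    and q: "q = st_of_pc P pc" using assms(1) by (auto simp: rep_conf_def)
  have q': "q ~= 1" "q - 1 = pc" using True by (auto simp: q st_of_pc_def)
  have s: "?s ! t = hdd (S t)" if "t < 4" for t using ts that by (simp add: stack_tape_read)
  have act: "map2 tape_act ts (only_act ?s t a m) = ts[t := tape_act (ts ! t) (a, m)]" if "t < 5" for t a m
  proof (intro nth_equalityI)
    fix i assume "i < length (map2 tape_act ts (only_act ?s t a m))"
    then show "map2 tape_act ts (only_act ?s t a m) ! i = ts[t := tape_act (ts ! t) (a, m)] ! i"
      using that ts(1) by (simp add: only_act_def nth_list_update) (cases "ts ! i", simp)
  qed (auto simp: only_act_def)
  have stay: "map2 tape_act ts (map (%b. (b, Stay)) ?s) = ts"
  proof (intro nth_equalityI)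
    fix i assume "i < length (map2 tape_act ts (map (%b. (b, Stay)) ?s))"
    then show "map2 tape_act ts (map (%b. (b, Stay)) ?s) ! i = ts ! i" by (cases "ts ! i") auto
  qed auto
  have left: "stack_tape (0 # S t) (tape_act (ts ! t) (hdd (S t), MoveL))" if "t < 4" for t
    using stack_tape_left[OF ts(2)[OF that]] stack_tape_read[OF ts(2)[OF that]] by simp
  note wr = stack_tape_write[OF ts(2)] and po = stack_tape_pop[OF ts(2)]
  have "wf_ins (P ! pc)" using assms(2) True by simp
  moreover have "tm_step (prog_tm P) (q, ts) =
      (case ins_delta P (P ! pc) pc ?s of (q', as) => (q', map2 tape_act ts as))"
    using q' True by (simp add: prog_tm_def)
  moreover have "istep P (pc, S, out) = istep1 (P ! pc) pc (S, out)" using True by (simp add: istep_def)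
  ultimately have step: "tm_step (prog_tm P) (q, ts) =
      (case ins_delta P (P ! pc) pc ?s of (q', as) => (q', map2 tape_act ts as))"
    "istep P (pc, S, out) = istep1 (P ! pc) pc (S, out)" "wf_ins (P ! pc)"
    by simp_all
  have upd: "rep_conf P (p, S(t := xs), out) (st_of_pc P p, ts[t := tp])"
    if "t < 4" "stack_tape xs tp" for p t xs tp
    using that ts by (auto simp: rep_conf_def nth_list_update)
  have same: "rep_conf P (p, S, out) (st_of_pc P p, ts)" for p
    using ts by (auto simp: rep_conf_def)
  have emit: "rep_conf P (p, S, out @ [a]) (st_of_pc P p, ts[4 := tape_act (ts ! 4) (a, MoveR)])" for p a
    using ts by (auto simp: rep_conf_def out_tape_emit)
  show ?thesis
  proof (cases "P ! pc")
    case (ILeft t)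
    then show ?thesis using step(3) upd[OF _ left] s by (simp del: tm_step.simps nth_map add: step(1,2) act)
  next
    case (IWrite t a)
    then show ?thesis using step(3) upd[OF _ wr] by (simp del: tm_step.simps add: step(1,2) act)
  next
    case (IPop t)
    then show ?thesis using step(3) upd[OF _ po] by (simp del: tm_step.simps add: step(1,2) act)
  next
    case (IEmit a)
    then show ?thesis using emit by (simp del: tm_step.simps add: step(1,2) act)
  next
    case (IJmp p)
    then show ?thesis using same stay by (simp del: tm_step.simps add: step(1,2))
  next
    case (IJeq t a p)
    then show ?thesis using step(3) same stay s by (simp del: tm_step.simps nth_map add: step(1,2))
  qed
qed

lemma rep_conf_steps:
  assumes "rep_conf P (pc, S, out) c" "\<forall>x\<in>set P. wf_ins x" "P ~= []"
  shows "rep_conf P ((istep P ^^ n) (pc, S, out)) ((tm_step (prog_tm P) ^^ n) c)"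
proof (induction n)
  case (Suc n)
  then show ?case using rep_conf_step[OF _ assms(2,3)]
    by (cases "(istep P ^^ n) (pc, S, out)"; cases "(tm_step (prog_tm P) ^^ n) c") auto
qed (use assms in auto)

definition input_mem :: "bool list => mem" where
  "input_mem x = ((%_. [])(0 := map bit_symbol x), [])"

theorem com_tm_computes:
  assumes wf: "wf_com c"
    and c: "!!x. EX n S. n <= T (length x) & exec c (input_mem x) n (S, map bit_symbol (f x))"
  shows "EX M. wf_tm M & tm_computes M f T"
proof (intro exI conjI)
  let ?P = "ccomp c 0"
  have ne: "?P ~= []" using clen_pos[of c] length_ccomp[of c 0] by force
  have wfP: "\<forall>x\<in>set ?P. wf_ins x" using wf wf_ins_ccomp by blast
  then show "wf_tm (prog_tm ?P)" by (rule wf_prog_tm)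
  show "tm_computes (prog_tm ?P) f T"
    unfolding tm_computes_def
  proof
    fix x
    obtain n S where n: "n <= T (length x)" "exec c (input_mem x) n (S, map bit_symbol (f x))"
      using c by blast
    have "code_at ?P 0 ?P" unfolding code_at_def by (intro exI[of _ "[]"]) simp
    from ccomp_correct[OF n(2) this]
    have run: "(istep ?P ^^ n) (0, input_mem x) = (clen c, S, map bit_symbol (f x))" by simp
    have "stack_tape (map bit_symbol x) (input_tape x)"
      by (auto simp: stack_tape_def input_tape_def nthd_def fun_eq_iff)
    moreover have "stack_tape [] blank_tape" "out_tape [] = blank_tape"
      by (auto simp: stack_tape_def blank_tape_def nthd_def out_tape_def)
    moreover have "replicate 4 blank_tape ! i = blank_tape" if "i < 4" for i using that by simp
    ultimately have "rep_conf ?P (0, input_mem x) (tm_init (prog_tm ?P) x)"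
      by (auto simp: rep_conf_def input_mem_def tm_init_def prog_tm_def st_of_pc_def nth_Cons')
    then have rep: "rep_conf ?P (clen c, S, map bit_symbol (f x))
        ((tm_step (prog_tm ?P) ^^ n) (tm_init (prog_tm ?P) x))"
      using rep_conf_steps[OF _ wfP ne, of 0 _ _ _ n] run unfolding input_mem_def by metis
    moreover have "tape_output (out_tape (map bit_symbol y)) y" for y
      by (simp add: tape_output_def out_tape_def nthd_def)
    moreover have "last ts = ts ! 4" if "length ts = 5" for ts :: "tape list"
      using that last_conv_nth[of ts] by force
    ultimately show "EX t<=T (length x). case (tm_step (prog_tm ?P) ^^ t) (tm_init (prog_tm ?P) x) of
        (q, ts) => q = 1 & tape_output (last ts) (f x)"
      using n(1) clen_pos[of c]
      by (intro exI[of _ n]) (auto simp: rep_conf_def st_of_pc_def)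
  qed
qed

section \<open>Binary trees on the stacks\<close>

datatype val = Lf | Nd val val

fun vsize :: "val => nat" where
  "vsize Lf = 1"
| "vsize (Nd a b) = 1 + vsize a + vsize b"

text \<open>Prefix notation: a code shows by itself where it ends, so it can lie on top of arbitrary
  other data on a stack.\<close>

fun vcode :: "val => nat list" where
  "vcode Lf = [1]"
| "vcode (Nd a b) = 2 # vcode a @ vcode b"

lemma length_vcode [simp]: "length (vcode x) = vsize x"
  by (induction x) auto

lemma set_vcode: "set (vcode x) \<subseteq> {1, 2}"
  by (induction x) auto

lemma vsize_pos [simp]: "vsize x > 0"
  by (cases x) auto

text \<open>Upper bounds in place of exact step counts, so that branches of different cost can share
  one statement.\<close>

definition runs :: "com => mem => nat => mem => bool" where
  "runs c s n s' <-> (EX m<=n. exec c s m s')"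

lemma runs_mono: "runs c s n s' ==> n <= n' ==> runs c s n' s'"
  unfolding runs_def by (meson le_trans)

lemma runs_atom:
  "runs (CLeft t) (S, out) 1 (S(t := 0 # S t), out)"
  "runs (CWrite t a) (S, out) 1 (S(t := a # tl (S t)), out)"
  "runs (CPop t) (S, out) 1 (S(t := tl (S t)), out)"
  "runs (CEmit a) (S, out) 1 (S, out @ [a])"
  unfolding runs_def using exec.intros(1-4) by (meson order_refl)+

lemma runs_Seq: "runs c1 s n1 s1 ==> runs c2 s1 n2 s2 ==> runs (c1 ;; c2) s (n1 + n2) s2"
  unfolding runs_def by (meson eSeq add_mono)

lemma runs_IfT: "hdd (S t) = a ==> runs c1 (S, out) n s' ==> runs (CIf t a c1 c2) (S, out) (n + 2) s'"
  unfolding runs_def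
proof (elim exE conjE)
  fix m assume "hdd (S t) = a" "m <= n" "exec c1 (S, out) m s'"
  then show "EX m<=n + 2. exec (CIf t a c1 c2) (S, out) m s'"
    by (intro exI[of _ "Suc m"]) (auto intro: eIfT)
qed

lemma runs_IfF: "hdd (S t) ~= a ==> runs c2 (S, out) n s' ==> runs (CIf t a c1 c2) (S, out) (n + 2) s'"
  unfolding runs_def
proof (elim exE conjE)
  fix m assume "hdd (S t) ~= a" "m <= n" "exec c2 (S, out) m s'"
  then show "EX m<=n + 2. exec (CIf t a c1 c2) (S, out) m s'"
    by (intro exI[of _ "Suc (Suc m)"]) (auto intro: eIfF)
qed

lemma runs_WhileE: "hdd (S t) = a ==> runs (CWhile t a c) (S, out) 1 (S, out)"
  unfolding runs_def by (meson eWhileE order_refl)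

lemma runs_WhileL:
  assumes "hdd (S t) ~= a" "runs c (S, out) n s1" "runs (CWhile t a c) s1 m s2"
  shows "runs (CWhile t a c) (S, out) (n + m + 2) s2"
proof -
  obtain n' m' where "n' <= n" "exec c (S, out) n' s1" "m' <= m" "exec (CWhile t a c) s1 m' s2"
    using assms by (auto simp: runs_def)
  then show ?thesis unfolding runs_def
    using eWhileL[of S t a c out n' s1 m' s2] assms(1) by (intro exI[of _ "Suc (n' + Suc m')"]) auto
qed

definition push :: "nat => nat => com" where
  "push t a = CLeft t ;; CWrite t a"

lemma runs_push: "runs (push t a) (S, out) 2 (S(t := a # S t), out)"
  using runs_Seq[OF runs_atom(1) runs_atom(2)[of t a], of t S out]
  by (simp add: push_def numeral_2_eq_2)

lemma wf_push [simp]: "wf_com (push t a) <-> t < 4 & a < 3"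
  by (simp add: push_def)

definition skip :: com where
  "skip = CLeft 0 ;; CPop 0"

lemma runs_skip: "runs skip (S, out) 2 (S, out)"
  using runs_Seq[OF runs_atom(1)[of 0 S out] runs_atom(3)[of 0]]
  by (simp add: skip_def numeral_2_eq_2)

text \<open>A symbol 2 replaces one pending subtree by two and thus adds a marker; a symbol 1
  completes one and removes a marker. The code arrives reversed on stack 0, and pouring it elsewhere
  restores the order.\<close>

definition grab_loop :: "nat => com" where
  "grab_loop t = CWhile 3 0
     (CIf t 2 (push 0 2 ;; CPop t ;; push 3 1) (push 0 1 ;; CPop t ;; CPop 3))"

text \<open>Stack 3 counts the subtrees that are still to be read.\<close>

lemma runs_grab_loop:
  assumes t: "t = 1 \<or> t = 2"
  shows "S t = vcode x @ r ==> S 3 = 1 # k ==>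
    runs (grab_loop t) (S(t := r, 0 := rev (vcode x) @ S 0, 3 := k), out) n s' ==>
    runs (grab_loop t) (S, out) (n + 9 * vsize x) s'"
proof (induction x arbitrary: S r k n)
  case Lf
  have "runs (push 0 1 ;; CPop t ;; CPop 3) (S, out) (2 + (1 + 1))
      (S(t := r, 0 := rev (vcode Lf) @ S 0, 3 := k), out)"
    by (rule runs_Seq[OF runs_push runs_Seq[OF runs_atom(3) runs_atom(3)], THEN back_subst[of "runs _ _ _"]])
      (use Lf t in \<open>auto simp: fun_eq_iff\<close>)
  then have "runs (CIf t 2 (push 0 2 ;; CPop t ;; push 3 1) (push 0 1 ;; CPop t ;; CPop 3)) (S, out) 6
      (S(t := r, 0 := rev (vcode Lf) @ S 0, 3 := k), out)"
    using Lf(1) by (intro runs_IfF[THEN runs_mono]) auto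
  from runs_WhileL[OF _ this Lf(3)[unfolded grab_loop_def]] Lf(2)
  show ?case by (auto simp: grab_loop_def elim!: runs_mono)
next
  case (Nd a b)
  let ?S = "S(t := vcode a @ vcode b @ r, 0 := 2 # S 0, 3 := 1 # 1 # k)"
  have "runs (push 0 2 ;; CPop t ;; push 3 1) (S, out) (2 + (1 + 2)) (?S, out)"
    by (rule runs_Seq[OF runs_push runs_Seq[OF runs_atom(3) runs_push], THEN back_subst[of "runs _ _ _"]])
      (use Nd.prems t in \<open>auto simp: fun_eq_iff\<close>)
  then have 1: "runs (CIf t 2 (push 0 2 ;; CPop t ;; push 3 1) (push 0 1 ;; CPop t ;; CPop 3)) (S, out) 7
      (?S, out)"
    using Nd.prems by (intro runs_IfT[THEN runs_mono]) auto
  let ?S' = "?S(t := vcode b @ r, 0 := rev (vcode a) @ ?S 0, 3 := 1 # k)"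
  have eq: "?S'(t := r, 0 := rev (vcode b) @ ?S' 0, 3 := k) = S(t := r, 0 := rev (vcode (Nd a b)) @ S 0, 3 := k)"
    using t by (auto simp: fun_eq_iff)
  \<comment> \<open>The hypothesis describes the rest of the loop, so the second subtree comes
    before the first: its run is the rest that follows the first one.\<close>
  have "runs (grab_loop t) (?S', out) (n + 9 * vsize b) s'"
    by (rule Nd.IH(2)[of _ r k]) (use t Nd.prems(3) in \<open>simp_all only: eq\<close>, auto)
  moreover have "?S t = vcode a @ vcode b @ r" "?S 3 = 1 # 1 # k" using t by auto
  ultimately have "runs (grab_loop t) (?S, out) (n + 9 * vsize b + 9 * vsize a) s'"
    by (intro Nd.IH(1)[where S = ?S and r = "vcode b @ r" and k = "1 # k"])
  note runs_WhileL[OF _ 1 this[unfolded grab_loop_def]]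
  then show ?case using Nd.prems(2) by (auto simp: grab_loop_def elim!: runs_mono)
qed

definition grab :: "nat => com" where
  "grab t = push 3 1 ;; grab_loop t"

definition clear0 :: com where
  "clear0 = CWhile 0 0 (CPop 0)"

definition pour :: "nat => com" where
  "pour t = CWhile 0 0 (CIf 0 2 (push t 2 ;; CPop 0) (push t 1 ;; CPop 0))"

definition pour12 :: com where
  "pour12 = CWhile 0 0 (CIf 0 2 (push 1 2 ;; push 2 2 ;; CPop 0) (push 1 1 ;; push 2 1 ;; CPop 0))"

text \<open>Stack 0 is scratch space, stack 1 carries the argument and stack 2 the saved values; the
  counting stack 3 is empty between programs.\<close>

definition mk :: "nat list => nat list => nat list => nat => nat list" where
  "mk X D V = (%t. if t = 0 then X else if t = 1 then D else if t = 2 then V else [])"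

lemma mk_simps [simp]:
  "mk X D V 0 = X" "mk X D V (Suc 0) = D" "mk X D V 1 = D" "mk X D V 2 = V" "mk X D V 3 = []"
  "(mk X D V)(0 := Y) = mk Y D V" "(mk X D V)(Suc 0 := Y) = mk X Y V" "(mk X D V)(1 := Y) = mk X Y V"
  "(mk X D V)(2 := Y) = mk X D Y"
  by (auto simp: mk_def fun_eq_iff)

lemma runs_grab_gen:
  assumes t: "t = 1 \<or> t = 2" and S: "S t = vcode x @ r" "S 3 = []"
  shows "runs (grab t) (S, out) (9 * vsize x + 3) (S(t := r, 0 := rev (vcode x) @ S 0), out)"
proof -
  let ?S = "S(t := r, 0 := rev (vcode x) @ S 0)"
  have "runs (grab_loop t) (?S, out) 1 (?S, out)"
    unfolding grab_loop_def by (rule runs_WhileE) (use t S in auto)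
  moreover have "(S(3 := [1]))(t := r, 0 := rev (vcode x) @ (S(3 := [1])) 0, 3 := []) = ?S"
    using t S by (auto simp: fun_eq_iff)
  ultimately have "runs (grab_loop t) (S(3 := [1]), out) (1 + 9 * vsize x) (?S, out)"
    using t S by (intro runs_grab_loop[of _ _ _ r "[]"]) auto
  then show ?thesis
    unfolding grab_def using runs_Seq[OF runs_push[of 3 1 S out]] S
    by (fastforce elim!: runs_mono)
qed

lemma runs_grab1: "runs (grab 1) (mk X (vcode x @ r) V, out) (9 * vsize x + 3) (mk (rev (vcode x) @ X) r V, out)"
  using runs_grab_gen[of 1 "mk X (vcode x @ r) V" x r out] by simp

lemma runs_grab2: "runs (grab 2) (mk X D (vcode x @ V), out) (9 * vsize x + 3) (mk (rev (vcode x) @ X) D V, out)"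
  using runs_grab_gen[of 2 "mk X D (vcode x @ V)" x V out] by simp

lemma runs_clear0: "0 \<notin> set X ==> runs clear0 (mk X D V, out) (3 * length X + 1) (mk [] D V, out)"
proof (induction X)
  case Nil
  then show ?case unfolding clear0_def using runs_WhileE[of "mk [] D V" 0 0] by simp
next
  case (Cons a X)
  then show ?case unfolding clear0_def
    using runs_WhileL[OF _ _ Cons.IH[unfolded clear0_def], of "mk (a # X) D V" out 1]
      runs_atom(3)[of 0 "mk (a # X) D V" out]
    by (auto elim!: runs_mono)
qed

lemma runs_pour:
  assumes t: "t = 1 \<or> t = 2"
  shows "set X \<subseteq> {1, 2} ==>
    runs (pour t) (mk X D V, out) (7 * length X + 1)
      (if t = 1 then mk [] (rev X @ D) V else mk [] D (rev X @ V), out)"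
proof (induction X arbitrary: D V)
  case Nil
  then show ?case unfolding pour_def using runs_WhileE[of "mk [] D V" 0 0] by simp
next
  case (Cons a X)
  let ?s = "(if t = 1 then mk X (a # D) V else mk X D (a # V), out)"
  have "runs (push t a ;; CPop 0) (mk (a # X) D V, out) (2 + 1) ?s"
    by (rule runs_Seq[OF runs_push runs_atom(3), THEN back_subst[of "runs _ _ _"]]) (use t in auto)
  then have 1: "runs (CIf 0 2 (push t 2 ;; CPop 0) (push t 1 ;; CPop 0)) (mk (a # X) D V, out) 5 ?s"
    using runs_IfT[of "mk (a # X) D V" 0 2] runs_IfF[of "mk (a # X) D V" 0 2] Cons.prems
    by (cases "a = 2") fastforce+
  have 2: "runs (pour t) ?s (7 * length X + 1)
      (if t = 1 then mk [] (rev (a # X) @ D) V else mk [] D (rev (a # X) @ V), out)"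
    using Cons.IH[of "a # D" V] Cons.IH[of D "a # V"] Cons.prems by auto
  show ?case
    using runs_WhileL[OF _ 1 2[unfolded pour_def]] Cons.prems
    unfolding pour_def by (auto elim!: runs_mono)
qed

lemma runs_pour12:
  "set X \<subseteq> {1, 2} ==>
    runs pour12 (mk X D V, out) (9 * length X + 1) (mk [] (rev X @ D) (rev X @ V), out)"
proof (induction X arbitrary: D V)
  case Nil
  then show ?case unfolding pour12_def using runs_WhileE[of "mk [] D V" 0 0] by simp
next
  case (Cons a X)
  let ?s = "(mk X (a # D) (a # V), out)"
  have "runs (push 1 a ;; push 2 a ;; CPop 0) (mk (a # X) D V, out) (2 + (2 + 1)) ?s"
    by (rule runs_Seq[OF runs_push runs_Seq[OF runs_push runs_atom(3)], THEN back_subst[of "runs _ _ _"]]) auto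
  then have 1: "runs (CIf 0 2 (push 1 2 ;; push 2 2 ;; CPop 0) (push 1 1 ;; push 2 1 ;; CPop 0))
      (mk (a # X) D V, out) 7 ?s"
    using runs_IfT[of "mk (a # X) D V" 0 2] runs_IfF[of "mk (a # X) D V" 0 2] Cons.prems
    by (cases "a = 2") fastforce+
  have 2: "runs pour12 ?s (9 * length X + 1) (mk [] (rev (a # X) @ D) (rev (a # X) @ V), out)"
    using Cons.IH[of "a # D" "a # V"] Cons.prems by auto
  show ?case
    using runs_WhileL[OF _ 1 2[unfolded pour12_def]] Cons.prems
    unfolding pour12_def by (auto elim!: runs_mono)
qed

definition drop1 :: com where "drop1 = grab 1 ;; clear0"
definition dup :: com where "dup = grab 1 ;; pour12"
definition save :: com where "save = grab 1 ;; pour 2"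
definition unsave :: com where "unsave = grab 2 ;; pour 1"

lemma wf_moves [simp]: "wf_com drop1" "wf_com dup" "wf_com save" "wf_com unsave" "wf_com skip"
  by (simp_all add: drop1_def dup_def save_def unsave_def grab_def grab_loop_def clear0_def pour_def
    pour12_def skip_def)

lemma vcode_bits: "0 \<notin> set (rev (vcode x))" "set (rev (vcode x)) \<subseteq> {1, 2}"
  using set_vcode[of x] by auto

lemma runs_drop1: "runs drop1 (mk [] (vcode x @ r) V, out) (12 * vsize x + 4) (mk [] r V, out)"
  unfolding drop1_def
  by (rule runs_Seq[OF runs_grab1 runs_clear0, THEN runs_mono]) (use vcode_bits(1)[of x] in auto)

lemma runs_dup:
  "runs dup (mk [] (vcode x @ r) V, out) (18 * vsize x + 4) (mk [] (vcode x @ r) (vcode x @ V), out)"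
  unfolding dup_def
  using runs_Seq[OF runs_grab1 runs_pour12, of x "[]" r V out] vcode_bits(2)[of x]
  by (auto elim!: runs_mono)

lemma runs_save:
  "runs save (mk [] (vcode x @ r) V, out) (16 * vsize x + 4) (mk [] r (vcode x @ V), out)"
  unfolding save_def
  using runs_Seq[OF runs_grab1 runs_pour[of 2], of x "[]" r V out] vcode_bits(2)[of x]
  by (auto elim!: runs_mono)

lemma runs_unsave:
  "runs unsave (mk [] D (vcode x @ V), out) (16 * vsize x + 4) (mk [] (vcode x @ D) V, out)"
  unfolding unsave_def
  using runs_Seq[OF runs_grab2 runs_pour[of 1], of x "[]" D V out] vcode_bits(2)[of x]
  by (auto elim!: runs_mono)

fun pushv :: "val => com" where
  "pushv Lf = push 1 1"
| "pushv (Nd a b) = pushv b ;; pushv a ;; push 1 2"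

lemma runs_pushv: "runs (pushv x) (mk [] r V, out) (2 * vsize x) (mk [] (vcode x @ r) V, out)"
proof (induction x arbitrary: r)
  case Lf
  then show ?case using runs_push[of 1 1 "mk [] r V" out] by simp
next
  case (Nd a b)
  have "runs (push 1 2) (mk [] (vcode a @ vcode b @ r) V, out) 2 (mk [] (vcode (Nd a b) @ r) V, out)"
    using runs_push[of 1 2 "mk [] (vcode a @ vcode b @ r) V" out] by simp
  then show ?case
    using runs_Seq[OF Nd.IH(2)[of r] runs_Seq[OF Nd.IH(1)]] by (fastforce elim!: runs_mono)
qed

lemma wf_pushv [simp]: "wf_com (pushv x)"
  by (induction x) auto

section \<open>Time-bounded computability of functions on encodable types\<close>

class treelike =
  fixes tre :: "'a => val"

instantiation val :: treelike begin
definition tre_val :: "val => val" where [simp]: "tre_val x = x"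
instance ..
end

instantiation unit :: treelike begin
definition tre_unit :: "unit => val" where [simp]: "tre_unit x = Lf"
instance ..
end

instantiation bool :: treelike begin
definition tre_bool :: "bool => val" where "tre_bool b = (if b then Nd Lf Lf else Lf)"
instance ..
end

instantiation nat :: treelike begin
primrec tre_nat :: "nat => val" where
  "tre_nat 0 = Lf"
| "tre_nat (Suc n) = Nd Lf (tre_nat n)"
instance ..
end

instantiation prod :: (treelike, treelike) treelike begin
definition tre_prod :: "'a \<times> 'b => val" where "tre_prod p = Nd (tre (fst p)) (tre (snd p))"
instance ..
end

instantiation list :: (treelike) treelike begin
primrec tre_list :: "'a list => val" where
  "tre_list [] = Lf"
| "tre_list (x # xs) = Nd (tre x) (tre_list xs)"
instance ..
end

lemma tre_simps [simp]:
  "tre True = Nd Lf Lf" "tre False = Lf" "tre (0::nat) = Lf" "tre (Suc n) = Nd Lf (tre n)"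
  "tre (a, b) = Nd (tre a) (tre b)" "tre ([]::'a::treelike list) = Lf" "tre (x # xs) = Nd (tre x) (tre xs)"
  by (simp_all add: tre_bool_def tre_prod_def)

definition esize :: "'a::treelike => nat" where
  "esize x = vsize (tre x)"

text \<open>Whatever lies below the argument, on the saving stack and on the output is arbitrary, so
  programs can be chained inside larger ones. The result has a size bound of its own, because the
  time of the next program in a chain is stated in terms of its argument.\<close>

definition impl_by :: "com => ('a::treelike => 'b::treelike) => (nat => nat) => bool" where
  "impl_by c f T <-> wf_com c &
     (ALL x r V out. runs c (mk [] (vcode (tre x) @ r) V, out) (T (esize x)) (mk [] (vcode (tre (f x)) @ r) V, out)) &
     (ALL x. esize (f x) <= T (esize x))"

definition impl :: "('a::treelike => 'b::treelike) => (nat => nat) => bool" where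
  "impl f T <-> (EX c. impl_by c f T)"

lemma impl_byD:
  assumes "impl_by c f T"
  shows "wf_com c" "runs c (mk [] (vcode (tre x) @ r) V, out) (T (esize x)) (mk [] (vcode (tre (f x)) @ r) V, out)"
    "esize (f x) <= T (esize x)"
  using assms by (auto simp: impl_by_def)

lemma impl_mono: "impl f T ==> (!!n. T n <= T' n) ==> impl f T'"
  unfolding impl_def impl_by_def by (meson runs_mono le_trans)

text \<open>A program sees only tree codes. A nonempty list can thus be treated as a pair, and a
  number as a list of units, at no cost.\<close>

lemma impl_recode: "impl f T ==> (!!x. tre (g x) = tre (f x)) ==> impl g T"
  unfolding impl_def impl_by_def by (simp add: esize_def)

lemma impl_id: "impl (%x. x) (%n. n + 2)"
  unfolding impl_def impl_by_def
  by (intro exI[of _ skip]) (auto intro: runs_skip[THEN runs_mono])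

lemma impl_const: "impl (%x. k) (%n. 12 * n + 4 + 2 * esize k)"
  unfolding impl_def impl_by_def
proof (intro exI[of _ "drop1 ;; pushv (tre k)"] conjI allI)
  fix x :: 'a and r V out
  show "runs (drop1 ;; pushv (tre k)) (mk [] (vcode (tre x) @ r) V, out) (12 * esize x + 4 + 2 * esize k)
     (mk [] (vcode (tre k) @ r) V, out)"
    unfolding esize_def by (rule runs_Seq[OF runs_drop1 runs_pushv])
qed auto

lemma impl_comp:
  assumes "impl f Tf" "impl g Tg" "mono Tf"
  shows "impl (%x. f (g x)) (%n. Tg n + Tf (Tg n))"
proof -
  obtain cf cg where c: "impl_by cf f Tf" "impl_by cg g Tg" using assms by (auto simp: impl_def)
  note f = impl_byD[OF c(1)] and g = impl_byD[OF c(2)]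
  have "Tf (esize (g x)) <= Tf (Tg (esize x))" for x using g(3) assms(3) by (simp add: monoD)
  then show ?thesis unfolding impl_def impl_by_def
    using f g by (intro exI[of _ "cg ;; cf"])
      (auto intro!: runs_Seq[OF g(2) f(2), THEN runs_mono] intro: le_trans[OF f(3)] add_increasing)
qed

lemma impl_pair:
  assumes "impl f Tf" "impl g Tg"
  shows "impl (%x. (f x, g x)) (%n. Tf n + Tg n + 34 * n + 10)"
proof -
  obtain cf cg where c: "impl_by cf f Tf" "impl_by cg g Tg" using assms by (auto simp: impl_def)
  note f = impl_byD[OF c(1)] and g = impl_byD[OF c(2)]
  have "runs (dup ;; cg ;; unsave ;; cf ;; push 1 2) (mk [] (vcode (tre x) @ r) V, out)
     (Tf (esize x) + Tg (esize x) + 34 * esize x + 10) (mk [] (vcode (tre (f x, g x)) @ r) V, out)" for x r V out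
  proof -
    have "runs (push 1 2) (mk [] (vcode (tre (f x)) @ vcode (tre (g x)) @ r) V, out) 2
       (mk [] (vcode (tre (f x, g x)) @ r) V, out)"
      using runs_push[of 1 2 "mk [] (vcode (tre (f x)) @ vcode (tre (g x)) @ r) V" out] by simp
    note runs_Seq[OF runs_dup runs_Seq[OF g(2) runs_Seq[OF runs_unsave runs_Seq[OF f(2) this]]]]
    then show ?thesis by (rule runs_mono) (simp add: esize_def)
  qed
  moreover have "esize (f x, g x) <= Tf (esize x) + Tg (esize x) + 34 * esize x + 10" for x
    using f(3)[of x] g(3)[of x] by (simp add: esize_def)
  ultimately show ?thesis unfolding impl_def impl_by_def
    using f(1) g(1) by (intro exI[of _ "dup ;; cg ;; unsave ;; cf ;; push 1 2"]) simp
qed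

lemma impl_fst: "impl fst (%n. 44 * n + 13)"
  unfolding impl_def impl_by_def
proof (intro exI[of _ "CPop 1 ;; save ;; drop1 ;; unsave"] conjI allI)
  fix x :: "'a \<times> 'b" and r V out
  obtain a b where x: "x = (a, b)" by (cases x)
  have "runs (CPop 1) (mk [] (vcode (tre x) @ r) V, out) 1 (mk [] (vcode (tre a) @ vcode (tre b) @ r) V, out)"
    using runs_atom(3)[of 1 "mk [] (vcode (tre x) @ r) V" out] by (simp add: x)
  note runs_Seq[OF this runs_Seq[OF runs_save runs_Seq[OF runs_drop1 runs_unsave]]]
  then show "runs (CPop 1 ;; save ;; drop1 ;; unsave) (mk [] (vcode (tre x) @ r) V, out)
      (44 * esize x + 13) (mk [] (vcode (tre (fst x)) @ r) V, out)"
    unfolding x fst_conv by (rule runs_mono) (simp add: esize_def)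
  show "esize (fst x) <= 44 * esize x + 13" by (simp add: x esize_def)
qed simp

lemma impl_snd: "impl snd (%n. 12 * n + 5)"
  unfolding impl_def impl_by_def
proof (intro exI[of _ "CPop 1 ;; drop1"] conjI allI)
  fix x :: "'a \<times> 'b" and r V out
  obtain a b where x: "x = (a, b)" by (cases x)
  have "runs (CPop 1) (mk [] (vcode (tre x) @ r) V, out) 1 (mk [] (vcode (tre a) @ vcode (tre b) @ r) V, out)"
    using runs_atom(3)[of 1 "mk [] (vcode (tre x) @ r) V" out] by (simp add: x)
  note runs_Seq[OF this runs_drop1]
  then show "runs (CPop 1 ;; drop1) (mk [] (vcode (tre x) @ r) V, out)
      (12 * esize x + 5) (mk [] (vcode (tre (snd x)) @ r) V, out)"
    unfolding x snd_conv by (rule runs_mono) (simp add: esize_def)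
  show "esize (snd x) <= 12 * esize x + 5" by (simp add: x esize_def)
qed simp

text \<open>
  Case distinction on the shape of a tree: it covers booleans, naturals and lists, since a
  nonempty list is encoded like the pair of its head and its tail.
\<close>

lemma impl_case:
  fixes l :: "'a::treelike => 'l::treelike" and p :: "'a => 'p::treelike" and q :: "'a => 'q::treelike"
  assumes "impl l Tl" "impl f Tf" "impl g Tg" "mono Tf" "mono Tg"
    and F: "!!x. tre (l x) = Lf & F x = f x \<or> tre (l x) = Nd (tre (p x)) (tre (q x)) & F x = g (x, (p x, q x))"
  shows "impl F (%n. Tl n + Tf n + Tg (n + Tl n + 1) + 34 * n + 16)"
proof -
  obtain cl cf cg where c: "impl_by cl l Tl" "impl_by cf f Tf" "impl_by cg g Tg"
    using assms(1-3) by (auto simp: impl_def)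
  note l = impl_byD[OF c(1)] and f = impl_byD[OF c(2)] and g = impl_byD[OF c(3)]
  let ?c = "dup ;; cl ;; CIf 1 2 (unsave ;; push 1 2 ;; cg) (CPop 1 ;; unsave ;; cf)"
  let ?T = "%n. Tl n + Tf n + Tg (n + Tl n + 1) + 34 * n + 16"
  have "runs ?c (mk [] (vcode (tre x) @ r) V, out) (?T (esize x)) (mk [] (vcode (tre (F x)) @ r) V, out)
      & esize (F x) <= ?T (esize x)" for x r V out
  proof (cases "tre (l x) = Lf")
    case True
    then have "runs (CPop 1) (mk [] (vcode (tre (l x)) @ r) (vcode (tre x) @ V), out) 1
        (mk [] r (vcode (tre x) @ V), out)" and Fx: "F x = f x"
      using F[of x] runs_atom(3)[of 1 "mk [] (vcode (tre (l x)) @ r) (vcode (tre x) @ V)" out] by auto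
    note runs_Seq[OF this(1) runs_Seq[OF runs_unsave f(2)]]
    from runs_IfF[OF _ this] have
      "runs (CIf 1 2 (unsave ;; push 1 2 ;; cg) (CPop 1 ;; unsave ;; cf))
        (mk [] (vcode (tre (l x)) @ r) (vcode (tre x) @ V), out)
        (1 + (16 * vsize (tre x) + 4 + Tf (esize x)) + 2) (mk [] (vcode (tre (f x)) @ r) V, out)"
      by (simp add: True)
    from runs_Seq[OF runs_dup runs_Seq[OF l(2) this]] show ?thesis
      using f(3)[of x] by (auto simp: Fx esize_def elim!: runs_mono)
  next
    case False
    then have lx: "tre (l x) = Nd (tre (p x)) (tre (q x))" and Fx: "F x = g (x, (p x, q x))"
      using F[of x] by auto
    have "esize (x, p x, q x) <= esize x + Tl (esize x) + 1"
      using l(3)[of x] lx by (simp add: esize_def)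
    then have le: "Tg (esize (x, p x, q x)) <= Tg (esize x + Tl (esize x) + 1)"
      using assms(5) by (simp add: monoD)
    have "runs (push 1 2) (mk [] (vcode (tre x) @ vcode (tre (l x)) @ r) V, out) 2
        (mk [] (vcode (tre (x, (p x, q x))) @ r) V, out)"
      using runs_push[of 1 2 "mk [] (vcode (tre x) @ vcode (tre (l x)) @ r) V" out] by (simp add: lx)
    note runs_Seq[OF runs_unsave runs_Seq[OF this g(2)]]
    from runs_IfT[OF _ this] have
      "runs (CIf 1 2 (unsave ;; push 1 2 ;; cg) (CPop 1 ;; unsave ;; cf))
        (mk [] (vcode (tre (l x)) @ r) (vcode (tre x) @ V), out)
        (16 * vsize (tre x) + 4 + (2 + Tg (esize (x, p x, q x))) + 2)
        (mk [] (vcode (tre (g (x, p x, q x))) @ r) V, out)"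
      by (simp add: lx)
    from runs_Seq[OF runs_dup runs_Seq[OF l(2) this]] show ?thesis
      using g(3)[of "(x, p x, q x)"] le by (auto simp: Fx esize_def elim!: runs_mono)
  qed
  then show ?thesis unfolding impl_def impl_by_def
    using l(1) f(1) g(1) by (intro exI[of _ ?c]) auto
qed

section \<open>Polynomial time\<close>

lemma poly_nat_mono: "x <= y ==> poly (p::nat poly) x <= poly p y"
  by (induction p) (auto intro!: add_mono mult_mono)

definition pbd :: "(nat => nat) => bool" where
  "pbd T <-> (\<exists>p::nat poly. ALL n. T n <= poly p n)"

named_theorems pbd_intros

lemma pbd_const [pbd_intros]: "pbd (%n. c)"
  unfolding pbd_def by (intro exI[of _ "[:c:]"]) simp

lemma pbd_id [pbd_intros]: "pbd (%n. n)"
  unfolding pbd_def by (intro exI[of _ "[:0, 1:]"]) simp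

lemma pbd_poly [pbd_intros]: "pbd (poly p)"
  unfolding pbd_def by (intro exI[of _ p]) simp

lemma pbd_add [pbd_intros]:
  assumes "pbd S" "pbd T" shows "pbd (%n. S n + T n)"
proof -
  obtain p q where "ALL n. S n <= poly p n" "ALL n. T n <= poly q n" using assms by (auto simp: pbd_def)
  then show ?thesis unfolding pbd_def by (intro exI[of _ "p + q"]) (simp add: add_mono)
qed

lemma pbd_mult [pbd_intros]:
  assumes "pbd S" "pbd T" shows "pbd (%n. S n * T n)"
proof -
  obtain p q where "ALL n. S n <= poly p n" "ALL n. T n <= poly q n" using assms by (auto simp: pbd_def)
  then show ?thesis unfolding pbd_def by (intro exI[of _ "p * q"]) (simp add: mult_mono)
qed

lemma pbd_Suc [pbd_intros]: "pbd S ==> pbd (%n. Suc (S n))"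
  using pbd_add[OF _ pbd_const[of 1], of S] by simp

lemma pbd_poly_comp [pbd_intros]:
  assumes "pbd T" shows "pbd (%n. poly p (T n))"
proof -
  obtain q where "ALL n. T n <= poly q n" using assms by (auto simp: pbd_def)
  then show ?thesis unfolding pbd_def
    by (intro exI[of _ "pcompose p q"]) (simp add: poly_pcompose poly_nat_mono)
qed

lemma pbd_power [pbd_intros]: "pbd S ==> pbd (%n. S n ^ k)"
  by (induction k) (auto intro: pbd_const pbd_mult)

definition pf :: "('a::treelike => 'b::treelike) => bool" where
  "pf f <-> (\<exists>p::nat poly. impl f (poly p))"

lemma pfI: "impl f T ==> pbd T ==> pf f"
  unfolding pf_def pbd_def by (meson impl_mono)

named_theorems pf_intros

lemma mono_poly: "mono (poly (p::nat poly))"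
  by (simp add: monoI poly_nat_mono)

lemma pf_ident [pf_intros]: "pf (%x. x)"
  by (rule pfI[OF impl_id]) (intro pbd_intros)

lemma pf_const [pf_intros]: "pf (%x. k)"
  by (rule pfI[OF impl_const]) (intro pbd_intros)

lemma pf_comp: "pf f ==> pf g ==> pf (%x. f (g x))"
  unfolding pf_def[of f] pf_def[of g]
  by (elim exE, rule pfI[OF impl_comp[OF _ _ mono_poly]], assumption, assumption) (intro pbd_intros)

lemma pf_pair [pf_intros]: "pf f ==> pf g ==> pf (%x. (f x, g x))"
  unfolding pf_def[of f] pf_def[of g]
  by (elim exE, rule pfI[OF impl_pair], assumption, assumption) (intro pbd_intros)

lemma pf_fst [pf_intros]: "pf f ==> pf (%x. fst (f x))"
  by (rule pf_comp[of fst], rule pfI[OF impl_fst]) (intro pbd_intros)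

lemma pf_snd [pf_intros]: "pf f ==> pf (%x. snd (f x))"
  by (rule pf_comp[of snd], rule pfI[OF impl_snd]) (intro pbd_intros)

lemma pf_recode: "pf f ==> (!!x. tre (g x) = tre (f x)) ==> pf g"
  unfolding pf_def by (meson impl_recode)

lemma pf_case:
  fixes l :: "'a::treelike => 'l::treelike" and p :: "'a => 'p::treelike" and q :: "'a => 'q::treelike"
  assumes "pf l" "pf f" "pf g"
    and F: "!!x. tre (l x) = Lf & F x = f x \<or> tre (l x) = Nd (tre (p x)) (tre (q x)) & F x = g (x, (p x, q x))"
  shows "pf F"
proof -
  obtain a b c where "impl l (poly a)" "impl f (poly b)" "impl g (poly c)" using assms(1-3) by (auto simp: pf_def)
  from impl_case[OF this mono_poly mono_poly, of F p q] F show ?thesis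
    by (rule_tac pfI) (auto intro!: pbd_intros)
qed

lemma pf_if [pf_intros]:
  assumes "pf b" "pf f" "pf g"
  shows "pf (%x. if b x then f x else g x)"
proof -
  have "pf (%z. f (fst z))" by (rule pf_comp[OF assms(2)]) (intro pf_intros)
  then show ?thesis
    by (rule pf_case[OF assms(1,3), where p = "%_. ()" and q = "%_. ()"]) auto
qed

lemma pf_case_list:
  fixes l :: "'a::treelike => 'e::treelike list"
  assumes "pf l" "pf f" "pf (%z. g (fst z) (fst (snd z)) (snd (snd z)))"
  shows "pf (%x. case l x of [] => f x | e # c => g x e c)"
proof (rule pf_case[OF assms, where p = "%x. hd (l x)" and q = "%x. tl (l x)"])
  fix x
  show "tre (l x) = Lf & (case l x of [] => f x | e # c => g x e c) = f x \<or>
      tre (l x) = Nd (tre (hd (l x))) (tre (tl (l x))) &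
      (case l x of [] => f x | e # c => g x e c) =
        g (fst (x, hd (l x), tl (l x))) (fst (snd (x, hd (l x), tl (l x)))) (snd (snd (x, hd (l x), tl (l x))))"
    by (cases "l x") auto
qed

lemma pf_case_nat:
  assumes "pf l" "pf f" "pf (%z. g (fst z) (snd z))"
  shows "pf (%x. case l x of 0 => f x | Suc n => g x n)"
proof (rule pf_case[OF assms(1,2), where p = "%x. ()" and q = "%x. l x - 1"])
  show "pf (%z. g (fst z) (snd (snd (z::_ \<times> unit \<times> nat))))"
    using pf_comp[OF assms(3), of "%z. (fst z, snd (snd z))"] by (simp add: pf_intros)
  fix x
  show "tre (l x) = Lf & (case l x of 0 => f x | Suc n => g x n) = f x \<or>
      tre (l x) = Nd (tre ()) (tre (l x - 1)) &
      (case l x of 0 => f x | Suc n => g x n) = g (fst (x, (), l x - 1)) (snd (snd (x, (), l x - 1)))"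
    by (cases "l x") auto
qed

lemma esize_simps [simp]:
  "esize True = 3" "esize False = 1" "esize (n::nat) = 2 * n + 1"
  "esize (a, b) = 1 + esize a + esize b" "esize ([]::'a::treelike list) = 1"
  "esize (x # xs) = 1 + esize x + esize xs" "esize () = 1"
  by (auto simp: esize_def) (induction n; simp)

lemma esize_pos [simp]: "0 < esize x"
  by (simp add: esize_def)

lemma esize_list: "esize xs = 1 + length xs + sum_list (map esize xs)"
  by (induction xs) auto

lemma length_le_esize: "length xs <= esize xs"
  by (simp add: esize_list)

lemma esize_mem: "x \<in> set xs ==> esize x <= esize xs"
  by (induction xs) auto

lemma esize_append: "esize (xs @ ys) + 1 = esize xs + esize ys"
  by (simp add: esize_list)

lemma esize_take: "esize (take k xs) <= esize xs"
proof -
  have "esize xs + 1 = esize (take k xs) + esize (drop k xs)"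
    using esize_append[of "take k xs" "drop k xs"] by simp
  then show ?thesis using esize_pos[of "drop k xs"] by linarith
qed

lemma esize_list_le:
  assumes "length xs <= m" "!!x. x \<in> set xs ==> esize x <= b"
  shows "esize xs <= m * (b + 1) + 1"
proof -
  have "sum_list (map esize xs) <= length xs * b"
    using sum_list_mono[of xs esize "%_. b"] assms(2) by (simp add: sum_list_triv)
  moreover have "length xs * b <= m * b" using assms(1) by simp
  ultimately show ?thesis using assms(1) unfolding esize_list add_mult_distrib2 mult_1_right by linarith
qed

subsection \<open>Bounded recursion\<close>

text \<open>\<open>B\<close> bounds only the accumulators that actually occur. The time is
  polynomial in the input size plus \<open>B\<close>, however large \<open>B\<close> is, which later
  admits accumulators of exponential size.\<close>

lemma fold_program:
  fixes h :: "'x::treelike \<times> 'e::treelike \<times> 'y::treelike => 'y"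
  assumes "pf h"
  shows "\<exists>c (q::nat poly). wf_com c & (ALL l x y r V out B.
    (ALL k<=length l. esize (fold (%e y. h (x, e, y)) (take k l) y) <= B) -->
    runs c (mk [] (vcode (tre (l, (x, y))) @ r) V, out) (poly q (esize (l, (x, y)) + B))
      (mk [] (vcode (tre (x, fold (%e y. h (x, e, y)) l y)) @ r) V, out))"
proof -
  define body where "body z = (case fst z of [] => z | e # c =>
      (c, (fst (snd z), h (fst (snd z), e, snd (snd z)))))" for z :: "'e list \<times> 'x \<times> 'y"
  have "pf body" unfolding body_def
    by (intro pf_case_list pf_intros pf_comp[OF assms])
  then obtain cb pb where cb: "impl_by cb body (poly pb)" by (auto simp: pf_def impl_def)
  \<comment> \<open>Between rounds the root symbol of the triple is kept off the stack. The top
    symbol is then the first one of the list code, and it is 1 precisely when the list is exhausted;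
    the body restores the root and removes it again.\<close>
  let ?lc = "push 1 2 ;; cb ;; CPop 1"
  let ?loop = "CWhile 1 1 ?lc"
  have loop: "runs ?loop (mk [] (vcode (tre l) @ vcode (tre (x, y)) @ r) V, out)
      (length l * (poly pb M + 5) + 1)
      (mk [] (1 # vcode (tre (x, fold (%e y. h (x, e, y)) l y)) @ r) V, out)"
    if "ALL k<=length l. esize (fold (%e y. h (x, e, y)) (take k l) y) <= B" "esize l + esize x + B + 2 <= M"
    for l x y r V out B M
    using that
  proof (induction l arbitrary: y)
    case Nil
    then show ?case using runs_WhileE[of "mk [] (1 # vcode (tre (x, y)) @ r) V" 1 1] by simp
  next
    case (Cons e l)
    let ?y = "h (x, e, y)"
    have "ALL k<=length l. esize (fold (%e y. h (x, e, y)) (take k l) ?y) <= B"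
    proof (intro allI impI)
      fix k assume "k <= length l"
      then show "esize (fold (%e y. h (x, e, y)) (take k l) ?y) <= B"
        using Cons.prems(1)[rule_format, of "Suc k"] by simp
    qed
    then have IH: "runs ?loop (mk [] (vcode (tre l) @ vcode (tre (x, ?y)) @ r) V, out)
      (length l * (poly pb M + 5) + 1)
      (mk [] (1 # vcode (tre (x, fold (%e y. h (x, e, y)) l ?y)) @ r) V, out)"
      using Cons.IH[of ?y] Cons.prems(2) by simp
    let ?z = "(e # l, (x, y))"
    have "esize y <= B" using Cons.prems(1)[rule_format, of 0] by simp
    then have "esize ?z <= M" using Cons.prems(2) by simp
    then have le: "poly pb (esize ?z) <= poly pb M" by (rule poly_nat_mono)
    have 1: "runs (push 1 2) (mk [] (vcode (tre (e # l)) @ vcode (tre (x, y)) @ r) V, out) 2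
        (mk [] (vcode (tre ?z) @ r) V, out)"
      using runs_push[of 1 2 "mk [] (vcode (tre (e # l)) @ vcode (tre (x, y)) @ r) V" out] by simp
    have b: "body ?z = (l, (x, ?y))" by (simp add: body_def)
    have 2: "runs (CPop 1) (mk [] (vcode (tre (body ?z)) @ r) V, out) 1
        (mk [] (vcode (tre l) @ vcode (tre (x, ?y)) @ r) V, out)"
      using runs_atom(3)[of 1 "mk [] (vcode (tre (body ?z)) @ r) V" out] by (simp add: b)
    note runs_Seq[OF 1 runs_Seq[OF impl_byD(2)[OF cb] 2]]
    from runs_WhileL[OF _ this IH] show ?case using le by (auto elim!: runs_mono)
  qed
  let ?c = "CPop 1 ;; ?loop ;; CPop 1"
  let ?q = "[:0, 1:] * (pcompose pb [:3, 1:] + [:5:]) + [:5:]"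
  have "runs ?c (mk [] (vcode (tre (l, (x, y))) @ r) V, out) (poly ?q (esize (l, (x, y)) + B))
      (mk [] (vcode (tre (x, fold (%e y. h (x, e, y)) l y)) @ r) V, out)"
    if B: "ALL k<=length l. esize (fold (%e y. h (x, e, y)) (take k l) y) <= B" for l x y r V out B
  proof -
    let ?n = "esize (l, (x, y)) + B" and ?f = "fold (%e y. h (x, e, y)) l y"
    have 1: "runs (CPop 1) (mk [] (vcode (tre (l, (x, y))) @ r) V, out) 1
       (mk [] (vcode (tre l) @ vcode (tre (x, y)) @ r) V, out)"
      using runs_atom(3)[of 1 "mk [] (vcode (tre (l, (x, y))) @ r) V" out] by simp
    have 2: "runs (CPop 1) (mk [] (1 # vcode (tre (x, ?f)) @ r) V, out) 1
       (mk [] (vcode (tre (x, ?f)) @ r) V, out)"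
      using runs_atom(3)[of 1 "mk [] (1 # vcode (tre (x, ?f)) @ r) V" out] by simp
    have "esize l + esize x + B + 2 <= 3 + ?n" by simp
    from runs_Seq[OF 1 runs_Seq[OF loop[OF B this] 2]]
    have "runs ?c (mk [] (vcode (tre (l, (x, y))) @ r) V, out)
       (1 + (length l * (poly pb (3 + ?n) + 5) + 1 + 1))
       (mk [] (vcode (tre (x, ?f)) @ r) V, out)" .
    moreover have "length l <= ?n" using length_le_esize[of l] by simp
    then have "length l * (poly pb (3 + ?n) + 5) <= ?n * (poly pb (3 + ?n) + 5)" by (rule mult_le_mono1)
    then have "1 + (length l * (poly pb (3 + ?n) + 5) + 1 + 1) <= poly ?q ?n"
      by (simp add: poly_pcompose)
    ultimately show ?thesis by (rule runs_mono)
  qed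
  then show ?thesis using impl_byD(1)[OF cb] by (intro exI[of _ ?c] exI[of _ ?q]) auto
qed

text \<open>The bound on the intermediate results may be exponential.\<close>

lemma impl_fold:
  fixes h :: "'x::treelike \<times> 'e::treelike \<times> 'y::treelike => 'y"
  assumes "pf h" "pf l" "pf i"
    and B: "!!x k. esize (fold (%e y. h (x, e, y)) (take k (l x)) (i x)) <= B (esize x)"
  shows "\<exists>q::nat poly. impl (%x. fold (%e y. h (x, e, y)) (l x) (i x)) (%n. poly q (n + B n))"
proof -
  obtain c q where wf: "wf_com c" and c: "!!l x y r V out B.
    (ALL k<=length l. esize (fold (%e y. h (x, e, y)) (take k l) y) <= B) ==>
    runs c (mk [] (vcode (tre (l, (x, y))) @ r) V, out) (poly q (esize (l, (x, y)) + B))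
      (mk [] (vcode (tre (x, fold (%e y. h (x, e, y)) l y)) @ r) V, out)"
    using fold_program[OF assms(1)] by blast
  have "pf (%x. (l x, (x, i x)))" by (intro pf_intros assms)
  then obtain ca pa where ca: "impl_by ca (%x. (l x, (x, i x))) (poly pa)" by (auto simp: pf_def impl_def)
  have "pf (snd :: 'x \<times> 'y => 'y)" by (intro pf_intros)
  then obtain cs ps where cs: "impl_by cs (snd :: 'x \<times> 'y => 'y) (poly ps)" by (auto simp: pf_def impl_def)
  let ?F = "%x. fold (%e y. h (x, e, y)) (l x) (i x)"
  let ?q = "pa + (pcompose q (pa + [:0, 1:]) + pcompose ps [:1, 1:]) + [:0, 1:]"
  have F: "esize (?F x) <= B (esize x)" for x using B[of x "length (l x)"] by simp
  have "runs (ca ;; c ;; cs) (mk [] (vcode (tre x) @ r) V, out) (poly ?q (esize x + B (esize x)))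
     (mk [] (vcode (tre (?F x)) @ r) V, out)" for x r V out
  proof -
    let ?n = "esize x + B (esize x)"
    note run = runs_Seq[OF impl_byD(2)[OF ca] runs_Seq[OF c impl_byD(2)[OF cs]], of x "B (esize x)" r V out]
    have "esize (l x, (x, i x)) <= poly pa (esize x)" using impl_byD(3)[OF ca, of x] by simp
    moreover have le: "poly pa (esize x) <= poly pa ?n" by (intro poly_nat_mono) simp
    ultimately have "poly q (esize (l x, (x, i x)) + B (esize x)) <= poly q (poly pa ?n + ?n)"
      by (intro poly_nat_mono add_mono) auto
    moreover have "poly ps (esize (x, ?F x)) <= poly ps (1 + ?n)" using F[of x]
      by (intro poly_nat_mono) simp
    ultimately show ?thesis using run B le by (auto simp: poly_pcompose elim!: runs_mono)
  qed
  moreover have "esize (?F x) <= poly ?q (esize x + B (esize x))" for x using F[of x] by simp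
  ultimately show ?thesis unfolding impl_def impl_by_def
    using wf impl_byD(1)[OF ca] impl_byD(1)[OF cs]
    by (intro exI[of _ ?q] exI[of _ "ca ;; c ;; cs"]) simp
qed

lemma pf_fold:
  fixes h :: "'x::treelike => 'e::treelike => 'y::treelike => 'y"
  assumes "pf (%z. h (fst z) (fst (snd z)) (snd (snd z)))" "pf l" "pf i"
    and B: "!!x k. esize (fold (h x) (take k (l x)) (i x)) <= B (esize x)" and "pbd B"
  shows "pf (%x. fold (h x) (l x) (i x))"
proof -
  obtain q :: "nat poly" where "impl (%x. fold (h x) (l x) (i x)) (%n. poly q (n + B n))"
    using impl_fold[OF assms(1-3), of B] B by auto
  then show ?thesis by (rule pfI) (intro pbd_intros assms(5))
qed

subsection \<open>Turing machines\<close>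

text \<open>Lists are built from the tail, so the bits are first reversed onto stack 2. Below a cons
  symbol 2, the bit True is the code 2 1 1 and False is the code 1.\<close>

definition read_prog :: com where
  "read_prog = CWhile 0 0 (CIf 0 2 (push 2 2 ;; CPop 0) (push 2 1 ;; CPop 0)) ;; push 1 1 ;;
     CWhile 2 0 (CIf 2 2 (push 1 1 ;; push 1 1 ;; push 1 2 ;; push 1 2 ;; CPop 2)
                         (push 1 1 ;; push 1 2 ;; CPop 2))"

definition write_prog :: com where
  "write_prog = CWhile 1 1 (CPop 1 ;; CIf 1 2 (CPop 1 ;; CPop 1 ;; CPop 1 ;; CEmit 2) (CPop 1 ;; CEmit 1))"

lemma runs_read_loop:
  "runs (CWhile 2 0 (CIf 2 2 (push 1 1 ;; push 1 1 ;; push 1 2 ;; push 1 2 ;; CPop 2)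
                         (push 1 1 ;; push 1 2 ;; CPop 2)))
    (mk [] (vcode (tre y)) (map bit_symbol x), out) (13 * length x + 1) (mk [] (vcode (tre (rev x @ y))) [], out)"
  (is "runs (CWhile 2 0 ?b) _ _ _")
proof (induction x arbitrary: y)
  case Nil
  then show ?case using runs_WhileE[of "mk [] (vcode (tre y)) []" 2 0] by simp
next
  case (Cons a x)
  let ?S = "mk [] (vcode (tre y)) (map bit_symbol (a # x))"
  have 1: "runs (push 1 1 ;; push 1 1 ;; push 1 2 ;; push 1 2 ;; CPop 2) (?S, out) (2 + (2 + (2 + (2 + 1))))
       (mk [] (2 # 2 # 1 # 1 # vcode (tre y)) (map bit_symbol x), out)"
    by (rule runs_Seq[OF runs_push runs_Seq[OF runs_push runs_Seq[OF runs_push runs_Seq[OF runs_push runs_atom(3)]]],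
        THEN back_subst[of "runs _ _ _"]]) simp
  have 2: "runs (push 1 1 ;; push 1 2 ;; CPop 2) (?S, out) (2 + (2 + 1))
       (mk [] (2 # 1 # vcode (tre y)) (map bit_symbol x), out)"
    by (rule runs_Seq[OF runs_push runs_Seq[OF runs_push runs_atom(3)], THEN back_subst[of "runs _ _ _"]]) simp
  have 3: "runs ?b (?S, out) 11 (mk [] (vcode (tre (a # y))) (map bit_symbol x), out)"
  proof (cases a)
    case True
    then show ?thesis by (intro runs_IfT[OF _ 1, THEN runs_mono, THEN back_subst[of "runs _ _ _"]])
      (auto simp: bit_symbol_def)
  next
    case False
    then show ?thesis by (intro runs_IfF[OF _ 2, THEN runs_mono, THEN back_subst[of "runs _ _ _"]])
      (auto simp: bit_symbol_def)
  qed
  have 4: "hdd (?S 2) ~= 0" by (simp add: bit_symbol_def)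
  show ?case using runs_WhileL[OF 4 3 Cons.IH] by (auto elim!: runs_mono)
qed

lemma runs_read_prog:
  "runs read_prog (input_mem x) (20 * length x + 5) (mk [] (vcode (tre x)) [], [])"
proof -
  have m: "input_mem x = (mk (map bit_symbol x) [] [], [])"
    by (auto simp: input_mem_def mk_def fun_eq_iff)
  have 1: "runs (CWhile 0 0 (CIf 0 2 (push 2 2 ;; CPop 0) (push 2 1 ;; CPop 0))) (input_mem x) (7 * length x + 1)
      (mk [] [] (map bit_symbol (rev x)), [])"
    using runs_pour[of 2 "map bit_symbol x" "[]" "[]" "[]"]
    by (auto simp: m pour_def rev_map bit_symbol_def)
  have 2: "runs (push 1 1) (mk [] [] (map bit_symbol (rev x)), []) 2
      (mk [] (vcode (tre ([]::bool list))) (map bit_symbol (rev x)), [])"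
    using runs_push[of 1 1 "mk [] [] (map bit_symbol (rev x))" "[]"] by simp
  show ?thesis unfolding read_prog_def
    by (rule runs_Seq[OF 1 runs_Seq[OF 2 runs_read_loop], THEN runs_mono, THEN back_subst[of "runs _ _ _"]]) auto
qed

lemma runs_write_prog:
  "runs write_prog (mk [] (vcode (tre x)) V, out) (10 * length x + 1) (mk [] [1] V, out @ map bit_symbol x)"
proof (induction x arbitrary: out)
  case Nil
  then show ?case using runs_WhileE[of "mk [] [1] V" 1 1] by (simp add: write_prog_def)
next
  case (Cons a x)
  let ?S' = "mk [] (vcode (tre a) @ vcode (tre x)) V" and ?S'' = "mk [] (vcode (tre x)) V"
  let ?out = "out @ [bit_symbol a]"
  have 0: "runs (CPop 1) (mk [] (vcode (tre (a # x))) V, out) 1 (?S', out)"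
    using runs_atom(3)[of 1 "mk [] (vcode (tre (a # x))) V" out] by simp
  have 1: "runs (CIf 1 2 (CPop 1 ;; CPop 1 ;; CPop 1 ;; CEmit 2) (CPop 1 ;; CEmit 1)) (?S', out) 6 (?S'', ?out)"
  proof (cases a)
    case True
    have "runs (CPop 1 ;; CPop 1 ;; CPop 1 ;; CEmit 2) (?S', out) (1 + (1 + (1 + 1))) (?S'', ?out)"
      by (rule runs_Seq[OF runs_atom(3) runs_Seq[OF runs_atom(3) runs_Seq[OF runs_atom(3) runs_atom(4)]],
        THEN back_subst[of "runs _ _ _"]]) (simp add: True bit_symbol_def)
    then show ?thesis by (intro runs_IfT[THEN runs_mono]) (auto simp: True)
  next
    case False
    have "runs (CPop 1 ;; CEmit 1) (?S', out) (1 + 1) (?S'', ?out)"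
      by (rule runs_Seq[OF runs_atom(3) runs_atom(4), THEN back_subst[of "runs _ _ _"]]) (simp add: False bit_symbol_def)
    then show ?thesis by (intro runs_IfF[THEN runs_mono]) (auto simp: False)
  qed
  have 2: "hdd (mk [] (vcode (tre (a # x))) V 1) ~= 1" by simp
  from runs_WhileL[OF 2 runs_Seq[OF 0 1] Cons.IH[unfolded write_prog_def]]
  show ?case unfolding write_prog_def by (auto elim!: runs_mono)
qed

text \<open>Reading costs \<open>20 * n + 5\<close> steps. The result has length at most the value
  of \<open>T\<close>, so writing it costs at most ten times that value plus 1, besides the run of
  the program itself. A list of n bits has size at most \<open>4 * n + 1\<close>.\<close>

theorem impl_tm_computes:
  assumes "impl (f :: bool list => bool list) T" "mono T"
  shows "EX M. wf_tm M & tm_computes M f (%n. 20 * n + 6 + 11 * T (4 * n + 1))"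
proof -
  obtain c where c: "impl_by c f T" using assms by (auto simp: impl_def)
  note c = impl_byD[OF c]
  show ?thesis
  proof (rule com_tm_computes[of "read_prog ;; c ;; write_prog"])
    show "wf_com (read_prog ;; c ;; write_prog)"
      using c(1) by (simp add: read_prog_def write_prog_def)
    fix x :: "bool list"
    have "esize x <= length x * (3 + 1) + 1"
      by (rule esize_list_le) (auto simp: esize_def tre_bool_def)
    then have "T (esize x) <= T (4 * length x + 1)" using assms(2) by (simp add: monoD mult.commute)
    moreover have "length (f x) <= T (esize x)" using c(3)[of x] length_le_esize[of "f x"] by simp
    moreover note runs_Seq[OF runs_read_prog runs_Seq[OF c(2)[of x "[]" "[]" "[]", simplified] runs_write_prog]]
    ultimately have "runs (read_prog ;; c ;; write_prog) (input_mem x) (20 * length x + 6 + 11 * T (4 * length x + 1))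
        (mk [] [1] [], map bit_symbol (f x))"
      by (auto elim!: runs_mono)
    then show "EX n S. n <= 20 * length x + 6 + 11 * T (4 * length x + 1) &
        exec (read_prog ;; c ;; write_prog) (input_mem x) n (S, map bit_symbol (f x))"
      by (auto simp: runs_def)
  qed
qed

theorem pf_polytime_computable: "pf f ==> polytime_computable f"
proof -
  assume "pf f"
  then obtain p where "impl f (poly p)" by (auto simp: pf_def)
  from impl_tm_computes[OF this mono_poly] obtain M where M: "wf_tm M"
    "tm_computes M f (%n. 20 * n + 6 + 11 * poly p (4 * n + 1))" by blast
  have "pbd (%n. 20 * n + 6 + 11 * poly p (4 * n + 1))" by (intro pbd_intros)
  then obtain q where q: "!!n. 20 * n + 6 + 11 * poly p (4 * n + 1) <= poly q n" by (auto simp: pbd_def)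
  have "tm_computes M f (poly q)" using M(2) q unfolding tm_computes_def by (meson le_trans)
  then show ?thesis using M(1) by (auto simp: polytime_computable_def)
qed

subsection \<open>A library of polynomial-time functions\<close>

lemma pf_size: "pf f ==> \<exists>p::nat poly. ALL x. esize (f x) <= poly p (esize x)"
  unfolding pf_def impl_def impl_by_def by blast

lemma pf_cong: "pf f ==> (!!x. g x = f x) ==> pf g"
  by (rule pf_recode) simp_all

lemma pf_Suc [pf_intros]: "pf f ==> pf (%x. Suc (f x))"
  by (rule pf_recode[of "%x. ((), f x)"]) (simp_all add: pf_intros)

lemma pf_Cons [pf_intros]: "pf f ==> pf g ==> pf (%x. f x # g x)"
  by (rule pf_recode[of "%x. (f x, g x)"]) (simp_all add: pf_intros)

lemma pf_Not [pf_intros]: "pf f ==> pf (%x. ~ f x)"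
proof -
  assume "pf f"
  then have "pf (%x. if f x then False else True)" by (intro pf_if pf_const)
  then show ?thesis by (rule pf_cong) auto
qed

lemma pf_conj [pf_intros]: "pf f ==> pf g ==> pf (%x. f x & g x)"
proof -
  assume "pf f" "pf g"
  then have "pf (%x. if f x then g x else False)" by (intro pf_if pf_const)
  then show ?thesis by (rule pf_cong) auto
qed

lemma pf_disj [pf_intros]: "pf f ==> pf g ==> pf (%x. f x \<or> g x)"
proof -
  assume "pf f" "pf g"
  then have "pf (%x. if f x then True else g x)" by (intro pf_if pf_const)
  then show ?thesis by (rule pf_cong) auto
qed

lemma pf_imp [pf_intros]: "pf f ==> pf g ==> pf (%x. f x --> g x)"
proof -
  assume "pf f" "pf g"
  then have "pf (%x. if f x then g x else True)" by (intro pf_if pf_const)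
  then show ?thesis by (rule pf_cong) auto
qed

definition units :: "nat => unit list" where
  "units n = replicate n ()"

text \<open>A number and the list of that many units have the same tree, so iteration over a number
  is a fold over a list.\<close>

lemma pf_units: "pf f ==> pf (%x. units (f x))"
proof (rule pf_recode)
  have "tre (units n) = tre n" for n by (induction n) (auto simp: units_def)
  then show "tre (units (f x)) = tre (f x)" for x .
qed

lemma take_units: "take k (units n) = units (min k n)"
  by (simp add: units_def)

lemma fold_units: "fold (%_. g) (units n) = g ^^ n"
proof (induction n)
  case (Suc n)
  then show ?case using funpow_Suc_apply[of n g] by (auto simp: units_def fun_eq_iff simp del: funpow.simps)
qed (simp add: units_def)

lemma pf_funpow:
  fixes g :: "'x::treelike => 'y::treelike => 'y"
  assumes "pf (%z. g (fst z) (snd z))" "pf n" "pf i"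
    and B: "!!x k. k <= n x ==> esize ((g x ^^ k) (i x)) <= B (esize x)" and "pbd B"
  shows "pf (%x. (g x ^^ n x) (i x))"
proof -
  have "pf (%z. g (fst z) (snd (snd (z::'x \<times> unit \<times> 'y))))"
    using pf_comp[OF assms(1), of "%z::'x \<times> unit \<times> 'y. (fst z, snd (snd z))"] by (simp add: pf_intros)
  from pf_fold[of "%x _. g x", OF this pf_units[OF assms(2)] assms(3), of B] B assms(5)
  show ?thesis by (simp add: take_units fold_units)
qed

lemma pf_case_nat_pred [pf_intros]: "pf f ==> pf (%x. f x - (1::nat))"
proof -
  assume "pf f"
  then have "pf (%x. case f x of 0 => 0 | Suc n => n)" by (intro pf_case_nat pf_intros)
  moreover have "(case m of 0 => 0 | Suc n => n) = m - 1" for m by (cases m) auto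
  ultimately show ?thesis by simp
qed

lemma esize_rev: "esize (rev xs) = esize xs"
  by (simp add: esize_list sum_list_rev flip: rev_map)

lemma pf_rev [pf_intros]:
  fixes f :: "'x::treelike => 'c::treelike list"
  assumes "pf f"
  shows "pf (%x. rev (f x))"
proof -
  have "pf (%x::'c list. fold (%e y. e # y) x [])"
    by (rule pf_fold[of "%_ e y. e # y" _ _ "%n. n"])
      (auto intro!: pf_intros pbd_intros esize_take simp: fold_Cons_rev[unfolded fun_eq_iff] esize_rev)
  moreover have "fold (%e y. e # y) x [] = rev x" for x :: "'c list"
    using fold_Cons_rev[of x] by simp
  ultimately have "pf (rev :: 'c list => _)" by (simp add: fun_eq_iff)
  from pf_comp[OF this assms] show ?thesis .
qed

lemma pf_append [pf_intros]: "pf f ==> pf g ==> pf (%x. f x @ g x)"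
proof -
  have eq: "fold (%e y. e # y) xs ys = rev xs @ ys" for xs ys :: "'b list"
    using fold_Cons_rev[of xs] by simp
  have b: "esize (rev (take k (rev xs)) @ ys) <= esize xs + esize ys" for k and xs ys :: "'b list"
    using esize_append[of "rev (take k (rev xs))" ys] esize_take[of k "rev xs"]
    unfolding esize_rev by linarith
  have "pf (%z::'b list \<times> 'b list. fold (%e y. e # y) (rev (fst z)) (snd z))"
    by (rule pf_fold[of "%_ e y. e # y" _ _ "%n. n"])
      (auto intro!: pf_intros pbd_intros simp: eq intro: le_trans[OF b])
  then have p: "pf (%z::'b list \<times> 'b list. fst z @ snd z)" by (simp add: eq)
  show "pf f ==> pf g ==> ?thesis"
    using pf_comp[OF p pf_pair[of f g]] by simp
qed

lemma pf_length [pf_intros]: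
  fixes f :: "'x::treelike => 'c::treelike list"
  assumes "pf f"
  shows "pf (%x. length (f x))"
proof -
  have eq: "fold (%_ y. Suc y) xs n = length xs + n" for xs :: "'c list" and n
    by (induction xs arbitrary: n) auto
  have "pf (%x::'c list. fold (%e y. Suc y) x 0)"
    by (rule pf_fold[of "%_ e y. Suc y" _ _ "%n. 2 * n + 1"])
      (auto intro!: pf_intros pbd_intros simp: eq intro: le_trans[OF min.cobounded1 length_le_esize])
  then have "pf (length :: 'c list => _)" by (simp add: eq)
  from pf_comp[OF this assms] show ?thesis .
qed

lemma pf_add [pf_intros]: "pf f ==> pf g ==> pf (%x. f x + g x :: nat)"
proof -
  have "pf (%x. length (units (f x) @ units (g x)))" if "pf f" "pf g"
    by (intro pf_intros pf_units that)
  then show "pf f ==> pf g ==> ?thesis" by (simp add: units_def)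
qed

lemma funpow_add_nat: "((%y. y + n) ^^ k) (m::nat) = m + k * n"
  by (induction k) auto

lemma funpow_diff_nat: "((%y. y - 1) ^^ k) (m::nat) = m - k"
  by (induction k) auto

lemma pf_mult [pf_intros]: "pf f ==> pf g ==> pf (%x. f x * g x :: nat)"
proof -
  have p: "pf (%z::nat \<times> nat. ((%y. y + snd z) ^^ fst z) 0)"
  proof (rule pf_funpow[of "%z y. y + snd z" _ _ "%n. 2 * (n * n) + 1"])
    fix z :: "nat \<times> nat" and k assume "k <= fst z"
    then show "esize (((%y. y + snd z) ^^ k) 0) <= 2 * (esize z * esize z) + 1"
      using mult_le_mono[of k "esize z" "snd z" "esize z"]
      by (cases z) (simp add: funpow_add_nat del: mult_Suc mult_Suc_right)
  qed (intro pf_intros pbd_intros)+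
  show "pf f ==> pf g ==> ?thesis"
    using pf_comp[OF p pf_pair[of f g]] by (simp add: funpow_add_nat)
qed

lemma pf_diff [pf_intros]: "pf f ==> pf g ==> pf (%x. f x - g x :: nat)"
proof -
  have p: "pf (%z::nat \<times> nat. ((%y. y - 1) ^^ snd z) (fst z))"
    by (rule pf_funpow[of "%z y. y - 1" _ _ "%n. n"])
      (auto intro!: pf_intros pbd_intros simp: funpow_diff_nat simp del: One_nat_def)
  show "pf f ==> pf g ==> ?thesis"
    using pf_comp[OF p pf_pair[of f g]] by (simp add: funpow_diff_nat del: One_nat_def)
qed

lemma pf_eq0: "pf f ==> pf (%x. f x = (0::nat))"
proof -
  assume "pf f"
  then have "pf (%x. case f x of 0 => True | Suc n => False)" by (intro pf_case_nat pf_const)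
  then show ?thesis by (rule pf_cong) (auto split: nat.splits)
qed

lemma pf_le [pf_intros]: "pf f ==> pf g ==> pf (%x. f x <= (g x :: nat))"
proof -
  assume "pf f" "pf g"
  then have "pf (%x. f x - g x = 0)" by (intro pf_eq0 pf_diff)
  then show ?thesis by simp
qed

lemma pf_less [pf_intros]: "pf f ==> pf g ==> pf (%x. f x < (g x :: nat))"
proof -
  assume "pf f" "pf g"
  then have "pf (%x. Suc (f x) <= g x)" by (intro pf_le pf_Suc)
  then show ?thesis by (simp add: Suc_le_eq)
qed

lemma pf_eq_nat [pf_intros]: "pf f ==> pf g ==> pf (%x. f x = (g x :: nat))"
proof -
  assume "pf f" "pf g"
  then have "pf (%x. f x <= g x & g x <= f x)" by (intro pf_le pf_conj)
  then show ?thesis by (simp add: order_eq_iff)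
qed

lemma pf_eq_bool [pf_intros]: "pf f ==> pf g ==> pf (%x. f x = (g x :: bool))"
proof -
  assume "pf f" "pf g"
  then have "pf (%x. if f x then g x else ~ g x)" by (intro pf_if pf_Not)
  then show ?thesis by (rule pf_cong) auto
qed

lemma pf_min [pf_intros]: "pf f ==> pf g ==> pf (%x. min (f x) (g x :: nat))"
  unfolding min_def by (intro pf_intros)

lemma pf_map [pf_intros]:
  fixes f :: "'x::treelike => 'e::treelike => 'y::treelike"
  assumes "pf l" "pf (%z. f (fst z) (snd z))"
  shows "pf (%x. map (f x) (l x))"
proof -
  have eq: "fold (%e y. f x e # y) xs ys = map (f x) (rev xs) @ ys" for x xs ys
    by (induction xs arbitrary: ys) auto
  obtain p q :: "nat poly" where p: "!!x. esize (l x) <= poly p (esize x)"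
    and q: "!!z. esize (f (fst z) (snd z)) <= poly q (esize z)"
    using pf_size[OF assms(1)] pf_size[OF assms(2)] by blast
  let ?B = "%n. poly p n * (poly q (n + poly p n + 1) + 1) + 1"
  have "esize (map (f x) (rev (take k (rev (l x))))) <= ?B (esize x)" for x k
  proof (rule esize_list_le)
    show "length (map (f x) (rev (take k (rev (l x))))) <= poly p (esize x)"
      using p[of x] length_le_esize[of "l x"] by auto
    fix y assume "y \<in> set (map (f x) (rev (take k (rev (l x)))))"
    then obtain e where e: "e \<in> set (l x)" "y = f x e" by (auto dest: in_set_takeD)
    have "esize y <= poly q (esize (x, e))" using q[of "(x, e)"] e by simp
    also have "\<dots> <= poly q (esize x + poly p (esize x) + 1)"
      using esize_mem[OF e(1)] p[of x] by (intro poly_nat_mono) simp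
    finally show "esize y <= poly q (esize x + poly p (esize x) + 1)" .
  qed
  then have "pf (%x. fold (%e y. f x e # y) (rev (l x)) [])"
    by (intro pf_fold[where B = ?B] pf_intros assms pf_comp[OF assms(2), of "%z. (fst z, fst (snd z))", simplified] pbd_intros)
      (simp add: eq)
  then show ?thesis by (simp add: eq)
qed

lemma pf_filter [pf_intros]:
  fixes P :: "'x::treelike => 'e::treelike => bool"
  assumes "pf l" "pf (%z. P (fst z) (snd z))"
  shows "pf (%x. filter (P x) (l x))"
proof -
  have eq: "fold (%e y. if P x e then e # y else y) xs ys = filter (P x) (rev xs) @ ys" for x xs ys
    by (induction xs arbitrary: ys) auto
  obtain p :: "nat poly" where p: "!!x. esize (l x) <= poly p (esize x)"
    using pf_size[OF assms(1)] by blast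
  have f: "esize (filter Q xs) <= esize xs" for Q and xs :: "'e list"
    by (induction xs) auto
  have "esize (filter (P x) (rev (take k (rev (l x))))) <= poly p (esize x)" for x k
    by (rule order_trans[OF f]) (use p[of x] esize_take[of k "rev (l x)"] in \<open>simp add: esize_rev\<close>)
  then have "pf (%x. fold (%e y. if P x e then e # y else y) (rev (l x)) [])"
    by (intro pf_fold[where B = "poly p"] pf_intros assms pf_comp[OF assms(2), of "%z. (fst z, fst (snd z))", simplified] pbd_intros)
      (simp add: eq)
  then show ?thesis by (simp add: eq)
qed

lemma pf_Nil_eq [pf_intros]: "pf l ==> pf (%x. l x = [])"
proof -
  assume "pf l"
  then have "pf (%x. length (l x) = 0)" by (intro pf_eq0 pf_length)
  then show ?thesis by simp
qed

lemma pf_Ball_set [pf_intros]: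
  assumes "pf l" "pf (%z. P (fst z) (snd z))"
  shows "pf (%x. \<forall>e\<in>set (l x). P x e)"
proof -
  have "pf (%x. filter (%e. ~ P x e) (l x) = [])" by (intro pf_intros assms)
  then show ?thesis by (simp add: filter_empty_conv)
qed

lemma pf_Bex_set [pf_intros]:
  assumes "pf l" "pf (%z. P (fst z) (snd z))"
  shows "pf (%x. \<exists>e\<in>set (l x). P x e)"
proof -
  have "pf (%x. ~ (\<forall>e\<in>set (l x). ~ P x e))" by (intro pf_Not pf_Ball_set assms)
  then show ?thesis by simp
qed

lemma pf_upt0:
  assumes n: "pf (n :: 'x::treelike => nat)"
  shows "pf (%x. [0..<n x])"
proof -
  have eq: "((%y. length y # y) ^^ k) [] = rev [0..<k]" for k by (induction k) auto
  have "pf (%n. ((%y. length y # y) ^^ n) [])"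
  proof (rule pf_funpow[of "%_ y. length y # y" "%n. n" "%_. []" "%n. n * (2 * n + 1 + 1) + 1"])
    fix n k :: nat assume "k <= n"
    then show "esize (((%y. length y # y) ^^ k) []) <= esize n * (2 * esize n + 1 + 1) + 1"
      unfolding eq by (intro esize_list_le) auto
  qed (intro pf_intros pbd_intros)+
  from pf_rev[OF pf_comp[OF this n]] show ?thesis by (simp add: eq)
qed

lemma pf_upt [pf_intros]: "pf m ==> pf n ==> pf (%x. [m x..<n x])"
proof -
  assume mn: "pf m" "pf n"
  have "pf (%x. map (%k. k + m x) [0..<n x - m x])" by (intro pf_intros pf_upt0 mn pf_comp[OF mn(1)])
  moreover have "map (%k. k + a) [0..<b - a] = [a..<b]" for a b
    by (simp add: map_add_upt)
      (cases "a <= b"; simp add: map_add_upt[of a "b - a"])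
  ultimately show ?thesis by simp
qed

lemma pf_All_less [pf_intros]:
  fixes n :: "'x::treelike => nat"
  assumes "pf n" "pf (%z. P (fst z) (snd z))"
  shows "pf (%x. \<forall>i<n x. P x i)"
proof -
  have "pf (%x. \<forall>i\<in>set [0..<n x]. P x i)" by (intro pf_intros assms)
  then show ?thesis by (simp add: Ball_def)
qed

lemma pf_Ex_less [pf_intros]:
  fixes n :: "'x::treelike => nat"
  assumes "pf n" "pf (%z. P (fst z) (snd z))"
  shows "pf (%x. \<exists>i<n x. P x i)"
proof -
  have "pf (%x. ~ (\<forall>i<n x. ~ P x i))" by (intro pf_Not pf_All_less assms)
  then show ?thesis by simp
qed

lemma pf_tl [pf_intros]: "pf f ==> pf (%x. tl (f x))"
proof -
  assume "pf f"
  then have "pf (%x. case f x of [] => [] | e # c => c)" by (intro pf_case_list pf_intros)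
  moreover have "(case xs of [] => [] | e # c => c) = tl xs" for xs :: "'b list" by (cases xs) auto
  ultimately show ?thesis by simp
qed

lemma funpow_tl: "(tl ^^ k) xs = drop k xs"
  by (induction k) (auto simp: drop_Suc tl_drop)

lemma esize_drop: "esize (drop k xs) <= esize xs"
proof -
  have "esize xs + 1 = esize (take k xs) + esize (drop k xs)"
    using esize_append[of "take k xs" "drop k xs"] by simp
  then show ?thesis using esize_pos[of "take k xs"] by linarith
qed

lemma pf_drop [pf_intros]: "pf n ==> pf f ==> pf (%x. drop (n x) (f x))"
proof -
  have p: "pf (%z::nat \<times> 'b list. (tl ^^ fst z) (snd z))"
    by (rule pf_funpow[of "%_. tl" _ _ "%n. n"])
      (auto intro!: pf_intros pbd_intros simp: funpow_tl intro: le_trans[OF esize_drop])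
  show "pf n ==> pf f ==> ?thesis"
    using pf_comp[OF p pf_pair[of n f]] by (simp add: funpow_tl)
qed

lemma pf_take [pf_intros]: "pf n ==> pf f ==> pf (%x. take (n x) (f x))"
proof -
  assume "pf n" "pf f"
  then have "pf (%x. rev (drop (length (f x) - n x) (rev (f x))))" by (intro pf_intros)
  moreover have "take (length xs - (length xs - k)) xs = take k xs" for k and xs :: "'b list"
    by (cases "k <= length xs") auto
  ultimately show ?thesis by (simp add: rev_drop)
qed

lemma pf_nth_default [pf_intros]:
  assumes "pf f" "pf i"
  shows "pf (%x. nth_default d (f x) (i x))"
proof -
  have "pf (%x. case drop (i x) (f x) of [] => d | e # c => e)" by (intro pf_case_list pf_intros assms)
  moreover have "(case drop k xs of [] => d | e # c => e) = nth_default d xs k" for k xs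
    by (cases "k < length xs") (auto simp: nth_default_def Cons_nth_drop_Suc[symmetric])
  ultimately show ?thesis by simp
qed

lemma pf_concat [pf_intros]:
  fixes f :: "'x::treelike => 'b::treelike list list"
  assumes "pf f"
  shows "pf (%x. concat (f x))"
proof (rule pf_comp[OF _ assms])
  have eq: "fold (%e y. e @ y) xs ys = concat (rev xs) @ ys" for xs and ys :: "'b list"
    by (induction xs arbitrary: ys) auto
  have c: "esize (concat xs) <= esize xs" for xs :: "'b list list"
  proof (induction xs)
    case (Cons x xs)
    then show ?case using esize_append[of x "concat xs"] by simp
  qed simp
  have "esize (concat (rev (take k (rev x)))) <= esize x" for k and x :: "'b list list"
    by (rule order_trans[OF c]) (use esize_take[of k "rev x"] in \<open>simp add: esize_rev\<close>)
  then have "pf (%x::'b list list. fold (%e y. e @ y) (rev x) [])"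
    by (intro pf_fold[where B = "%n. n"] pf_intros pbd_intros) (simp add: eq)
  then show "pf (concat :: 'b list list => _)" by (simp add: eq)
qed

lemma pf_eq_list:
  fixes f g :: "'x::treelike => 'e::treelike list"
  assumes e: "pf (%z::'e \<times> 'e. fst z = snd z)" and "pf f" "pf g"
  shows "pf (%x. f x = g x)"
proof -
  have "pf (%x. length (f x) = length (g x) &
      (\<forall>i<length (f x). nth_default undefined (f x) i = nth_default undefined (g x) i))"
    by (intro pf_intros assms pf_comp[OF e, of "%z. (_ z, _ z)", simplified] pf_comp[OF assms(2)] pf_comp[OF assms(3)])
  moreover have "(length xs = length ys & (\<forall>i<length xs. nth_default undefined xs i = nth_default undefined ys i)) =
      (xs = ys)" for xs ys :: "'e list"
    by (auto simp: list_eq_iff_nth_eq nth_default_def)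
  ultimately show ?thesis by simp
qed

lemma pf_eq_bool_list [pf_intros]: "pf f ==> pf g ==> pf (%x. f x = (g x :: bool list))"
  by (rule pf_eq_list) (intro pf_intros)

lemma pf_eq_nat_list [pf_intros]: "pf f ==> pf g ==> pf (%x. f x = (g x :: nat list))"
  by (rule pf_eq_list) (intro pf_intros)

lemma pf_mem_nat_list [pf_intros]: "pf f ==> pf g ==> pf (%x. f x \<in> set (g x :: nat list))"
proof -
  assume f: "pf f" and g: "pf g"
  have "pf (%z. f (fst z))" by (rule pf_comp[OF f]) (intro pf_intros)
  then have "pf (%x. \<exists>e\<in>set (g x). f x = e)" by (intro pf_Bex_set pf_eq_nat pf_snd pf_ident g)
  then show ?thesis by simp
qed

text \<open>The quotient is the number of positive multiples of n up to m. Numbers being unary, this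
  search is polynomial and reduces division to filtering.\<close>

lemma div_conv_filter: "m div n = (if n = 0 then 0 else length (filter (%k. k * n <= m) [1..<Suc m]))"
proof (cases "n = 0")
  case False
  have "filter (%k. k * n <= m) [1..<Suc m] = filter (%k. k <= m div n) [1..<Suc m]"
    using False by (intro filter_cong) (auto simp: less_eq_div_iff_mult_less_eq)
  also have "length \<dots> = card {k \<in> {1..<Suc m}. k <= m div n}"
    by (subst distinct_card[symmetric]) (auto simp del: upt_Suc)
  also have "{k \<in> {1..<Suc m}. k <= m div n} = {1..m div n}"
    using le_trans[OF _ div_le_dividend[of m n]] by (auto simp: less_Suc_eq_le)
  finally show ?thesis using False by simp
qed simp

lemma pf_div [pf_intros]:
  assumes "pf f" "pf g"
  shows "pf (%x. f x div g x :: nat)"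
  unfolding div_conv_filter by (intro pf_intros assms pf_comp[OF assms(1)] pf_comp[OF assms(2)])

lemma pf_mod [pf_intros]:
  assumes "pf f" "pf g"
  shows "pf (%x. f x mod g x :: nat)"
  unfolding minus_div_mult_eq_mod[symmetric] by (intro pf_intros assms)

lemma pf_poly [pf_intros]: "pf f ==> pf (%x. poly p (f x :: nat))"
proof (induction p)
  case (pCons a p)
  then show ?case by (simp add: pf_intros)
qed (simp add: pf_intros)

subsection \<open>Exponential time from padding\<close>

text \<open>The base is at least 2, so a coefficient a is absorbed by a further factors. A single
  power is wanted because a power of an exponential is again an exponential, with the exponent
  multiplied.\<close>

lemma poly_le_power: "EX k. ALL m. poly (q::nat poly) m <= (m + 2) ^ k"
proof (induction q)
  case (pCons a q)
  then obtain k where k: "!!m. poly q m <= (m + 2) ^ k" by blast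
  have "poly (pCons a q) m <= (m + 2) ^ (a + k + 2)" for m
  proof -
    have "a <= 2 ^ a" by (simp add: less_imp_le)
    also have "(2::nat) ^ a <= (m + 2) ^ a" by (intro power_mono) auto
    also have "\<dots> <= (m + 2) ^ (a + k + 1)" by (intro power_increasing) auto
    finally have "a <= (m + 2) ^ (a + k + 1)" .
    moreover have "m * poly q m <= (m + 2) * (m + 2) ^ k" using k[of m] by (intro mult_le_mono) auto
    moreover have "(m + 2) * (m + 2) ^ k <= (m + 2) ^ (a + k + 1)"
      unfolding power_Suc[symmetric] by (intro power_increasing) auto
    ultimately have "poly (pCons a q) m <= 2 * (m + 2) ^ (a + k + 1)" by simp
    also have "\<dots> <= (m + 2) * (m + 2) ^ (a + k + 1)" by (intro mult_le_mono) auto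
    finally show ?thesis by (simp add: ac_simps)
  qed
  then show ?case by blast
qed simp

text \<open>The number \<open>2 ^ poly p (length x)\<close> is handed to \<open>F\<close> in unary,
  so polynomial time in it is exponential time in the input. It is produced by repeated doubling:
  the intermediate values are exponential, the number of rounds is polynomial.\<close>

theorem pf_EXPTIME:
  fixes p :: "nat poly"
  assumes "pf (F :: bool list \<times> nat => bool)"
  shows "{x. F (x, 2 ^ poly p (length x))} \<in> EXPTIME"
proof -
  define B where "B n = 2 * 2 ^ poly p n + (1::nat)" for n
  have eq: "fold (%_ y. y + y) (units k) 1 = (2::nat) ^ k" for k
    unfolding fold_units by (induction k) auto
  have B: "esize (fold (%e y. y + y) (take k (units (poly p (length x)))) (1::nat)) <= B (esize x)"
    for k and x :: "bool list"
  proof -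
    have "min k (poly p (length x)) <= poly p (esize x)"
      using poly_nat_mono[OF length_le_esize[of x], of p] by simp
    then have "(2::nat) ^ min k (poly p (length x)) <= 2 ^ poly p (esize x)" by (intro power_increasing) auto
    then show ?thesis by (simp only: take_units eq B_def esize_simps)
  qed
  have "pf (%z::bool list \<times> unit \<times> nat. snd (snd z) + snd (snd z))"
    "pf (%x::bool list. units (poly p (length x)))" "pf (%x::bool list. 1::nat)"
    by (intro pf_intros pf_units)+
  from impl_fold[of "%z::bool list \<times> unit \<times> nat. snd (snd z) + snd (snd z)", OF this, of B] B
  obtain q :: "nat poly" where
    "impl (%x::bool list. fold (%e y. y + y) (units (poly p (length x))) (1::nat)) (%n. poly q (n + B n))"
    by (auto simp del: One_nat_def esize_simps)
  then have e: "impl (%x::bool list. (2::nat) ^ poly p (length x)) (%n. poly q (n + B n))" by (simp only: eq)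
  have "pf (%z. [F z])" by (intro pf_intros assms)
  then obtain r where r: "impl (%z. [F z]) (poly r)" by (auto simp: pf_def)
  let ?S = "%n. n + 2 + poly q (n + B n) + 34 * n + 10"
  have G: "impl (%x. [F (x, 2 ^ poly p (length x))]) (%n. ?S n + poly r (?S n))"
    by (rule impl_comp[OF r impl_pair[OF impl_id e] mono_poly])
  have "pbd (%m. (m + 2 + poly q m + 34 * m + 10) + poly r (m + 2 + poly q m + 34 * m + 10))"
    by (intro pbd_intros)
  then obtain Q where Q: "!!m. (m + 2 + poly q m + 34 * m + 10) + poly r (m + 2 + poly q m + 34 * m + 10) <= poly Q m"
    by (auto simp: pbd_def)
  have "?S n + poly r (?S n) <= poly Q (n + B n)" for n
    by (rule order_trans[OF _ Q]) (intro add_mono poly_nat_mono; simp)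
  from impl_mono[OF G this] have G': "impl (%x. [F (x, 2 ^ poly p (length x))]) (%n. poly Q (n + B n))" .
  have "mono (%n. poly Q (n + B n))"
    unfolding B_def by (intro monoI poly_nat_mono add_mono mult_le_mono power_increasing) auto
  from impl_tm_computes[OF G' this] obtain M where M: "wf_tm M"
    "tm_computes M (%x. [F (x, 2 ^ poly p (length x))]) (%n. 20 * n + 6 + 11 * poly Q (4 * n + 1 + B (4 * n + 1)))"
    by blast
  have "pbd (%m. 20 * m + 6 + 11 * poly Q m)" by (intro pbd_intros)
  then obtain R where R: "!!m. 20 * m + 6 + 11 * poly Q m <= poly R m" by (auto simp: pbd_def)
  obtain k where k: "!!m. poly R m <= (m + 2) ^ k" using poly_le_power by blast
  define P :: "nat poly" where "P = [:k:] * ([:4, 4:] + pcompose p [:1, 4:])"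
  have "20 * n + 6 + 11 * poly Q (4 * n + 1 + B (4 * n + 1)) <= 2 ^ poly P n" for n
  proof -
    let ?m = "4 * n + 1 + B (4 * n + 1)" and ?a = "4 * n + poly p (4 * n + 1)"
    have le: "4 * n + 1 <= 2 ^ ?a * 2"
    proof -
      have "4 * n + 1 <= 2 ^ (4 * n)" using less_exp[of "4 * n"] by linarith
      also have "(2::nat) ^ (4 * n) <= 2 ^ ?a" by (intro power_increasing) auto
      finally show ?thesis by simp
    qed
    moreover have "(2::nat) ^ poly p (4 * n + 1) <= 2 ^ ?a" by (intro power_increasing) auto
    moreover have "(1::nat) <= 2 ^ ?a" by simp
    ultimately have "?m + 2 <= 2 ^ ?a * 16" unfolding B_def by linarith
    also have "\<dots> = 2 ^ (?a + 4)" by (simp add: power_add)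
    finally have "?m + 2 <= 2 ^ (?a + 4)" .
    then have "(?m + 2) ^ k <= (2 ^ (?a + 4)) ^ k" by (intro power_mono) auto
    also have "((2::nat) ^ (?a + 4)) ^ k = 2 ^ poly P n"
      unfolding P_def power_mult[symmetric] by (simp add: poly_pcompose algebra_simps)
    finally have "poly R ?m <= 2 ^ poly P n" using k[of ?m] by linarith
    moreover have "20 * n + 6 + 11 * poly Q ?m <= 20 * ?m + 6 + 11 * poly Q ?m" by simp
    ultimately show ?thesis using R[of ?m] by linarith
  qed
  then have "tm_computes M (%x. [F (x, 2 ^ poly p (length x))]) (%n. 2 ^ poly P n)"
    using M(2) unfolding tm_computes_def by (meson le_trans)
  then show ?thesis using M(1) unfolding EXPTIME_def by auto
qed

section \<open>Equilibria without strategies of deviators\<close>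

section \<open>Subgame perfect equilibria in terms of plays\<close>

definition owner :: "('v, 'i, 'z) arena_scheme => 'v => 'i" where
  "owner A v = (THE i. i \<in> players A & v \<in> owned A i)"

definition joint :: "('v, 'i, 'z) arena_scheme => ('i => 'v strategy) => 'v strategy" where
  "joint A \<sigma> h = \<sigma> (owner A (last h)) h"

definition sub_out :: "('v, 'i, 'z) arena_scheme => ('i => 'v strategy) => 'v list => 'v => 'v word" where
  "sub_out A \<sigma> h v = outcome A (sub_profile \<sigma> h) v"

lemma owner_eq: "is_arena A ==> i \<in> players A ==> v \<in> owned A i ==> owner A v = i"
  unfolding owner_def
  by (intro the_equality) (auto simp: is_arena_def disjoint_family_on_def, blast)

lemma owner_owned:
  assumes "is_arena A" "v \<in> verts A"
  shows "owner A v \<in> players A & v \<in> owned A (owner A v)"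
proof -
  have "v \<in> (\<Union>i\<in>players A. owned A i)" using assms by (simp add: is_arena_def)
  then obtain i where "i \<in> players A" "v \<in> owned A i" by blast
  then show ?thesis using owner_eq[OF assms(1)] by auto
qed

lemma consistent_owner:
  assumes "is_arena A" "play A \<pi>" "i \<in> players A"
  shows "consistent A i \<tau> \<pi> <-> (ALL n. owner A (\<pi> n) = i --> \<pi> (Suc n) = \<tau> (prefix (Suc n) \<pi>))"
proof -
  have "\<pi> n \<in> verts A" for n using assms(2) by (auto simp: play_def omega_words_def)
  then have "\<pi> n \<in> owned A i <-> owner A (\<pi> n) = i" for n
    using owner_owned[OF assms(1)] owner_eq[OF assms(1,3)] by metis
  then show ?thesis by (simp add: consistent_def)
qed

lemma last_subsequence [simp]: "last (prefix (Suc n) \<pi>) = \<pi> n"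
  by (simp add: last_conv_nth subsequence_def)

lemma play_verts: "play A \<pi> ==> \<pi> n \<in> verts A"
  by (auto simp: play_def omega_words_def)

lemma play_history:
  assumes "play A \<pi>"
  shows "history A (prefix n \<pi>)"
proof -
  have "successively (%u v. (u, v) \<in> edges A) (map \<pi> [0..<n])"
    using assms by (auto simp: successively_conv_nth play_def)
  then show ?thesis using play_verts[OF assms] by (auto simp: history_def subsequence_def)
qed

lemma history_append:
  assumes "history A (h @ [\<pi> 0])" "play A \<pi>"
  shows "history A (h @ prefix n \<pi>)"
proof (cases n)
  case 0
  then show ?thesis using assms(1) by (auto simp: history_def successively_append_iff)
next
  case (Suc m)
  then have "hd (prefix n \<pi>) = \<pi> 0" "\<pi> [0 \<rightarrow> n] ~= []"
    by (simp_all add: subsequence_def upt_conv_Cons del: upt_Suc)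
  then show ?thesis using assms(1) play_history[OF assms(2), of n]
    by (auto simp: history_def successively_append_iff)
qed

context
  fixes A :: "('v, 'i, 'z) arena_scheme" and \<sigma> :: "'i => 'v strategy"
  assumes A: "is_arena A" and \<sigma>: "is_profile A \<sigma>"
begin

lemma profile_edge:
  assumes "i \<in> players A" "x \<in> owned A i" "history A (h @ h' @ [x])"
  shows "(x, sub_profile \<sigma> h i (h' @ [x])) \<in> edges A"
proof -
  have "is_strategy A i (\<sigma> i)" using \<sigma> assms(1) by (simp add: is_profile_def)
  then show ?thesis using assms(2,3) unfolding is_strategy_def sub_profile_def
    by (metis append.assoc)
qed

lemma Hist_history:
  assumes "history A (h @ [v])" "h' @ [x] \<in> Hist A v"
  shows "history A (h @ h' @ [x])"
proof -
  have "hd (h' @ [x]) = v" "history A (h' @ [x])" using assms(2) by (auto simp: Hist_def)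
  then show ?thesis using assms(1)
    by (auto simp: history_def successively_append_iff)
qed

lemma dev_outcome:
  assumes h: "history A (h @ [v])" and \<tau>: "is_strategy A i \<tau>" and v: "v \<in> verts A"
  shows "\<exists>!\<pi>. play A \<pi> & \<pi> 0 = v & (\<forall>j\<in>players A. consistent A j (((sub_profile \<sigma> h)(i := \<tau>)) j) \<pi>)"
proof (rule outcome_unique[OF A _ v])
  fix j h' x assume *: "j \<in> players A" "x \<in> owned A j" "h' @ [x] \<in> Hist A v"
  show "(x, ((sub_profile \<sigma> h)(i := \<tau>)) j (h' @ [x])) \<in> edges A"
  proof (cases "j = i")
    case True
    then show ?thesis using \<tau> * by (auto simp: is_strategy_def Hist_def)
  next
    case False
    then show ?thesis using profile_edge[OF *(1,2) Hist_history[OF h *(3)]] by simp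
  qed
qed

lemma sub_outcome:
  assumes h: "history A (h @ [v])" and v: "v \<in> verts A"
  shows "\<exists>!\<pi>. play A \<pi> & \<pi> 0 = v & (\<forall>j\<in>players A. consistent A j (sub_profile \<sigma> h j) \<pi>)"
proof (rule outcome_unique[OF A _ v])
  fix j h' x assume *: "j \<in> players A" "x \<in> owned A j" "h' @ [x] \<in> Hist A v"
  show "(x, sub_profile \<sigma> h j (h' @ [x])) \<in> edges A"
    using profile_edge[OF *(1,2) Hist_history[OF h *(3)]] .
qed

lemma joint_consistent:
  assumes "play A \<pi>"
  shows "(\<forall>j\<in>players A - X. consistent A j (sub_profile \<sigma> h j) \<pi>) <->
    (ALL n. owner A (\<pi> n) \<notin> X --> \<pi> (Suc n) = joint A \<sigma> (h @ prefix (Suc n) \<pi>))"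
proof -
  have "last (h @ prefix (Suc n) \<pi>) = \<pi> n" for n by (simp add: last_append)
  then have j: "joint A \<sigma> (h @ prefix (Suc n) \<pi>) = \<sigma> (owner A (\<pi> n)) (h @ prefix (Suc n) \<pi>)" for n
    unfolding joint_def by metis
  have "owner A (\<pi> n) \<in> players A" for n using owner_owned[OF A play_verts[OF assms]] by blast
  then show ?thesis unfolding j
    by (auto simp: consistent_owner[OF A assms] sub_profile_def simp del: subsequence_append)
qed

lemma sub_out_props:
  assumes h: "history A (h @ [v])"
  shows "play A (sub_out A \<sigma> h v)" "sub_out A \<sigma> h v 0 = v"
    "sub_out A \<sigma> h v (Suc n) = joint A \<sigma> (h @ sub_out A \<sigma> h v [0 \<rightarrow> Suc n])"
proof -
  have v: "v \<in> verts A" using h by (simp add: history_def)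
  have p: "play A (sub_out A \<sigma> h v) & sub_out A \<sigma> h v 0 = v &
      (\<forall>j\<in>players A. consistent A j (sub_profile \<sigma> h j) (sub_out A \<sigma> h v))"
    unfolding sub_out_def outcome_def by (rule theI'[OF sub_outcome[OF h v]])
  then show "play A (sub_out A \<sigma> h v)" "sub_out A \<sigma> h v 0 = v" by auto
  show "sub_out A \<sigma> h v (Suc n) = joint A \<sigma> (h @ sub_out A \<sigma> h v [0 \<rightarrow> Suc n])"
    using joint_consistent[of "sub_out A \<sigma> h v" "{}" h] p by simp
qed

lemma sub_out_unique:
  assumes h: "history A (h @ [v])"
    and \<pi>: "play A \<pi>" "\<pi> 0 = v" "!!n. \<pi> (Suc n) = joint A \<sigma> (h @ prefix (Suc n) \<pi>)"
  shows "\<pi> = sub_out A \<sigma> h v"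
proof -
  have v: "v \<in> verts A" using h by (simp add: history_def)
  have "play A \<pi> & \<pi> 0 = v & (\<forall>j\<in>players A. consistent A j (sub_profile \<sigma> h j) \<pi>)"
    using joint_consistent[OF \<pi>(1), of "{}" h] \<pi> by simp
  moreover have "play A (sub_out A \<sigma> h v) & sub_out A \<sigma> h v 0 = v &
      (\<forall>j\<in>players A. consistent A j (sub_profile \<sigma> h j) (sub_out A \<sigma> h v))"
    unfolding sub_out_def outcome_def by (rule theI'[OF sub_outcome[OF h v]])
  ultimately show ?thesis using sub_outcome[OF h v] by blast
qed

text \<open>Along the prefixes of the given play the new strategy repeats that play; a departure
  from the profile there only happens at vertices of \<open>i\<close>. Elsewhere \<open>i\<close>
  keeps using the old strategy, because a strategy must be legal on every history.\<close>

lemma realize_deviation: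
  assumes h: "history A (h @ [v])" and i: "i \<in> players A"
    and \<pi>: "play A \<pi>" "\<pi> 0 = v"
      "!!n. owner A (\<pi> n) ~= i ==> \<pi> (Suc n) = joint A \<sigma> (h @ prefix (Suc n) \<pi>)"
  shows "\<exists>\<tau>. is_strategy A i \<tau> & outcome A ((sub_profile \<sigma> h)(i := \<tau>)) v = \<pi>"
proof (intro exI conjI)
  define \<tau> where "\<tau> h' = (if EX n. h' = prefix (Suc n) \<pi> then \<pi> (length h') else \<sigma> i h')" for h'
  have \<tau>\<pi>: "\<tau> (prefix (Suc n) \<pi>) = \<pi> (Suc n)" for n
    unfolding \<tau>_def by (auto simp del: subsequence_append)
  show s: "is_strategy A i \<tau>" unfolding is_strategy_def
  proof (intro allI ballI impI)
    fix h' x assume *: "x \<in> owned A i" "history A (h' @ [x])"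
    show "(x, \<tau> (h' @ [x])) \<in> edges A"
    proof (cases "EX n. h' @ [x] = prefix (Suc n) \<pi>")
      case True
      then obtain n where n: "h' @ [x] = prefix (Suc n) \<pi>" by blast
      then have "x = \<pi> n" by (metis last_snoc last_subsequence)
      then show ?thesis unfolding n \<tau>\<pi> using \<pi>(1) by (simp add: play_def)
    next
      case False
      then have "\<tau> (h' @ [x]) = \<sigma> i (h' @ [x])" unfolding \<tau>_def by (rule if_not_P)
      then show ?thesis using * \<sigma> i unfolding is_profile_def is_strategy_def by simp
    qed
  qed
  have v: "v \<in> verts A" using h by (simp add: history_def)
  have "play A \<pi> & \<pi> 0 = v & (\<forall>j\<in>players A. consistent A j (((sub_profile \<sigma> h)(i := \<tau>)) j) \<pi>)"
  proof (intro conjI ballI)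
    fix j assume j: "j \<in> players A"
    show "consistent A j (((sub_profile \<sigma> h)(i := \<tau>)) j) \<pi>"
    proof (cases "j = i")
      case True
      then show ?thesis using \<tau>\<pi> by (simp add: consistent_def del: subsequence_append)
    next
      case False
      then show ?thesis using joint_consistent[OF \<pi>(1), of "{i}" h] \<pi>(3) j by auto
    qed
  qed (use \<pi> in auto)
  moreover have "play A (outcome A ((sub_profile \<sigma> h)(i := \<tau>)) v) &
      outcome A ((sub_profile \<sigma> h)(i := \<tau>)) v 0 = v & (\<forall>j\<in>players A.
        consistent A j (((sub_profile \<sigma> h)(i := \<tau>)) j) (outcome A ((sub_profile \<sigma> h)(i := \<tau>)) v))"
    unfolding outcome_def by (rule theI'[OF dev_outcome[OF h s v]])
  ultimately show "outcome A ((sub_profile \<sigma> h)(i := \<tau>)) v = \<pi>" using dev_outcome[OF h s v] by blast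
qed

end

lemma outcome_subgame: "outcome (subgame G h) \<sigma> v = outcome G \<sigma> v"
  by (simp add: outcome_def subgame_def play_def consistent_def)

lemma is_strategy_subgame: "is_strategy (subgame G h) i \<tau> = is_strategy G i \<tau>"
  by (simp add: is_strategy_def subgame_def history_def)

theorem nash_equilibrium_subgame_iff:
  fixes G :: "('v, 'i, 'p) game"
  assumes A: "is_arena G" and \<sigma>: "is_profile G \<sigma>" and h: "history G (h @ [v])"
  shows "nash_equilibrium (subgame G h) (sub_profile \<sigma> h) v <->
    (\<forall>i\<in>players G. \<forall>\<pi>. play G \<pi> --> \<pi> 0 = v -->
       (ALL n. owner G (\<pi> n) ~= i --> \<pi> (Suc n) = joint G \<sigma> (h @ prefix (Suc n) \<pi>)) -->
       (pay G i (h \<frown> sub_out G \<sigma> h v), pay G i (h \<frown> \<pi>)) \<notin> pref G i)" (is "?l = ?r")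
proof
  assume ?l
  show ?r
  proof (intro ballI allI impI)
    fix i \<pi> assume i: "i \<in> players G" and \<pi>: "play G \<pi>" "\<pi> 0 = v"
      "ALL n. owner G (\<pi> n) ~= i --> \<pi> (Suc n) = joint G \<sigma> (h @ prefix (Suc n) \<pi>)"
    obtain \<tau> where "is_strategy G i \<tau>" "outcome G ((sub_profile \<sigma> h)(i := \<tau>)) v = \<pi>"
      using realize_deviation[OF A \<sigma> h i \<pi>(1,2)] \<pi>(3) by blast
    then show "(pay G i (h \<frown> sub_out G \<sigma> h v), pay G i (h \<frown> \<pi>)) \<notin> pref G i"
      using \<open>?l\<close> i unfolding nash_equilibrium_def outcome_subgame is_strategy_subgame
      by (auto simp: subgame_def sub_out_def)
  qed
next
  assume r: ?r
  show ?l unfolding nash_equilibrium_def outcome_subgame is_strategy_subgame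
  proof (intro ballI allI impI)
    fix i \<tau> assume i: "i \<in> players (subgame G h)" and \<tau>: "is_strategy G i \<tau>"
    let ?\<pi> = "outcome G ((sub_profile \<sigma> h)(i := \<tau>)) v"
    have v: "v \<in> verts G" using h by (simp add: history_def)
    have p: "play G ?\<pi> & ?\<pi> 0 = v & (\<forall>j\<in>players G. consistent G j (((sub_profile \<sigma> h)(i := \<tau>)) j) ?\<pi>)"
      unfolding outcome_def by (rule theI'[OF dev_outcome[OF A \<sigma> h \<tau> v]])
    then have "\<forall>j\<in>players G - {i}. consistent G j (sub_profile \<sigma> h j) ?\<pi>"
      by (metis DiffE fun_upd_other insertI1)
    then have "ALL n. owner G (?\<pi> n) ~= i --> ?\<pi> (Suc n) = joint G \<sigma> (h @ ?\<pi> [0 \<rightarrow> Suc n])"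
      using joint_consistent[OF A \<sigma>, of ?\<pi> "{i}" h] p by simp
    then show "(pay (subgame G h) i (outcome G (sub_profile \<sigma> h) v), pay (subgame G h) i ?\<pi>)
        \<notin> pref (subgame G h) i"
      using r i p by (auto simp: subgame_def sub_out_def)
  qed
qed

lemma prefix_conc_prefix: "(h \<frown> \<pi>) [0 \<rightarrow> length h + k] = h @ prefix k \<pi>"
  by (rule nth_equalityI) (auto simp: conc_def nth_append)

text \<open>Nothing is required before position \<open>t\<close>. A subgame thus becomes a suffix of
  a play of the whole game, and the automata can read plays from their first vertex.\<close>

definition deviates :: "('v, 'i, 'z) arena_scheme => ('i => 'v strategy) => 'i set => nat => 'v word => bool" where
  "deviates A \<sigma> X t w <-> (ALL n>=t. owner A (w n) \<notin> X --> w (Suc n) = joint A \<sigma> (prefix (Suc n) w))"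

lemma prefix_eq_mono:
  assumes "w [0 \<rightarrow> Suc t] = prefix (Suc t) w'" "n <= t"
  shows "w n = w' n" "w [0 \<rightarrow> n] = prefix n w'"
proof -
  have "w m = w' m" if "m <= t" for m
    using arg_cong[OF assms(1), of "%h. h ! m"] that by (simp add: subsequence_def del: upt_Suc)
  then show "w n = w' n" "w [0 \<rightarrow> n] = prefix n w'" using assms(2) by (auto simp: subsequence_def)
qed

lemma deviates_unique:
  assumes "deviates A \<sigma> {} t w" "deviates A \<sigma> {} t w'" "w [0 \<rightarrow> Suc t] = prefix (Suc t) w'"
  shows "w = w'"
proof -
  have "w [0 \<rightarrow> Suc (t + n)] = prefix (Suc (t + n)) w'" for n
    by (induction n) (use assms in \<open>simp_all add: deviates_def\<close>)
  then have "w n = w' n" for n using prefix_eq_mono(1)[of w "t + n" w' n] by simp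
  then show ?thesis by blast
qed

lemma play_split: "w = prefix t w \<frown> suffix t w"
  by simp

lemma play_conc:
  assumes "history A (h @ [v])" "play A \<pi>" "\<pi> 0 = v"
  shows "play A (h \<frown> \<pi>)"
proof -
  have hist: "history A ((h \<frown> \<pi>) [0 \<rightarrow> length h + k])" for k
    unfolding prefix_conc_prefix by (rule history_append) (use assms in auto)
  have "(h \<frown> \<pi>) m \<in> verts A & ((h \<frown> \<pi>) m, (h \<frown> \<pi>) (Suc m)) \<in> edges A" for m
  proof -
    have "history A ((h \<frown> \<pi>) [0 \<rightarrow> length h + Suc (Suc m)])" by (rule hist)
    then show ?thesis
      by (auto simp: history_def subsequence_def successively_conv_nth simp del: upt_Suc dest!: spec[of _ m])
  qed
  then have "range (h \<frown> \<pi>) \<subseteq> verts A" "ALL m. ((h \<frown> \<pi>) m, (h \<frown> \<pi>) (Suc m)) \<in> edges A"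
    by blast+
  then show ?thesis unfolding play_def omega_words_def by blast
qed

lemma play_hist: "play A w ==> history A (prefix t w @ [w t])"
  using play_history[of A w "Suc t"] by simp

lemma conc_deviates:
  "deviates A \<sigma> X (length h) (h \<frown> \<pi>) <->
    (ALL n. owner A (\<pi> n) \<notin> X --> \<pi> (Suc n) = joint A \<sigma> (h @ prefix (Suc n) \<pi>))"
proof -
  have *: "(h \<frown> \<pi>) (length h + n) = \<pi> n" "(h \<frown> \<pi>) [0 \<rightarrow> Suc (length h + n)] = h @ prefix (Suc n) \<pi>" for n
    using prefix_conc_prefix[of h \<pi> "Suc n"] by simp_all
  show ?thesis
  proof
    assume "deviates A \<sigma> X (length h) (h \<frown> \<pi>)"
    then show "ALL n. owner A (\<pi> n) \<notin> X --> \<pi> (Suc n) = joint A \<sigma> (h @ prefix (Suc n) \<pi>)"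
      unfolding deviates_def by (metis * le_add1 add_Suc_right)
  next
    assume r: "ALL n. owner A (\<pi> n) \<notin> X --> \<pi> (Suc n) = joint A \<sigma> (h @ prefix (Suc n) \<pi>)"
    show "deviates A \<sigma> X (length h) (h \<frown> \<pi>)"
      unfolding deviates_def by (metis r * le_Suc_ex add_Suc_right)
  qed
qed

context
  fixes G :: "('v, 'i, 'p) game" and \<sigma>
  assumes A: "is_arena G" and \<sigma>: "is_profile G \<sigma>"
begin

lemma follow_exists:
  assumes h: "history G (h @ [v])"
  shows "EX w. play G w & w [0 \<rightarrow> Suc (length h)] = h @ [v] & deviates G \<sigma> {} (length h) w"
proof (intro exI conjI)
  note p = sub_out_props[OF A \<sigma> h]
  let ?w = "h \<frown> sub_out G \<sigma> h v"
  show "play G ?w" by (rule play_conc[OF h p(1,2)])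
  show "?w [0 \<rightarrow> Suc (length h)] = h @ [v]"
    using prefix_conc_prefix[of h "sub_out G \<sigma> h v" 1] p(2) by (simp add: subsequence_def)
  show "deviates G \<sigma> {} (length h) ?w" using p(3) by (simp add: conc_deviates)
qed

text \<open>Quantification over deviating strategies is traded for quantification over plays: in a
  subgame, the outcomes reachable by \<open>i\<close> alone are exactly the plays that depart from
  the profile only at vertices of \<open>i\<close>. Two plays with a common prefix then stand for a
  subgame.\<close>

theorem SPE_iff_plays:
  assumes v0: "v0 \<in> verts G"
  shows "subgame_perfect_equilibrium G \<sigma> v0 <->
    (ALL w w' t. \<forall>i\<in>players G. play G w --> play G w' --> w 0 = v0 --> w' [0 \<rightarrow> Suc t] = prefix (Suc t) w -->
       deviates G \<sigma> {} t w --> deviates G \<sigma> {i} t w' --> (pay G i w, pay G i w') \<notin> pref G i)" (is "_ <-> ?r")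
proof
  assume spe: "subgame_perfect_equilibrium G \<sigma> v0"
  show ?r
  proof (intro allI ballI impI)
    fix w w' t i
    assume *: "i \<in> players G" "play G w" "play G w'" "w 0 = v0" "w' [0 \<rightarrow> Suc t] = prefix (Suc t) w"
      "deviates G \<sigma> {} t w" "deviates G \<sigma> {i} t w'"
    let ?h = "w [0 \<rightarrow> t]" and ?v = "w t"
    have h: "history G (?h @ [?v])" by (rule play_hist[OF *(2)])
    have pre: "w' [0 \<rightarrow> t] = ?h" "w' t = ?v" using prefix_eq_mono[OF *(5), of t] by simp_all
    have "?h @ [?v] \<in> Hist G v0" using h *(4) by (cases t) (auto simp: Hist_def hd_append upt_rec subsequence_def)
    then have ne: "nash_equilibrium (subgame G ?h) (sub_profile \<sigma> ?h) ?v"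
      using spe by (simp add: subgame_perfect_equilibrium_def)
    have pl: "play G (suffix t w)" "play G (suffix t w')"
      using *(2,3) by (auto simp: play_def omega_words_def)
    have "suffix t w = sub_out G \<sigma> ?h ?v"
      by (rule sub_out_unique[OF A \<sigma> h pl(1)])
        (use *(6) conc_deviates[of G \<sigma> "{}" ?h "suffix t w"] in auto)
    then have w: "w = ?h \<frown> sub_out G \<sigma> ?h ?v" using play_split[of w t] by metis
    have w': "w' = ?h \<frown> suffix t w'" using play_split[of w' t] pre by metis
    have "deviates G \<sigma> {i} (length ?h) (?h \<frown> suffix t w')" using *(7) w' by simp
    then have "(pay G i (?h \<frown> sub_out G \<sigma> ?h ?v), pay G i (?h \<frown> suffix t w')) \<notin> pref G i"
      using ne[unfolded nash_equilibrium_subgame_iff[OF A \<sigma> h]] *(1) pl(2) pre(2)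
      unfolding conc_deviates by simp
    then show "(pay G i w, pay G i w') \<notin> pref G i" using w w' by simp
  qed
next
  assume r: ?r
  show "subgame_perfect_equilibrium G \<sigma> v0"
    unfolding subgame_perfect_equilibrium_def
  proof (intro conjI allI impI \<sigma>)
    fix h v assume hv: "h @ [v] \<in> Hist G v0"
    then have h: "history G (h @ [v])" by (simp add: Hist_def)
    note p = sub_out_props[OF A \<sigma> h]
    show "nash_equilibrium (subgame G h) (sub_profile \<sigma> h) v"
      unfolding nash_equilibrium_subgame_iff[OF A \<sigma> h]
    proof (intro ballI allI impI)
      fix i \<pi> assume \<pi>: "i \<in> players G" "play G \<pi>" "\<pi> 0 = v"
        "ALL n. owner G (\<pi> n) ~= i --> \<pi> (Suc n) = joint G \<sigma> (h @ prefix (Suc n) \<pi>)"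
      show "(pay G i (h \<frown> sub_out G \<sigma> h v), pay G i (h \<frown> \<pi>)) \<notin> pref G i"
      proof (rule r[rule_format, of i _ _ "length h"])
        show "play G (h \<frown> sub_out G \<sigma> h v)" "play G (h \<frown> \<pi>)"
          using play_conc[OF h] p \<pi> by blast+
        show "(h \<frown> sub_out G \<sigma> h v) 0 = v0" using hv p(2) by (cases h) (auto simp: Hist_def)
        show "(h \<frown> \<pi>) [0 \<rightarrow> Suc (length h)] = (h \<frown> sub_out G \<sigma> h v) [0 \<rightarrow> Suc (length h)]"
          using prefix_conc_prefix[of h \<pi> 1] prefix_conc_prefix[of h "sub_out G \<sigma> h v" 1] p(2) \<pi>(3)
          by (simp add: subsequence_def)
        show "deviates G \<sigma> {} (length h) (h \<frown> sub_out G \<sigma> h v)" "deviates G \<sigma> {i} (length h) (h \<frown> \<pi>)"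
          using p(3) \<pi>(4) by (simp_all add: conc_deviates)
      qed (rule \<pi>(1))
    qed
  qed
qed

lemma outcome_deviates:
  assumes "play G w" "deviates G \<sigma> {} 0 w"
  shows "outcome G \<sigma> (w 0) = w"
proof -
  have h: "history G ([] @ [w 0])" using play_hist[OF assms(1), of 0] by simp
  have "w = sub_out G \<sigma> [] (w 0)"
    by (rule sub_out_unique[OF A \<sigma> h assms(1)]) (use assms(2) in \<open>auto simp: deviates_def\<close>)
  then show ?thesis by (simp add: sub_out_def sub_profile_def)
qed

end


lemma deviates_mono: "deviates A \<sigma> X t w ==> X \<subseteq> Y ==> t <= t' ==> deviates A \<sigma> Y t' w"
  unfolding deviates_def by (meson le_trans subsetD)

section \<open>Hardness: from alternating computations to equilibria\<close>

section \<open>Safety games checked by small automata, as equilibrium problems\<close>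

lemma limit_eventually_const:
  assumes "!!k. k >= N ==> f k = c"
  shows "limit f = {c}"
proof -
  have "(INFM k. f k = x) <-> x = c" for x
  proof
    assume "INFM k. f k = x"
    then obtain k where "k >= N" "f k = x" unfolding INFM_nat_le by blast
    then show "x = c" using assms by simp
  next
    assume "x = c"
    then show "INFM k. f k = x" unfolding INFM_nat_le using assms by (meson le_cases)
  qed
  then show ?thesis by (auto simp: limit_def)
qed

lemma dpa_run_foldl: "dpa_run A w k = foldl (dpa_trans A) (dpa_init A) (prefix k w)"
  by (induction k) auto

text \<open>
  Player 1 moves at the vertices in \<open>ex\<close> and may always escape to the sink 0; player 0 moves
  elsewhere. Automaton \<open>i < B\<close> has the error state 2, and state 3 is entered in the sink.
\<close>

locale bitgame =
  fixes n :: nat and ex :: "nat => bool" and es :: "(nat \<times> nat) list"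
    and B :: nat and \<delta> :: "nat => nat => nat => nat" and ini :: "nat => nat" and v0 :: nat
  assumes es: "set es \<subseteq> {..<n} \<times> {..<n}"
    and ex0: "ex 0" and sink: "!!u. (0, u) \<in> set es <-> u = 0"
    and escape: "!!v. v < n ==> ex v ==> (v, 0) \<in> set es"
    and univ_succ: "!!v. v < n ==> ~ ex v ==> EX u. (v, u) \<in> set es"
    and univ_ex: "!!v u. ~ ex v ==> (v, u) \<in> set es ==> ex u"
    and v0: "v0 < n" and \<delta>: "!!i v q. q < 2 ==> \<delta> i v q < 3" and ini: "!!i. ini i < 2"
begin

text \<open>The two moving players 0 and 1 only watch for the sink; player \<open>i + 2\<close> runs
  checker \<open>i\<close>. Reading vertex 0 overrides even an error, so fleeing to the sink
  absolves all checkers.\<close>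

definition ctrans :: "nat => nat => nat => nat" where
  "ctrans i q a = (if a = 0 then 3 else if q >= 2 \<or> i < 2 then q else \<delta> (i - 2) a q)"

definition cinit :: "nat => nat" where
  "cinit i = (if i < 2 then 0 else ini (i - 2))"

definition tgt :: "nat => nat" where
  "tgt i = (if i < 2 then 3 else 2)"

text \<open>Payoff 1 means that the run eventually stays in \<open>tgt i\<close>, payoff 0 that it
  does not. The language of payoff 2 is empty; it brings the number of payoffs to three.\<close>

definition table :: "nat => nat => dpa_table" where
  "table i p = \<lparr>tab_init = cinit i,
     tab_prio = map (%q. if p < 2 & (q = tgt i) = (p = 1) then 0 else 1) [0..<4],
     tab_trans = map (%q. map (ctrans i q) [0..<n]) [0..<4]\<rparr>"

text \<open>Player 0 likes the sink, player 1 is indifferent, and a checker rejects its payoff 1 in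
  favour of itself. The constraint 0 bites for player 1, whose empty preference demands equality:
  the outcome has to avoid the sink.\<close>

definition inp :: rp_input where
  "inp = \<lparr>inp_edges = es, inp_owner = map (%v. if ex v then 1 else 0) [0..<n],
     inp_prefs = map (%i. if i = 0 then [(0, 1)] else if i = 1 then [] else [(1, 1)]) [0..<B + 2],
     inp_auts = map (%i. map (table i) [0..<3]) [0..<B + 2],
     inp_start = v0, inp_constr = map (%i. 0) [0..<B + 2]\<rparr>"

definition cl :: "nat => nat list => nat" where
  "cl i xs = foldl (ctrans i) (cinit i) xs"

lemma ctrans_less4: "q < 4 ==> ctrans i q a < 4"
  using \<delta>[of q "i - 2" a] by (auto simp: ctrans_def)

lemma cinit_less2: "cinit i < 2"
  using ini[of "i - 2"] by (auto simp: cinit_def)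

lemma cl_less4: "cl i xs < 4"
proof (induction xs rule: rev_induct)
  case Nil
  then show ?case using cinit_less2[of i] by (simp add: cl_def)
next
  case (snoc x xs)
  then show ?case using ctrans_less4 by (simp add: cl_def)
qed

lemma cl_snoc: "cl i (xs @ [x]) = ctrans i (cl i xs) x"
  by (simp add: cl_def)

lemma cl_eq3: "cl i xs = 3 <-> 0 \<in> set xs"
proof (induction xs rule: rev_induct)
  case Nil
  then show ?case using cinit_less2[of i] by (simp add: cl_def)
next
  case (snoc x xs)
  then show ?case using \<delta>[of "cl i xs" "i - 2" x] by (auto simp: cl_snoc ctrans_def)
qed

lemma wf_table_table: "wf_table n (table i p)"
proof -
  have "cinit i < 4" using cinit_less2[of i] by simp
  then show ?thesis
    by (auto simp: wf_table_def table_def is_dpa_def dpa_of_table_def ctrans_less4)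
qed

lemma run_table:
  assumes "w \<in> omega_words {..<n}"
  shows "dpa_run (dpa_of_table (table i p)) w k = cl i (prefix k w)"
proof (induction k)
  case 0
  then show ?case by (simp add: cl_def dpa_of_table_def table_def)
next
  case (Suc k)
  have "w k < n" using assms by (auto simp: omega_words_def)
  then show ?case using Suc cl_less4[of i "w [0 \<rightarrow> k]"]
    by (simp add: cl_snoc) (simp add: dpa_of_table_def table_def)
qed

definition ev :: "nat => nat word => bool" where
  "ev i w <-> (EX N. ALL k>=N. cl i (prefix k w) = tgt i)"

lemma zero_mem_prefix: "0 \<in> set (prefix k w) <-> (\<exists>j<k. w j = 0)"
  by (auto simp: subsequence_def)

lemma zero_ev:
  assumes "w j = 0"
  shows "ev i w <-> i < 2"
proof -
  have *: "cl i (prefix k w) = 3" if "k >= Suc j" for k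
    unfolding cl_eq3 zero_mem_prefix using assms that by (intro exI[of _ j]) auto
  show ?thesis
  proof
    assume "ev i w"
    then obtain N where "ALL k>=N. cl i (prefix k w) = tgt i" by (auto simp: ev_def)
    then have "cl i (prefix (max N (Suc j)) w) = tgt i" by simp
    then show "i < 2" using *[of "max N (Suc j)"] by (auto simp: tgt_def split: if_splits)
  next
    assume "i < 2"
    then show "ev i w" unfolding ev_def using * by (intro exI[of _ "Suc j"]) (simp add: tgt_def)
  qed
qed

lemma nonzero_cl_mono:
  assumes "!!j. w j ~= 0" "cl i (prefix m w) = 2" "k >= m"
  shows "cl i (prefix k w) = 2"
  using assms(3)
proof (induction k rule: dec_induct)
  case (step k)
  then show ?case using assms(1) by (simp add: cl_snoc ctrans_def)
qed (use assms in simp)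

lemma nonzero_ev:
  assumes "!!j. w j ~= 0"
  shows "ev i w <-> 2 <= i & (EX k. cl i (prefix k w) = 2)"
proof -
  have 3: "cl i (prefix k w) ~= 3" for k unfolding cl_eq3 zero_mem_prefix using assms by simp
  show ?thesis
  proof (cases "i < 2")
    case True
    then show ?thesis using 3 by (auto simp: ev_def tgt_def)
  next
    case False
    have "cl i (prefix k w) = 2" if "cl i (prefix m w) = 2" "m <= k" for m k
      using nonzero_cl_mono[of w i m k] assms that by blast
    then show ?thesis using False unfolding ev_def tgt_def by (auto intro: le_refl)
  qed
qed

lemma not_ev:
  assumes "~ ev i w"
  shows "EX N. ALL k>=N. cl i (prefix k w) ~= tgt i"
proof (cases "EX j. w j = 0")
  case True
  then obtain j where j: "w j = 0" by blast
  then have "cl i (prefix k w) = 3" if "k >= Suc j" for k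
    unfolding cl_eq3 zero_mem_prefix using that by (intro exI[of _ j]) auto
  then show ?thesis using assms zero_ev[of w, OF j] by (intro exI[of _ "Suc j"]) (simp add: tgt_def)
next
  case False
  then have "cl i (prefix k w) ~= 3" for k unfolding cl_eq3 zero_mem_prefix by simp
  then show ?thesis using False assms nonzero_ev[of w i] by (auto simp: tgt_def)
qed

text \<open>State 3 is never left, and state 2 only towards 3. Being in the target therefore
  stabilises along every word, the priorities become constant, and the limit is a singleton.\<close>

lemma lang_table:
  assumes "w \<in> omega_words {..<n}"
  shows "w \<in> dpa_lang {..<n} (dpa_of_table (table i p)) <-> p < 2 & ev i w = (p = 1)"
proof -
  obtain N where N: "ALL k>=N. (cl i (prefix k w) = tgt i) = ev i w"
    using not_ev[of i w] ev_def[of i w] by (cases "ev i w") blast+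
  let ?c = "if p < 2 & ev i w = (p = 1) then 0 else 1 :: nat"
  have "(dpa_prio (dpa_of_table (table i p)) \<circ> dpa_run (dpa_of_table (table i p)) w) k = ?c" if "k >= N" for k
    unfolding o_def run_table[OF assms] using N that cl_less4[of i "w [0 \<rightarrow> k]"]
    by (simp add: dpa_of_table_def table_def)
  then have "limit (dpa_prio (dpa_of_table (table i p)) \<circ> dpa_run (dpa_of_table (table i p)) w) = {?c}"
    by (rule limit_eventually_const)
  then show ?thesis using assms by (auto simp: dpa_lang_def)
qed

definition the_game :: "(nat, nat, nat) game" where
  "the_game = \<lparr>verts = {..<n}, edges = set es, players = {..<B + 2},
     owned = (%i. {v. v < n & (if ex v then 1 else 0) = i}), payoffs = (%i. {..<3}),
     pref = (%i. if i = 0 then {(0, 1)} else if i = 1 then {} else {(1, 1)}),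
     pay = (%i w. if ev i w then 1 else 0)\<rparr>"

lemma inp_nth:
  "v < n ==> inp_owner inp ! v = (if ex v then 1 else 0)"
  "i < B + 2 ==> inp_prefs inp ! i = (if i = 0 then [(0, 1)] else if i = 1 then [] else [(1, 1)])"
  "i < B + 2 ==> p < 3 ==> inp_auts inp ! i ! p = table i p"
  "i < B + 2 ==> inp_constr inp ! i = 0" "i < B + 2 ==> length (inp_auts inp ! i) = 3"
  "length (inp_owner inp) = n" "length (inp_prefs inp) = B + 2" "length (inp_auts inp) = B + 2"
  "length (inp_constr inp) = B + 2" "inp_edges inp = es" "inp_start inp = v0"
  by (simp_all add: inp_def del: upt_Suc)

lemma is_instance_the_game: "is_instance inp the_game"
proof -
  have succ: "EX v. (u, v) \<in> set es" if "u < n" for u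
    using escape[OF that] univ_succ[OF that] by (cases "ex u") auto
  have ar: "is_arena the_game"
    using succ es by (auto simp: is_arena_def the_game_def disjoint_family_on_def)
  have lang: "dpa_lang {..<n} (dpa_of_table (table i p)) = pay_preimage the_game i p" for i p
  proof -
    have "w \<in> dpa_lang {..<n} (dpa_of_table (table i p)) <-> w \<in> pay_preimage the_game i p" for w
    proof (cases "w \<in> omega_words {..<n}")
      case True
      then show ?thesis unfolding lang_table[OF True]
        by (auto simp: pay_preimage_def the_game_def)
    next
      case False
      then show ?thesis by (simp add: dpa_lang_def pay_preimage_def the_game_def)
    qed
    then show ?thesis by blast
  qed
  have rep: "represents inp the_game"
    using lang wf_table_table unfolding represents_def
    by (auto simp: inp_nth) (auto simp: the_game_def inp_nth)
  have "omega_regular {..<n} (pay_preimage the_game i p)" for i p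
    unfolding omega_regular_def using lang wf_table_table[of i p]
    by (auto simp: wf_table_def intro!: exI[of _ "dpa_of_table (table i p)"])
  then have "rp_game the_game"
    using ar by (auto simp: rp_game_def is_game_def the_game_def)
  then show ?thesis using rep v0
    by (auto simp: is_instance_def inp_nth) (auto simp: the_game_def inp_nth)
qed

definition stepq :: "nat => (nat => nat) => nat => nat" where
  "stepq u q = (%i. ctrans (i + 2) (q i) u)"

definition safe :: "(nat \<times> (nat => nat)) set => bool" where
  "safe W <-> (\<forall>(v, q)\<in>W. v ~= 0 & (\<forall>i<B. q i < 2) &
     (ex v --> (EX u. (v, u) \<in> set es & (u, stepq u q) \<in> W)) &
     (~ ex v --> (ALL u. (v, u) \<in> set es --> (u, stepq u q) \<in> W)))"

definition st :: "nat list => nat => nat" where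
  "st h = (%i. cl (i + 2) h)"

lemma st_snoc: "st (h @ [u]) = stepq u (st h)"
  by (simp add: st_def stepq_def cl_snoc fun_eq_iff)

context
  fixes G :: "(nat, nat, nat) game"
  assumes inst: "is_instance inp G"
begin

lemma G_simps [simp]:
  "verts G = {..<n}" "edges G = set es" "players G = {..<B + 2}"
  "i < B + 2 ==> owned G i = {v. v < n & (if ex v then 1 else 0) = i}"
  "pref G 0 = {(0, 1)}" "pref G (Suc 0) = {}" "i < B ==> pref G (Suc (Suc i)) = {(1, 1)}"
  and arena: "is_arena G"
  using inst
  by (auto simp: is_instance_def represents_def inp_nth rp_game_def is_game_def)

lemma pay_eq:
  assumes "w \<in> omega_words {..<n}" "i < B + 2"
  shows "pay G i w = (if ev i w then 1 else 0)"
proof -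
  let ?p = "if ev i w then 1 else 0 :: nat"
  have "?p < 3" by simp
  moreover have "payoffs G i = {..<length (inp_auts inp ! i)} & (\<forall>p\<in>payoffs G i.
      dpa_lang (verts G) (dpa_of_table (inp_auts inp ! i ! p)) = pay_preimage G i p)"
    using inst assms(2) unfolding is_instance_def represents_def by (simp add: inp_nth(6-8))
  ultimately have "dpa_lang {..<n} (dpa_of_table (inp_auts inp ! i ! ?p)) = pay_preimage G i ?p"
    using assms(2) inp_nth(5)[of i] by (simp del: split_paired_All)
  then have "dpa_lang {..<n} (dpa_of_table (table i ?p)) = pay_preimage G i ?p"
    using assms(2) inp_nth(3)[of i ?p] by simp
  moreover have "w \<in> dpa_lang {..<n} (dpa_of_table (table i ?p))"
    unfolding lang_table[OF assms(1)] by auto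
  ultimately show ?thesis by (simp add: pay_preimage_def)
qed

lemma owner_G: "v < n ==> owner G v = (if ex v then 1 else 0)"
  by (rule owner_eq[OF arena]) auto

lemma play_words: "play G w ==> w \<in> omega_words {..<n}"
  by (simp add: play_def)

lemma play_less: "play G w ==> w k < n" and play_es: "play G w ==> (w k, w (Suc k)) \<in> set es"
  using play_verts[of G w k] by (simp_all add: play_def)

lemma start_follow:
  assumes "is_profile G \<sigma>"
  shows "EX w. play G w & w 0 = v0 & deviates G \<sigma> {} 0 w & outcome G \<sigma> v0 = w"
proof -
  have "history G ([] @ [v0])" using v0 by (simp add: history_def)
  from follow_exists[OF arena assms this] obtain w where
    w: "play G w" "w [0 \<rightarrow> Suc 0] = [v0]" "deviates G \<sigma> {} 0 w" by auto
  have "w 0 = v0" using w(2) by (simp add: subsequence_def)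
  then show ?thesis using w(1,3) outcome_deviates[OF arena assms w(1,3)] by blast
qed

text \<open>The set collects the situations on plays that avoid the sink and follow the profile from
  some time on. Such plays are outcomes of subgames, so reflexivity keeps all their checkers free of
  errors. At a vertex of player 0, every alternative successor must again be continued without the
  sink, since otherwise player 0 would profit from choosing it.\<close>

lemma spe_safe:
  assumes spe: "subgame_perfect_equilibrium G \<sigma> v0" and win: "pay G 1 (outcome G \<sigma> v0) = 0"
  shows "EX W. safe W & (v0, st [v0]) \<in> W"
proof -
  have \<sigma>: "is_profile G \<sigma>" using spe by (simp add: subgame_perfect_equilibrium_def)
  have v0': "v0 \<in> verts G" using v0 by simp
  note S = spe[unfolded SPE_iff_plays[OF arena \<sigma> v0'], rule_format]
  define good where "good w t <-> play G w & w 0 = v0 & deviates G \<sigma> {} t w & (ALL k. w k ~= 0)" for w t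
  have less2: "cl (i + 2) (prefix k w) < 2" if g: "good w t" and i: "i < B" for w t i k
  proof -
    have w: "play G w" "!!k. w k ~= 0" using g by (simp_all add: good_def)
    have "(pay G (i + 2) w, pay G (i + 2) w) \<notin> pref G (i + 2)"
      by (rule S[of _ w w t]) (use g i deviates_mono[of G \<sigma> "{}" t w _ t] in \<open>auto simp: good_def\<close>)
    then have "~ ev (i + 2) w" using i pay_eq[OF play_words[OF w(1)], of "i + 2"] by (simp split: if_splits)
    then have "cl (i + 2) (prefix k w) ~= 2" using nonzero_ev[of w "i + 2"] w(2) by auto
    moreover have "cl (i + 2) (prefix k w) ~= 3" unfolding cl_eq3 zero_mem_prefix using w(2) by simp
    ultimately show ?thesis using cl_less4[of "i + 2" "w [0 \<rightarrow> k]"] by linarith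
  qed
  have no_ev: "~ ev i w" if "good w t" "i < 2" for w t i
    using that nonzero_ev[of w i] by (auto simp: good_def)
  define W where "W = {(w t, st (prefix (Suc t) w)) | w t. good w t}"
  have "safe W"
    unfolding safe_def
  proof (intro ballI, unfold split_beta, intro conjI allI impI)
    fix y assume "y \<in> W"
    moreover define v q where "v = fst y" and "q = snd y"
    ultimately obtain w t where g: "good w t" and vq: "v = w t" "q = st (prefix (Suc t) w)" unfolding W_def by auto
    have w: "play G w" "w 0 = v0" "deviates G \<sigma> {} t w" using g by (simp_all add: good_def)
    have nxt: "(w' (Suc t), stepq (w' (Suc t)) q) \<in> W" if "good w' (Suc t)" "w' [0 \<rightarrow> Suc t] = prefix (Suc t) w" for w'
    proof -
      have "st (prefix (Suc (Suc t)) w') = stepq (w' (Suc t)) q"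
        using st_snoc[of "w' [0 \<rightarrow> Suc t]" "w' (Suc t)"] that(2) vq(2) by simp
      then show ?thesis using that(1) unfolding W_def by force
    qed
    show "fst y ~= 0" using g vq(1) by (simp add: good_def v_def q_def)
    show "snd y i < 2" if "i < B" for i using less2[OF g that, of "Suc t"] vq(2) by (simp add: st_def q_def)
    show "EX u. (fst y, u) \<in> set es & (u, stepq u (snd y)) \<in> W" if "ex (fst y)"
      unfolding v_def[symmetric] q_def[symmetric] using nxt[of w] g play_es[OF w(1), of t] deviates_mono[OF w(3)] vq(1) by (auto simp: good_def)
    show "(u, stepq u (snd y)) \<in> W" if u': "~ ex (fst y)" "(fst y, u) \<in> set es" for u
    proof -
      note u = u'[folded v_def q_def]
      have "history G (prefix (Suc t) w @ [u])"
        using play_history[OF w(1), of "Suc t"] u(2) es vq(1) by (auto simp: history_def successively_append_iff)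
      from follow_exists[OF arena \<sigma> this] obtain w' where
        w': "play G w'" "w' [0 \<rightarrow> Suc (Suc t)] = prefix (Suc t) w @ [u]" "deviates G \<sigma> {} (Suc t) w'"
        by (auto simp del: subsequence_append)
      then have e: "w' [0 \<rightarrow> Suc t] = prefix (Suc t) w" "w' (Suc t) = u" by simp_all
      have t: "w' t = v" "w' 0 = v0" using prefix_eq_mono(1)[OF e(1)] w(2) vq(1) by simp_all
      \<comment> \<open>The play \<open>w'\<close> leaves the profile only at time t, and that
        vertex belongs to player 0; later it follows the profile again.\<close>
      have "deviates G \<sigma> {0} t w'"
        unfolding deviates_def
      proof (intro allI impI)
        fix k assume k: "t <= k" "owner G (w' k) \<notin> {0}"
        then have "k ~= t" using t(1) u(1) owner_G[OF play_less[OF w'(1)], of t] by auto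
        then show "w' (Suc k) = joint G \<sigma> (prefix (Suc k) w')" using w'(3) k(1) by (simp add: deviates_def)
      qed
      then have "(pay G 0 w, pay G 0 w') \<notin> pref G 0" using S[of 0 w w' t] w w'(1) e(1) by simp
      then have "~ ev 0 w'" using no_ev[OF g, of 0] pay_eq[OF play_words, of _ 0] w(1) w'(1) by (simp split: if_splits)
      then have "good w' (Suc t)" using zero_ev[of w' _ 0] w' t(2) by (auto simp: good_def)
      then show ?thesis using nxt[of w'] e by (simp add: v_def q_def)
    qed
  qed
  moreover
  obtain w where w: "play G w" "w 0 = v0" "deviates G \<sigma> {} 0 w" "outcome G \<sigma> v0 = w"
    using start_follow[OF \<sigma>] by blast
  then have "~ ev 1 w" using win pay_eq[OF play_words[OF w(1)], of 1] by (auto split: if_splits)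
  then have "good w 0" using w zero_ev[of w _ 1] by (auto simp: good_def)
  then have "(w 0, st (prefix (Suc 0) w)) \<in> W" unfolding W_def by blast
  then have "(v0, st [v0]) \<in> W" using w(2) by (simp add: subsequence_def)
  ultimately show ?thesis by blast
qed

text \<open>Player 1 stays inside \<open>W\<close> and flees once the situation lies outside; player
  0 leaves \<open>W\<close> whenever possible. If leaving is possible, the prescribed play already
  ends in the sink, so player 0 cannot improve on it, and the flight removes all errors. If it is
  not, even deviations of player 0 remain in \<open>W\<close>.\<close>

lemma safe_spe:
  assumes W: "safe W" "(v0, st [v0]) \<in> W"
  shows "\<exists>\<sigma>. subgame_perfect_equilibrium G \<sigma> v0 & (\<forall>i<B + 2. pay G i (outcome G \<sigma> v0) = 0)"
proof -
  define inW where "inW h <-> (last h, st h) \<in> W" for h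
  define fE where "fE h = (if inW h then SOME u. (last h, u) \<in> set es & inW (h @ [u]) else 0)" for h
  define fA where "fA h = (if EX u. (last h, u) \<in> set es & ~ inW (h @ [u])
    then SOME u. (last h, u) \<in> set es & ~ inW (h @ [u]) else SOME u. (last h, u) \<in> set es)" for h
  define \<sigma> where "\<sigma> = (%i::nat. if i = 1 then fE else fA)"
  have fE: "(last h, fE h) \<in> set es & inW (h @ [fE h])" if "inW h" "ex (last h)" for h
  proof -
    have "EX u. (last h, u) \<in> set es & inW (h @ [u])"
      using W(1) that unfolding safe_def inW_def by (auto simp: st_snoc)
    from someI_ex[OF this] show ?thesis using that by (simp add: fE_def)
  qed
  have fA: "(last h, fA h) \<in> set es & ((EX u. (last h, u) \<in> set es & ~ inW (h @ [u])) --> ~ inW (h @ [fA h]))"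
    if "last h < n" "~ ex (last h)" for h
  proof (cases "EX u. (last h, u) \<in> set es & ~ inW (h @ [u])")
    case True
    from someI_ex[OF this] show ?thesis by (simp add: fA_def True)
  next
    case False
    then have "fA h = (SOME u. (last h, u) \<in> set es)" unfolding fA_def by (rule if_not_P)
    with someI_ex[OF univ_succ[OF that]] False show ?thesis by auto
  qed
  have \<sigma>: "is_profile G \<sigma>" unfolding is_profile_def is_strategy_def
  proof (intro ballI allI impI)
    fix i h v assume "i \<in> players G" "v \<in> owned G i" "history G (h @ [v])"
    then have v: "v < n" "(if ex v then 1 else 0) = i" by auto
    show "(v, \<sigma> i (h @ [v])) \<in> edges G"
      using fE[of "h @ [v]"] fA[of "h @ [v]"] escape[of v] v by (cases "ex v") (auto simp: \<sigma>_def fE_def)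
  qed
  have jE: "joint G \<sigma> h = fE h" if "last h < n" "ex (last h)" for h
    using that by (simp add: joint_def owner_G \<sigma>_def)
  have jA: "joint G \<sigma> h = fA h" if "last h < n" "~ ex (last h)" for h
    using that by (simp add: joint_def owner_G \<sigma>_def)
  have stay: "inW (prefix (Suc k) w)"
    if w: "play G w" "deviates G \<sigma> {0} m w" and m: "inW (prefix (Suc m) w)" "m <= k" for w m k
    using m(2)
  proof (induction k rule: dec_induct)
    case (step k)
    let ?h = "w [0 \<rightarrow> Suc k]"
    have l: "last ?h = w k" by (rule last_subsequence)
    have "inW (?h @ [w (Suc k)])"
    proof (cases "ex (w k)")
      case True
      then have "w (Suc k) = fE ?h" using w(2) step.hyps play_less[OF w(1), of k] jE[of ?h] l by (simp add: deviates_def owner_G)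
      then show ?thesis using fE[of ?h] step.IH True l by simp
    next
      case False
      then show ?thesis using W(1) step.IH play_es[OF w(1), of k] l unfolding safe_def inW_def st_snoc by auto
    qed
    then show ?case by simp
  qed (rule m(1))
  have nz: "~ ev i w"
    if w: "play G w" and m: "!!k. k >= m ==> inW (prefix (Suc k) w)" and i: "i < B + 2" for w m i
  proof
    have pi: "w k ~= 0 & (\<forall>i<B. cl (i + 2) (prefix (Suc k) w) < 2)" if "k >= m" for k
    proof -
      have "(w k, st (prefix (Suc k) w)) \<in> W" using m[OF that] unfolding inW_def last_subsequence .
      then show ?thesis using W(1) unfolding safe_def st_def by auto
    qed
    have zero: "w (j + d) = 0" if "w j = 0" for j d
    proof (induction d)
      case (Suc d)
      then show ?case using play_es[OF w, of "j + d"] sink by simp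
    qed (simp add: that)
    have nz: "w j ~= 0" for j using zero[of j m] pi[of "j + m"] by auto
    assume "ev i w"
    then obtain k where k: "2 <= i" "cl i (prefix k w) = 2" using nonzero_ev[of w i] nz by blast
    have c: "cl i (prefix (Suc (m + k)) w) = 2" by (rule nonzero_cl_mono[OF nz k(2)]) simp
    have "i - 2 < B" "i - 2 + 2 = i" using i k(1) by simp_all
    then show False using pi[of "m + k"] c by (metis le_add1 less_irrefl)
  qed
  have v0': "v0 \<in> verts G" using v0 by simp
  have "subgame_perfect_equilibrium G \<sigma> v0"
    unfolding SPE_iff_plays[OF arena \<sigma> v0']
  proof (intro allI ballI impI)
    fix w w' t i
    assume i: "i \<in> players G" and w: "play G w" "play G w'" "w 0 = v0" "w' [0 \<rightarrow> Suc t] = prefix (Suc t) w"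
      "deviates G \<sigma> {} t w" "deviates G \<sigma> {i} t w'"
    let ?h = "w [0 \<rightarrow> Suc t]"
    have l: "last ?h = w t" by (rule last_subsequence)
    have fw: "w (Suc t) = joint G \<sigma> ?h" "w (Suc (Suc t)) = joint G \<sigma> (?h @ [w (Suc t)])"
      using w(5) by (simp_all add: deviates_def)
    \<comment> \<open>Where \<open>W\<close> is lost, the prescribed play reaches the sink within
      two steps: by \<open>univ_ex\<close> a vertex of player 1 comes right after a vertex of player
      0.\<close>
    have key: "(EX k. w k = 0) \<or> ((\<forall>i<B + 2. ~ ev i w) & (i = 0 --> ~ ev 0 w'))"
    proof (cases "inW ?h \<or> (~ ex (w t) & (ALL u. (w t, u) \<in> set es --> inW (?h @ [u])))")
      case True
      have "~ ev j \<rho>" if \<rho>: "play G \<rho>" "\<rho> [0 \<rightarrow> Suc t] = ?h" "deviates G \<sigma> {0} t \<rho>" and j: "j < B + 2" for \<rho> j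
      proof -
        have "(w t, \<rho> (Suc t)) \<in> set es" using play_es[OF \<rho>(1), of t] prefix_eq_mono(1)[OF \<rho>(2), of t] by simp
        then have "inW ?h \<or> inW (?h @ [\<rho> (Suc t)])" using True by blast
        then have "inW (prefix (Suc t) \<rho>) \<or> inW (prefix (Suc (Suc t)) \<rho>)" using \<rho>(2) by simp
        then have "inW (prefix (Suc (Suc t)) \<rho>)" using stay[OF \<rho>(1,3), of "Suc t"] by auto
        then have "inW (prefix (Suc k) \<rho>)" if "k >= Suc t" for k
          using stay[OF \<rho>(1) deviates_mono[OF \<rho>(3), of _ "Suc t"], of k] that by simp
        then show ?thesis using nz[OF \<rho>(1)] j by blast
      qed
      then show ?thesis using w deviates_mono[OF w(5)] by auto
    next
      case False
      show ?thesis
      proof (cases "ex (w t)")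
        case True
        then have "w (Suc t) = 0" using fw(1) jE[of ?h] play_less[OF w(1), of t] False l by (simp add: fE_def)
        then show ?thesis by blast
      next
        case nex: False
        have u: "(w t, w (Suc t)) \<in> set es & ~ inW (?h @ [w (Suc t)])"
          using fA[of ?h] fw(1) jA[of ?h] play_less[OF w(1), of t] nex False l by auto
        then have "ex (w (Suc t))" using univ_ex[OF nex] by blast
        then have "w (Suc (Suc t)) = 0"
          using fw(2) jE[of "?h @ [w (Suc t)]"] u play_less[OF w(1), of "Suc t"] by (simp add: fE_def)
        then show ?thesis by blast
      qed
    qed
    have i': "i < B + 2" using i by simp
    note pays = pay_eq[OF play_words[OF w(1)] i'] pay_eq[OF play_words[OF w(2)] i']
    consider "i = 0" | "i = 1" | j where "i = Suc (Suc j)" "j < B" using i by (cases i; cases "i - 1") auto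
    then show "(pay G i w, pay G i w') \<notin> pref G i"
    proof cases
      case 1
      then show ?thesis using key pays zero_ev[of w _ 0] by auto
    next
      case 3
      then have "~ ev i w" using key zero_ev[of w _ i] by auto
      then show ?thesis using 3 pays by simp
    qed simp
  qed
  moreover have "pay G i (outcome G \<sigma> v0) = 0" if "i < B + 2" for i
  proof -
    obtain w where w: "play G w" "w 0 = v0" "deviates G \<sigma> {} 0 w" "outcome G \<sigma> v0 = w"
      using start_follow[OF \<sigma>] by blast
    have "inW (prefix (Suc 0) w)" using W(2) w(2) by (simp add: inW_def subsequence_def)
    then have "inW (prefix (Suc k) w)" for k using stay[OF w(1) deviates_mono[OF w(3)]] by blast
    then show ?thesis using nz[OF w(1) _ that] pay_eq[OF play_words[OF w(1)] that] w(4) by simp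
  qed
  ultimately show ?thesis by blast
qed

end

theorem inp_problem_iff:
  "enc_input inp \<in> constrained_SPE_problem <-> (EX W. safe W & (v0, st [v0]) \<in> W)"
proof
  assume "enc_input inp \<in> constrained_SPE_problem"
  then obtain G where G: "is_instance inp G" "constrained_SPE_exists G (inp_start inp) (%i. inp_constr inp ! i)"
    unfolding constrained_SPE_problem_def using inj_enc_input by (auto dest: injD)
  obtain \<sigma> where \<sigma>: "subgame_perfect_equilibrium G \<sigma> v0"
    "\<forall>i\<in>players G. inp_constr inp ! i = pay G i (outcome G \<sigma> v0) \<or>
       (inp_constr inp ! i, pay G i (outcome G \<sigma> v0)) \<in> pref G i"
    using G(2) by (auto simp: constrained_SPE_exists_def inp_def)
  have "pay G 1 (outcome G \<sigma> v0) = 0"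
    using \<sigma>(2)[rule_format, of 1] G_simps[OF G(1)] by (simp add: inp_def nth_Cons' del: upt_Suc)
  from spe_safe[OF G(1) \<sigma>(1) this] show "EX W. safe W & (v0, st [v0]) \<in> W" .
next
  assume "EX W. safe W & (v0, st [v0]) \<in> W"
  then obtain W where "safe W" "(v0, st [v0]) \<in> W" by blast
  from safe_spe[OF is_instance_the_game this] obtain \<sigma> where
    \<sigma>: "subgame_perfect_equilibrium the_game \<sigma> v0" "\<forall>i<B + 2. pay the_game i (outcome the_game \<sigma> v0) = 0"
    by blast
  have "inp_constr inp ! i = 0" if "i < B + 2" for i using that by (simp add: inp_def del: upt_Suc)
  then have "constrained_SPE_exists the_game (inp_start inp) (%i. inp_constr inp ! i)"
    unfolding constrained_SPE_exists_def
    using \<sigma> by (intro exI[of _ \<sigma>]) (auto simp: inp_def G_simps[OF is_instance_the_game] simp del: upt_Suc)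
  then show "enc_input inp \<in> constrained_SPE_problem"
    unfolding constrained_SPE_problem_def using is_instance_the_game by blast
qed

lemma inp_three_payoffs: "enc_input inp \<in> three_payoff_instances"
  unfolding three_payoff_instances_def using is_instance_the_game
  by (auto intro!: exI[of _ inp] exI[of _ the_game] simp: the_game_def)

end

section \<open>Binary counters held by automata\<close>

definition num :: "nat => (nat => nat) => nat" where
  "num k q = (\<Sum>i<k. q i * 2 ^ i)"

text \<open>The local share of bit \<open>i\<close> in a decrement for which \<open>r\<close> is
  claimed to be the lowest bit set: bits below \<open>r\<close> pass from 0 to 1 and bit
  \<open>r\<close> from 1 to 0. A wrong claim sends some bit to the error state 2, so no bit has to
  know the others.\<close>

definition bitdec :: "nat => nat => nat => nat" where
  "bitdec r i q = (if i < r then (if q = 0 then 1 else 2) else if i = r then (if q = 1 then 0 else 2) else q)"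

definition bitinc :: "nat => nat => nat => nat" where
  "bitinc r i q = (if i < r then (if q = 1 then 0 else 2) else if i = r then (if q = 0 then 1 else 2) else q)"

lemma num_Suc [simp]: "num (Suc k) q = num k q + q k * 2 ^ k"
  by (simp add: num_def)

lemma num_0 [simp]: "num 0 q = 0"
  by (simp add: num_def)

lemma num_cong: "(!!i. i < k ==> q i = q' i) ==> num k q = num k q'"
  by (simp add: num_def)

lemma num_less: "\<forall>i<k. q i < 2 ==> num k q < 2 ^ k"
proof (induction k)
  case (Suc k)
  then have "num k q < 2 ^ k" "q k < 2" by auto
  then show ?case by (cases "q k") auto
qed simp

lemma num_ones: "\<forall>i<k. q i = 1 ==> Suc (num k q) = 2 ^ k"
  by (induction k) auto

lemma num_zero: "\<forall>i<k. q i = 0 ==> num k q = 0"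
  by (induction k) auto

lemma num_dec:
  "\<forall>i<k. bitdec r i (q i) < 2 ==> r < k ==> num k q = Suc (num k (%i. bitdec r i (q i)))"
proof (induction k)
  case (Suc k)
  show ?case
  proof (cases "r = k")
    case True
    have b: "q k = 1" "\<forall>i<k. q i = 0"
      using Suc.prems(1) True by (auto simp: bitdec_def split: if_splits)
    have "Suc (num k (%i. bitdec r i (q i))) = 2 ^ k"
      by (rule num_ones) (use b True in \<open>auto simp: bitdec_def\<close>)
    moreover have "bitdec r k (q k) = 0" using b True by (simp add: bitdec_def)
    ultimately show ?thesis using b num_zero[of k q] by simp
  next
    case False
    then have "r < k" using Suc.prems(2) by simp
    moreover have "bitdec r k (q k) = q k" using \<open>r < k\<close> by (simp add: bitdec_def)
    ultimately show ?thesis using Suc by simp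
  qed
qed simp

lemma num_inc:
  "\<forall>i<k. bitinc r i (q i) < 2 ==> r < k ==> num k (%i. bitinc r i (q i)) = Suc (num k q)"
proof (induction k)
  case (Suc k)
  show ?case
  proof (cases "r = k")
    case True
    have b: "q k = 0" "\<forall>i<k. q i = 1"
      using Suc.prems(1) True by (auto simp: bitinc_def split: if_splits)
    have "num k (%i. bitinc r i (q i)) = 0"
      by (rule num_zero) (use b True in \<open>auto simp: bitinc_def\<close>)
    moreover have "bitinc r k (q k) = 1" using b True by (simp add: bitinc_def)
    ultimately show ?thesis using b num_ones[of k q] by simp
  next
    case False
    then have "r < k" using Suc.prems(2) by simp
    moreover have "bitinc r k (q k) = q k" using \<open>r < k\<close> by (simp add: bitinc_def)
    ultimately show ?thesis using Suc by simp
  qed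
qed simp

lemma num_dec_ex:
  assumes "num k q > 0" "\<forall>i<k. q i < 2"
  shows "\<exists>r<k. \<forall>i<k. bitdec r i (q i) < 2"
proof -
  let ?P = "%i. i < k & q i ~= 0"
  have "EX i. ?P i" using num_zero[of k q] assms(1) by fastforce
  then obtain r where r: "?P r" "!!i. i < r ==> ~ ?P i" using exists_least_iff[of ?P] by blast
  have "q i = 0" if "i < r" for i using r(2)[OF that] r(1) that by simp
  moreover have "q r < 2" using r(1) assms(2) by simp
  then have "q r = 1" using r(1) by linarith
  ultimately show ?thesis using r(1) assms(2)
    by (intro exI[of _ r]) (simp add: bitdec_def)
qed

lemma num_inc_ex:
  assumes "Suc (num k q) < 2 ^ k" "\<forall>i<k. q i < 2"
  shows "\<exists>r<k. \<forall>i<k. bitinc r i (q i) < 2"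
proof -
  let ?P = "%i. i < k & q i ~= 1"
  have "EX i. ?P i" using num_ones[of k q] assms(1) by fastforce
  then obtain r where r: "?P r" "!!i. i < r ==> ~ ?P i" using exists_least_iff[of ?P] by blast
  have "q i = 1" if "i < r" for i using r(2)[OF that] r(1) that by simp
  moreover have "q r < 2" using r(1) assms(2) by simp
  then have "q r = 0" using r(1) by linarith
  ultimately show ?thesis using r(1) assms(2)
    by (intro exI[of _ r]) (simp add: bitinc_def)
qed

lemma num_inj:
  "\<forall>i<k. q i < 2 ==> \<forall>i<k. q' i < 2 ==> num k q = num k q' ==> i < k ==> q i = q' i"
proof (induction k)
  case (Suc k)
  have less: "num k q < 2 ^ k" "num k q' < 2 ^ k" using Suc.prems by (auto intro: num_less)
  have b: "q k < 2" "q' k < 2" using Suc.prems by auto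
  then have k: "q k = q' k" using Suc.prems(3) less by (auto simp: less_2_cases_iff)
  then have n: "num k q = num k q'" using Suc.prems(3) by simp
  show ?case
  proof (cases "i = k")
    case False
    then show ?thesis using Suc.IH[OF _ _ n] Suc.prems by simp
  qed (simp add: k)
qed simp

definition bits :: "nat => nat => nat" where
  "bits v i = v div 2 ^ i mod 2"

lemma num_bits: "num k (bits v) = v mod 2 ^ k"
proof (induction k)
  case (Suc k)
  have "v mod (2 ^ k * 2) = 2 ^ k * (v div 2 ^ k mod 2) + v mod 2 ^ k" by (rule mod_mult2_eq)
  then show ?case using Suc by (simp add: bits_def mult.commute)
qed simp

text \<open>The binary digits of \<open>2 ^ (k - 1)\<close>, which is the zero point of a counter
  that must also represent negative offsets.\<close>

definition midbit :: "nat => nat => nat" where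
  "midbit k i = (if Suc i = k then 1 else 0)"

definition chk :: "nat => nat => nat => nat" where
  "chk k i q = (if q = midbit k i then q else 2)"

text \<open>Being different from the midpoint is certified by one digit, so only the named bit is
  examined; equality is checked by all bits at once in \<open>chk\<close>.\<close>

definition nchk :: "nat => nat => nat => nat => nat" where
  "nchk k r i q = (if i = r & q = midbit k i then 2 else q)"

lemma num_midbit: "k > 0 ==> num k (midbit k) = 2 ^ (k - 1)"
  by (cases k) (auto simp: midbit_def num_def intro!: sum.neutral)

lemma midbit_less: "midbit k i < 2"
  by (simp add: midbit_def)

lemma num_eq_mid: "k > 0 ==> \<forall>i<k. q i < 2 ==> num k q = 2 ^ (k - 1) <-> (\<forall>i<k. q i = midbit k i)"
  using num_inj[of k q "midbit k"] num_midbit[of k] num_cong[of k q "midbit k"] midbit_less by auto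

section \<open>Runs of Turing machines\<close>

context
  fixes M :: tm
  assumes M: "wf_tm M"
begin

text \<open>As in \<open>tm_step\<close>, the halting state repeats its configuration. The
  computation is then defined at all times, and the moment of inspection can be fixed in
  advance.\<close>

definition dstep :: "nat => nat list => nat \<times> (nat \<times> move) list" where
  "dstep q s = (if q = 1 then (1, map (%b. (b, Stay)) s) else tm_delta M q s)"

definition cfg :: "bool list => nat => config" where
  "cfg x t = (tm_step M ^^ t) (tm_init M x)"

definition cfg_state where "cfg_state x t = fst (cfg x t)"
definition cfg_head where "cfg_head x t j = fst (snd (cfg x t) ! j)"
definition cfg_cell where "cfg_cell x t j z = snd (snd (cfg x t) ! j) z"
definition cfg_syms where "cfg_syms x t = map (%j. cfg_cell x t j (cfg_head x t j)) [0..<tm_tapes M]"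

lemma cfg_length: "length (snd (cfg x t)) = tm_tapes M"
  and cfg_state_less: "cfg_state x t < tm_states M"
  and cfg_cell_less: "j < tm_tapes M ==> cfg_cell x t j z < tm_symbols M"
  and cfg_step: "cfg x (Suc t) = (fst (dstep (cfg_state x t) (cfg_syms x t)),
     map2 tape_act (snd (cfg x t)) (snd (dstep (cfg_state x t) (cfg_syms x t))))"
  and dstep_length: "length (snd (dstep (cfg_state x t) (cfg_syms x t))) = tm_tapes M"
proof -
  have wf: "tm_tapes M >= 1" "tm_states M >= 2" "tm_symbols M >= 3" using M by (auto simp: wf_tm_def)
  let ?inv = "%c. length (snd c) = tm_tapes M & fst c < tm_states M &
    (ALL j z. j < tm_tapes M --> snd (snd c ! j) z < tm_symbols M)"
  have rd: "tape_read tp = snd tp (fst tp)" for tp by (cases tp) auto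
  have syms: "cfg_syms x t = map tape_read (snd (cfg x t))" if "length (snd (cfg x t)) = tm_tapes M" for t
    by (rule nth_equalityI) (use that in \<open>auto simp: cfg_syms_def cfg_cell_def cfg_head_def rd\<close>)
  have d: "fst (dstep q s) < tm_states M & length (snd (dstep q s)) = tm_tapes M &
      fst ` set (snd (dstep q s)) \<subseteq> {..<tm_symbols M}"
    if "q < tm_states M" "length s = tm_tapes M" "set s \<subseteq> {..<tm_symbols M}" for q s
    using M that unfolding wf_tm_def dstep_def by (auto simp: split_beta image_image)
  have step: "tm_step M (q, ts) = (fst (dstep q (map tape_read ts)), map2 tape_act ts (snd (dstep q (map tape_read ts))))"
    for q ts
  proof (cases "q = 1")
    case True
    have "tape_act (ts ! t) (tape_read (ts ! t), Stay) = ts ! t" for t by (cases "ts ! t") auto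
    then have "map2 tape_act ts (map ((%b. (b, Stay)) \<circ> tape_read) ts) = ts"
      by (intro nth_equalityI) auto
    then show ?thesis using True by (simp add: dstep_def)
  qed (simp add: dstep_def split_beta)
  have inv: "?inv (cfg x t)" for t
  proof (induction t)
    case 0
    have "snd ((input_tape x # replicate (tm_tapes M - 1) blank_tape) ! j) z < tm_symbols M"
      if "j < tm_tapes M" for j z
      using wf that by (cases j) (auto simp: input_tape_def bit_symbol_def blank_tape_def)
    then show ?case using wf by (simp add: cfg_def tm_init_def)
  next
    case (Suc t)
    obtain q ts where c: "cfg x t = (q, ts)" by (cases "cfg x t")
    have s: "set (map tape_read ts) \<subseteq> {..<tm_symbols M}"
    proof
      fix a assume "a \<in> set (map tape_read ts)"
      then obtain j where "j < tm_tapes M" "a = tape_read (ts ! j)" using Suc by (auto simp: c in_set_conv_nth)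
      then show "a \<in> {..<tm_symbols M}" using Suc by (cases "ts ! j") (auto simp: c)
    qed
    note d' = d[of q "map tape_read ts", OF _ _ s]
    have l: "length (snd (dstep q (map tape_read ts))) = tm_tapes M" using d' Suc by (auto simp: c)
    have "snd (map2 tape_act ts (snd (dstep q (map tape_read ts))) ! j) z < tm_symbols M"
      if j: "j < tm_tapes M" for j z
    proof -
      let ?a = "snd (dstep q (map tape_read ts)) ! j"
      have "?a \<in> set (snd (dstep q (map tape_read ts)))" using l j by simp
      then have "fst ?a < tm_symbols M" using d' Suc by (auto simp: c)
      moreover have "snd (ts ! j) z < tm_symbols M" using Suc j by (simp add: c)
      ultimately show ?thesis using l j Suc by (cases ?a; cases "ts ! j") (auto simp: c)
    qed
    moreover have "cfg x (Suc t) = tm_step M (q, ts)" using c by (simp add: cfg_def)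
    ultimately show ?case using d' l Suc unfolding step c by simp
  qed
  show l: "length (snd (cfg x t)) = tm_tapes M" and "cfg_state x t < tm_states M"
    using inv by (auto simp: cfg_state_def)
  show "j < tm_tapes M ==> cfg_cell x t j z < tm_symbols M" using inv by (simp add: cfg_cell_def)
  show "cfg x (Suc t) = (fst (dstep (cfg_state x t) (cfg_syms x t)),
     map2 tape_act (snd (cfg x t)) (snd (dstep (cfg_state x t) (cfg_syms x t))))"
  proof -
    have "cfg x (Suc t) = tm_step M (fst (cfg x t), snd (cfg x t))" by (simp add: cfg_def)
    then show ?thesis unfolding step syms[OF l] cfg_state_def .
  qed
  have "set (cfg_syms x t) \<subseteq> {..<tm_symbols M}"
    using inv by (auto simp: cfg_syms_def cfg_cell_def)
  then show "length (snd (dstep (cfg_state x t) (cfg_syms x t))) = tm_tapes M"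
    using d[of "cfg_state x t" "cfg_syms x t"] inv[of t] by (simp add: cfg_syms_def cfg_state_def)
qed

definition wsym :: "nat => nat list => nat => nat" where
  "wsym q s j = fst (snd (dstep q s) ! j)"

definition wmove :: "nat => nat list => nat => int" where
  "wmove q s j = offset (snd (snd (dstep q s) ! j))"

lemma cfg_state_Suc: "cfg_state x (Suc t) = fst (dstep (cfg_state x t) (cfg_syms x t))"
  unfolding cfg_state_def by (simp add: cfg_step flip: cfg_state_def)

lemma cfg_tape_Suc: "j < tm_tapes M ==> snd (cfg x (Suc t)) ! j =
   tape_act (snd (cfg x t) ! j) (snd (dstep (cfg_state x t) (cfg_syms x t)) ! j)"
  by (simp add: cfg_step cfg_length dstep_length)

lemma cfg_head_Suc: "j < tm_tapes M ==>
    cfg_head x (Suc t) j = cfg_head x t j + wmove (cfg_state x t) (cfg_syms x t) j"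
  unfolding cfg_head_def wmove_def
  by (cases "snd (cfg x t) ! j"; cases "snd (dstep (cfg_state x t) (cfg_syms x t)) ! j")
    (simp add: cfg_tape_Suc)

lemma cfg_cell_Suc: "j < tm_tapes M ==> cfg_cell x (Suc t) j z =
    (if z = cfg_head x t j then wsym (cfg_state x t) (cfg_syms x t) j else cfg_cell x t j z)"
  unfolding cfg_head_def wsym_def cfg_cell_def
  by (cases "snd (cfg x t) ! j"; cases "snd (dstep (cfg_state x t) (cfg_syms x t)) ! j")
    (simp add: cfg_tape_Suc)

lemma cfg_0: "cfg_state x 0 = 0" "j < tm_tapes M ==> cfg_head x 0 j = 0"
  "j < tm_tapes M ==> cfg_cell x 0 j z =
     (if j = 0 & 0 <= z & nat z < length x then bit_symbol (x ! nat z) else 0)"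
  by (auto simp: cfg_state_def cfg_head_def cfg_cell_def cfg_def tm_init_def input_tape_def blank_tape_def nth_Cons')

lemma cfg_head_bound: "j < tm_tapes M ==> \<bar>cfg_head x t j\<bar> <= int t"
proof (induction t)
  case (Suc t)
  have "\<bar>wmove (cfg_state x t) (cfg_syms x t) j\<bar> <= 1"
    unfolding wmove_def by (cases "snd (snd (dstep (cfg_state x t) (cfg_syms x t)) ! j)") auto
  then show ?case using Suc by (simp add: cfg_head_Suc)
qed (simp add: cfg_0)

lemma cfg_result:
  assumes "tm_computes M (%x. [x \<in> K]) T" "T (length x) <= t"
  shows "cfg_state x t = 1" "cfg_cell x t (tm_tapes M - 1) 0 = bit_symbol (x \<in> K)"
proof -
  have "EX t<=T (length x). case cfg x t of (q, ts) => q = 1 & tape_output (last ts) [x \<in> K]"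
    using spec[OF assms(1)[unfolded tm_computes_def], of x] unfolding cfg_def .
  then obtain t0 where t0: "t0 <= T (length x)"
    "case cfg x t0 of (q, ts) => q = 1 & tape_output (last ts) [x \<in> K]" by (elim exE conjE)
  obtain q ts where q: "cfg x t0 = (q, ts)" by (cases "cfg x t0")
  then have c: "cfg x t0 = (1, ts)" "tape_output (last ts) [x \<in> K]" using t0(2) by simp_all
  have "cfg x (t0 + d) = (1, ts)" for d
  proof (induction d)
    case (Suc d)
    have "cfg x (t0 + Suc d) = tm_step M (cfg x (t0 + d))" by (simp add: cfg_def)
    then show ?case unfolding Suc by simp
  qed (simp add: c(1))
  from this[of "t - t0"] have ct: "cfg x t = (1, ts)" using t0(1) assms(2) by simp
  then show "cfg_state x t = 1" by (simp add: cfg_state_def)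
  have "length ts = tm_tapes M" using cfg_length[of x t] ct by simp
  moreover have "tm_tapes M >= 1" using M by (simp add: wf_tm_def)
  ultimately have "last ts = ts ! (tm_tapes M - 1)" by (metis last_conv_nth length_0_conv not_one_le_zero)
  then show "cfg_cell x t (tm_tapes M - 1) 0 = bit_symbol (x \<in> K)"
    using c(2) ct by (simp add: cfg_cell_def tape_output_def)
qed

end

section \<open>A computation as a safety game\<close>

text \<open>
  A control holds a claim about a configuration: its state, the symbols under the heads, and that
  the tracked cell of the tape \<open>j\<close> contains \<open>a\<close>; the last component requires the tracked cell to
  be cell 0.
\<close>

type_synonym ctrl = "nat \<times> nat list \<times> nat \<times> nat \<times> bool"

definition ctrls :: "tm => ctrl list" where
  "ctrls M = concat (map (%q. concat (map (%s. concat (map (%j. concat (map (%a.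
     map (%f. (q, s, j, a, f)) [False, True])
       [0..<tm_symbols M])) [0..<tm_tapes M])) (List.n_lists (tm_tapes M) [0..<tm_symbols M])))
       [0..<tm_states M])"

locale comp_game =
  fixes M :: tm and x :: "bool list" and m :: nat
  assumes M: "wf_tm M" and xm: "length x <= 2 ^ m"
begin

abbreviation "k \<equiv> tm_tapes M"
abbreviation "Q \<equiv> cfg_state M x"
abbreviation "H \<equiv> cfg_head M x"
abbreviation "cell \<equiv> cfg_cell M x"
abbreviation "Sy \<equiv> cfg_syms M x"
abbreviation "n \<equiv> length x"

text \<open>Up to the final time, heads and tracked cells are within \<open>2 ^ m\<close> of cell 0,
  so offsets are within \<open>2 * 2 ^ m\<close> of the midpoint \<open>4 * 2 ^ m\<close>. With
  three extra bits the counter never comes near its ends, not even after the decrements of a walk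
  along the input.\<close>

definition "md = m + 3"
definition "C = length (ctrls M)"
text \<open>A common bound for both numeric fields of a vertex: positions in the input, bit values,
  and the numbers of bits.\<close>

definition "R = n + md + 3"
definition "NV = 14 * C * R * R"

definition "cq c = fst (ctrls M ! c)"
definition "cs c = fst (snd (ctrls M ! c))"
definition "cj c = fst (snd (snd (ctrls M ! c)))"
definition "ca c = fst (snd (snd (snd (ctrls M ! c))))"
definition "cF c = snd (snd (snd (snd (ctrls M ! c))))"

definition vx :: "nat => nat => nat => nat => nat" where
  "vx l c i r = ((l * C + c) * R + i) * R + r"

definition "kd v = v div R div R div C"
definition "cc v = v div R div R mod C"
definition "ii v = v div R mod R"
definition "rr v = v mod R"

definition "tedge c c' <-> cj c' = cj c & ca c' = ca c & cF c' = cF c & fst (dstep M (cq c') (cs c')) = cq c"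
definition "dir c = (if wmove M (cq c) (cs c) (cj c) = 1 then 1
  else if wmove M (cq c) (cs c) (cj c) = - 1 then 2 else 0 :: nat)"
text \<open>The case where the tracked cell is the one being written: the claimed content must be
  the written symbol, and the claim is continued with the symbol that was read. In
  \<open>repk\<close>, by contrast, attention moves to a cell under some head, which lets the
  challenger examine every claimed symbol.\<close>

definition "zedge c c' <-> wsym M (cq c) (cs c) (cj c) = ca c & cq c' = cq c & cs c' = cs c &
  cj c' = cj c & cF c' = cF c & ca c' = cs c ! cj c"
definition "repk c c' <-> cq c' = cq c & cs c' = cs c & ca c' = cs c ! cj c' & ~ cF c'"
definition "fin c <-> cq c = 1 & cj c = k - 1 & ca c = 2 & cF c"
definition "xsym i = (if nth_default False x i then 2 else 1 :: nat)"

definition "isA v <-> kd v = 7 \<or> kd v = 8"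

text \<open>Stage \<open>i\<close> of a walk along the input. No single vertex can compare the
  binary counter with \<open>i\<close>, so it is compared with the midpoint and decremented once per
  input cell. Past the end, the tracked cell lies outside the input and must be blank.\<close>

definition wentry :: "nat => nat => nat => bool" where
  "wentry i c v <-> (i < n & cc v = c & ii v = i & (kd v = 11 \<or> kd v = 12 & rr v < md)) \<or>
     (n <= i & kd v = 10 & ca c = 0)"

text \<open>
  The kinds of vertices: 1 start; 2 choice of a bit of the initial position counter; 3 and 4 the
  challenger keeps or replaces the tracked cell; 5 the clock is decremented; 6 the preceding
  configuration is claimed and the position counter moved; 7 and 8 the head is, or is not, on the
  tracked cell; 9 the clock is 0; 10 end; 11, 12 and 13 comparison with the input.
\<close>

definition edge :: "nat => nat => bool" where
  "edge u v <-> (~ isA u & v = 0) \<or>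
    (kd u = 1 & kd v = 2 & rr v = 0) \<or>
    (kd u = 2 & (if Suc (rr u) < md then kd v = 2 & rr v = Suc (rr u) else kd v = 3 & fin (cc v))) \<or>
    ((kd u = 3 \<or> kd u = 4) & cc v = cc u & (kd v = 5 & rr v < m \<or> kd v = 9 & cq (cc u) = 0)) \<or>
    (kd u = 5 & kd v = 6 & tedge (cc u) (cc v) & rr v < md) \<or>
    (kd u = 6 & (kd v = 7 & zedge (cc u) (cc v) \<or> kd v = 8 & cc v = cc u & rr v < md)) \<or>
    (isA u & (kd v = 3 & cc v = cc u \<or> kd v = 4 & repk (cc u) (cc v))) \<or>
    (kd u = 9 & (if cj (cc u) = 0 then wentry 0 (cc u) v else kd v = 10 & ca (cc u) = 0)) \<or>
    (kd u = 10 & kd v = 10) \<or>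
    (kd u = 11 & kd v = 10 & ca (cc u) = xsym (ii u)) \<or>
    (kd u = 12 & kd v = 13 & cc v = cc u & ii v = ii u & rr v < md) \<or>
    (kd u = 13 & wentry (Suc (ii u)) (cc u) v)"

definition tbit :: "nat => nat => nat => nat" where
  "tbit b v q = (if kd v = 5 then bitdec (rr v) b q else if kd v = 9 & q ~= 0 then 2 else q)"

text \<open>The counter holds the offset of the tracked cell from the head, not its address. Being
  under the head is then equality with a constant, and switching to a cell under a head (kind 4)
  stores a constant. In exchange, each backward step must add the movement of the head (kind
  6).\<close>

definition dbit :: "nat => nat => nat => nat" where
  "dbit i v q =
     (if kd v = 2 & rr v = i then (if ii v = 1 then 1 else 0)
      else if kd v = 4 then midbit md i
      else if kd v = 6 & dir (cc v) = 1 then bitinc (rr v) i q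
      else if kd v = 6 & dir (cc v) = 2 \<or> kd v = 13 then bitdec (rr v) i q
      else if kd v = 7 \<or> kd v = 11 \<or> kd v = 9 & cF (cc v) then chk md i q
      else if kd v = 8 \<or> kd v = 12 then nchk md (rr v) i q
      else q)"

definition bit_op :: "nat => nat => nat => nat" where
  "bit_op b v q = (if b < m then tbit b v q else dbit (b - m) v q)"

definition bit_ini :: "nat => nat" where
  "bit_ini b = (if b < m then 1 else 0)"

definition es :: "(nat \<times> nat) list" where
  "es = concat (map (%u. map (%v. (u, v)) (filter (edge u) [0..<NV])) [0..<NV])"

lemma set_es: "(u, v) \<in> set es <-> u < NV & v < NV & edge u v"
  by (auto simp: es_def)

lemma tm_facts: "k >= 1" "tm_states M >= 2" "tm_symbols M >= 3"
  using M by (auto simp: wf_tm_def)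

lemma ctrls_iff: "(q, s, j, a, f) \<in> set (ctrls M) <-> q < tm_states M & length s = k &
    set s \<subseteq> {..<tm_symbols M} & j < k & a < tm_symbols M"
  by (cases f) (auto simp: ctrls_def set_n_lists lessThan_atLeast0)

lemma ctrl_ex:
  assumes "q < tm_states M" "length s = k" "set s \<subseteq> {..<tm_symbols M}" "j < k" "a < tm_symbols M"
  obtains c where "c < C" "cq c = q" "cs c = s" "cj c = j" "ca c = a" "cF c = f"
proof -
  have "(q, s, j, a, f) \<in> set (ctrls M)" using assms by (simp add: ctrls_iff)
  then obtain c where "c < C" "ctrls M ! c = (q, s, j, a, f)" by (auto simp: in_set_conv_nth C_def)
  then show thesis using that by (simp add: cq_def cs_def cj_def ca_def cF_def)
qed

lemma ctrl_bounds:
  assumes "c < C"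
  shows "cj c < k" "length (cs c) = k"
proof -
  have "ctrls M ! c \<in> set (ctrls M)" using assms by (simp add: C_def)
  then have "(cq c, cs c, cj c, ca c, cF c) \<in> set (ctrls M)"
    by (simp add: cq_def cs_def cj_def ca_def cF_def)
  then show "cj c < k" "length (cs c) = k" by (simp_all add: ctrls_iff)
qed

lemma Sy_props: "length (Sy t) = k" "set (Sy t) \<subseteq> {..<tm_symbols M}" "j < k ==> Sy t ! j = cell t j (H t j)"
  using cfg_cell_less[OF M] by (auto simp: cfg_syms_def[OF M])

lemma C_pos: "C > 0"
  using ctrl_ex[of 0 "Sy 0" 0 0 False] tm_facts Sy_props[of 0] by (metis gr_zeroI not_less0
    less_le_trans zero_less_numeral zero_less_one)

lemma R_pos: "R > 0"
  by (simp add: R_def)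

lemma vx_simps [simp]:
  assumes "c < C" "i < R" "r < R"
  shows "kd (vx l c i r) = l" "cc (vx l c i r) = c" "ii (vx l c i r) = i" "rr (vx l c i r) = r"
  using assms by (simp_all add: kd_def cc_def ii_def rr_def vx_def)

lemma vx_less: "c < C ==> i < R ==> r < R ==> l < 14 ==> vx l c i r < NV"
proof -
  assume "c < C" "i < R" "r < R" "l < 14"
  have s: "a * b + c < a' * b" if "c < b" "a < a'" for a a' b c :: nat
  proof -
    have "a * b + c < Suc a * b" using that(1) by simp
    also have "\<dots> <= a' * b" using that(2) by (intro mult_le_mono1) simp
    finally show ?thesis .
  qed
  show ?thesis unfolding vx_def NV_def by (intro s) fact+
qed

lemma cc_less: "cc v < C"
  using C_pos by (simp add: cc_def)

lemma kd_0: "kd 0 = 0"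
  by (simp add: kd_def)

lemma rm: "r < md ==> r < R" "r < m ==> r < R" "i <= n ==> i < R" "b < 2 ==> b < R" "0 < R"
  by (auto simp: R_def md_def)

definition start :: nat where
  "start = vx 1 0 0 0"

sublocale bitgame NV "%v. ~ isA v" es "m + md" bit_op bit_ini start
proof
  show "set es \<subseteq> {..<NV} \<times> {..<NV}" by (auto simp: set_es)
  have NV: "0 < NV" using C_pos R_pos by (simp add: NV_def)
  show "~ isA 0" by (simp add: isA_def kd_0)
  show "(0, u) \<in> set es <-> u = 0" for u using NV by (auto simp: set_es edge_def kd_0 isA_def)
  show "v < NV ==> ~ isA v ==> (v, 0) \<in> set es" for v using NV by (simp add: set_es edge_def)
  show "v < NV ==> ~ ~ isA v ==> EX u. (v, u) \<in> set es" for v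
    using vx_less[OF cc_less[of v] R_pos R_pos, of 3] cc_less[of v] R_pos
    by (intro exI[of _ "vx 3 (cc v) 0 0"]) (simp add: set_es edge_def)
  show "~ ~ isA v ==> (v, u) \<in> set es ==> ~ isA u" for v u
    by (auto simp: set_es edge_def isA_def)
  show "start < NV" unfolding start_def by (intro vx_less C_pos R_pos) simp
  show "q < 2 ==> bit_op i v q < 3" for i v q
  proof -
    assume q: "q < 2"
    have 1: "bitdec r b p < 3" "bitinc r b p < 3" "chk l b p < 3" "nchk l r b p < 3" if "p < 2" for r b l p
      using that by (simp_all add: bitdec_def bitinc_def chk_def nchk_def)
    have 2: "midbit l b < 3" "q < 3" for l b using q by (simp_all add: midbit_def)
    show ?thesis unfolding bit_op_def tbit_def dbit_def using q by (simp add: 1 2)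
  qed
  show "bit_ini i < 2" for i by (simp add: bit_ini_def)
qed

definition "good q <-> (\<forall>b<m + md. q b < (2::nat))"
definition "tv q = num m q"
definition "dv q = num md (%i. q (m + i))"
definition "mid = (2::nat) ^ (md - 1)"

lemma goodD: "good q ==> i < m ==> q i < 2" "good q ==> i < md ==> q (m + i) < 2"
  by (auto simp: good_def)

lemma stepq_bits:
  assumes "good q" "u ~= 0"
  shows "b < m ==> stepq u q b = tbit b u (q b)" "i < md ==> stepq u q (m + i) = dbit i u (q (m + i))"
proof -
  assume "b < m"
  moreover from this have "~ 2 <= q b" using goodD(1)[OF assms(1)] by fastforce
  ultimately show "stepq u q b = tbit b u (q b)" using assms(2) by (simp add: stepq_def ctrans_def bit_op_def)
next
  assume "i < md"
  then have "~ 2 <= q (m + i)" using goodD(2)[OF assms(1)] by fastforce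
  then show "stepq u q (m + i) = dbit i u (q (m + i))" using assms(2) by (simp add: stepq_def ctrans_def bit_op_def)
qed

lemma good_stepq:
  assumes "good q" "u ~= 0"
  shows "good (stepq u q) <-> (\<forall>b<m. tbit b u (q b) < 2) & (\<forall>i<md. dbit i u (q (m + i)) < 2)"
proof -
  have "(\<forall>b<m + md. P b) <-> (\<forall>b<m. P b) & (\<forall>i<md. P (m + i))" for P
    by (metis add.commute add_diff_inverse_nat less_diff_conv2 nat_add_left_cancel_less not_less trans_less_add1)
  then show ?thesis unfolding good_def[of "stepq u q"] by (simp add: stepq_bits[OF assms])
qed

lemma tv_step: "good q ==> u ~= 0 ==> tv (stepq u q) = num m (%b. tbit b u (q b))"
  unfolding tv_def by (rule num_cong) (simp add: stepq_bits)

lemma dv_step: "good q ==> u ~= 0 ==> dv (stepq u q) = num md (%i. dbit i u (q (m + i)))"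
  unfolding dv_def by (rule num_cong) (simp add: stepq_bits)

lemma md_pos: "md > 0"
  by (simp add: md_def)

lemma tv_same: "good q ==> u ~= 0 ==> kd u ~= 5 ==> good (stepq u q) ==> tv (stepq u q) = tv q"
  unfolding tv_step unfolding tv_def good_stepq by (rule num_cong) (auto simp: tbit_def split: if_splits)

lemma tv_dec: "good q ==> u ~= 0 ==> kd u = 5 ==> rr u < m ==> good (stepq u q) ==> tv q = Suc (tv (stepq u q))"
  unfolding tv_step unfolding tv_def good_stepq using num_dec[of m "rr u" q] by (simp add: tbit_def)

lemma tv_zero: "good q ==> u ~= 0 ==> kd u = 9 ==> good (stepq u q) ==> tv q = 0"
  unfolding tv_def good_stepq by (rule num_zero) (auto simp: tbit_def split: if_splits)

lemma dbit_same: "kd u ~= 2 ==> kd u ~= 4 ==> kd u ~= 13 ==> kd u = 6 --> dir (cc u) = 0 ==>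
    dbit i u p < 2 ==> dbit i u p = p"
  unfolding dbit_def by (cases "kd u = 6"; simp) (auto simp: chk_def nchk_def split: if_splits)

lemma dv_same:
  "good q ==> u ~= 0 ==> kd u \<notin> {2, 4, 13} ==> kd u = 6 --> dir (cc u) = 0 ==> good (stepq u q) ==>
    dv (stepq u q) = dv q"
  unfolding dv_step unfolding dv_def good_stepq
  by (rule num_cong, rule dbit_same) auto

lemma dv_mid4: "good q ==> u ~= 0 ==> kd u = 4 ==> dv (stepq u q) = mid"
  unfolding dv_step mid_def using num_midbit[OF md_pos] by (simp add: dbit_def)

lemma dv_mid: 
  assumes "good q" "u ~= 0" "kd u = 7 \<or> kd u = 11 \<or> kd u = 9 & cF (cc u)" "good (stepq u q)"
  shows "dv q = mid"
proof -
  have "\<forall>i<md. q (m + i) = midbit md i"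
  proof (intro allI impI)
    fix i assume "i < md"
    then have "dbit i u (q (m + i)) < 2" using assms(4) unfolding good_stepq[OF assms(1,2)] by simp
    moreover have "dbit i u (q (m + i)) = chk md i (q (m + i))" using assms(3) by (auto simp: dbit_def)
    ultimately show "q (m + i) = midbit md i" by (simp add: chk_def split: if_splits)
  qed
  then show ?thesis unfolding dv_def mid_def
    using num_eq_mid[OF md_pos, of "%i. q (m + i)"] goodD(2)[OF assms(1)] by simp
qed

lemma dv_nmid: 
  assumes "good q" "u ~= 0" "kd u = 8 \<or> kd u = 12" "rr u < md" "good (stepq u q)"
  shows "dv q ~= mid"
proof -
  have "q (m + rr u) ~= midbit md (rr u)"
  proof -
    have "dbit (rr u) u (q (m + rr u)) < 2" using assms(4,5) unfolding good_stepq[OF assms(1,2)] by simp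
    moreover have "dbit (rr u) u (q (m + rr u)) = nchk md (rr u) (rr u) (q (m + rr u))"
      using assms(3) by (auto simp: dbit_def)
    ultimately show ?thesis by (simp add: nchk_def split: if_splits)
  qed
  then show ?thesis unfolding dv_def mid_def
    using num_eq_mid[OF md_pos, of "%i. q (m + i)"] goodD(2)[OF assms(1)] assms(4) by auto
qed

lemma dv_inc:
  "good q ==> u ~= 0 ==> kd u = 6 ==> dir (cc u) = 1 ==> rr u < md ==> good (stepq u q) ==>
    dv (stepq u q) = Suc (dv q)"
  unfolding dv_step unfolding dv_def good_stepq using num_inc[of md "rr u" "%i. q (m + i)"] by (simp add: dbit_def)

lemma dv_dec:
  "good q ==> u ~= 0 ==> kd u = 6 & dir (cc u) = 2 \<or> kd u = 13 ==> rr u < md ==> good (stepq u q) ==>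
    dv q = Suc (dv (stepq u q))"
  unfolding dv_step unfolding dv_def good_stepq using num_dec[of md "rr u" "%i. q (m + i)"]
  by (auto simp: dbit_def)

text \<open>Converts an offset back into an absolute address. It is this address that stays fixed
  while a claim is traced back in time.\<close>

definition pos :: "nat => nat => nat => int" where
  "pos t j d = int d - int mid + H t j"

lemma dv_move:
  assumes "good q" "u ~= 0" "kd u = 6" "rr u < md" "good (stepq u q)"
  shows "int (dv (stepq u q)) = int (dv q) + wmove M (cq (cc u)) (cs (cc u)) (cj (cc u))"
proof -
  let ?w = "wmove M (cq (cc u)) (cs (cc u)) (cj (cc u))"
  have "?w = 1 \<or> ?w = - 1 \<or> ?w = 0" unfolding wmove_def[OF M]
    by (cases "snd (snd (dstep M (cq (cc u)) (cs (cc u))) ! cj (cc u))") auto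
  then show ?thesis
  proof (elim disjE)
    assume "?w = 1"
    then show ?thesis using dv_inc[OF assms(1-3) _ assms(4,5)] by (simp add: dir_def)
  next
    assume w: "?w = - 1"
    then have "dv q = Suc (dv (stepq u q))"
      by (intro dv_dec) (use assms in \<open>auto simp: dir_def\<close>)
    then show ?thesis using w by simp
  next
    assume "?w = 0"
    then show ?thesis using dv_same[OF assms(1,2) _ _ assms(5)] assms(3) by (simp add: dir_def)
  qed
qed

lemma H_move: "j < k ==> H (Suc t) j = H t j + wmove M (Q t) (Sy t) j"
  by (rule cfg_head_Suc[OF M])

lemma cell_Suc: "j < k ==> cell (Suc t) j z = (if z = H t j then wsym M (Q t) (Sy t) j else cell t j z)"
  by (rule cfg_cell_Suc[OF M])

lemma Q_Suc: "Q (Suc t) = fst (dstep M (Q t) (Sy t))"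
  by (rule cfg_state_Suc[OF M])

lemma cell_0: "j < k ==> cell 0 j z = (if j = 0 & 0 <= z & nat z < n then xsym (nat z) else 0)"
  using cfg_0(3)[OF M, of j x z] by (simp add: xsym_def bit_symbol_def nth_default_def)

lemma H_0: "j < k ==> H 0 j = 0"
  by (rule cfg_0(2)[OF M])

lemma H_bound: "j < k ==> \<bar>H t j\<bar> <= int t"
  by (rule cfg_head_bound[OF M])

lemma kd_start: "kd start = 1"
  unfolding start_def by (rule vx_simps(1)[OF C_pos R_pos R_pos])

lemma vx_nonzero: "c < C ==> i < R ==> r < R ==> l > 0 ==> vx l c i r ~= 0"
  using vx_simps(1)[of c i r l] kd_0 by (metis less_numeral_extra(3))

lemma start_nonzero: "start ~= 0"
  unfolding start_def by (rule vx_nonzero[OF C_pos R_pos R_pos]) simp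

subsection \<open>From a safe set to the computation\<close>

context
  fixes W
  assumes W: "safe W"
begin

lemma W_D:
  assumes "(v, q) \<in> W"
  shows "v ~= 0" "good q" "~ isA v ==> EX u. (v, u) \<in> set es & (u, stepq u q) \<in> W"
    "isA v ==> (v, u) \<in> set es ==> (u, stepq u q) \<in> W"
  using bspec[OF W[unfolded safe_def] assms] by (auto simp: good_def)

lemma W_good: "(v, q) \<in> W ==> v ~= 0 & good q"
  using W_D(1,2) by blast

lemma W_ex:
  assumes "(v, q) \<in> W" "~ isA v"
  obtains u where "edge v u" "(u, stepq u q) \<in> W" "u ~= 0" "good (stepq u q)" "u < NV"
proof -
  obtain u where "(v, u) \<in> set es" "(u, stepq u q) \<in> W" using W_D(3)[OF assms] by blast
  then show thesis using that[of u] W_good[of u] by (simp add: set_es)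
qed

lemma W_isA:
  assumes "(v, q) \<in> W" "isA v" "edge v u" "u < NV" "v < NV"
  shows "(u, stepq u q) \<in> W & u ~= 0 & good (stepq u q)"
  using W_D(4)[OF assms(1,2), of u] W_good[of u] assms by (simp add: set_es)

text \<open>The sum of the counter and \<open>i\<close> does not change during the walk, so it
  identifies one cell of the initial tape. The premise excludes the input cells already passed; when
  the walk runs off the end, the cell lies outside the input and is blank.\<close>

lemma walk_sound:
  "wentry i c u ==> (u, stepq u q) \<in> W ==> good q ==> \<forall>i'<i. int (dv q) - int mid + int i ~= int i' ==>
    cell 0 0 (int (dv q) - int mid + int i) = ca c"
proof (induction "n - i" arbitrary: i c u q rule: less_induct)
  case less
  let ?z = "int (dv q) - int mid + int i"
  note q = less.prems(3)
  have u: "u ~= 0" "good (stepq u q)" using W_good[OF less.prems(2)] by auto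
  have nu: "~ isA u" using less.prems(1) by (auto simp: wentry_def isA_def)
  consider "n <= i" "ca c = 0" | "i < n" "cc u = c" "ii u = i" "kd u = 11"
    | "i < n" "cc u = c" "ii u = i" "kd u = 12" "rr u < md"
    using less.prems(1) by (auto simp: wentry_def)
  then show ?case
  proof cases
    case 1
    have "~ (0 <= ?z & nat ?z < n)"
    proof
      assume "0 <= ?z & nat ?z < n"
      then show False using less.prems(4)[rule_format, of "nat ?z"] 1 by simp
    qed
    then have "(if 0 <= ?z & nat ?z < n then xsym (nat ?z) else 0) = 0" by (rule if_not_P)
    then show ?thesis using cell_0[of 0 ?z] tm_facts 1 by (metis less_le_trans zero_less_one)
  next
    case 2
    have "dv q = mid" by (rule dv_mid[OF q u(1)]) (use 2 u in auto)
    then have z: "?z = int i" by simp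
    obtain v where "edge u v" "(v, stepq v (stepq u q)) \<in> W" "v ~= 0" using W_ex[OF less.prems(2) nu] by metis
    then have "ca c = xsym i" using 2 by (auto simp: edge_def isA_def)
    then show ?thesis unfolding z using cell_0[of 0 "int i"] tm_facts 2 by simp
  next
    case 3
    have ne: "dv q ~= mid" by (rule dv_nmid[OF q u(1)]) (use 3 u in auto)
    have d1: "dv (stepq u q) = dv q" by (rule dv_same[OF q u(1)]) (use 3 u in auto)
    let ?q = "stepq u q"
    obtain v where v: "edge u v" "(v, stepq v ?q) \<in> W" "v ~= 0" "good (stepq v ?q)"
      using W_ex[OF less.prems(2) nu] by metis
    then have v': "kd v = 13" "cc v = c" "ii v = i" "rr v < md" using 3 by (auto simp: edge_def isA_def)
    have d2: "dv ?q = Suc (dv (stepq v ?q))" by (rule dv_dec[OF u(2) v(3)]) (use v v' in auto)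
    have "~ isA v" using v' by (simp add: isA_def)
    then obtain w where w: "edge v w" "(w, stepq w (stepq v ?q)) \<in> W" "w ~= 0" using W_ex[OF v(2)] by metis
    then have "wentry (Suc i) c w" using v' by (auto simp: edge_def isA_def)
    moreover have z: "int (dv (stepq v ?q)) - int mid + int (Suc i) = ?z" using d1 d2 by simp
    moreover have "\<forall>i'<Suc i. ?z ~= int i'" using less.prems(4) ne by (auto simp: less_Suc_eq)
    moreover have "n - Suc i < n - i" using 3(1) by simp
    ultimately show ?thesis using less.hyps[of "Suc i" c w "stepq v ?q"] w(2) v(4) unfolding z by blast
  qed
qed

text \<open>Induction on the clock. One step back, the challenger may keep the tracked cell, which
  settles its earlier content, or switch to the cell under any head, which settles all symbols that
  the step reads. State and symbols being correct, the transition is the real one, and it determines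
  the later content of the tracked cell.\<close>

lemma claims_sound:
  "(v, q) \<in> W ==> kd v = 3 \<or> kd v = 4 ==> v < NV ==> tv q = t ==>
    cq (cc v) = Q t & cell t (cj (cc v)) (pos t (cj (cc v)) (dv q)) = ca (cc v) &
    (cF (cc v) --> pos t (cj (cc v)) (dv q) = 0)"
proof (induction t arbitrary: v q)
  case 0
  let ?c = "cc v" and ?j = "cj (cc v)"
  have q: "good q" using W_good[OF 0(1)] by simp
  have j: "?j < k" using ctrl_bounds(1)[OF cc_less] .
  have nv: "~ isA v" using 0(2) by (auto simp: isA_def)
  obtain u where u: "edge v u" "(u, stepq u q) \<in> W" "u ~= 0" "good (stepq u q)"
    using W_ex[OF 0(1) nv] by metis
  have "~ (kd u = 5 & rr u < m)" using tv_dec[OF q u(3) _ _ u(4)] 0(4) by auto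
  then have u': "kd u = 9" "cc u = ?c" "cq ?c = 0" using u(1,3) 0(2) by (auto simp: edge_def isA_def)
  have nu: "~ isA u" using u'(1) by (simp add: isA_def)
  have d: "dv (stepq u q) = dv q" by (rule dv_same[OF q u(3)]) (use u' u in auto)
  have "pos 0 ?j (dv q) = 0" if "cF ?c"
    using dv_mid[OF q u(3) _ u(4)] u' that H_0[OF j] by (simp add: pos_def)
  moreover have "cell 0 ?j (pos 0 ?j (dv q)) = ca ?c"
  proof -
    obtain w where w: "edge u w" "(w, stepq w (stepq u q)) \<in> W" "w ~= 0"
      using W_ex[OF u(2)] u' nu by metis
    have p: "pos 0 ?j (dv q) = int (dv (stepq u q)) - int mid + int 0" using H_0[OF j] d by (simp add: pos_def)
    show ?thesis
    proof (cases "?j = 0")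
      case True
      then have "wentry 0 ?c w" using w u' by (auto simp: edge_def isA_def)
      from walk_sound[OF this w(2) u(4)] show ?thesis using p by (simp add: True)
    next
      case False
      then have "ca ?c = 0" using w u' by (auto simp: edge_def isA_def)
      then show ?thesis using cell_0[OF j] False by simp
    qed
  qed
  ultimately show ?case using u'(3) cfg_0(1)[OF M] by simp
next
  case (Suc t)
  let ?c = "cc v" and ?j = "cj (cc v)"
  have q: "good q" using W_good[OF Suc.prems(1)] by simp
  have j: "?j < k" using ctrl_bounds(1)[OF cc_less] .
  have nv: "~ isA v" using Suc.prems(2) by (auto simp: isA_def)
  obtain u where u: "edge v u" "(u, stepq u q) \<in> W" "u ~= 0" "good (stepq u q)"
    using W_ex[OF Suc.prems(1) nv] by metis
  have "kd u ~= 9" using tv_zero[OF q u(3) _ u(4)] Suc.prems(4) by auto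
  then have u': "kd u = 5" "cc u = ?c" "rr u < m" using u(1,3) Suc.prems(2) by (auto simp: edge_def isA_def)
  let ?q1 = "stepq u q"
  have t1: "tv ?q1 = t" using tv_dec[OF q u(3) u'(1,3) u(4)] Suc.prems(4) by simp
  have d1: "dv ?q1 = dv q" by (rule dv_same[OF q u(3)]) (use u' u in auto)
  have nu: "~ isA u" using u'(1) by (simp add: isA_def)
  obtain w where w: "edge u w" "(w, stepq w ?q1) \<in> W" "w ~= 0" "good (stepq w ?q1)"
    using W_ex[OF u(2) nu] by metis
  then have w': "kd w = 6" "tedge ?c (cc w)" "rr w < md" using u' by (auto simp: edge_def isA_def)
  let ?e = "cc w" and ?q2 = "stepq w ?q1"
  have e: "cj ?e = ?j" "ca ?e = ca ?c" "cF ?e = cF ?c" "fst (dstep M (cq ?e) (cs ?e)) = cq ?c"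
    using w'(2) by (auto simp: tedge_def)
  have t2: "tv ?q2 = t" using tv_same[OF u(4) w(3) _ w(4)] w' t1 by simp
  have d2: "int (dv ?q2) = int (dv q) + wmove M (cq ?e) (cs ?e) ?j"
    using dv_move[OF u(4) w(3) w'(1,3) w(4)] d1 e by simp
  have nw: "~ isA w" using w'(1) by (simp add: isA_def)
  obtain y where y: "edge w y" "(y, stepq y ?q2) \<in> W" "y ~= 0" "good (stepq y ?q2)" "y < NV"
    using W_ex[OF w(2) nw] by metis
  let ?q3 = "stepq y ?q2"
  have y': "kd y = 7 & zedge ?e (cc y) \<or> kd y = 8 & cc y = ?e & rr y < md" using y(1,3) w' by (auto simp: edge_def isA_def)
  then have uy: "isA y" and cy: "cq (cc y) = cq ?e" "cs (cc y) = cs ?e" "cj (cc y) = ?j" "cF (cc y) = cF ?c"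
    using e by (auto simp: isA_def zedge_def)
  have t3: "tv ?q3 = t" using tv_same[OF w(4) y(3) _ y(4)] y' t2 by auto
  have d3: "dv ?q3 = dv ?q2" by (rule dv_same[OF w(4) y(3)]) (use y' y in auto)
  let ?g = "vx 3 (cc y) 0 0"
  have g: "kd ?g = 3" "cc ?g = cc y" "?g < NV"
    using cc_less R_pos by (auto intro: vx_less)
  have "edge y ?g" using uy g by (simp add: edge_def)
  from W_isA[OF y(2) uy this g(3) y(5)] have gW: "(?g, stepq ?g ?q3) \<in> W" "?g ~= 0" "good (stepq ?g ?q3)" by auto
  have tg: "tv (stepq ?g ?q3) = t" using tv_same[OF y(4) gW(2) _ gW(3)] g t3 by simp
  have dg: "dv (stepq ?g ?q3) = dv ?q2" using dv_same[OF y(4) gW(2) _ _ gW(3)] g d3 by simp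
  have IHg: "cq ?e = Q t" "cell t ?j (pos t ?j (dv ?q2)) = ca (cc y)" "cF ?c --> pos t ?j (dv ?q2) = 0"
    using Suc.IH[OF gW(1) _ g(3) tg] g dg cy by auto
  \<comment> \<open>The challenger's switch to the cell under head \<open>j'\<close> resets the
    counter to the midpoint, so the induction hypothesis speaks about the symbol that this head
    reads.\<close>
  have "cs ?e ! j' = Sy t ! j'" if j': "j' < k" for j'
  proof -
    have "(cq ?e, cs ?e, cj ?e, ca ?e, cF ?e) \<in> set (ctrls M)"
      using cc_less[of w] by (simp add: cq_def cs_def cj_def ca_def cF_def C_def)
    then have ce: "cq ?e < tm_states M" "length (cs ?e) = k" "set (cs ?e) \<subseteq> {..<tm_symbols M}"
      by (simp_all add: ctrls_iff)
    moreover have "cs ?e ! j' < tm_symbols M" using subsetD[OF ce(3) nth_mem[of j' "cs ?e"]] ce(2) j' by simp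
    ultimately obtain f where f: "f < C" "cq f = cq ?e" "cs f = cs ?e" "cj f = j'" "ca f = cs ?e ! j'" "~ cF f"
      using ctrl_ex[of "cq ?e" "cs ?e" j' "cs ?e ! j'" False] j' by metis
    let ?h = "vx 4 f 0 0"
    have h: "kd ?h = 4" "cc ?h = f" "?h < NV" using f R_pos by (auto intro: vx_less)
    have "edge y ?h" using uy h f cy by (simp add: edge_def repk_def)
    from W_isA[OF y(2) uy this h(3) y(5)] have hW: "(?h, stepq ?h ?q3) \<in> W" "?h ~= 0" "good (stepq ?h ?q3)" by auto
    have th: "tv (stepq ?h ?q3) = t" using tv_same[OF y(4) hW(2) _ hW(3)] h t3 by simp
    have dh: "dv (stepq ?h ?q3) = mid" using dv_mid4[OF y(4) hW(2)] h by simp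
    have "cell t j' (H t j') = cs ?e ! j'" using Suc.IH[OF hW(1) _ h(3) th] h f dh by (simp add: pos_def)
    then show ?thesis using Sy_props(3)[OF j'] by simp
  qed
  then have s: "cs ?e = Sy t" using ctrl_bounds(2)[OF cc_less] Sy_props(1) by (metis nth_equalityI)
  have p: "pos (Suc t) ?j (dv q) = pos t ?j (dv ?q2)"
    using d2 H_move[OF j, of t] unfolding pos_def IHg(1) s by simp
  have "cell (Suc t) ?j (pos t ?j (dv ?q2)) = ca ?c"
    using y'
  proof
    assume y7: "kd y = 7 & zedge ?e (cc y)"
    then have "dv ?q2 = mid" using dv_mid[OF w(4) y(3) _ y(4)] by simp
    then have "pos t ?j (dv ?q2) = H t ?j" by (simp add: pos_def)
    moreover have "wsym M (Q t) (Sy t) ?j = ca ?c" using y7 e s IHg(1) by (auto simp: zedge_def)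
    ultimately show ?thesis using cell_Suc[OF j, of t] by simp
  next
    assume y8: "kd y = 8 & cc y = ?e & rr y < md"
    then have "dv ?q2 ~= mid" using dv_nmid[OF w(4) y(3) _ _ y(4)] by simp
    then have "pos t ?j (dv ?q2) ~= H t ?j" by (simp add: pos_def)
    then show ?thesis using cell_Suc[OF j, of t] IHg(2) y8 e by simp
  qed
  then show ?case using p IHg(3) e(4) Q_Suc[of t] IHg(1) s by simp
qed

lemma init_sound:
  "(v, q) \<in> W ==> kd v = 2 ==> v < NV ==> rr v < md ==> Suc (tv q) = 2 ^ m ==>
    Q (2 ^ m - 1) = 1 & cell (2 ^ m - 1) (k - 1) 0 = 2"
proof (induction "md - rr v" arbitrary: v q rule: less_induct)
  case less
  have q: "good q" using W_good[OF less.prems(1)] by simp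
  have nv: "~ isA v" using less.prems(2) by (simp add: isA_def)
  obtain u where u: "edge v u" "(u, stepq u q) \<in> W" "u ~= 0" "good (stepq u q)" "u < NV"
    using W_ex[OF less.prems(1) nv] by metis
  show ?case
  proof (cases "Suc (rr v) < md")
    case True
    then have u': "kd u = 2" "rr u = Suc (rr v)" using u less.prems by (auto simp: edge_def isA_def)
    have "tv (stepq u q) = tv q" using tv_same[OF q u(3) _ u(4)] u' by simp
    then show ?thesis using less.hyps[of u "stepq u q"] u u' less.prems True by simp
  next
    case False
    then have u': "kd u = 3" "fin (cc u)" using u less.prems by (auto simp: edge_def isA_def)
    have "tv (stepq u q) = 2 ^ m - 1" using tv_same[OF q u(3) _ u(4)] u' less.prems by simp
    from claims_sound[OF u(2) _ u(5) this] show ?thesis using u' by (auto simp: fin_def)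
  qed
qed

lemma start_sound:
  assumes "(start, st [start]) \<in> W"
  shows "Q (2 ^ m - 1) = 1 & cell (2 ^ m - 1) (k - 1) 0 = 2"
proof -
  let ?q = "st [start]"
  note s = kd_start start_nonzero
  have q: "good ?q" using W_good[OF assms] by simp
  have ns: "~ isA start" using s(1) by (simp add: isA_def)
  obtain u where u: "edge start u" "(u, stepq u ?q) \<in> W" "u ~= 0" "good (stepq u ?q)" "u < NV"
    using W_ex[OF assms ns] by metis
  then have u': "kd u = 2" "rr u = 0" using s by (auto simp: edge_def isA_def)
  have "?q b = 1" if "b < m" for b
    using that s by (simp add: st_def cl_def ctrans_def cinit_def bit_ini_def bit_op_def tbit_def)
  then have "Suc (tv ?q) = 2 ^ m" unfolding tv_def by (intro num_ones) simp
  then show ?thesis using init_sound[OF u(2) u'(1) u(5)] u' tv_same[OF q u(3) _ u(4)] md_pos by simp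
qed

end

end

context comp_game
begin

subsection \<open>From the computation to a safe set\<close>

lemma vx_pos: "c < C ==> i < R ==> r < R ==> l > 0 ==> 0 < vx l c i r"
  using vx_nonzero[of c i r l] by simp

definition tracked :: "nat => nat => int => bool" where
  "tracked c t z <-> cell t (cj c) z = ca c & (cF c --> z = 0) & \<bar>z\<bar> <= 2 ^ m"

text \<open>The offset of cell 0 from the last head at the final time. The reduction cannot know
  where the head will be, so the counter is guessed bit by bit (kind 2). The flag of the control
  pays for this: at time 0 all heads are on cell 0, and a flagged claim must then have its counter
  at the midpoint.\<close>

definition dstar :: nat where
  "dstar = nat (int mid - H (2 ^ m - 1) (k - 1))"

definition walked :: "nat => nat => int => bool" where
  "walked i c z <-> i <= n & cell 0 0 z = ca c & \<bar>z\<bar> <= 2 ^ m & (\<forall>i'<i. z ~= int i')"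

definition inv :: "nat => (nat => nat) => bool" where
  "inv v q <->
    (kd v = 1 & (\<forall>b<m. q b = 1) & (\<forall>i<md. q (m + i) = 0)) \<or>
    (kd v = 2 & (\<forall>b<m. q b = 1) & rr v < md & (\<forall>i<md. q (m + i) = (if i <= rr v then bits dstar i else 0))) \<or>
    ((kd v = 3 \<or> kd v = 4) & tracked (cc v) (tv q) (pos (tv q) (cj (cc v)) (dv q)) & cq (cc v) = Q (tv q)) \<or>
    (kd v = 5 & tracked (cc v) (Suc (tv q)) (pos (Suc (tv q)) (cj (cc v)) (dv q)) & cq (cc v) = Q (Suc (tv q))) \<or>
    (kd v = 6 & tracked (cc v) (Suc (tv q)) (pos (tv q) (cj (cc v)) (dv q)) & cq (cc v) = Q (tv q) & cs (cc v) = Sy (tv q)) \<or>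
    (isA v & tracked (cc v) (tv q) (pos (tv q) (cj (cc v)) (dv q)) & cq (cc v) = Q (tv q) & cs (cc v) = Sy (tv q)) \<or>
    (kd v = 9 & tracked (cc v) 0 (pos 0 (cj (cc v)) (dv q))) \<or>
    kd v = 10 \<or>
    (kd v = 11 & ca (cc v) = xsym (ii v)) \<or>
    (kd v = 12 & ii v < n & walked (Suc (ii v)) (cc v) (int (dv q) - int mid + int (ii v))) \<or>
    (kd v = 13 & walked (Suc (ii v)) (cc v) (int (dv q) - int mid + int (ii v) + 1))"

definition WI :: "(nat \<times> (nat => nat)) set" where
  "WI = {(v, q). v < NV & v ~= 0 & good q & inv v q}"

definition next_ok :: "nat => (nat => nat) => nat => bool" where
  "next_ok v q u <-> edge v u & u < NV & u ~= 0 & good (stepq u q) & inv u (stepq u q)"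

lemma tv_bound: "good q ==> tv q < 2 ^ m"
  unfolding tv_def by (rule num_less) (simp add: good_def)

lemma dv_bound: "good q ==> dv q < 2 ^ md"
  unfolding dv_def by (rule num_less) (simp add: good_def)

lemma mid_eq: "mid = 4 * 2 ^ m" "2 ^ md = 8 * (2::nat) ^ m"
  by (simp_all add: mid_def md_def power_add)

lemma good_id:
  assumes "good q" "u ~= 0" "kd u \<in> {3, 10}"
  shows "good (stepq u q) & tv (stepq u q) = tv q & dv (stepq u q) = dv q"
proof -
  have "good (stepq u q)" using assms(3) goodD[OF assms(1)]
    unfolding good_stepq[OF assms(1,2)] by (auto simp: tbit_def dbit_def)
  then show ?thesis using tv_same[OF assms(1,2)] dv_same[OF assms(1,2)] assms(3) by auto
qed

lemma good_dmid:
  assumes "good q" "u ~= 0" "kd u = 7 \<or> kd u = 11" "dv q = mid"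
  shows "good (stepq u q) & tv (stepq u q) = tv q & dv (stepq u q) = dv q"
proof -
  have "\<forall>i<md. q (m + i) = midbit md i"
    using num_eq_mid[OF md_pos, of "%i. q (m + i)"] goodD(2)[OF assms(1)] assms(4)
    by (simp add: dv_def mid_def)
  then have "good (stepq u q)" using assms(3) goodD[OF assms(1)]
    unfolding good_stepq[OF assms(1,2)] by (auto simp: tbit_def dbit_def chk_def midbit_less)
  then show ?thesis using tv_same[OF assms(1,2)] dv_same[OF assms(1,2)] assms(3) by auto
qed

lemma good_dnmid:
  assumes "good q" "u ~= 0" "kd u = 8 \<or> kd u = 12" "q (m + rr u) ~= midbit md (rr u)"
  shows "good (stepq u q) & tv (stepq u q) = tv q & dv (stepq u q) = dv q"
proof -
  have "good (stepq u q)" using assms(3,4) goodD[OF assms(1)]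
    unfolding good_stepq[OF assms(1,2)] by (auto simp: tbit_def dbit_def nchk_def)
  then show ?thesis using tv_same[OF assms(1,2)] dv_same[OF assms(1,2)] assms(3) by auto
qed

lemma dnmid_ex:
  assumes "good q" "dv q ~= mid"
  shows "\<exists>r<md. q (m + r) ~= midbit md r"
  using num_eq_mid[OF md_pos, of "%i. q (m + i)"] goodD(2)[OF assms(1)] assms(2)
  by (auto simp: dv_def mid_def)

lemma int_le_power: "a <= 2 ^ m ==> int a <= 2 ^ m"
  by (metis of_nat_le_iff of_nat_numeral of_nat_power)

lemma next_okI:
  "edge v u ==> u < NV ==> u ~= 0 ==> good (stepq u q) ==> inv u (stepq u q) ==> EX u. next_ok v q u"
  by (auto simp: next_ok_def)

lemma walk_complete:
  assumes q: "good q" and w: "walked i c (int (dv q) - int mid + int i)" and c: "c < C"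
    and e: "!!u. wentry i c u ==> edge v u"
  shows "EX u. next_ok v q u"
proof -
  let ?z = "int (dv q) - int mid + int i"
  have k0: "0 < k" using tm_facts by simp
  have z: "cell 0 0 ?z = ca c" and iR: "i <= n" using w by (auto simp: walked_def)
  consider "i = n" | "i < n" "dv q = mid" | "i < n" "dv q ~= mid" using iR by linarith
  then show ?thesis
  proof cases
    case 1
    have "~ (0 <= ?z & nat ?z < n)"
    proof
      assume "0 <= ?z & nat ?z < n"
      then have "nat ?z < i" "?z = int (nat ?z)" using 1 by auto
      then show False using w unfolding walked_def by blast
    qed
    then have "(if 0 <= ?z & nat ?z < n then xsym (nat ?z) else 0) = 0" by (rule if_not_P)
    then have ca: "ca c = 0" using z cell_0[OF k0, of ?z] by metis
    let ?u = "vx 10 0 0 0"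
    have u: "kd ?u = 10" "?u < NV" "?u ~= 0"
      using C_pos R_pos by (auto intro: vx_less vx_pos)
    then have "wentry i c ?u" using 1 ca by (simp add: wentry_def)
    then show ?thesis using e u good_id[OF q u(3)] by (intro next_okI[of v ?u]) (simp_all add: inv_def isA_def)
  next
    case 2
    let ?u = "vx 11 c i 0"
    have u: "kd ?u = 11" "cc ?u = c" "ii ?u = i" "?u < NV" "?u ~= 0"
      using c R_pos rm(3)[OF iR] by (auto intro: vx_less vx_pos)
    have "ca c = xsym i" using z 2 cell_0[OF k0, of "int i"] by simp
    moreover have "wentry i c ?u" using 2 u by (simp add: wentry_def)
    ultimately show ?thesis using e u good_dmid[OF q u(5)] 2 by (intro next_okI[of v ?u]) (simp_all add: inv_def isA_def)
  next
    case 3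
    obtain r where r: "r < md" "q (m + r) ~= midbit md r" using dnmid_ex[OF q 3(2)] by blast
    let ?u = "vx 12 c i r"
    have u: "kd ?u = 12" "cc ?u = c" "ii ?u = i" "rr ?u = r" "?u < NV" "?u ~= 0"
      using c rm(1)[OF r(1)] rm(3)[OF iR] by (auto intro: vx_less vx_pos)
    have "wentry i c ?u" using 3 u r by (simp add: wentry_def)
    moreover have "?z ~= int i" using 3 by simp
    then have "walked (Suc i) c ?z" using w 3 unfolding walked_def by (auto simp: less_Suc_eq)
    ultimately show ?thesis using e u good_dnmid[OF q u(6)] r 3 by (intro next_okI[of v ?u]) (simp_all add: inv_def isA_def)
  qed
qed

lemma good_dec:
  assumes "good q" "u ~= 0" "kd u = 6 & dir (cc u) = 2 \<or> kd u = 13" "\<forall>i<md. bitdec (rr u) i (q (m + i)) < 2" "rr u < md"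
  shows "good (stepq u q) & tv (stepq u q) = tv q & dv q = Suc (dv (stepq u q))"
proof -
  have "good (stepq u q)" using assms(3,4) goodD[OF assms(1)]
    unfolding good_stepq[OF assms(1,2)] by (auto simp: tbit_def dbit_def)
  then show ?thesis using tv_same[OF assms(1,2)] dv_dec[OF assms(1,2)] assms(3,5) by auto
qed

lemma good_inc:
  assumes "good q" "u ~= 0" "kd u = 6 & dir (cc u) = 1" "\<forall>i<md. bitinc (rr u) i (q (m + i)) < 2" "rr u < md"
  shows "good (stepq u q) & tv (stepq u q) = tv q & dv (stepq u q) = Suc (dv q)"
proof -
  have "good (stepq u q)" using assms(3,4) goodD[OF assms(1)]
    unfolding good_stepq[OF assms(1,2)] by (auto simp: tbit_def dbit_def)
  then show ?thesis using tv_same[OF assms(1,2)] dv_inc[OF assms(1,2)] assms(3,5) by auto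
qed

lemma bits_less: "bits a i < 2"
  by (simp add: bits_def)

lemma dstar_eq: "int dstar = int mid - H (2 ^ m - 1) (k - 1)" "dstar < 2 ^ md"
proof -
  have "k - 1 < k" using tm_facts by simp
  from H_bound[OF this, of "2 ^ m - 1"] have b: "\<bar>H (2 ^ m - 1) (k - 1)\<bar> <= 2 ^ m"
    by (simp add: of_nat_diff)
  have "int mid = 4 * 2 ^ m" using mid_eq(1) by simp
  moreover have "(0::int) < 2 ^ m" by simp
  ultimately have "0 <= int mid - H (2 ^ m - 1) (k - 1)" "int mid - H (2 ^ m - 1) (k - 1) < 8 * 2 ^ m"
    using b by linarith+
  moreover from this show 1: "int dstar = int mid - H (2 ^ m - 1) (k - 1)" unfolding dstar_def by simp
  ultimately have "int dstar < int (2 ^ md)" unfolding mid_eq(2) by simp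
  then show "dstar < 2 ^ md" by (simp only: of_nat_less_iff)
qed

lemma init_step:
  assumes q: "good q" and u: "u ~= 0" "kd u = 2" "rr u = r" "ii u = bits dstar r" "r < md"
    and t: "\<forall>b<m. q b = 1" and d: "\<forall>i<md. q (m + i) = (if i < r then bits dstar i else 0)"
  shows "good (stepq u q) & inv u (stepq u q)"
proof -
  have b: "(if bits dstar r = 1 then 1 else 0) = bits dstar r" using bits_less[of dstar r] by auto
  have g: "good (stepq u q)" unfolding good_stepq[OF q u(1)] using t d u
    by (auto simp: tbit_def dbit_def bits_less)
  have "\<forall>i<md. stepq u q (m + i) = (if i <= r then bits dstar i else 0)"
    using d u b by (auto simp: stepq_bits[OF q u(1)] dbit_def)
  moreover have "\<forall>b<m. stepq u q b = 1" using t u by (simp add: stepq_bits[OF q u(1)] tbit_def)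
  ultimately show ?thesis using g u unfolding inv_def by simp
qed

text \<open>Every choice is dictated by the true computation; \<open>inv\<close> says that all
  claims agree with it. It remains to see that the counter operations needed are possible and that
  the guessed bit index can be supplied.\<close>

lemma safe_step:
  assumes acc: "Q (2 ^ m - 1) = 1" "cell (2 ^ m - 1) (k - 1) 0 = 2"
    and v: "v < NV" and q: "good q" and i: "inv v q" and nA: "~ isA v"
  shows "EX u. next_ok v q u"
proof -
  let ?c = "cc v" and ?t = "tv q" and ?d = "dv q"
  let ?j = "cj ?c"
  have c: "?c < C" by (rule cc_less)
  have j: "?j < k" by (rule ctrl_bounds(1)[OF c])
  note t = tv_bound[OF q] and d = dv_bound[OF q]
  have imid: "int mid = 4 * 2 ^ m" using mid_eq(1) by simp
  have np: "n <= 2 ^ m" by (rule xm)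
  show ?thesis
  proof (insert i[unfolded inv_def], (elim disjE; (elim conjE)?), goal_cases)
    case 1
    let ?u = "vx 2 0 (bits dstar 0) 0"
    have u: "kd ?u = 2" "rr ?u = 0" "ii ?u = bits dstar 0" "?u < NV" "?u ~= 0"
      using C_pos R_pos rm(4)[OF bits_less] by (auto intro: vx_less vx_pos)
    have "edge v ?u" using u 1 by (simp add: edge_def)
    then show ?thesis using init_step[OF q u(5,1,2,3) md_pos 1(2)] 1(3) u by (intro next_okI[of v ?u]) simp_all
  next
    case 2
    show ?thesis
    proof (cases "Suc (rr v) < md")
      case True
      let ?r = "Suc (rr v)"
      let ?u = "vx 2 0 (bits dstar ?r) ?r"
      have u: "kd ?u = 2" "rr ?u = ?r" "ii ?u = bits dstar ?r" "?u < NV" "?u ~= 0"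
        using C_pos rm(1)[OF True] rm(4)[OF bits_less] by (auto intro: vx_less vx_pos)
      have "edge v ?u" using u 2 True by (simp add: edge_def)
      then show ?thesis using init_step[OF q u(5,1,2,3) True 2(2)] 2(4) u
        by (intro next_okI[of v ?u]) (simp_all add: less_Suc_eq_le)
    next
      case False
      then have r: "Suc (rr v) = md" using 2 by simp
      obtain f where f: "f < C" "cq f = 1" "cj f = k - 1" "ca f = 2" "cF f"
        by (rule ctrl_ex[of 1 "Sy 0" "k - 1" 2 True]) (use tm_facts Sy_props(1,2)[of 0] in auto)
      let ?u = "vx 3 f 0 0"
      have u: "kd ?u = 3" "cc ?u = f" "?u < NV" "?u ~= 0"
        using f R_pos by (auto intro: vx_less vx_pos)
      have e: "edge v ?u" using u 2 r f by (simp add: edge_def fin_def)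
      have "Suc ?t = 2 ^ m" unfolding tv_def by (rule num_ones) (use 2 in simp)
      then have t': "?t = 2 ^ m - 1" by simp
      have "?d = num md (bits dstar)" unfolding dv_def by (rule num_cong) (use 2 r in auto)
      then have "?d = dstar" using num_bits[of md dstar] dstar_eq(2) by simp
      then have "pos ?t (k - 1) ?d = 0" using dstar_eq(1) by (simp add: pos_def t')
      then show ?thesis using e u f acc good_id[OF q u(4)] by (intro next_okI[of v ?u]) (simp_all add: inv_def isA_def tracked_def t')
    qed
  next
    case 3
    note A34 = 3
    show ?thesis
    proof (cases "?t = 0")
      case True
      let ?u = "vx 9 ?c 0 0"
      have u: "kd ?u = 9" "cc ?u = ?c" "?u < NV" "?u ~= 0"
        using c R_pos by (auto intro: vx_less vx_pos)
      have e: "edge v ?u" using u A34 True cfg_0(1)[OF M, of x] by (simp add: edge_def)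
      have z: "q b = 0" if "b < m" for b
        using num_inj[of m q "%_. 0" b] goodD(1)[OF q] num_zero[of m "%_. 0"] True that by (simp add: tv_def)
      have mb: "q (m + i) = midbit md i" if "cF ?c" "i < md" for i
      proof -
        have "?d = mid" using A34(2) that(1) H_0[OF j] True unfolding tracked_def pos_def by simp
        then show ?thesis using num_eq_mid[OF md_pos, of "%i. q (m + i)"] goodD(2)[OF q] that(2)
          by (simp add: dv_def mid_def)
      qed
      have g: "good (stepq ?u q)" unfolding good_stepq[OF q u(4)]
        using u z mb goodD(2)[OF q] by (auto simp: tbit_def dbit_def chk_def midbit_less)
      have "dv (stepq ?u q) = ?d" by (rule dv_same[OF q u(4)]) (use u g in auto)
      then show ?thesis using e u g A34 True by (intro next_okI[of v ?u]) (simp_all add: inv_def isA_def)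
    next
      case False
      then obtain r where r: "r < m" "\<forall>i<m. bitdec r i (q i) < 2"
        using num_dec_ex[of m q] goodD(1)[OF q] by (auto simp: tv_def)
      let ?u = "vx 5 ?c 0 r"
      have u: "kd ?u = 5" "cc ?u = ?c" "rr ?u = r" "?u < NV" "?u ~= 0"
        using c R_pos rm(2)[OF r(1)] by (auto intro: vx_less vx_pos)
      have e: "edge v ?u" using u A34 r by (auto simp: edge_def)
      have g: "good (stepq ?u q)" unfolding good_stepq[OF q u(5)]
        using u r goodD(2)[OF q] by (auto simp: tbit_def dbit_def)
      have "dv (stepq ?u q) = ?d" by (rule dv_same[OF q u(5)]) (use u g in auto)
      moreover have "?t = Suc (tv (stepq ?u q))" by (rule tv_dec[OF q u(5)]) (use u g r in auto)
      ultimately show ?thesis using e u g A34 by (intro next_okI[of v ?u]) (simp_all add: inv_def isA_def)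
    qed
  next
    case 4
    note A5 = 4
    let ?f = "cF ?c"
    have "ca ?c < tm_symbols M" "?j < k"
    proof -
      have "(cq ?c, cs ?c, cj ?c, ca ?c, cF ?c) \<in> set (ctrls M)"
        using c by (simp add: cq_def cs_def cj_def ca_def cF_def C_def)
      then show "ca ?c < tm_symbols M" "?j < k" by (simp_all add: ctrls_iff)
    qed
    then obtain g where g: "g < C" "cq g = Q ?t" "cs g = Sy ?t" "cj g = ?j" "ca g = ca ?c" "cF g = ?f"
      using ctrl_ex[of "Q ?t" "Sy ?t" ?j "ca ?c" ?f] cfg_state_less[OF M, of x ?t] Sy_props(1,2) by metis
    let ?w = "wmove M (Q ?t) (Sy ?t) ?j"
    let ?z = "pos (Suc ?t) ?j ?d"
    have te: "tedge ?c g" using g A5(3) Q_Suc[of ?t] by (simp add: tedge_def)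
    have z: "\<bar>?z\<bar> <= 2 ^ m" using A5(2) by (simp add: tracked_def)
    have HS: "\<bar>H (Suc ?t) ?j\<bar> <= 2 ^ m" using H_bound[OF j, of "Suc ?t"] int_le_power[OF Suc_leI[OF t]] by linarith
    \<comment> \<open>Both the tracked cell and the head are within \<open>2 ^ m\<close> of cell 0,
      which keeps the offset far enough from both ends to move in either direction.\<close>
    have dlo: "int ?d >= 2 * 2 ^ m" "int ?d <= 6 * 2 ^ m" using z HS imid unfolding pos_def by linarith+
    have one: "(1::int) <= 2 ^ m" by simp
    have d0: "?d > 0" using dlo(1) one by linarith
    have d1: "Suc ?d < 2 ^ md" 
    proof -
      have "int ?d + 1 < 8 * 2 ^ m" using dlo(2) one by linarith
      then have "int (Suc ?d) < int (2 ^ md)" unfolding mid_eq(2) by simp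
      then show ?thesis by (simp only: of_nat_less_iff)
    qed
    have gd: "\<forall>i<md. q (m + i) < 2" using goodD(2)[OF q] by simp
    have fin: "EX u. next_ok v q u"
      if r: "r < md" and st: "!!u. u ~= 0 ==> kd u = 6 ==> cc u = g ==> rr u = r ==>
        good (stepq u q) & tv (stepq u q) = ?t & int (dv (stepq u q)) = int ?d + ?w" for r
    proof -
      let ?u = "vx 6 g 0 r"
      have u: "kd ?u = 6" "cc ?u = g" "rr ?u = r" "?u < NV" "?u ~= 0"
        using g R_pos rm(1)[OF r] by (auto intro: vx_less vx_pos)
      have e: "edge v ?u" using u A5 r te by (auto simp: edge_def)
      note s = st[OF u(5,1,2,3)]
      have "pos ?t ?j (dv (stepq ?u q)) = ?z" using s H_move[OF j, of ?t] by (simp add: pos_def)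
      then show ?thesis using e u s g A5(2) by (intro next_okI[of v ?u]) (simp_all add: inv_def isA_def tracked_def)
    qed
    have "?w = 1 \<or> ?w = - 1 \<or> ?w = 0" unfolding wmove_def[OF M]
      by (cases "snd (snd (dstep M (Q ?t) (Sy ?t)) ! ?j)") auto
    then show ?thesis
    proof (elim disjE)
      assume w: "?w = 1"
      obtain r where r: "r < md" "\<forall>i<md. bitinc r i (q (m + i)) < 2"
        using num_inc_ex[of md "%i. q (m + i)"] d1 gd unfolding dv_def by blast
      show ?thesis
      proof (rule fin[OF r(1)])
        fix u assume "u ~= 0" "kd u = 6" "cc u = g" "rr u = r"
        then show "good (stepq u q) & tv (stepq u q) = ?t & int (dv (stepq u q)) = int ?d + ?w"
          using good_inc[OF q, of u] r w g by (simp add: dir_def)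
      qed
    next
      assume w: "?w = - 1"
      obtain r where r: "r < md" "\<forall>i<md. bitdec r i (q (m + i)) < 2"
        using num_dec_ex[of md "%i. q (m + i)"] d0 gd unfolding dv_def by blast
      show ?thesis
      proof (rule fin[OF r(1)])
        fix u assume "u ~= 0" "kd u = 6" "cc u = g" "rr u = r"
        then show "good (stepq u q) & tv (stepq u q) = ?t & int (dv (stepq u q)) = int ?d + ?w"
          using good_dec[OF q, of u] r w g by (simp add: dir_def)
      qed
    next
      assume w: "?w = 0"
      show ?thesis
      proof (rule fin[OF md_pos])
        fix u assume u: "u ~= 0" "kd u = 6" "cc u = g"
        then have d0: "dir (cc u) = 0" using w g by (simp add: dir_def)
        have "good (stepq u q)" unfolding good_stepq[OF q u(1)]
          using u d0 goodD[OF q] by (simp add: tbit_def dbit_def)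
        then show "good (stepq u q) & tv (stepq u q) = ?t & int (dv (stepq u q)) = int ?d + ?w"
          using dv_same[OF q u(1)] tv_same[OF q u(1)] u d0 w by simp
      qed
    qed
  next
    case 5
    note A6 = 5
    show ?thesis
    proof (cases "?d = mid")
      case True
      then have p: "pos ?t ?j ?d = H ?t ?j" by (simp add: pos_def)
      then have w: "wsym M (Q ?t) (Sy ?t) ?j = ca ?c" using A6(2) cell_Suc[OF j, of ?t] by (simp add: tracked_def)
      have "Sy ?t ! ?j < tm_symbols M" using Sy_props(3)[OF j] cfg_cell_less[OF M j] by simp
      then obtain g where g: "g < C" "cq g = Q ?t" "cs g = Sy ?t" "cj g = ?j" "ca g = Sy ?t ! ?j" "cF g = cF ?c"
        using ctrl_ex[of "Q ?t" "Sy ?t" ?j "Sy ?t ! ?j" "cF ?c"] cfg_state_less[OF M, of x ?t] Sy_props(1,2) j by metis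
      let ?u = "vx 7 g 0 0"
      have u: "kd ?u = 7" "cc ?u = g" "?u < NV" "?u ~= 0"
        using g R_pos by (auto intro: vx_less vx_pos)
      have e: "edge v ?u" using u A6 g w by (auto simp: edge_def zedge_def)
      have "tracked g ?t (pos ?t ?j ?d)" using A6(2) g Sy_props(3)[OF j, of ?t] by (simp add: tracked_def p)
      then show ?thesis using e u g good_dmid[OF q u(4)] True by (intro next_okI[of v ?u]) (simp_all add: inv_def isA_def)
    next
      case False
      obtain r where r: "r < md" "q (m + r) ~= midbit md r" using dnmid_ex[OF q False] by blast
      let ?u = "vx 8 ?c 0 r"
      have u: "kd ?u = 8" "cc ?u = ?c" "rr ?u = r" "?u < NV" "?u ~= 0"
        using c R_pos rm(1)[OF r(1)] by (auto intro: vx_less vx_pos)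
      have e: "edge v ?u" using u A6 r by (auto simp: edge_def)
      have "pos ?t ?j ?d ~= H ?t ?j" using False by (simp add: pos_def)
      then have "tracked ?c ?t (pos ?t ?j ?d)" using A6(2) cell_Suc[OF j, of ?t] by (simp add: tracked_def)
      then show ?thesis using e u r good_dnmid[OF q u(5)] A6 by (intro next_okI[of v ?u]) (simp_all add: inv_def isA_def)
    qed
  next
    case 6
    then show ?thesis using nA by simp
  next
    case 7
    note A9 = 7
    have p: "pos 0 ?j ?d = int ?d - int mid + int 0" using H_0[OF j] by (simp add: pos_def)
    show ?thesis
    proof (cases "?j = 0")
      case True
      have "walked 0 ?c (int ?d - int mid + int 0)" using A9(2) True p unfolding walked_def tracked_def by simp
      from walk_complete[OF q this c, of v] show ?thesis using A9(1) True by (simp add: edge_def)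
    next
      case False
      have ca: "ca ?c = 0" using A9(2) cell_0[OF j] False by (simp add: tracked_def)
      let ?u = "vx 10 0 0 0"
      have u: "kd ?u = 10" "?u < NV" "?u ~= 0"
        using C_pos R_pos by (auto intro: vx_less vx_pos)
      then have "edge v ?u" using ca A9 False by (simp add: edge_def)
      then show ?thesis using u good_id[OF q u(3)] by (intro next_okI[of v ?u]) (simp_all add: inv_def isA_def)
    qed
  next
    case 8
    note A10 = 8
    let ?u = "vx 10 0 0 0"
    have u: "kd ?u = 10" "?u < NV" "?u ~= 0"
      using C_pos R_pos by (auto intro: vx_less vx_pos)
    then have "edge v ?u" using A10 by (simp add: edge_def)
    then show ?thesis using u good_id[OF q u(3)] by (intro next_okI[of v ?u]) (simp_all add: inv_def isA_def)
  next
    case 9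
    note A11 = 9
    let ?u = "vx 10 0 0 0"
    have u: "kd ?u = 10" "?u < NV" "?u ~= 0"
      using C_pos R_pos by (auto intro: vx_less vx_pos)
    then have "edge v ?u" using A11 by (simp add: edge_def)
    then show ?thesis using u good_id[OF q u(3)] by (intro next_okI[of v ?u]) (simp_all add: inv_def isA_def)
  next
    case 10
    note A12 = 10
    let ?z = "int ?d - int mid + int (ii v)"
    have "\<bar>?z\<bar> <= 2 ^ m" using A12(3) by (simp add: walked_def)
    moreover have "int (ii v) <= 2 ^ m" using A12(2) np by (intro int_le_power) simp
    moreover have "(1::int) <= 2 ^ m" by simp
    ultimately have "int ?d > 0" using imid by linarith
    then obtain r where r: "r < md" "\<forall>i<md. bitdec r i (q (m + i)) < 2"
      using num_dec_ex[of md "%i. q (m + i)"] goodD(2)[OF q] unfolding dv_def by auto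
    let ?u = "vx 13 ?c (ii v) r"
    have u: "kd ?u = 13" "cc ?u = ?c" "ii ?u = ii v" "rr ?u = r" "?u < NV" "?u ~= 0"
      using c rm(1)[OF r(1)] rm(3)[of "ii v"] A12(2) by (auto intro: vx_less vx_pos)
    have e: "edge v ?u" using u A12 r by (auto simp: edge_def)
    have g: "good (stepq ?u q)" "?d = Suc (dv (stepq ?u q))" using good_dec[OF q u(6)] u r by auto
    then have "int (dv (stepq ?u q)) - int mid + int (ii v) + 1 = ?z" by simp
    then have "walked (Suc (ii v)) ?c (int (dv (stepq ?u q)) - int mid + int (ii v) + 1)"
      using A12(3) by (simp only:)
    then show ?thesis using e u g(1) by (intro next_okI[of v ?u]) (simp_all add: inv_def isA_def)
  next
    case 11
    note A13 = 11
    have "walked (Suc (ii v)) ?c (int ?d - int mid + int (Suc (ii v)))" using A13(2) by (simp add: algebra_simps)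
    from walk_complete[OF q this c, of v] show ?thesis using A13(1) by (simp add: edge_def)
  qed
qed

lemma safe_step_A:
  assumes v: "v < NV" and q: "good q" and i: "inv v q" and A: "isA v" and e: "edge v u" "u < NV"
  shows "(u, stepq u q) \<in> WI"
proof -
  let ?c = "cc v" and ?t = "tv q" and ?d = "dv q"
  let ?j = "cj ?c"
  have i': "tracked ?c ?t (pos ?t ?j ?d)" "cq ?c = Q ?t" "cs ?c = Sy ?t"
    using i A unfolding inv_def isA_def by auto
  have u: "kd u = 3 & cc u = ?c \<or> kd u = 4 & repk ?c (cc u)" using e A by (auto simp: edge_def isA_def)
  then have u0: "u ~= 0" using kd_0 by (cases "u = 0") auto
  show ?thesis using u
  proof
    assume "kd u = 3 & cc u = ?c"
    then show ?thesis using good_id[OF q u0] u0 e(2) i' unfolding WI_def inv_def by simp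
  next
    assume u4: "kd u = 4 & repk ?c (cc u)"
    let ?j' = "cj (cc u)"
    have j': "?j' < k" by (rule ctrl_bounds(1)[OF cc_less])
    have g: "good (stepq u q)" unfolding good_stepq[OF q u0] using u4 goodD(1)[OF q]
      by (simp add: tbit_def dbit_def midbit_less)
    have tt: "tv (stepq u q) = ?t" by (rule tv_same[OF q u0]) (use u4 g in auto)
    have "dv (stepq u q) = mid" by (rule dv_mid4[OF q u0]) (use u4 in simp)
    then have p: "pos ?t ?j' (dv (stepq u q)) = H ?t ?j'" by (simp add: pos_def)
    have "\<bar>H ?t ?j'\<bar> <= 2 ^ m" using H_bound[OF j', of ?t] int_le_power[OF less_imp_le[OF tv_bound[OF q]]] by linarith
    then have "tracked (cc u) ?t (H ?t ?j')"
      using u4 i'(3) Sy_props(3)[OF j', of ?t] by (simp add: tracked_def repk_def)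
    then show ?thesis using g u0 e(2) i'(2) u4 unfolding WI_def inv_def tt p by (simp add: repk_def tt p)
  qed
qed

theorem comp_safe_iff:
  "(EX W. safe W & (start, st [start]) \<in> W) <-> Q (2 ^ m - 1) = 1 & cell (2 ^ m - 1) (k - 1) 0 = 2"
proof
  assume "EX W. safe W & (start, st [start]) \<in> W"
  then show "Q (2 ^ m - 1) = 1 & cell (2 ^ m - 1) (k - 1) 0 = 2" using start_sound by blast
next
  assume acc: "Q (2 ^ m - 1) = 1 & cell (2 ^ m - 1) (k - 1) 0 = 2"
  have "safe WI" unfolding safe_def
  proof (clarify)
    fix v q assume "(v, q) \<in> WI"
    then have v: "v < NV" "v ~= 0" "good q" "inv v q" by (auto simp: WI_def)
    have "EX u. (v, u) \<in> set es & (u, stepq u q) \<in> WI" if "~ isA v"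
      using safe_step[of v q] acc v that unfolding next_ok_def WI_def set_es by blast
    moreover have "ALL u. (v, u) \<in> set es --> (u, stepq u q) \<in> WI" if "isA v"
      using safe_step_A[OF v(1,3,4) that] by (simp add: set_es)
    ultimately show "v ~= 0 & (\<forall>i<m + md. q i < 2) &
       (~ isA v --> (EX u. (v, u) \<in> set es & (u, stepq u q) \<in> WI)) &
       (~ ~ isA v --> (ALL u. (v, u) \<in> set es --> (u, stepq u q) \<in> WI))"
      using v by (simp add: good_def)
  qed
  moreover have "st [start] b = bit_ini b" if "b < m + md" for b
    using start_nonzero kd_start by (simp add: st_def cl_def ctrans_def cinit_def bit_ini_def bit_op_def tbit_def dbit_def)
  then have "(start, st [start]) \<in> WI"
    using start_nonzero kd_start v0 unfolding WI_def inv_def by (auto simp: good_def bit_ini_def)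
  ultimately show "EX W. safe W & (start, st [start]) \<in> W" by blast
qed

end

section \<open>The reduction is computable in polynomial time\<close>

lemma enc_digits_steps:
  "((%(a, b). if a = 0 then (a, b) else (a div 2, b @ [False, odd a])) ^^ k) (n, b) =
    (n div 2 ^ k, b @ take (2 * k) (enc_digits n))"
proof (induction k arbitrary: n b)
  case (Suc k)
  show ?case
  proof (cases "n = 0")
    case True
    then show ?thesis using Suc[of 0 b] unfolding funpow_Suc_apply by (simp add: enc_digits.simps[of 0])
  next
    case False
    then show ?thesis unfolding funpow_Suc_apply
      by (simp add: Suc enc_digits.simps[of n] div_mult2_eq)
  qed
qed simp

lemma length_enc_digits: "length (enc_digits n) <= 2 * n"
proof (induction n rule: less_induct)
  case (less n)
  show ?case
  proof (cases "n = 0")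
    case False
    then have "length (enc_digits (n div 2)) <= 2 * (n div 2)" by (intro less) auto
    moreover have "n div 2 < n" using False by simp
    ultimately have "Suc (Suc (length (enc_digits (n div 2)))) <= 2 * n" by linarith
    then show ?thesis using False by (subst enc_digits.simps) simp
  qed (simp add: enc_digits.simps)
qed

lemma esize_bools: "esize (b :: bool list) <= 4 * length b + 1"
proof -
  have "esize x <= 3" for x :: bool by (cases x) auto
  then show ?thesis using esize_list_le[of b "length b" 3] by (simp add: mult.commute)
qed

lemma pf_enc_digits: "pf f ==> pf (%x. enc_digits (f x))"
proof -
  assume f: "pf f"
  define g where "g = (%(a::nat, b). if a = 0 then (a, b) else (a div 2, b @ [False, odd a]))"
  have g': "g z = (if fst z = 0 then z else (fst z div 2, snd z @ [False, ~ fst z mod 2 = 0]))" for z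
    by (cases z) (simp add: g_def even_iff_mod_2_eq_zero)
  have "pf (%n. (g ^^ n) (n, []))"
  proof (rule pf_funpow[of "%_. g" "%n. n" "%n. (n, [])" "%n. 10 * n + 3"])
    show "pf (%z. g (snd z))" unfolding g' by (intro pf_intros)
    fix n k :: nat
    have "length (take (2 * k) (enc_digits n)) <= 2 * n" using length_enc_digits[of n] by simp
    then have E: "esize (take (2 * k) (enc_digits n)) <= 8 * n + 1"
      using esize_bools[of "take (2 * k) (enc_digits n)"] by linarith
    have "1 + (2 * (n div 2 ^ k) + 1) + esize (take (2 * k) (enc_digits n)) <= 1 + (2 * n + 1) + (8 * n + 1)"
      by (intro add_mono mult_le_mono order_refl E div_le_dividend)
    also have "\<dots> <= 10 * esize n + 3" by simp
    finally show "esize ((g ^^ k) (n, [])) <= 10 * esize n + 3"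
      unfolding g_def enc_digits_steps esize_simps append_Nil .
  qed (intro pf_intros pbd_intros)+
  then have "pf (%n. snd ((g ^^ n) (n, [])))" by (rule pf_snd)
  then have "pf enc_digits"
    unfolding g_def enc_digits_steps using length_enc_digits by simp
  then show ?thesis using f by (rule pf_comp)
qed

lemma pf_enc_group [pf_intros]: "pf f ==> pf (%x. enc_group (f x))"
  unfolding enc_group_def by (intro pf_intros)

lemma pf_enc_nat [pf_intros]: "pf f ==> pf (%x. enc_nat (f x))"
  unfolding enc_nat_def by (intro pf_intros pf_enc_digits)

lemma pf_enc_list [pf_intros]:
  "pf l ==> pf (%z. f (fst z) (snd z)) ==> pf (%x. enc_list (f x) (l x))"
  unfolding enc_list_def by (intro pf_intros)

lemma enc_list_map: "enc_list f (map g xs) = enc_list (%x. f (g x)) xs"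
  by (simp add: enc_list_def o_def)

lemma pf_enc_pair [pf_intros]: "pf f ==> pf (%x. enc_pair (f x))"
  unfolding enc_pair_def by (intro pf_intros)

text \<open>A function on a range bounded by a constant is a lookup in a constant list. The machine
  being simulated is fixed, so all relations between controls are constant data of the
  reduction.\<close>

lemma pf_table1:
  fixes f :: "nat => 'b::treelike"
  assumes "pf c" "!!e. c e < b"
  shows "pf (%e. f (c e))"
proof (rule pf_cong)
  show "pf (%e. nth_default undefined (map f [0..<b]) (c e))" by (intro pf_intros assms)
  show "f (c e) = nth_default undefined (map f [0..<b]) (c e)" for e
    using assms(2)[of e] by (simp add: nth_default_def)
qed

lemma pf_table2:
  fixes f :: "nat => nat => 'b::treelike"
  assumes "pf c" "!!e. c e < b" "pf c'" "!!e. c' e < b"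
  shows "pf (%e. f (c e) (c' e))"
proof (rule pf_cong)
  show "pf (%e. nth_default undefined (nth_default [] (map (%i. map (f i) [0..<b]) [0..<b]) (c e)) (c' e))"
    by (intro pf_intros assms)
  show "f (c e) (c' e) = nth_default undefined (nth_default [] (map (%i. map (f i) [0..<b]) [0..<b]) (c e)) (c' e)" for e
    using assms(2,4)[of e] by (simp add: nth_default_def)
qed

context
  fixes M :: tm and mm :: "bool list => nat"
  assumes G: "!!x. comp_game M x (mm x)" and mm: "pf mm"
begin

interpretation G: comp_game M "X :: bool list" "mm X" for X
  by (rule G)

named_theorems red_intros

lemma pf_mm [red_intros]: "pf X ==> pf (%e. mm (X e))"
  by (rule pf_comp[OF mm])

lemma pf_md [red_intros]: "pf X ==> pf (%e. comp_game.md (mm (X e)))"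
  unfolding G.md_def by (intro pf_intros red_intros)

lemma pf_R [red_intros]: "pf X ==> pf (%e. comp_game.R (X e) (mm (X e)))"
  unfolding G.R_def by (intro pf_intros red_intros)

lemma pf_NV [red_intros]: "pf X ==> pf (%e. comp_game.NV M (X e) (mm (X e)))"
  unfolding G.NV_def by (intro pf_intros red_intros)

lemma pf_decode [red_intros]:
  assumes "pf X" "pf V"
  shows "pf (%e. comp_game.kd M (X e) (mm (X e)) (V e))" "pf (%e. comp_game.cc M (X e) (mm (X e)) (V e))"
    "pf (%e. comp_game.ii (X e) (mm (X e)) (V e))" "pf (%e. comp_game.rr (X e) (mm (X e)) (V e))"
  unfolding G.kd_def G.cc_def G.ii_def G.rr_def by (intro pf_intros red_intros assms)+

lemma pf_control [red_intros]:
  assumes "pf X" "pf V"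
  shows "pf (%e. comp_game.cq M (comp_game.cc M (X e) (mm (X e)) (V e)))"
    "pf (%e. comp_game.cj M (comp_game.cc M (X e) (mm (X e)) (V e)))"
    "pf (%e. comp_game.ca M (comp_game.cc M (X e) (mm (X e)) (V e)))"
    "pf (%e. comp_game.cF M (comp_game.cc M (X e) (mm (X e)) (V e)))"
    "pf (%e. comp_game.dir M (comp_game.cc M (X e) (mm (X e)) (V e)))"
    "pf (%e. comp_game.fin M (comp_game.cc M (X e) (mm (X e)) (V e)))"
  by (rule pf_table1[OF pf_decode(2)[OF assms] G.cc_less])+

lemma pf_relations [red_intros]:
  assumes "pf X" "pf U" "pf V"
  shows "pf (%e. comp_game.tedge M (comp_game.cc M (X e) (mm (X e)) (U e)) (comp_game.cc M (X e) (mm (X e)) (V e)))"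
    "pf (%e. comp_game.zedge M (comp_game.cc M (X e) (mm (X e)) (U e)) (comp_game.cc M (X e) (mm (X e)) (V e)))"
    "pf (%e. comp_game.repk M (comp_game.cc M (X e) (mm (X e)) (U e)) (comp_game.cc M (X e) (mm (X e)) (V e)))"
  by (rule pf_table2[OF pf_decode(2)[OF assms(1,2)] G.cc_less pf_decode(2)[OF assms(1,3)] G.cc_less])+

lemma pf_xsym [red_intros]: "pf X ==> pf I ==> pf (%e. comp_game.xsym (X e) (I e))"
  unfolding G.xsym_def by (intro pf_intros red_intros)

lemma pf_isA [red_intros]: "pf X ==> pf V ==> pf (%e. comp_game.isA M (X e) (mm (X e)) (V e))"
  unfolding G.isA_def by (intro pf_intros red_intros)

lemma pf_wentry [red_intros]: "pf X ==> pf I ==> pf U ==> pf V ==>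
    pf (%e. comp_game.wentry M (X e) (mm (X e)) (I e) (comp_game.cc M (X e) (mm (X e)) (U e)) (V e))"
  unfolding G.wentry_def by (intro pf_intros red_intros)

lemma pf_edge [red_intros]: "pf X ==> pf U ==> pf V ==> pf (%e. comp_game.edge M (X e) (mm (X e)) (U e) (V e))"
  unfolding G.edge_def by (intro pf_intros red_intros)

lemma pf_bits [red_intros]:
  assumes "pf K" "pf Rr" "pf I" "pf Qq"
  shows "pf (%e. bitdec (Rr e) (I e) (Qq e))" "pf (%e. bitinc (Rr e) (I e) (Qq e))"
    "pf (%e. midbit (K e) (I e))" "pf (%e. chk (K e) (I e) (Qq e))" "pf (%e. nchk (K e) (Rr e) (I e) (Qq e))"
  unfolding bitdec_def bitinc_def midbit_def chk_def nchk_def by (intro pf_intros assms)+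

lemma pf_tbit [red_intros]: "pf X ==> pf I ==> pf V ==> pf Qq ==>
    pf (%e. comp_game.tbit M (X e) (mm (X e)) (I e) (V e) (Qq e))"
  unfolding G.tbit_def by (intro pf_intros red_intros pf_const)

lemma pf_dbit [red_intros]: "pf X ==> pf I ==> pf V ==> pf Qq ==>
    pf (%e. comp_game.dbit M (X e) (mm (X e)) (I e) (V e) (Qq e))"
  unfolding G.dbit_def by (intro pf_intros red_intros pf_const)

lemma pf_bit_op [red_intros]: "pf X ==> pf I ==> pf V ==> pf Qq ==>
    pf (%e. comp_game.bit_op M (X e) (mm (X e)) (I e) (V e) (Qq e))"
  unfolding G.bit_op_def by (intro pf_intros red_intros)

lemma pf_bit_ini [red_intros]: "pf X ==> pf I ==> pf (%e. comp_game.bit_ini (mm (X e)) (I e))"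
  unfolding G.bit_ini_def by (intro pf_intros red_intros)

lemma pf_es [red_intros]: "pf X ==> pf (%e. comp_game.es M (X e) (mm (X e)))"
proof -
  assume X: "pf X"
  have "pf (%x. comp_game.es M x (mm x))" unfolding G.es_def by (intro pf_intros red_intros)
  from pf_comp[OF this X] show ?thesis .
qed

lemma pf_start [red_intros]: "pf X ==> pf (%e. comp_game.start M (X e) (mm (X e)))"
  unfolding G.start_def G.vx_def by (intro pf_intros red_intros)

lemma pf_reduction: "pf (%x. enc_input (G.inp x))"
  unfolding enc_input_def G.inp_def rp_input.simps enc_list_map G.table_def enc_table_def dpa_table.simps
    G.ctrans_def G.cinit_def G.tgt_def
  by (intro pf_intros red_intros)

end

theorem EXPTIME_hard_three_payoffs: "EXPTIME_hard_on three_payoff_instances constrained_SPE_problem"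
  unfolding EXPTIME_hard_on_def
proof
  fix K assume "K \<in> EXPTIME"
  then obtain M and p :: "nat poly" where M: "wf_tm M" "tm_computes M (%x. [x \<in> K]) (%n. 2 ^ poly p n)"
    by (auto simp: EXPTIME_def)
  \<comment> \<open>The summand 1 makes \<open>2 ^ mm x - 1\<close>, the largest value of the clock,
    reach the time bound; the summand \<open>length x\<close> makes the input fit into
    \<open>2 ^ mm x\<close> cells.\<close>
  define mm where "mm x = poly p (length x) + length x + 1" for x :: "bool list"
  have le: "poly p (length x) <= mm x" "length x <= mm x" for x by (simp_all add: mm_def)
  have G: "comp_game M x (mm x)" for x
    using M(1) le_trans[OF le(2)[of x] less_imp_le[OF less_exp]] by unfold_locales
  have mm: "pf mm" unfolding mm_def by (intro pf_intros)
  interpret G: comp_game M x "mm x" for x by (rule G)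
  let ?f = "%x. enc_input (G.inp x)"
  have "x \<in> K <-> ?f x \<in> constrained_SPE_problem" for x
  proof -
    have "poly p (length x) < mm x" by (simp add: mm_def)
    then have "2 ^ poly p (length x) < (2::nat) ^ mm x" by (intro power_strict_increasing) auto
    then have "2 ^ poly p (length x) <= (2::nat) ^ mm x - 1" by linarith
    from cfg_result[OF M this] have
      "cfg_state M x (2 ^ mm x - 1) = 1" "cfg_cell M x (2 ^ mm x - 1) (tm_tapes M - 1) 0 = bit_symbol (x \<in> K)" .
    then show ?thesis unfolding G.inp_problem_iff G.comp_safe_iff by (simp add: bit_symbol_def)
  qed
  moreover have "?f x \<in> three_payoff_instances" for x by (rule G.inp_three_payoffs)
  ultimately show "EX f. polytime_computable f &
      (ALL x. f x \<in> three_payoff_instances & (x \<in> K <-> f x \<in> constrained_SPE_problem))"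
    using pf_polytime_computable[OF pf_reduction[OF G mm]] by (intro exI[of _ ?f]) blast
qed

section \<open>Parity games, Streett conditions and bounded counters\<close>

section \<open>Positional determinacy of finite parity games\<close>

lemma limit_finite_props:
  assumes "finite (range f)"
  shows "limit f ~= {}" "finite (limit f)"
  using assms limit_nonempty[of f] finite_subset[OF limit_in_range[of f]] by auto

lemma limit_Max_eq:
  assumes "!!n. f n <= (d::nat)" "INFM n. f n = d"
  shows "Max (limit f) = d"
proof (rule Max_eqI)
  have "range f \<subseteq> {..d}" using assms(1) by auto
  then show "finite (limit f)" by (meson finite_atMost finite_subset limit_in_range)
  show "d \<in> limit f" using assms(2) by (simp add: limit_def)
  show "y <= d" if "y \<in> limit f" for y
    using that assms(1) limit_in_range[of f] by auto
qed

context
  fixes E :: "'v => 'v set" and own :: "'v => bool" and pr :: "'v => nat"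
begin

definition conform :: "bool => 'v set => ('v => 'v) => (nat => 'v) => bool" where
  "conform b W \<sigma> \<rho> <-> (ALL n. \<rho> n \<in> W & \<rho> (Suc n) \<in> E (\<rho> n) & (own (\<rho> n) = b --> \<rho> (Suc n) = \<sigma> (\<rho> n)))"

text \<open>Closure is relative to \<open>X\<close>: the opponent may have edges leaving
  \<open>X\<close>, and only those inside are considered. This lets regions of a subgame be found
  after an attractor has been removed.\<close>

definition wreg :: "bool => 'v set => 'v set => ('v => 'v) => bool" where
  "wreg b X W \<sigma> <-> W \<subseteq> X & (\<forall>u\<in>W. if own u = b then \<sigma> u \<in> E u \<inter> W else E u \<inter> X \<subseteq> W) &
     (\<forall>\<rho>. conform b W \<sigma> \<rho> --> even (Max (limit (pr \<circ> \<rho>))) = b)"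

primrec attrn :: "bool => 'v set => 'v set => nat => 'v set" where
  "attrn b X T 0 = T"
| "attrn b X T (Suc n) = attrn b X T n \<union>
     {u \<in> X. if own u = b then E u \<inter> attrn b X T n ~= {} else E u \<inter> X \<subseteq> attrn b X T n}"

definition attr :: "bool => 'v set => 'v set => 'v set" where
  "attr b X T = (\<Union>n. attrn b X T n)"

lemma attrn_mono: "i <= j ==> attrn b X T i \<subseteq> attrn b X T j"
proof (induction j rule: dec_induct)
  case (step j)
  then show ?case unfolding attrn.simps by blast
qed simp

lemma attr_sub: "T \<subseteq> X ==> attr b X T \<subseteq> X" and attr_super: "T \<subseteq> attr b X T"
proof -
  have "attrn b X T n \<subseteq> X" if "T \<subseteq> X" for n
  proof (induction n)
    case (Suc n)
    then show ?case unfolding attrn.simps by blast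
  qed (simp add: that)
  then show "T \<subseteq> X ==> attr b X T \<subseteq> X" unfolding attr_def by blast
  have "attrn b X T 0 \<subseteq> attr b X T" unfolding attr_def by (rule UN_upper) simp
  then show "T \<subseteq> attr b X T" by simp
qed

lemma attr_strategy:
  "\<exists>\<sigma> rk. \<forall>u\<in>attr b X T - T. if own u = b then \<sigma> u \<in> E u \<inter> attr b X T & rk (\<sigma> u) < (rk u :: nat)
     else \<forall>v\<in>E u \<inter> X. v \<in> attr b X T & rk v < rk u"
proof -
  define rk where "rk u = (LEAST n. u \<in> attrn b X T n)" for u
  have rk: "u \<in> attrn b X T (rk u)" if "u \<in> attr b X T" for u
    unfolding rk_def by (rule LeastI_ex[of "%n. u \<in> attrn b X T n"]) (use that in \<open>simp add: attr_def\<close>)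
  have rk_le: "rk u <= n" if "u \<in> attrn b X T n" for u n
    unfolding rk_def by (rule Least_le[of "%n. u \<in> attrn b X T n"]) (rule that)
  have sub: "attrn b X T n \<subseteq> attr b X T" for n by (auto simp: attr_def)
  have *: "if own u = b then EX v. v \<in> E u \<inter> attr b X T & rk v < rk u
     else \<forall>v\<in>E u \<inter> X. v \<in> attr b X T & rk v < rk u" if u: "u \<in> attr b X T - T" for u
  proof -
    obtain n where n: "rk u = Suc n" using rk[of u] u by (cases "rk u") auto
    have "u \<notin> attrn b X T n" using rk_le[of u n] n by auto
    then have "if own u = b then E u \<inter> attrn b X T n ~= {} else E u \<inter> X \<subseteq> attrn b X T n"
      using rk[of u] u n by (auto split: if_splits)
    then show ?thesis using sub[of n] rk_le[of _ n] unfolding n by (auto simp: less_Suc_eq_le split: if_splits)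
  qed
  define \<sigma> where "\<sigma> u = (SOME v. v \<in> E u \<inter> attr b X T & rk v < rk u)" for u
  have "\<sigma> u \<in> E u \<inter> attr b X T & rk (\<sigma> u) < rk u" if "u \<in> attr b X T - T" "own u = b" for u
    unfolding \<sigma>_def by (rule someI_ex) (use *[OF that(1)] that(2) in auto)
  then show ?thesis using * by (intro exI[of _ \<sigma>] exI[of _ rk]) (auto split: if_splits)
qed

text \<open>At a vertex of the opponent, finiteness of \<open>X\<close> is decisive: if all
  successors are attracted, their stages have a maximum, so the vertex itself is attracted after
  finitely many rounds.\<close>

lemma attr_compl:
  assumes "finite X" "u \<in> X" "u \<notin> attr b X T"
  shows "if own u = b then E u \<inter> attr b X T = {} else ~ E u \<inter> X \<subseteq> attr b X T"
proof (cases "own u = b")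
  case True
  have "v \<notin> attrn b X T n" if "v \<in> E u" for v n
  proof
    assume "v \<in> attrn b X T n"
    then have "u \<in> attrn b X T (Suc n)" using assms(2) True that by auto
    then show False using assms(3) by (auto simp: attr_def simp del: attrn.simps)
  qed
  then show ?thesis using True by (auto simp: attr_def)
next
  case False
  have "EX n. E u \<inter> X \<subseteq> attrn b X T n" if "E u \<inter> X \<subseteq> attr b X T"
  proof -
    have fin: "finite (E u \<inter> X)" using assms(1) by simp
    have "\<forall>v\<in>E u \<inter> X. EX n. v \<in> attrn b X T n" using that by (auto simp: attr_def)
    then obtain g where g: "\<forall>v\<in>E u \<inter> X. v \<in> attrn b X T (g v)" by metis
    have "v \<in> attrn b X T (Max (g ` (E u \<inter> X)))" if "v \<in> E u \<inter> X" for v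
    proof -
      have "g v <= Max (g ` (E u \<inter> X))" using fin that by (intro Max_ge) auto
      then show ?thesis using g that attrn_mono[of "g v"] by blast
    qed
    then show ?thesis by blast
  qed
  moreover have "u \<in> attr b X T" if "E u \<inter> X \<subseteq> attrn b X T n" for n
  proof -
    have "u \<in> attrn b X T (Suc n)" using False assms(2) that by simp
    then show ?thesis unfolding attr_def by blast
  qed
  ultimately show ?thesis using assms(3) False by metis
qed

lemma attr_reach:
  assumes st: "\<forall>u\<in>Y - T. if own u = b then \<sigma> u \<in> E u \<inter> Y & rk (\<sigma> u) < (rk u :: nat)
     else \<forall>v\<in>E u \<inter> X. v \<in> Y & rk v < rk u"
    and \<rho>: "!!n. \<rho> n \<in> X & \<rho> (Suc n) \<in> E (\<rho> n)" "!!n. \<rho> n \<in> Y - T ==> own (\<rho> n) = b ==> \<rho> (Suc n) = \<sigma> (\<rho> n)"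
  shows "\<rho> i \<in> Y ==> EX j>=i. \<rho> j \<in> T"
proof (induction "rk (\<rho> i)" arbitrary: i rule: less_induct)
  case less
  show ?case
  proof (cases "\<rho> i \<in> T")
    case False
    then have "\<rho> (Suc i) \<in> Y & rk (\<rho> (Suc i)) < rk (\<rho> i)"
      using bspec[OF st, of "\<rho> i"] less.prems \<rho>(1)[of i] \<rho>(1)[of "Suc i"] \<rho>(2)[of i] by (auto split: if_splits)
    then show ?thesis using less.hyps[of "Suc i"] Suc_leD by blast
  qed auto
qed

lemma conform_suffix:
  assumes "!!n. n >= i ==> \<rho> n \<in> W & \<rho> (Suc n) \<in> E (\<rho> n) & (own (\<rho> n) = b --> \<rho> (Suc n) = \<sigma> (\<rho> n))"
    and "wreg b X W \<sigma>"
  shows "even (Max (limit (pr \<circ> \<rho>))) = b"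
proof -
  have "conform b W \<sigma> (suffix i \<rho>)" using assms(1) by (simp add: conform_def)
  then have "even (Max (limit (pr \<circ> suffix i \<rho>))) = b" using assms(2) unfolding wreg_def by blast
  moreover have "pr \<circ> suffix i \<rho> = suffix i (pr \<circ> \<rho>)" by (auto simp: suffix_def)
  ultimately show ?thesis by simp
qed

text \<open>Zielonka's recursion. Let \<open>d\<close> be the largest priority and \<open>b\<close>
  its parity, and remove the attractor of \<open>b\<close> to the vertices of priority
  \<open>d\<close>. If the opponent wins nothing in the rest, \<open>b\<close> wins everywhere:
  either \<open>d\<close> recurs, or the play finally stays in the rest. Otherwise the opponent's
  winning region there, together with its attractor, is split off and the remainder is solved by
  recursion.\<close>

theorem parity_determined:
  assumes "finite X" "!!u. u \<in> X ==> E u \<inter> X ~= {}"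
  shows "\<exists>W \<sigma> W' \<sigma>'. W \<union> W' = X & wreg b X W \<sigma> & wreg (~ b) X W' \<sigma>'"
  using assms
proof (induction "card X" arbitrary: X b rule: less_induct)
  case less
  note fin = less.prems(1) and tot = less.prems(2)
  show ?case
  proof (cases "X = {}")
    case True
    then show ?thesis by (auto simp: wreg_def conform_def)
  next
    case False
    define d where "d = Max (pr ` X)"
    have main: "\<exists>W \<sigma> W' \<sigma>'. W \<union> W' = X & wreg b X W \<sigma> & wreg (~ b) X W' \<sigma>'" if b: "even d = b" for b
    proof -
      define D where "D = {u \<in> X. pr u = d}"
      have DX: "D \<subseteq> X" by (auto simp: D_def)
      have "d \<in> pr ` X" unfolding d_def by (rule Max_in) (use fin False in auto)
      then have D0: "D ~= {}" by (auto simp: D_def)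
      define Y where "Y = attr b X D"
      define X1 where "X1 = X - Y"
      note YX = attr_sub[OF DX, of b, folded Y_def] and DY = attr_super[of D b X, folded Y_def]
      have trap1: "if own u = b then E u \<inter> X \<subseteq> X1 else E u \<inter> X1 ~= {}" if "u \<in> X1" for u
        using attr_compl[OF fin, of u b D] that unfolding X1_def Y_def by (auto split: if_splits)
      have "card X1 < card X" using fin D0 DY DX by (intro psubset_card_mono) (auto simp: X1_def)
      moreover have "E u \<inter> X1 ~= {}" if "u \<in> X1" for u
        using trap1[OF that] tot[of u] that by (auto simp: X1_def split: if_splits)
      moreover have "finite X1" using fin by (simp add: X1_def)
      ultimately obtain W1 \<sigma>1 V1 \<tau>1 where ih1: "W1 \<union> V1 = X1" "wreg b X1 W1 \<sigma>1" "wreg (~ b) X1 V1 \<tau>1"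
        using less.hyps[of X1 b] by blast
      show ?thesis
      proof (cases "V1 = {}")
        case True
        obtain \<sigma>A rk where A: "\<forall>u\<in>Y - D. if own u = b then \<sigma>A u \<in> E u \<inter> Y & rk (\<sigma>A u) < (rk u :: nat)
            else \<forall>v\<in>E u \<inter> X. v \<in> Y & rk v < rk u"
          using attr_strategy[of b X D] unfolding Y_def by blast
        define \<sigma> where "\<sigma> u = (if u \<in> D then SOME v. v \<in> E u \<inter> X else if u \<in> Y then \<sigma>A u else \<sigma>1 u)" for u
        have W1: "W1 = X1" using True ih1 by auto
        have "\<sigma> u \<in> E u \<inter> X" if uX: "u \<in> X" and "own u = b" for u
        proof -
          consider "u \<in> D" | "u \<in> Y - D" | "u \<in> X1" "u \<notin> D" "u \<notin> Y" using uX DY by (auto simp: X1_def)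
          then show ?thesis
          proof cases
            case 1
            then show ?thesis unfolding \<sigma>_def using some_in_eq[of "E u \<inter> X"] tot[OF uX] by auto
          next
            case 2
            then show ?thesis using bspec[OF A 2] that YX by (auto simp: \<sigma>_def)
          next
            case 3
            then have "\<sigma>1 u \<in> E u \<inter> X1" using ih1(2) W1 that unfolding wreg_def by (metis (full_types))
            then show ?thesis using 3 by (auto simp: \<sigma>_def X1_def)
          qed
        qed
        moreover have "even (Max (limit (pr \<circ> \<rho>))) = b" if \<rho>: "conform b X \<sigma> \<rho>" for \<rho>
        proof (cases "INFM n. \<rho> n \<in> Y")
          case inf: True
          have "EX j>=i. \<rho> j \<in> D" for i
          proof -
            obtain j where j: "j >= i" "\<rho> j \<in> Y" using inf by (auto simp: INFM_nat_le)
            have "EX l>=j. \<rho> l \<in> D"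
              by (rule attr_reach[of Y D b \<sigma>A rk X \<rho>, OF A _ _ j(2)]) (use \<rho> in \<open>auto simp: conform_def \<sigma>_def\<close>)
            then show ?thesis using j(1) le_trans by blast
          qed
          then have "INFM n. (pr \<circ> \<rho>) n = d" unfolding INFM_nat_le D_def by fastforce
          moreover have "(pr \<circ> \<rho>) n <= d" for n using \<rho> fin by (auto simp: conform_def d_def)
          ultimately show ?thesis using limit_Max_eq[of "pr \<circ> \<rho>" d] b by simp
        next
          case False
          then obtain i where i: "!!n. n >= i ==> \<rho> n \<notin> Y" by (auto simp: INFM_nat_le)
          show ?thesis
            by (rule conform_suffix[OF _ ih1(2), of i])
              (use \<rho> i W1 DY in \<open>auto simp: conform_def X1_def \<sigma>_def\<close>)
        qed
        ultimately have "wreg b X X \<sigma>" by (simp add: wreg_def)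
        moreover have "wreg (~ b) X {} \<sigma>" by (simp add: wreg_def conform_def)
        ultimately show ?thesis by blast
      next
        case V1: False
        have V1X: "V1 \<subseteq> X" using ih1 by (auto simp: X1_def)
        define Z where "Z = attr (~ b) X V1"
        define X2 where "X2 = X - Z"
        note ZX = attr_sub[OF V1X, of "~ b", folded Z_def] and VZ = attr_super[of V1 "~ b" X, folded Z_def]
        have trap2: "if own u = b then E u \<inter> X2 ~= {} else E u \<inter> X \<subseteq> X2" if "u \<in> X2" for u
          using attr_compl[OF fin, of u "~ b" V1] that unfolding X2_def Z_def by (auto split: if_splits)
        have "card X2 < card X" using fin V1 VZ V1X by (intro psubset_card_mono) (auto simp: X2_def)
        moreover have "E u \<inter> X2 ~= {}" if "u \<in> X2" for u
          using trap2[OF that] tot[of u] that by (auto simp: X2_def split: if_splits)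
        moreover have "finite X2" using fin by (simp add: X2_def)
        ultimately obtain W2 \<sigma>2 V2 \<tau>2 where ih2: "W2 \<union> V2 = X2" "wreg b X2 W2 \<sigma>2" "wreg (~ b) X2 V2 \<tau>2"
          using less.hyps[of X2 b] by blast
        \<comment> \<open>\<open>X2\<close> is the complement of an attractor of the opponent, so
          the opponent cannot leave it; a region of \<open>b\<close> in \<open>X2\<close> is
          therefore a region of \<open>b\<close> in \<open>X\<close>.\<close>
        have "wreg b X W2 \<sigma>2"
        proof -
          have "E u \<inter> X \<subseteq> W2" if "u \<in> W2" "own u ~= b" for u
          proof -
            have "u \<in> X2" using that ih2 by auto
            then have "E u \<inter> X \<subseteq> X2" using trap2[of u] that by auto
            moreover have "E u \<inter> X2 \<subseteq> W2" using ih2(2) that unfolding wreg_def by metis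
            ultimately show ?thesis by auto
          qed
          then show ?thesis using ih2(2) unfolding wreg_def X2_def by auto
        qed
        moreover
        obtain \<tau>A rk where A: "\<forall>u\<in>Z - V1. if own u = (~ b) then \<tau>A u \<in> E u \<inter> Z & rk (\<tau>A u) < (rk u :: nat)
            else \<forall>v\<in>E u \<inter> X. v \<in> Z & rk v < rk u"
          using attr_strategy[of "~ b" X V1] unfolding Z_def by blast
        define \<tau> where "\<tau> u = (if u \<in> V1 then \<tau>1 u else if u \<in> Z then \<tau>A u else \<tau>2 u)" for u
        have closed1: "if own u = (~ b) then \<tau> u \<in> E u \<inter> V1 else E u \<inter> X \<subseteq> V1" if "u \<in> V1" for u
        proof -
          have u: "u \<in> X1" using that ih1 by auto
          have "if own u = (~ b) then \<tau>1 u \<in> E u \<inter> V1 else E u \<inter> X1 \<subseteq> V1"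
            using ih1(3) that unfolding wreg_def by blast
          then show ?thesis using trap1[OF u] that by (auto simp: \<tau>_def split: if_splits)
        qed
        have "wreg (~ b) X (Z \<union> V2) \<tau>"
        proof -
          have "if own u = (~ b) then \<tau> u \<in> E u \<inter> (Z \<union> V2) else E u \<inter> X \<subseteq> Z \<union> V2" if u: "u \<in> Z \<union> V2" for u
          proof -
            consider "u \<in> V1" | "u \<in> Z - V1" | "u \<in> V2" "u \<notin> Z" "u \<notin> V1" using u VZ by auto
            then show ?thesis
            proof cases
              case 1
              then show ?thesis using closed1[OF 1] VZ by (auto split: if_splits)
            next
              case 2
              then show ?thesis using bspec[OF A 2] by (auto simp: \<tau>_def split: if_splits)
            next
              case 3
              have "if own u = (~ b) then \<tau>2 u \<in> E u \<inter> V2 else E u \<inter> X2 \<subseteq> V2"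
                using ih2(3) 3 unfolding wreg_def by blast
              then show ?thesis using 3 by (auto simp: \<tau>_def X2_def split: if_splits)
            qed
          qed
          moreover have "even (Max (limit (pr \<circ> \<rho>))) = (~ b)" if \<rho>: "conform (~ b) (Z \<union> V2) \<tau> \<rho>" for \<rho>
          proof (cases "EX i. \<rho> i \<in> Z")
            case True
            then obtain i where "\<rho> i \<in> Z" by blast
            have sub: "Z \<union> V2 \<subseteq> X" using ZX ih2 by (auto simp: X2_def)
            have "EX j>=i. \<rho> j \<in> V1"
              by (rule attr_reach[of Z V1 "~ b" \<tau>A rk X \<rho>, OF A _ _ \<open>\<rho> i \<in> Z\<close>]) (use \<rho> sub in \<open>auto simp: conform_def \<tau>_def\<close>)
            then obtain j where j: "\<rho> j \<in> V1" by blast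
            have "\<rho> n \<in> V1" if "n >= j" for n using that
            proof (induction n rule: dec_induct)
              case (step n)
              have "\<rho> (Suc n) \<in> E (\<rho> n) \<inter> X" "own (\<rho> n) = (~ b) --> \<rho> (Suc n) = \<tau> (\<rho> n)"
                using \<rho> sub by (auto simp: conform_def)
              then show ?case using closed1[OF step.IH] by (auto split: if_splits)
            qed (rule j)
            then show ?thesis
              by (intro conform_suffix[OF _ ih1(3), of j]) (use \<rho> in \<open>auto simp: conform_def \<tau>_def\<close>)
          next
            case False
            then show ?thesis
              by (intro conform_suffix[OF _ ih2(3), of 0]) (use \<rho> VZ in \<open>auto simp: conform_def \<tau>_def\<close>)
          qed
          moreover have "Z \<union> V2 \<subseteq> X" using ZX ih2 by (auto simp: X2_def)
          ultimately show ?thesis unfolding wreg_def by blast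
        qed
        moreover have "W2 \<union> (Z \<union> V2) = X" using ih2(1) ZX by (auto simp: X2_def)
        ultimately show ?thesis by blast
      qed
    qed
    show ?thesis
    proof (cases "even d = b")
      case True
      then show ?thesis by (rule main)
    next
      case False
      then have "even d = (~ b)" by blast
      from main[OF this] show ?thesis by (metis Un_commute)
    qed
  qed
qed

end

section \<open>Streett conditions and bounded counters\<close>

context
  fixes k :: nat and red green :: "nat => 'u => bool"
begin

definition streett :: "(nat => 'u) => bool" where
  "streett \<rho> <-> (\<forall>r<k. (INFM n. red r (\<rho> n)) --> (INFM n. green r (\<rho> n)))"

text \<open>
  The memory \<open>m r\<close> is the set of pairs that have turned green since \<open>r\<close> did. This is the index
  appearance record, stored without the order that it induces on the pairs.
\<close>

definition upm :: "(nat => nat set) => 'u => nat => nat set" where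
  "upm m u r = (if r < k & ~ green r u then m r \<union> {s. s < k & green s u} else {})"

text \<open>The size of \<open>m r\<close> is the place of \<open>r\<close> in the record. Events at
  later places dominate, and at equal places a green event (even) outranks a red one (odd). The 0 is
  the priority of a state without any event.\<close>

definition prios :: "(nat => nat set) => 'u => nat set" where
  "prios m u = {0} \<union> (%r. 2 * card (m r) + 2) ` {r. r < k & green r u} \<union>
     (%r. 2 * card (m r) + 1) ` {r. r < k & red r u}"

definition mems :: "(nat => nat set) set" where
  "mems = {m. ALL r s. s \<in> m r --> r < k & s < k}"

lemma upm_mems: "m \<in> mems ==> upm m u \<in> mems"
  by (simp add: mems_def upm_def)

lemma finite_prios: "finite (prios m u)" "prios m u ~= {}"
  by (auto simp: prios_def)

lemma mems_card: "finite mems" "card mems <= 2 ^ (k * k)"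
proof -
  let ?F = "%m. {(r, s). s \<in> m r}"
  have sub: "?F ` mems \<subseteq> Pow ({..<k} \<times> {..<k})"
    by (auto simp: mems_def)
  have inj: "inj_on ?F mems"
  proof (rule inj_onI)
    fix m m' assume "?F m = ?F m'"
    then have "!!r s. s \<in> m r <-> s \<in> m' r" by blast
    then show "m = m'" by blast
  qed
  have fin: "finite (Pow ({..<k} \<times> {..<k}))" by simp
  show "finite mems" using inj_on_finite[OF inj sub fin] .
  have "card mems <= card (Pow ({..<k} \<times> {..<k}))" by (rule card_inj_on_le[OF inj sub fin])
  then show "card mems <= 2 ^ (k * k)" by (simp add: card_Pow)
qed

context
  fixes m :: "nat => nat => nat set" and \<rho> :: "nat => 'u"
  assumes m0: "m 0 \<in> mems" and mS: "!!n. m (Suc n) = upm (m n) (\<rho> n)"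
begin

lemma m_mems: "m n \<in> mems"
  by (induction n) (simp_all add: m0 mS upm_mems)

lemma m_sub: "m n r \<subseteq> {..<k}"
  using m_mems[of n] by (auto simp: mems_def)

lemma finite_m: "finite (m n r)"
  using m_sub finite_subset by blast

lemma m_grow:
  assumes "i <= j" "r < k" "!!n. i <= n ==> n < j ==> ~ green r (\<rho> n)"
  shows "m i r \<subseteq> m j r"
  using assms
proof (induction j rule: dec_induct)
  case (step j)
  then show ?case by (auto simp: mS upm_def)
qed simp

lemma iar_bound: "Max (prios (m n) (\<rho> n)) <= 2 * k + 2"
proof -
  have "card (m n r) <= k" for r using card_mono[OF _ m_sub[of n r]] by simp
  then have "\<forall>x\<in>prios (m n) (\<rho> n). x <= 2 * k + 2" by (auto simp: prios_def intro: le_SucI)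
  then show ?thesis using finite_prios by simp
qed

lemma iar_finite: "finite (range (%n. Max (prios (m n) (\<rho> n))))"
proof -
  have "range (%n. Max (prios (m n) (\<rho> n))) \<subseteq> {..2 * k + 2}" using iar_bound by auto
  then show ?thesis using finite_subset by blast
qed

lemma iar_Max_ge:
  assumes "!!i. EX n>=i. d <= Max (prios (m n) (\<rho> n))"
  shows "d <= Max (limit (%n. Max (prios (m n) (\<rho> n))))"
proof -
  let ?f = "%n. Max (prios (m n) (\<rho> n))"
  note lim = limit_finite_props[OF iar_finite]
  obtain i where i: "limit ?f = range (suffix i ?f)"
    using limit_is_suffix[OF iar_finite] by blast
  obtain n where n: "n >= i" "d <= ?f n" using assms by blast
  have "?f n \<in> limit ?f" unfolding i using n(1) by (intro image_eqI[of _ _ "n - i"]) auto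
  then show ?thesis using n(2) lim(2) Max_ge le_trans by blast
qed

text \<open>If the maximum were odd, say \<open>2 * e + 1\<close>, some pair would be red infinitely
  often with a record of size \<open>e\<close>. Its record only grows until its next green event,
  which therefore has priority at least \<open>2 * e + 2\<close>.\<close>

lemma iar_even:
  assumes st: "streett \<rho>"
  shows "even (Max (limit (%n. Max (prios (m n) (\<rho> n)))))"
proof (rule ccontr)
  let ?f = "%n. Max (prios (m n) (\<rho> n))"
  let ?M = "Max (limit ?f)"
  assume odd: "odd ?M"
  then obtain e where e: "?M = 2 * e + 1" by (rule oddE)
  note lim = limit_finite_props[OF iar_finite]
  have "?M \<in> limit ?f" using lim by (intro Max_in)
  then have inf: "INFM n. ?f n = 2 * e + 1" using e by (simp add: limit_def)
  have ex: "EX r. r < k & red r (\<rho> n) & card (m n r) = e" if "?f n = 2 * e + 1" for n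
  proof -
    have "2 * e + 1 \<in> prios (m n) (\<rho> n)" using Max_in[OF finite_prios, of "m n" "\<rho> n"] that by simp
    then show ?thesis unfolding prios_def by (auto, presburger)
  qed
  have "INFM n. \<exists>r\<in>{..<k}. red r (\<rho> n) & card (m n r) = e"
    by (rule INFM_mono[OF inf]) (use ex in blast)
  then obtain r where r: "r < k" "INFM n. red r (\<rho> n) & card (m n r) = e"
    by (auto simp: INFM_finite_Bex_distrib)
  then have "INFM n. red r (\<rho> n)" by (auto elim: INFM_mono)
  then have gr: "INFM n. green r (\<rho> n)" using st r(1) by (simp add: streett_def)
  have "EX n>=i. 2 * e + 2 <= ?f n" for i
  proof -
    obtain t where t: "t >= i" "card (m t r) = e" using r(2) by (auto simp: INFM_nat_le)
    obtain t' where t': "t' >= t" "green r (\<rho> t')" using gr by (auto simp: INFM_nat_le)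
    define g where "g = (LEAST n. n >= t & green r (\<rho> n))"
    have g: "g >= t" "green r (\<rho> g)"
      using LeastI[of "%n. n >= t & green r (\<rho> n)" t'] t' unfolding g_def by auto
    have "~ green r (\<rho> n)" if "t <= n" "n < g" for n
      using not_less_Least[of n "%n. n >= t & green r (\<rho> n)"] that unfolding g_def by blast
    then have "m t r \<subseteq> m g r" using m_grow[OF g(1) r(1)] by blast
    then have "e <= card (m g r)" using t(2) card_mono[OF finite_m] by blast
    moreover have "2 * card (m g r) + 2 \<in> prios (m g) (\<rho> g)" using g(2) r(1) by (simp add: prios_def)
    then have "2 * card (m g r) + 2 <= ?f g" using finite_prios by (intro Max_ge)
    ultimately show ?thesis using g(1) t(1) by (intro exI[of _ g]) linarith
  qed
  from iar_Max_ge[OF this] e show False by simp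
qed

text \<open>Suppose \<open>r\<close> is red infinitely often but finally never green. Its record
  comes to include the set \<open>I\<close> of all pairs that are green infinitely often, so
  priority \<open>2 * card I + 1\<close> or more recurs. A member of \<open>I\<close> is missing
  from its own record, which stays inside \<open>I\<close>, so its green events reach at most
  \<open>2 * card I\<close>.\<close>

lemma iar_streett:
  assumes even: "even (Max (limit (%n. Max (prios (m n) (\<rho> n)))))"
  shows "streett \<rho>"
  unfolding streett_def
proof (intro allI impI, rule ccontr)
  let ?f = "%n. Max (prios (m n) (\<rho> n))"
  let ?M = "Max (limit ?f)"
  fix r assume r: "r < k" "INFM n. red r (\<rho> n)" "~ (INFM n. green r (\<rho> n))"
  define I where "I = {s. s < k & (INFM n. green s (\<rho> n))}"
  have finI: "finite I" by (simp add: I_def)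
  have "\<forall>s\<in>{..<k} - I. EX b. ALL n>=b. ~ green s (\<rho> n)" by (auto simp: I_def INFM_nat_le)
  then obtain b where b: "!!s n. s \<in> {..<k} - I ==> b s <= n ==> ~ green s (\<rho> n)" by metis
  define b0 where "b0 = Max (b ` ({..<k} - I))"
  have b0: "s \<in> I" if "green s (\<rho> n)" "s < k" "b0 <= n" for s n
  proof (rule ccontr)
    assume "s \<notin> I"
    then have "b s <= b0" unfolding b0_def using that by (intro Max_ge) auto
    then show False using b[of s n] that \<open>s \<notin> I\<close> by auto
  qed
  have rI: "r \<notin> I" using r by (simp add: I_def)
  have ng: "~ green r (\<rho> n)" if "b0 <= n" for n using b0 rI r(1) that by blast
  have "\<forall>s\<in>I. EX g>=b0. green s (\<rho> g)" by (auto simp: I_def INFM_nat_le)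
  then obtain g where g: "!!s. s \<in> I ==> b0 <= g s & green s (\<rho> (g s))" by metis
  define b1 where "b1 = Max (insert b0 ((%s. Suc (g s)) ` I))"
  have b01: "b0 <= b1" and gb1: "!!s. s \<in> I ==> Suc (g s) <= b1"
    unfolding b1_def using finI by (intro Max_ge; auto)+
  have Ir: "I \<subseteq> m n r" if "b1 <= n" for n
  proof
    fix s assume s: "s \<in> I"
    have "s \<in> m (Suc (g s)) r"
      using g[OF s] s ng[of "g s"] r(1) by (auto simp: mS upm_def I_def)
    also have "m (Suc (g s)) r \<subseteq> m n r"
      by (rule m_grow) (use g[OF s] gb1[OF s] that r(1) ng in auto)
    finally show "s \<in> m n r" .
  qed
  have Is: "m n s \<subseteq> I - {s}" if "s \<in> I" "b1 <= n" for n s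
  proof -
    have "m n s \<subseteq> I - {s}" if "Suc (g s) <= n" for n using that
    proof (induction n rule: dec_induct)
      case base
      then show ?case using g[OF \<open>s \<in> I\<close>] by (simp add: mS upm_def)
    next
      case (step n)
      then have "b0 <= n" using g[OF \<open>s \<in> I\<close>] by auto
      then show ?case using step.IH b0[of _ n] by (auto simp: mS upm_def split: if_splits)
    qed
    then show ?thesis using gb1[OF that(1)] that(2) by auto
  qed
  have "EX n>=i. 2 * card I + 1 <= ?f n" for i
  proof -
    obtain n where n: "n >= max i b1" "red r (\<rho> n)" using r(2) unfolding INFM_nat_le by blast
    have "card I <= card (m n r)" using card_mono[OF finite_m Ir] n by simp
    moreover have "2 * card (m n r) + 1 <= ?f n"
      by (intro Max_ge finite_prios) (use n r(1) in \<open>simp add: prios_def\<close>)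
    ultimately show ?thesis using n(1) by (intro exI[of _ n]) linarith
  qed
  from iar_Max_ge[OF this] have ge: "2 * card I + 1 <= ?M" .
  have "?M \<in> limit ?f" using limit_finite_props[OF iar_finite] by (intro Max_in)
  then have "INFM n. ?f n = ?M" by (simp add: limit_def)
  then obtain n where n: "n >= b1" "?f n = ?M" by (auto simp: INFM_nat_le)
  have "?M \<in> prios (m n) (\<rho> n)" using Max_in[OF finite_prios, of "m n" "\<rho> n"] n(2) by simp
  then obtain s where s: "s < k" "green s (\<rho> n)" "?M = 2 * card (m n s) + 2"
    using even ge unfolding prios_def by auto
  have "s \<in> I" using b0 s n b01 by auto
  then have "card (m n s) <= card (I - {s})" using Is n finI by (intro card_mono) auto
  also have "\<dots> = card I - 1" using \<open>s \<in> I\<close> finI by simp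
  finally have "card (m n s) <= card I - 1" .
  moreover have "card I ~= 0" using \<open>s \<in> I\<close> finI by auto
  ultimately show False using s(3) ge by linarith
qed

end

definition upc :: "nat list => 'u => nat list" where
  "upc c u = map (%r. if green r u then 0 else if red r u then Suc (c ! r) else c ! r) [0..<k]"

definition counts :: "nat => nat list set" where
  "counts K = {c. length c = k & set c \<subseteq> {..K}}"

definition bsafe :: "'u set => ('u => 'a set) => ('u => 'a => 'u set) => nat => ('u \<times> nat list) set => bool" where
  "bsafe U A R K W <-> W \<subseteq> U \<times> counts K & (\<forall>(u, c)\<in>W. \<forall>a\<in>A u. \<exists>u'\<in>R u a. (u', upc c u') \<in> W)"

lemma length_upc [simp]: "length (upc c u) = k" and nth_upc: "r < k ==>
    upc c u ! r = (if green r u then 0 else if red r u then Suc (c ! r) else c ! r)"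
  by (simp_all add: upc_def)

primrec cnt :: "nat list => (nat => 'u) => nat => nat list" where
  "cnt c \<rho> 0 = c"
| "cnt c \<rho> (Suc n) = upc (cnt c \<rho> n) (\<rho> (Suc n))"

lemma bounded_streett:
  assumes "!!n. cnt c \<rho> n \<in> counts K"
  shows "streett \<rho>"
  unfolding streett_def
proof (intro allI impI, rule ccontr)
  fix r assume r: "r < k" "INFM n. red r (\<rho> n)" "~ (INFM n. green r (\<rho> n))"
  then obtain b where b: "!!n. b <= n ==> ~ green r (\<rho> n)" by (auto simp: INFM_nat_le)
  have "EX n>=b. j <= cnt c \<rho> n ! r" for j
  proof (induction j)
    case (Suc j)
    then obtain n where n: "n >= b" "j <= cnt c \<rho> n ! r" by blast
    have mono: "j <= cnt c \<rho> n' ! r" if "n <= n'" for n' using that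
    proof (induction n' rule: dec_induct)
      case (step i)
      then show ?case using b[of "Suc i"] n(1) r(1) by (auto simp: nth_upc)
    qed (rule n(2))
    obtain n' where n': "n' >= Suc n" "red r (\<rho> n')" using r(2) unfolding INFM_nat_le by blast
    then obtain i where i: "n' = Suc i" "n <= i" by (cases n') auto
    have "Suc j <= cnt c \<rho> n' ! r"
      using mono[OF i(2)] b[of n'] n' n(1) i r(1) by (auto simp: nth_upc)
    then show ?case using n n' by (intro exI[of _ n']) linarith
  qed auto
  then obtain n where "Suc K <= cnt c \<rho> n ! r" by blast
  moreover have "set (cnt c \<rho> n) \<subseteq> {..K}" "length (cnt c \<rho> n) = k"
    using assms[of n] by (simp_all add: counts_def)
  then have "cnt c \<rho> n ! r \<in> {..K}" using r(1) nth_mem[of r "cnt c \<rho> n"] by (metis subsetD)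
  ultimately show False by simp
qed

text \<open>Each unit of a counter is a red event since the last green one. More such events than
  elements of \<open>S\<close> must hit some element twice, with no green event in between.\<close>

lemma cnt_pigeon:
  assumes "r < k" and fin: "finite S" and s: "!!t. s t \<in> S" and big: "card S < cnt (replicate k 0) \<rho> n ! r"
  shows "EX i j. i < j & j <= n & s i = s j & red r (\<rho> i) & (ALL t. i <= t & t <= j --> ~ green r (\<rho> t))"
proof -
  have "EX z T. T \<subseteq> {z..n} & (\<forall>t\<in>T. red r (\<rho> t)) & (ALL t. z <= t & t <= n --> ~ green r (\<rho> t)) &
      card T = cnt (replicate k 0) \<rho> n ! r"
  proof (induction n)
    case 0
    then show ?case using assms(1) by (intro exI[of _ 1] exI[of _ "{}"]) auto
  next
    case (Suc n)
    then obtain z T where zT: "T \<subseteq> {z..n}" "\<forall>t\<in>T. red r (\<rho> t)" "!!t. z <= t & t <= n ==> ~ green r (\<rho> t)"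
      "card T = cnt (replicate k 0) \<rho> n ! r" by blast
    have "finite T" using zT(1) finite_subset by blast
    consider "green r (\<rho> (Suc n))" | "~ green r (\<rho> (Suc n))" "red r (\<rho> (Suc n))"
      | "~ green r (\<rho> (Suc n))" "~ red r (\<rho> (Suc n))" by blast
    then show ?case
    proof cases
      case 1
      then show ?thesis using assms(1) by (intro exI[of _ "Suc (Suc n)"] exI[of _ "{}"]) (auto simp: nth_upc)
    next
      case 2
      let ?z = "min z (Suc n)"
      have "insert (Suc n) T \<subseteq> {?z..Suc n}" using zT(1) by auto
      moreover have "~ green r (\<rho> t)" if "?z <= t & t <= Suc n" for t
        using zT(3)[of t] that 2 by (cases "t = Suc n") (auto simp: min_def split: if_splits)
      moreover have "Suc n \<notin> T" using zT(1) by auto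
      then have "card (insert (Suc n) T) = cnt (replicate k 0) \<rho> (Suc n) ! r"
        using zT(4) 2 assms(1) \<open>finite T\<close> by (simp add: nth_upc)
      ultimately show ?thesis using zT(2) 2 by (intro exI[of _ ?z] exI[of _ "insert (Suc n) T"]) auto
    next
      case 3
      have "~ green r (\<rho> t)" if "z <= t & t <= Suc n" for t
        using zT(3)[of t] that 3 by (cases "t = Suc n") auto
      moreover have "T \<subseteq> {z..Suc n}" using zT(1) by auto
      ultimately show ?thesis using zT(2,4) 3 assms(1)
        by (intro exI[of _ z] exI[of _ T]) (auto simp: nth_upc)
    qed
  qed
  then obtain z T where zT: "T \<subseteq> {z..n}" "\<forall>t\<in>T. red r (\<rho> t)" "ALL t. z <= t & t <= n --> ~ green r (\<rho> t)"
    "card T = cnt (replicate k 0) \<rho> n ! r" by blast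
  have "~ inj_on s T"
  proof
    assume "inj_on s T"
    then have "card T <= card S" by (rule card_inj_on_le) (use s fin in auto)
    then show False using big zT(4) by linarith
  qed
  then obtain i j where ij: "i \<in> T" "j \<in> T" "s i = s j" "i ~= j" by (auto simp: inj_on_def)
  have "EX i j. i \<in> T & j \<in> T & s i = s j & i < j"
    using ij by (metis linorder_neqE_nat)
  then show ?thesis using zT by (meson atLeastAtMost_iff le_trans subsetD)
qed


type_synonym ('s, 'b) pvert = "(('s \<times> (nat => nat set)) \<times> 'b option) option"

context
  fixes U :: "'u set" and A :: "'u => 'a set" and R :: "'u => 'a => 'u set"
  assumes fin: "finite U" "!!u. u \<in> U ==> finite (A u)" and A0: "!!u. u \<in> U ==> A u ~= {}"
    and RU: "!!u a. u \<in> U ==> a \<in> A u ==> R u a \<subseteq> U"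
begin

text \<open>\<open>None\<close> is a sink that Prover loses; it makes the graph total.\<close>

definition pE :: "('u, 'a) pvert => ('u, 'a) pvert set" where
  "pE x = (case x of None => {None}
     | Some ((u, m), None) => {Some ((u, m), Some a) | a. a \<in> A u}
     | Some ((u, m), Some a) => insert None {Some ((u', upm m u), None) | u'. u' \<in> R u a})"

definition pown :: "('u, 'a) pvert => bool" where
  "pown x = (case x of None => True | Some (_, None) => False | Some (_, Some _) => True)"

definition ppr :: "('u, 'a) pvert => nat" where
  "ppr x = (case x of None => 1 | Some ((u, m), _) => Max (prios m u))"

definition pX :: "('u, 'a) pvert set" where
  "pX = insert None (Some ` (SIGMA (u, m) : U \<times> mems. insert None (Some ` A u)))"

lemma pX_simps: "None \<in> pX" "Some ((u, m), None) \<in> pX <-> u \<in> U & m \<in> mems"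
  "Some ((u, m), Some a) \<in> pX <-> u \<in> U & m \<in> mems & a \<in> A u"
  by (auto simp: pX_def)

lemma pX_finite: "finite pX"
  unfolding pX_def using fin mems_card(1)
  by (intro finite.insertI finite_imageI finite_SigmaI) auto

lemma pX_total: "x \<in> pX ==> pE x \<inter> pX ~= {}"
proof (cases x)
  case (Some y)
  obtain u m a where y: "y = ((u, m), a)" by (metis prod.exhaust)
  assume "x \<in> pX"
  then show ?thesis using A0[of u] Some y by (cases a) (auto simp: pX_simps pE_def)
qed (auto simp: pE_def pX_def)

lemma limit_double: "limit (%n. f (n div 2)) = limit f"
proof -
  have "(INFM n. f (n div 2) = x) <-> (INFM n. f n = x)" for x
  proof
    assume "INFM n. f (n div 2) = x"
    then have "EX n>=i. f n = x" for i
      unfolding INFM_nat_le by (metis div_le_mono nonzero_mult_div_cancel_left zero_neq_numeral)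
    then show "INFM n. f n = x" by (simp add: INFM_nat_le)
  next
    assume *: "INFM n. f n = x"
    have "EX n>=i. f (n div 2) = x" for i
    proof -
      obtain n where "n >= i" "f n = x" using * by (auto simp: INFM_nat_le)
      then show ?thesis by (intro exI[of _ "2 * n"]) simp
    qed
    then show "INFM n. f (n div 2) = x" by (simp add: INFM_nat_le)
  qed
  then show ?thesis by (simp add: limit_def)
qed

lemma double_Max:
  "Max (limit (ppr \<circ> (%n. Some ((\<rho> (n div 2), m (n div 2)), if even n then None else Some (a (n div 2)))))) =
     Max (limit (%n. Max (prios (m n) (\<rho> n))))"
proof -
  have "ppr \<circ> (%n. Some ((\<rho> (n div 2), m (n div 2)), if even n then None else Some (a (n div 2)))) =
      (%n. (%n. Max (prios (m n) (\<rho> n))) (n div 2))"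
    by (auto simp: ppr_def)
  then show ?thesis using limit_double[of "%n. Max (prios (m n) (\<rho> n))"] by simp
qed

text \<open>The hypothesis \<open>win\<close> is weak: the winning play may depend on the whole
  strategy of Challenger, including its future. Determinacy turns it into a genuine strategy of
  Prover, since a positional winning strategy of Challenger from the start would contradict
  \<open>win\<close>. The bound \<open>K\<close> counts the states times the memories, the positions
  that a positional strategy can tell apart.\<close>

theorem bsafe_exists:
  assumes u0: "u0 \<in> U" and K: "card U * 2 ^ (k * k) <= K"
    and win: "!!\<tau>. (!!h u. u \<in> U ==> \<tau> (h @ [u]) \<in> A u) ==>
      \<exists>\<rho>. \<rho> 0 = u0 & (ALL n. \<rho> (Suc n) \<in> R (\<rho> n) (\<tau> (map \<rho> [0..<Suc n]))) & streett \<rho>"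
  shows "EX W. bsafe U A R K W & (u0, replicate k 0) \<in> W"
proof -
  define m0 :: "nat => nat set" where "m0 = (%_. {})"
  have m0: "m0 \<in> mems" by (simp add: m0_def mems_def)
  obtain W \<sigma> W' \<sigma>' where W: "W \<union> W' = pX" "wreg pE pown ppr True pX W \<sigma>" "wreg pE pown ppr (~ True) pX W' \<sigma>'"
    using parity_determined[where X = pX and E = pE and own = pown and pr = ppr and b = True, OF pX_finite pX_total] by blast
  have WX: "W \<subseteq> pX" "W' \<subseteq> pX" using W(1) by auto
  have st0: "Some ((u0, m0), None) \<in> pX" by (simp add: pX_simps u0 m0)
  define mem where "mem \<rho> n = rec_nat m0 (%n m. upm m (\<rho> n)) n" for \<rho> :: "nat => 'u" and n
  have mem: "mem \<rho> 0 = m0" "mem \<rho> (Suc n) = upm (mem \<rho> n) (\<rho> n)" for \<rho> n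
    by (simp_all add: mem_def)
  have "Some ((u0, m0), None) \<notin> W'"
  proof
    assume in0: "Some ((u0, m0), None) \<in> W'"
    define ml where "ml h = foldl upm m0 h" for h :: "'u list"
    have ml: "ml (map \<rho> [0..<n]) = mem \<rho> n" for \<rho> n
      by (induction n) (simp_all add: ml_def mem)
    define mv where "mv u m = (SOME a. a \<in> A u & (Some ((u, m), None) \<in> W' --> \<sigma>' (Some ((u, m), None)) = Some ((u, m), Some a)))" for u m
    have mv: "mv u m \<in> A u & (Some ((u, m), None) \<in> W' --> \<sigma>' (Some ((u, m), None)) = Some ((u, m), Some (mv u m)))"
      if "u \<in> U" for u m
      unfolding mv_def
    proof (rule someI_ex)
      show "EX a. a \<in> A u & (Some ((u, m), None) \<in> W' --> \<sigma>' (Some ((u, m), None)) = Some ((u, m), Some a))"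
      proof (cases "Some ((u, m), None) \<in> W'")
        case True
        then have "\<sigma>' (Some ((u, m), None)) \<in> pE (Some ((u, m), None))"
          using W(3) unfolding wreg_def pown_def by fastforce
        then show ?thesis by (auto simp: pE_def)
      qed (use A0[OF that] in auto)
    qed
    obtain \<rho> where \<rho>: "\<rho> 0 = u0" "!!n. \<rho> (Suc n) \<in> R (\<rho> n) (mv (\<rho> n) (mem \<rho> n))" "streett \<rho>"
      using win[of "%h. mv (last h) (ml (butlast h))"] mv by (auto simp: ml)
    have \<rho>U: "\<rho> n \<in> U" for n
    proof (induction n)
      case (Suc n)
      then show ?case using RU[OF Suc] mv[OF Suc] \<rho>(2)[of n] by blast
    qed (simp add: \<rho>(1) u0)
    let ?P = "%n. Some ((\<rho> (n div 2), mem \<rho> (n div 2)), if even n then None else Some (mv (\<rho> (n div 2)) (mem \<rho> (n div 2)))) :: ('u, 'a) pvert"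
    have edge: "?P (Suc n) \<in> pE (?P n) \<inter> pX & (~ pown (?P n) --> (?P n \<in> W' --> ?P (Suc n) = \<sigma>' (?P n)))" for n
      using \<rho>(2)[of "n div 2"] mv[OF \<rho>U, of "n div 2" "mem \<rho> (n div 2)"] \<rho>U m_mems[of "mem \<rho>" \<rho>] m0 mem upm_mems
      by (cases "even n") (auto simp: pE_def pown_def pX_simps elim!: evenE oddE)
    have "conform pE pown (~ True) W' \<sigma>' P" if edge: "!!n. P (Suc n) \<in> pE (P n) \<inter> pX &
        (~ pown (P n) --> P n \<in> W' --> P (Suc n) = \<sigma>' (P n))" and P0: "P 0 \<in> W'" for P
    proof -
      have "P n \<in> W'" for n
      proof (induction n)
        case (Suc n)
        have "if pown (P n) = (~ True) then \<sigma>' (P n) \<in> pE (P n) \<inter> W' else pE (P n) \<inter> pX \<subseteq> W'"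
          using W(3) Suc unfolding wreg_def by blast
        then show ?case using edge[of n] Suc by (cases "pown (P n)") auto
      qed (rule P0)
      then show ?thesis using edge unfolding conform_def by blast
    qed
    from this[of ?P, OF edge] have "conform pE pown (~ True) W' \<sigma>' ?P"
      using in0 \<rho>(1) by (simp add: mem)
    then have "even (Max (limit (ppr \<circ> ?P))) = (~ True)" using W(3) unfolding wreg_def by blast
    moreover have "even (Max (limit (%n. Max (prios (mem \<rho> n) (\<rho> n)))))"
      by (rule iar_even[where m = "mem \<rho>"]) (simp_all add: mem m0 \<rho>(3))
    ultimately show False using double_Max[of \<rho> "mem \<rho>" "%n. mv (\<rho> n) (mem \<rho> n)"] by simp
  qed
  then have inW: "Some ((u0, m0), None) \<in> W" using W(1) st0 by blast
  have None: "None \<notin> W"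
  proof
    assume "None \<in> W"
    moreover from this have "\<sigma> None \<in> pE None" using W(2) unfolding wreg_def pown_def by fastforce
    ultimately have "conform pE pown True W \<sigma> (%_. None)" by (simp add: conform_def pE_def)
    then have "even (Max (limit (ppr \<circ> (%_. None))))" using W(2) unfolding wreg_def by blast
    moreover have "limit (ppr \<circ> (%_. None)) = {1}" by (auto simp: ppr_def limit_def)
    ultimately show False by simp
  qed
  have W_chal: "Some ((u, m), Some a) \<in> W" if "Some ((u, m), None) \<in> W" "a \<in> A u" for u m a
  proof -
    have "pE (Some ((u, m), None)) \<inter> pX \<subseteq> W" using W(2) that(1) unfolding wreg_def pown_def by fastforce
    moreover have "Some ((u, m), Some a) \<in> pE (Some ((u, m), None)) \<inter> pX"
      using that WX(1) by (auto simp: pE_def pX_simps dest!: subsetD)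
    ultimately show ?thesis by blast
  qed
  have W_resp: "\<exists>u'\<in>R u a. \<sigma> (Some ((u, m), Some a)) = Some ((u', upm m u), None)"
    "\<sigma> (Some ((u, m), Some a)) \<in> pE (Some ((u, m), Some a)) \<inter> W"
    if "Some ((u, m), Some a) \<in> W" for u m a
  proof -
    show *: "\<sigma> (Some ((u, m), Some a)) \<in> pE (Some ((u, m), Some a)) \<inter> W"
      using W(2) that unfolding wreg_def pown_def by fastforce
    then show "\<exists>u'\<in>R u a. \<sigma> (Some ((u, m), Some a)) = Some ((u', upm m u), None)"
      using None by (auto simp: pE_def)
  qed
  define good where "good \<rho> n <-> \<rho> 0 = u0 & (ALL t<=n. Some ((\<rho> t, mem \<rho> t), None) \<in> W) &
    (\<forall>t<n. \<exists>a\<in>A (\<rho> t). \<sigma> (Some ((\<rho> t, mem \<rho> t), Some a)) = Some ((\<rho> (Suc t), mem \<rho> (Suc t)), None))" for \<rho> n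
  have good_in: "\<rho> t \<in> U" "mem \<rho> t \<in> mems" if "good \<rho> n" "t <= n" for \<rho> n t
    using that WX(1) unfolding good_def by (auto dest!: subsetD simp: pX_simps)
  have bound: "cnt (replicate k 0) \<rho> n ! r <= K" if g: "good \<rho> n" and r: "r < k" for \<rho> n r
  proof (rule ccontr)
    assume "~ ?thesis"
    moreover have "card (U \<times> mems) <= K"
      using mems_card(2) K by (simp add: card_cartesian_product) (meson le_trans mult_le_mono2)
    ultimately have big: "card (U \<times> mems) < cnt (replicate k 0) \<rho> n ! r" by linarith
    have "(\<rho> (min t n), mem \<rho> (min t n)) \<in> U \<times> mems" for t using good_in[OF g, of "min t n"] by simp
    from cnt_pigeon[where s = "%t. (\<rho> (min t n), mem \<rho> (min t n))", OF r _ this big]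
    obtain i j where "i < j" "j <= n" "\<rho> (min i n) = \<rho> (min j n)" "mem \<rho> (min i n) = mem \<rho> (min j n)"
      "red r (\<rho> i)" "!!t. i <= t ==> t <= j ==> ~ green r (\<rho> t)"
      using fin(1) mems_card(1) by auto
    then have ij: "i < j" "j <= n" "\<rho> i = \<rho> j" "mem \<rho> i = mem \<rho> j"
      "red r (\<rho> i)" "!!t. i <= t ==> t <= j ==> ~ green r (\<rho> t)" by simp_all
    have "\<forall>t<n. EX a. a \<in> A (\<rho> t) & \<sigma> (Some ((\<rho> t, mem \<rho> t), Some a)) = Some ((\<rho> (Suc t), mem \<rho> (Suc t)), None)"
      using g unfolding good_def by blast
    then obtain a where a: "!!t. t < n ==> a t \<in> A (\<rho> t)"
      "!!t. t < n ==> \<sigma> (Some ((\<rho> t, mem \<rho> t), Some (a t))) = Some ((\<rho> (Suc t), mem \<rho> (Suc t)), None)"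
      by metis
    \<comment> \<open>An excessive counter yields a segment from a position back to itself that
      contains a red event and no green one. Going round it forever conforms to the winning strategy
      and violates the Streett condition.\<close>
    define l where "l t = i + t mod (j - i)" for t
    have l: "l t < j" "i <= l t" for t
    proof -
      have "t mod (j - i) < j - i" using ij(1) by simp
      then show "l t < j" "i <= l t" unfolding l_def by linarith+
    qed
    have lS: "\<rho> (l (Suc t)) = \<rho> (Suc (l t))" "mem \<rho> (l (Suc t)) = mem \<rho> (Suc (l t))" for t
    proof -
      have "l (Suc t) = (if Suc (l t) = j then i else Suc (l t))"
        using ij(1) l[of t] by (simp add: l_def mod_Suc) linarith
      then show "\<rho> (l (Suc t)) = \<rho> (Suc (l t))" "mem \<rho> (l (Suc t)) = mem \<rho> (Suc (l t))"
        using ij(3,4) by simp_all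
    qed
    let ?P = "%t. Some ((\<rho> (l (t div 2)), mem \<rho> (l (t div 2))), if even t then None else Some (a (l (t div 2)))) :: ('u, 'a) pvert"
    have W1: "Some ((\<rho> (l t), mem \<rho> (l t)), None) \<in> W" for t
      using g l[of t] ij(2) unfolding good_def by auto
    have W2: "Some ((\<rho> (l t), mem \<rho> (l t)), Some (a (l t))) \<in> W" for t
      using W_chal[OF W1] a(1)[of "l t"] l[of t] ij(2) by simp
    have "conform pE pown True W \<sigma> ?P"
      unfolding conform_def
    proof
      fix t
      have aA: "a (l (t div 2)) \<in> A (\<rho> (l (t div 2)))" using a(1) l[of "t div 2"] ij(2) by auto
      show "?P t \<in> W & ?P (Suc t) \<in> pE (?P t) & (pown (?P t) = True --> ?P (Suc t) = \<sigma> (?P t))"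
      proof (cases "even t")
        case True
        then show ?thesis using W1 aA by (simp add: pE_def pown_def)
      next
        case False
        then have "Suc t div 2 = Suc (t div 2)" by presburger
        then have "?P (Suc t) = \<sigma> (?P t)" using False a(2)[of "l (t div 2)"] l[of "t div 2"] ij(2) lS by simp
        moreover have "?P t \<in> W" using W2 False by simp
        moreover have "\<sigma> (?P t) \<in> pE (?P t)" using W_resp(2) W2 False by auto
        ultimately show ?thesis by simp
      qed
    qed
    then have "even (Max (limit (ppr \<circ> ?P)))" using W(2) unfolding wreg_def by blast
    then have "even (Max (limit (%t. Max (prios (mem \<rho> (l t)) (\<rho> (l t))))))" 
      using double_Max[of "%t. \<rho> (l t)" "%t. mem \<rho> (l t)" "%t. a (l t)"] by simp
    then have "streett (%t. \<rho> (l t))"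
      using iar_streett[of "%t. mem \<rho> (l t)" "%t. \<rho> (l t)"] good_in[OF g] l[of 0] ij(2) lS(2) by (auto simp: mem)
    moreover have "INFM t. red r (\<rho> (l t))"
      unfolding INFM_nat_le
    proof
      fix t
      have "1 <= j - i" using ij(1) by linarith
      then have "t * (j - i) >= t" by simp
      moreover have "l (t * (j - i)) = i" by (simp add: l_def)
      ultimately show "EX s>=t. red r (\<rho> (l s))" using ij(5) by metis
    qed
    ultimately obtain t where "green r (\<rho> (l t))" using r unfolding streett_def by (auto dest: INFM_EX)
    then show False using ij(6)[of "l t"] l[of t] by simp
  qed
  define W2 where "W2 = {(\<rho> n, cnt (replicate k 0) \<rho> n) | \<rho> n. good \<rho> n}"
  have "W2 \<subseteq> U \<times> counts K"
  proof -
    have "length (cnt (replicate k 0) \<rho> n) = k" for \<rho> n by (cases n) simp_all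
    then show ?thesis
      using good_in(1) bound unfolding W2_def counts_def by (auto simp: in_set_conv_nth)
  qed
  moreover have "\<exists>u'\<in>R u a. (u', upc c u') \<in> W2" if uc: "(u, c) \<in> W2" and a: "a \<in> A u" for u c a
  proof -
    obtain \<rho> n where \<rho>: "good \<rho> n" "u = \<rho> n" "c = cnt (replicate k 0) \<rho> n" using uc by (auto simp: W2_def)
    have "Some ((u, mem \<rho> n), None) \<in> W" using \<rho> by (simp add: good_def)
    from W_resp[OF W_chal[OF this a]] obtain u' where u': "u' \<in> R u a"
      "\<sigma> (Some ((u, mem \<rho> n), Some a)) = Some ((u', upm (mem \<rho> n) u), None)"
      "Some ((u', upm (mem \<rho> n) u), None) \<in> W" by auto
    define \<rho>' where "\<rho>' t = (if t <= n then \<rho> t else u')" for t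
    have mem': "mem \<rho>' t = mem \<rho> t" if "t <= Suc n" for t
      using that by (induction t) (simp_all add: mem \<rho>'_def)
    have cnt': "cnt (replicate k 0) \<rho>' t = cnt (replicate k 0) \<rho> t" if "t <= n" for t
      using that by (induction t) (simp_all add: \<rho>'_def)
    have "good \<rho>' (Suc n)"
      unfolding good_def
    proof (intro conjI allI impI)
      show "\<rho>' 0 = u0" using \<rho>(1) by (simp add: \<rho>'_def good_def)
      show "Some ((\<rho>' t, mem \<rho>' t), None) \<in> W" if "t <= Suc n" for t
        using that \<rho> u'(3) mem'[OF that] by (cases "t = Suc n") (auto simp: \<rho>'_def good_def mem)
      show "\<exists>a\<in>A (\<rho>' t). \<sigma> (Some ((\<rho>' t, mem \<rho>' t), Some a)) = Some ((\<rho>' (Suc t), mem \<rho>' (Suc t)), None)"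
        if "t < Suc n" for t
      proof (cases "t = n")
        case True
        then show ?thesis using u'(2) \<rho>(2) a mem' by (auto simp: \<rho>'_def mem)
      next
        case False
        then show ?thesis using \<rho>(1) that mem'[of t] mem'[of "Suc t"] by (simp add: \<rho>'_def good_def)
      qed
    qed
    moreover have "\<rho>' (Suc n) = u'" "cnt (replicate k 0) \<rho>' (Suc n) = upc c u'"
      using cnt'[of n] \<rho>(3) by (simp_all add: \<rho>'_def)
    ultimately have "(u', upc c u') \<in> W2" unfolding W2_def by (smt (verit) mem_Collect_eq)
    then show ?thesis using u'(1) by blast
  qed
  ultimately have "bsafe U A R K W2" unfolding bsafe_def by auto
  moreover have "good (%_. u0) 0" using inW by (simp add: good_def mem)
  then have "(u0, replicate k 0) \<in> W2" unfolding W2_def by force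
  ultimately show ?thesis by blast
qed

end
end

section \<open>Membership: the game between Prover and Challenger\<close>

section \<open>Subgame perfect equilibria as a game between Prover and Challenger\<close>

text \<open>The largest recurring priority has parity \<open>b\<close> iff every recurring state of
  the wrong parity is outbid by a recurring larger priority. With one condition per state, their
  number is at most the number of listed states, even though priorities are written in
  binary.\<close>

lemma dpa_accepts_iff:
  assumes "finite (range \<rho>)" "range \<rho> \<subseteq> Q"
  shows "even (Max (limit (p \<circ> \<rho>))) = b <->
    (\<forall>q\<in>Q. even (p q) ~= b --> (INFM n. \<rho> n = q) --> (INFM n. p (\<rho> n) > (p q :: nat)))" (is "?l <-> ?r")
proof -
  have fin: "finite (range (p \<circ> \<rho>))" using assms(1) by (metis finite_imageI image_comp)
  note lim = limit_finite_props[OF fin]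
  let ?M = "Max (limit (p \<circ> \<rho>))"
  have M: "?M \<in> limit (p \<circ> \<rho>)" using lim by simp
  show ?thesis
  proof
    assume l: ?l
    show ?r
    proof (intro ballI impI)
      fix q assume q: "q \<in> Q" "even (p q) ~= b" "INFM n. \<rho> n = q"
      have "p q \<in> limit (p \<circ> \<rho>)" using q(3) unfolding limit_def by (auto elim: INFM_mono)
      then have "p q <= ?M" using lim by simp
      then have "p q < ?M" using l q(2) by (metis le_neq_implies_less)
      then show "INFM n. p (\<rho> n) > p q" using M unfolding limit_def by (auto elim!: INFM_mono)
    qed
  next
    assume r: ?r
    show ?l
    proof (rule ccontr)
      assume nl: "~ ?l"
      have "INFM n. \<exists>q\<in>range \<rho>. \<rho> n = q & p q = ?M" using M unfolding limit_def by (auto elim!: INFM_mono)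
      then obtain q where q: "q \<in> range \<rho>" "INFM n. \<rho> n = q & p q = ?M"
        unfolding INFM_finite_Bex_distrib[OF assms(1)] by blast
      then have pq: "p q = ?M" "INFM n. \<rho> n = q" by (auto dest: INFM_EX elim: INFM_mono)
      then have "INFM n. p (\<rho> n) > ?M" using r q(1) assms(2) nl by (metis subsetD)
      then have "INFM n. \<exists>d\<in>range (p \<circ> \<rho>). (p \<circ> \<rho>) n = d & d > ?M" by (auto elim!: INFM_mono)
      then obtain d where "INFM n. (p \<circ> \<rho>) n = d & d > ?M"
        unfolding INFM_finite_Bex_distrib[OF fin] by blast
      then have "d \<in> limit (p \<circ> \<rho>)" "d > ?M" unfolding limit_def by (auto dest: INFM_EX elim: INFM_mono)
      then show False using lim(2) by (meson Max_ge leD)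
    qed
  qed
qed


definition autos :: "rp_input => (nat \<times> nat \<times> dpa_table) list" where
  "autos I = concat (map (%i. map (%p. (i, p, inp_auts I ! i ! p)) [0..<length (inp_auts I ! i)])
     [0..<length (inp_auts I)])"

abbreviation "num_aut I \<equiv> length (autos I)"

definition "aut_pl I ka = fst (autos I ! ka)"
definition "aut_py I ka = fst (snd (autos I ! ka))"
definition "aut_tab I ka = snd (snd (autos I ! ka))"

definition pairs :: "rp_input => (nat \<times> nat) list" where
  "pairs I = concat (map (%ka. map (Pair ka) [0..<length (tab_prio (aut_tab I ka))]) [0..<num_aut I])"

abbreviation "nve I \<equiv> length (inp_owner I)"
abbreviation "npl I \<equiv> length (inp_auts I)"
abbreviation "npr I \<equiv> length (pairs I)"

text \<open>
  A state consists of the current vertex, the successor that Prover's profile prescribes there, the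
  states of all automata before the current vertex is read, the payoffs of the play that follows the
  profile from now on, the set of the pairs \<open>(i, p)\<close> such that \<open>p\<close> would be a profitable deviation
  of \<open>i\<close> from an earlier position since which only \<open>i\<close> has deviated, and a flag: 0 if the last
  step followed the profile, and \<open>Suc i\<close> if player \<open>i\<close> deviated in it.
\<close>

type_synonym ustate = "nat \<times> nat \<times> nat list \<times> nat list \<times> bool list \<times> nat"

definition uv :: "ustate => nat" where "uv u = fst u"
definition uw :: "ustate => nat" where "uw u = fst (snd u)"
definition us :: "ustate => nat list" where "us u = fst (snd (snd u))"
definition ux :: "ustate => nat list" where "ux u = fst (snd (snd (snd u)))"
definition uS :: "ustate => bool list" where "uS u = fst (snd (snd (snd (snd u))))"
definition uf :: "ustate => nat" where "uf u = snd (snd (snd (snd (snd u))))"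

lemma u_simps [simp]: "uv (v, w, s, x, S, f) = v" "uw (v, w, s, x, S, f) = w" "us (v, w, s, x, S, f) = s"
  "ux (v, w, s, x, S, f) = x" "uS (v, w, s, x, S, f) = S" "uf (v, w, s, x, S, f) = f"
  by (simp_all add: uv_def uw_def us_def ux_def uS_def uf_def)

definition ustates :: "rp_input => ustate set" where
  "ustates I = {u. uv u < nve I & uw u < nve I &
     length (us u) = num_aut I & (\<forall>ka<num_aut I. us u ! ka < length (tab_prio (aut_tab I ka))) &
     length (ux u) = npl I & (\<forall>i<npl I. ux u ! i < length (inp_auts I ! i)) &
     length (uS u) = num_aut I & uf u <= npl I}"

definition unext :: "rp_input => ustate => nat list" where
  "unext I u = map (%ka. tab_trans (aut_tab I ka) ! (us u ! ka) ! uv u) [0..<num_aut I]"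

definition uok :: "rp_input => nat list => bool" where
  "uok I x <-> (\<forall>i<npl I. (x ! i, x ! i) \<notin> set (inp_prefs I ! i))"

definition udev :: "rp_input => nat list => nat => bool" where
  "udev I x ka <-> (x ! aut_pl I ka, aut_py I ka) \<in> set (inp_prefs I ! aut_pl I ka)"

text \<open>Any move other than the announced one is a deviation of the owner of the vertex. Entries
  of all other players then lapse, as more than one player has deviated since they were made, and
  the deviator's new label must not be among the recorded entries of that player. \<open>uok\<close>
  forbids labels that are preferred to themselves, because following the profile also counts as a
  deviation.\<close>

definition ustep :: "rp_input => ustate => nat => ustate => bool" where
  "ustep I u a u' <-> uv u' = a & (a, uw u') \<in> set (inp_edges I) & us u' = unext I u &
     (if a = uw u then ux u' = ux u & uS u' = uS u & uf u' = 0
      else uok I (ux u') & uf u' = Suc (inp_owner I ! uv u) &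
        (\<forall>ka<num_aut I. aut_pl I ka = inp_owner I ! uv u --> aut_py I ka = ux u' ! (inp_owner I ! uv u) --> ~ uS u ! ka) &
        uS u' = map (%ka. aut_pl I ka = inp_owner I ! uv u & uS u ! ka \<or> udev I (ux u') ka) [0..<num_aut I])"

text \<open>Required to recur for every automaton that accepts. It stops recurring only if from some
  time on each step either follows the profile with another payoff announced, or is a deviation of
  the player concerned with this payoff recorded as profitable.\<close>

definition fgreen :: "rp_input => nat => ustate => bool" where
  "fgreen I ka u <-> (if uf u = 0 then aut_py I ka = ux u ! aut_pl I ka
     else uf u = Suc (aut_pl I ka) --> ~ uS u ! ka)"

definition upri :: "rp_input => nat => nat => nat" where
  "upri I r q = tab_prio (aut_tab I (fst (pairs I ! r))) ! q"

definition ured :: "rp_input => nat => ustate => bool" where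
  "ured I r u <-> us u ! fst (pairs I ! r) = snd (pairs I ! r) & even (upri I r (snd (pairs I ! r)))"

definition ugreen :: "rp_input => nat => ustate => bool" where
  "ugreen I r u <-> upri I r (us u ! fst (pairs I ! r)) > upri I r (snd (pairs I ! r)) \<or> fgreen I (fst (pairs I ! r)) u"

definition uinit :: "rp_input => ustate => bool" where
  "uinit I u <-> uv u = inp_start I & (inp_start I, uw u) \<in> set (inp_edges I) &
     us u = map (%ka. tab_init (aut_tab I ka)) [0..<num_aut I] & uok I (ux u) &
     (\<forall>i<npl I. inp_constr I ! i = ux u ! i \<or> (inp_constr I ! i, ux u ! i) \<in> set (inp_prefs I ! i)) &
     uS u = map (udev I (ux u)) [0..<num_aut I] & uf u = 0"

definition umoves :: "rp_input => ustate => nat set" where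
  "umoves I u = {a. (uv u, a) \<in> set (inp_edges I)}"

definition uresp :: "rp_input => ustate => nat => ustate set" where
  "uresp I u a = {u' \<in> ustates I. ustep I u a u'}"

abbreviation "uwin I K W \<equiv> bsafe (npr I) (ured I) (ugreen I) (ustates I) (umoves I) (uresp I) K W"

lemma autos_iff: "(i, p, T) \<in> set (autos I) <-> i < npl I & p < length (inp_auts I ! i) & T = inp_auts I ! i ! p"
  unfolding autos_def by (fastforce simp: image_iff)

lemma aut_props:
  assumes "ka < num_aut I"
  shows "aut_pl I ka < npl I" "aut_py I ka < length (inp_auts I ! aut_pl I ka)"
    "aut_tab I ka = inp_auts I ! aut_pl I ka ! aut_py I ka"
proof -
  have "(aut_pl I ka, aut_py I ka, aut_tab I ka) \<in> set (autos I)"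
    using nth_mem[OF assms] by (simp add: aut_pl_def aut_py_def aut_tab_def)
  then show "aut_pl I ka < npl I" "aut_py I ka < length (inp_auts I ! aut_pl I ka)"
    "aut_tab I ka = inp_auts I ! aut_pl I ka ! aut_py I ka" by (simp_all add: autos_iff)
qed

lemma aut_index:
  assumes "i < npl I" "p < length (inp_auts I ! i)"
  shows "\<exists>ka<num_aut I. aut_pl I ka = i & aut_py I ka = p"
proof -
  have "(i, p, inp_auts I ! i ! p) \<in> set (autos I)" using assms by (simp add: autos_iff)
  then show ?thesis unfolding in_set_conv_nth by (auto simp: aut_pl_def aut_py_def)
qed

lemma pairs_nth:
  assumes "r < npr I"
  shows "fst (pairs I ! r) < num_aut I" "snd (pairs I ! r) < length (tab_prio (aut_tab I (fst (pairs I ! r))))"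
  using nth_mem[OF assms] by (auto simp: pairs_def)

lemma pairs_index:
  assumes "ka < num_aut I" "q < length (tab_prio (aut_tab I ka))"
  shows "\<exists>r<npr I. pairs I ! r = (ka, q)"
proof -
  have "(ka, q) \<in> set (pairs I)" using assms unfolding pairs_def by (fastforce simp: image_iff)
  then show ?thesis by (auto simp: in_set_conv_nth)
qed

definition aut_ok :: "rp_input => bool" where
  "aut_ok I <-> (\<forall>ka<num_aut I. wf_table (nve I) (aut_tab I ka))"

lemma aut_ok_dpa:
  assumes "aut_ok I" "ka < num_aut I"
  shows "tab_init (aut_tab I ka) < length (tab_prio (aut_tab I ka))"
    "q < length (tab_prio (aut_tab I ka)) ==> a < nve I ==>
      tab_trans (aut_tab I ka) ! q ! a < length (tab_prio (aut_tab I ka))"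
  using assms by (auto simp: aut_ok_def wf_table_def is_dpa_def dpa_of_table_def)

lemma unext_run:
  assumes "us (u 0) = map (%ka. tab_init (aut_tab I ka)) [0..<num_aut I]"
    and "!!t. us (u (Suc t)) = unext I (u t)" "!!t. uv (u t) = w t" and "ka < num_aut I"
  shows "us (u t) ! ka = dpa_run (dpa_of_table (aut_tab I ka)) w t"
  by (induction t) (use assms in \<open>simp_all add: unext_def dpa_of_table_def\<close>)

lemma run_range:
  assumes "aut_ok I" "ka < num_aut I" "w \<in> omega_words {..<nve I}"
  shows "range (dpa_run (dpa_of_table (aut_tab I ka)) w) \<subseteq> {..<length (tab_prio (aut_tab I ka))}"
proof -
  have "dpa_run (dpa_of_table (aut_tab I ka)) w n < length (tab_prio (aut_tab I ka))" for n
  proof (induction n)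
    case (Suc n)
    have "w n < nve I" using assms(3) by (auto simp: omega_words_def)
    then show ?case using aut_ok_dpa(2)[OF assms(1,2) Suc] by (simp add: dpa_of_table_def)
  qed (use aut_ok_dpa(1)[OF assms(1,2)] in \<open>simp add: dpa_of_table_def\<close>)
  then show ?thesis by auto
qed

lemma lang_iff:
  assumes "aut_ok I" "ka < num_aut I" "w \<in> omega_words {..<nve I}"
    and run: "!!t. us (u t) ! ka = dpa_run (dpa_of_table (aut_tab I ka)) w t"
  shows "(w \<in> dpa_lang {..<nve I} (dpa_of_table (aut_tab I ka))) = b <->
    (\<forall>r<npr I. fst (pairs I ! r) = ka --> even (upri I r (snd (pairs I ! r))) ~= b -->
      (INFM t. us (u t) ! ka = snd (pairs I ! r)) -->
      (INFM t. upri I r (us (u t) ! ka) > upri I r (snd (pairs I ! r))))"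
proof -
  let ?\<rho> = "dpa_run (dpa_of_table (aut_tab I ka)) w" and ?n = "length (tab_prio (aut_tab I ka))"
    and ?p = "%q. tab_prio (aut_tab I ka) ! q"
  note r = run_range[OF assms(1-3)]
  have "finite (range ?\<rho>)" using r finite_subset by blast
  from dpa_accepts_iff[OF this r, of ?p b]
  have "(w \<in> dpa_lang {..<nve I} (dpa_of_table (aut_tab I ka))) = b <->
    (\<forall>q\<in>{..<?n}. even (?p q) ~= b --> (INFM n. ?\<rho> n = q) --> (INFM n. ?p (?\<rho> n) > ?p q))"
    using assms(3) by (simp add: dpa_lang_def dpa_of_table_def)
  also have "\<dots> <-> (\<forall>r<npr I. fst (pairs I ! r) = ka --> even (?p (snd (pairs I ! r))) ~= b -->
      (INFM n. ?\<rho> n = snd (pairs I ! r)) --> (INFM n. ?p (?\<rho> n) > ?p (snd (pairs I ! r))))"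
    (is "?l <-> ?r")
  proof
    show "?l ==> ?r" using pairs_nth(2) by fastforce
    assume r: ?r
    show ?l
    proof
      fix q assume "q \<in> {..<?n}"
      then obtain j where "j < npr I" "pairs I ! j = (ka, q)"
        using pairs_index[OF assms(2)] by auto
      then show "even (?p q) ~= b --> (INFM n. ?\<rho> n = q) --> (INFM n. ?p (?\<rho> n) > ?p q)"
        using spec[OF r, of j] by simp
    qed
  qed
  finally show ?thesis by (simp add: run upri_def cong: conj_cong imp_cong)
qed

text \<open>Rejection is a conjunction over the even states of the automaton, and recurrence of
  \<open>fgreen\<close> does not depend on the state. The alternative between the two can hence be
  distributed over the conjunction by adding \<open>fgreen\<close> to the green event of every
  pair.\<close>

lemma streett_lang_iff:
  assumes "aut_ok I" "w \<in> omega_words {..<nve I}"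
    and run: "!!ka t. ka < num_aut I ==> us (u t) ! ka = dpa_run (dpa_of_table (aut_tab I ka)) w t"
  shows "streett (npr I) (ured I) (ugreen I) u <->
    (\<forall>ka<num_aut I. w \<in> dpa_lang {..<nve I} (dpa_of_table (aut_tab I ka)) -->
      (INFM t. fgreen I ka (u t)))"
proof -
  note L = lang_iff[OF assms(1) _ assms(2) run, where b = False]
  have red: "(INFM t. ured I r (u t)) <-> even (upri I r (snd (pairs I ! r))) & (INFM t. us (u t) ! fst (pairs I ! r) = snd (pairs I ! r))" for r
    by (auto simp: ured_def)
  have green: "(INFM t. ugreen I r (u t)) <-> (INFM t. upri I r (us (u t) ! fst (pairs I ! r)) > upri I r (snd (pairs I ! r))) \<or>
      (INFM t. fgreen I (fst (pairs I ! r)) (u t))" for r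
    by (simp add: ugreen_def INFM_disj_distrib)
  show ?thesis
  proof
    assume st: "streett (npr I) (ured I) (ugreen I) u"
    show "\<forall>ka<num_aut I. w \<in> dpa_lang {..<nve I} (dpa_of_table (aut_tab I ka)) -->
      (INFM t. fgreen I ka (u t))"
    proof (intro allI impI)
      fix ka assume k: "ka < num_aut I" and l: "w \<in> dpa_lang {..<nve I} (dpa_of_table (aut_tab I ka))"
      from l L[OF k k] obtain j where j: "j < npr I" "fst (pairs I ! j) = ka"
        "even (upri I j (snd (pairs I ! j)))" "INFM t. us (u t) ! ka = snd (pairs I ! j)"
        "~ (INFM t. upri I j (us (u t) ! ka) > upri I j (snd (pairs I ! j)))" by auto
      then have "INFM t. ugreen I j (u t)" using st red[of j] unfolding streett_def by simp
      then show "INFM t. fgreen I ka (u t)" using green[of j] j by simp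
    qed
  next
    assume r: "\<forall>ka<num_aut I. w \<in> dpa_lang {..<nve I} (dpa_of_table (aut_tab I ka)) -->
      (INFM t. fgreen I ka (u t))"
    show "streett (npr I) (ured I) (ugreen I) u"
      unfolding streett_def red green
    proof (intro allI impI)
      fix j assume j: "j < npr I" "even (upri I j (snd (pairs I ! j))) & (INFM t. us (u t) ! fst (pairs I ! j) = snd (pairs I ! j))"
      note k = pairs_nth(1)[OF j(1)]
      show "(INFM t. upri I j (us (u t) ! fst (pairs I ! j)) > upri I j (snd (pairs I ! j))) \<or>
          (INFM t. fgreen I (fst (pairs I ! j)) (u t))"
      proof (cases "w \<in> dpa_lang {..<nve I} (dpa_of_table (aut_tab I (fst (pairs I ! j))))")
        case True
        then show ?thesis using r k by simp
      next
        case False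
        then show ?thesis using L[OF k k] j by simp
      qed
    qed
  qed
qed

lemma since_Suc: "(EX t'<=Suc t. (ALL n. t' <= n --> n < Suc t --> X n) & Q t') <->
    X t & (EX t'<=t. (ALL n. t' <= n --> n < t --> X n) & Q t') \<or> Q (Suc t)"
  by (auto simp: le_Suc_eq less_Suc_eq)

lemma ustates_bound:
  assumes "nve I <= M" "npl I <= M"
    "!!ka. ka < num_aut I ==> length (tab_prio (aut_tab I ka)) <= M" "!!i. i < npl I ==> length (inp_auts I ! i) <= M"
  shows "finite (ustates I)"
    "card (ustates I) <= Suc M * (Suc M * (Suc M ^ num_aut I * (Suc M ^ npl I * (2 ^ num_aut I * Suc M))))"
proof -
  let ?L = "%l. {xs. set xs \<subseteq> {..M} & length xs = l}" and ?B = "{xs :: bool list. set xs \<subseteq> UNIV & length xs = num_aut I}"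
  let ?X = "{..M} \<times> {..M} \<times> ?L (num_aut I) \<times> ?L (npl I) \<times> ?B \<times> {..M}"
  have sub: "ustates I \<subseteq> ?X"
  proof
    fix u assume u: "u \<in> ustates I"
    obtain v w s x S f where u': "u = (v, w, s, x, S, f)" by (metis prod.exhaust)
    have "set s \<subseteq> {..M}" "set x \<subseteq> {..M}"
      using u assms(3,4) unfolding u' ustates_def by (auto simp: in_set_conv_nth) (meson less_imp_le less_le_trans)+
    then show "u \<in> ?X" using u assms(1,2) unfolding u' ustates_def by simp
  qed
  have "finite ?X" by (intro finite_cartesian_product finite_lists_length_eq) auto
  then show "finite (ustates I)" "card (ustates I) <= Suc M * (Suc M * (Suc M ^ num_aut I * (Suc M ^ npl I * (2 ^ num_aut I * Suc M))))"
    using sub card_mono[OF _ sub] card_lists_length_eq[of "{..M}"] card_lists_length_eq[of "UNIV :: bool set" "num_aut I"]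
    by (auto simp: card_cartesian_product intro: finite_subset)
qed

lemma finite_ustates: "finite (ustates I)"
proof -
  define M where "M = Max (insert (nve I) (insert (npl I) ((%ka. length (tab_prio (aut_tab I ka))) ` {..<num_aut I} \<union>
    (%i. length (inp_auts I ! i)) ` {..<npl I})))"
  show ?thesis by (rule ustates_bound(1)[of I M]; unfold M_def, intro Max_ge; simp)
qed

locale spe_instance =
  fixes I :: rp_input and G :: "(nat, nat, nat) game"
  assumes inst: "is_instance I G"
begin

abbreviation "nv \<equiv> nve I"
abbreviation "np \<equiv> npl I"

lemma arena: "is_arena G" and verts: "verts G = {..<nv}" and edges: "edges G = set (inp_edges I)"
  and players: "players G = {..<np}" and start: "inp_start I < nv"
  using inst by (auto simp: is_instance_def rp_game_def is_game_def represents_def)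

lemma owned: "i < np ==> owned G i = {v. v < nv & inp_owner I ! v = i}"
  and payoffs: "i < np ==> payoffs G i = {..<length (inp_auts I ! i)}"
  and pref: "i < np ==> pref G i = set (inp_prefs I ! i)"
  using inst by (auto simp: is_instance_def represents_def)

lemma owner: "v < nv ==> owner G v = inp_owner I ! v" "v < nv ==> inp_owner I ! v < np"
  using owner_owned[OF arena, of v] by (auto simp: verts players owned)

lemma edge_verts: "(u, v) \<in> set (inp_edges I) ==> u < nv & v < nv"
  using arena by (auto simp: is_arena_def edges verts)

lemma total: "v < nv ==> EX u. (v, u) \<in> set (inp_edges I)"
  using arena by (auto simp: is_arena_def edges verts)

lemma auts: "aut_ok I"
proof -
  have "wf_table nv (aut_tab I ka)" if "ka < num_aut I" for ka
    using inst aut_props[OF that] payoffs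
    by (auto simp: is_instance_def represents_def)
  then show ?thesis by (simp add: aut_ok_def)
qed

lemma pay_lt: "w \<in> omega_words {..<nv} ==> i < np ==> pay G i w < length (inp_auts I ! i)"
  using inst payoffs[of i] by (auto simp: is_instance_def rp_game_def is_game_def players verts)

lemma pay_iff:
  assumes "w \<in> omega_words {..<nv}" "ka < num_aut I"
  shows "w \<in> dpa_lang {..<nv} (dpa_of_table (aut_tab I ka)) <-> pay G (aut_pl I ka) w = aut_py I ka"
proof -
  have "dpa_lang {..<nv} (dpa_of_table (aut_tab I ka)) = pay_preimage G (aut_pl I ka) (aut_py I ka)"
    using inst aut_props[OF assms(2)] payoffs by (auto simp: is_instance_def represents_def)
  then show ?thesis using assms(1) by (simp add: pay_preimage_def verts)
qed

lemma play_words: "play G w ==> w \<in> omega_words {..<nv}"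
  by (simp add: play_def verts)

lemma play_lt: "play G w ==> w t < nv"
  using play_verts[of G w t] by (simp add: verts)

lemma streett_pay_iff:
  assumes w: "play G w" and run: "us (u 0) = map (%ka. tab_init (aut_tab I ka)) [0..<num_aut I]"
    "!!t. us (u (Suc t)) = unext I (u t)" "!!t. uv (u t) = w t"
  shows "streett (npr I) (ured I) (ugreen I) u <->
    (\<forall>ka<num_aut I. pay G (aut_pl I ka) w = aut_py I ka --> (INFM t. fgreen I ka (u t)))"
  using streett_lang_iff[OF auts play_words[OF w] unext_run[OF run]] pay_iff[OF play_words[OF w]] by simp


section \<open>From a winning region of Prover to an equilibrium\<close>

context
  fixes K W u0
  assumes W: "uwin I K W" "(u0, replicate (npr I) 0) \<in> W" and u0: "uinit I u0"
begin

definition nx :: "ustate \<times> nat list => nat => ustate \<times> nat list" where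
  "nx y a = (SOME y'. y' \<in> W & fst y' \<in> uresp I (fst y) a & snd y' = upc (npr I) (ured I) (ugreen I) (snd y) (fst y'))"

text \<open>The last clause is what makes deviations unprofitable: a payoff recorded as profitable
  is never the announced one. While only its player deviates the record persists, so
  \<open>fgreen\<close> fails at every such step and the payoff cannot be the one obtained.\<close>

definition uinv :: "ustate \<times> nat list => bool" where
  "uinv y <-> y \<in> W & (uv (fst y), uw (fst y)) \<in> set (inp_edges I) &
     (\<forall>ka<num_aut I. (udev I (ux (fst y)) ka --> uS (fst y) ! ka) &
        (aut_py I ka = ux (fst y) ! aut_pl I ka --> ~ uS (fst y) ! ka))"

lemma nx:
  assumes "y \<in> W" "(uv (fst y), a) \<in> set (inp_edges I)"
  shows "nx y a \<in> W" "fst (nx y a) \<in> ustates I" "ustep I (fst y) a (fst (nx y a))"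
    "snd (nx y a) = upc (npr I) (ured I) (ugreen I) (snd y) (fst (nx y a))"
proof -
  obtain u c where y: "y = (u, c)" by fastforce
  have "\<forall>a\<in>umoves I u. \<exists>u'\<in>uresp I u a. (u', upc (npr I) (ured I) (ugreen I) c u') \<in> W"
    using W(1) assms(1) y unfolding bsafe_def by blast
  then obtain u' where "u' \<in> uresp I u a" "(u', upc (npr I) (ured I) (ugreen I) c u') \<in> W"
    using assms(2) y by (auto simp: umoves_def)
  then have "EX y'. y' \<in> W & fst y' \<in> uresp I (fst y) a & snd y' = upc (npr I) (ured I) (ugreen I) (snd y) (fst y')"
    using y by (intro exI[of _ "(u', upc (npr I) (ured I) (ugreen I) c u')"]) simp
  from someI_ex[OF this, folded nx_def]
  show "nx y a \<in> W" "fst (nx y a) \<in> ustates I" "ustep I (fst y) a (fst (nx y a))"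
    "snd (nx y a) = upc (npr I) (ured I) (ugreen I) (snd y) (fst (nx y a))"
    by (simp_all add: uresp_def)
qed

lemma uok_dev: "uok I x ==> ka < num_aut I ==> aut_py I ka = x ! aut_pl I ka ==> ~ udev I x ka"
  using aut_props(1)[of ka I] by (auto simp: uok_def udev_def)

lemma uinv0: "uinv (u0, replicate (npr I) 0)"
  using u0 W(2) uok_dev by (auto simp: uinv_def uinit_def)

lemma uinv_nx:
  assumes "uinv y" "(uv (fst y), a) \<in> set (inp_edges I)"
  shows "uinv (nx y a)"
proof -
  have yW: "y \<in> W" using assms by (simp add: uinv_def)
  note n = nx[OF yW assms(2)]
  show ?thesis
  proof (cases "a = uw (fst y)")
    case True
    then have "udev I (ux (fst (nx y a))) ka = udev I (ux (fst y)) ka" for ka using n(3) by (simp add: ustep_def)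
    then show ?thesis using True n(1,3) assms by (simp add: uinv_def ustep_def)
  next
    case False
    then show ?thesis using n(1,3) uok_dev[of "ux (fst (nx y a))"] by (auto simp: uinv_def ustep_def)
  qed
qed

definition pos :: "nat list => ustate \<times> nat list" where
  "pos h = foldl nx (u0, replicate (npr I) 0) (tl h)"

text \<open>The equilibrium plays what Prover announces. Histories that do not begin at the start
  vertex still need a legal move, and there any successor will do.\<close>

definition prof :: "nat => nat strategy" where
  "prof i h = (if h \<in> Hist G (inp_start I) then uw (fst (pos h)) else SOME v. (last h, v) \<in> set (inp_edges I))"

lemma pos_snoc: "h ~= [] ==> pos (h @ [v]) = nx (pos h) v"
  by (simp add: pos_def)

lemma pos_inv: "h \<in> Hist G (inp_start I) ==> uinv (pos h) & uv (fst (pos h)) = last h"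
proof (induction h rule: rev_induct)
  case (snoc v h)
  show ?case
  proof (cases "h = []")
    case True
    then show ?thesis using snoc.prems uinv0 u0 by (simp add: pos_def Hist_def uinit_def)
  next
    case False
    then have h: "h \<in> Hist G (inp_start I)" "(last h, v) \<in> set (inp_edges I)"
      using snoc.prems by (auto simp: Hist_def history_def successively_append_iff edges)
    then have p: "uinv (pos h)" "(uv (fst (pos h)), v) \<in> set (inp_edges I)" using snoc.IH by auto
    have "ustep I (fst (pos h)) v (fst (nx (pos h) v))" using nx(3) p by (simp add: uinv_def)
    then show ?thesis using uinv_nx[OF p] False by (simp add: pos_snoc ustep_def)
  qed
qed (simp add: Hist_def)

lemma prof_profile: "is_profile G prof"
  unfolding is_profile_def is_strategy_def
proof (intro ballI allI impI)
  fix i h v assume "i \<in> players G" "v \<in> owned G i" and h: "history G (h @ [v])"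
  then have v: "v < nv" by (auto simp: history_def verts)
  show "(v, prof i (h @ [v])) \<in> edges G"
  proof (cases "h @ [v] \<in> Hist G (inp_start I)")
    case True
    then show ?thesis using pos_inv[OF True] unfolding uinv_def prof_def edges by simp metis
  next
    case False
    have "EX u. (v, u) \<in> set (inp_edges I)" using total[OF v] .
    from someI_ex[OF this] show ?thesis using False by (simp add: prof_def edges)
  qed
qed

lemma play_Hist: "play G w ==> w 0 = inp_start I ==> w [0 \<rightarrow> Suc t] \<in> Hist G (inp_start I)"
  using play_history[of G w "Suc t"] by (simp add: Hist_def subsequence_def hd_map del: upt_Suc)

lemma joint_pos: "h \<in> Hist G (inp_start I) ==> joint G prof h = uw (fst (pos h))"
  by (simp add: joint_def prof_def)

context
  fixes w
  assumes w: "play G w" "w 0 = inp_start I"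
begin

definition P :: "nat => ustate \<times> nat list" where "P t = pos (prefix (Suc t) w)"

lemma P_inv: "uinv (P t)" "uv (fst (P t)) = w t"
  using pos_inv[OF play_Hist[OF w], of t] by (simp_all add: P_def)

lemma P_Suc: "P (Suc t) = nx (P t) (w (Suc t))"
  using pos_snoc[of "w [0 \<rightarrow> Suc t]" "w (Suc t)"] by (simp add: P_def)

lemma P_step: "ustep I (fst (P t)) (w (Suc t)) (fst (P (Suc t)))"
proof -
  have "(w t, w (Suc t)) \<in> set (inp_edges I)" using w(1) by (simp add: play_def edges)
  then show ?thesis using nx(3)[of "P t" "w (Suc t)"] P_inv[of t] P_Suc by (simp add: uinv_def)
qed

lemma P_green:
  assumes "ka < num_aut I" "pay G (aut_pl I ka) w = aut_py I ka"
  shows "INFM t. fgreen I ka (fst (P t))"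
proof -
  have W0: "P 0 = (u0, replicate (npr I) 0)" by (simp add: P_def pos_def)
  have e: "(w t, w (Suc t)) \<in> set (inp_edges I)" for t using w(1) by (simp add: play_def edges)
  have "snd (P t) = cnt (npr I) (ured I) (ugreen I) (replicate (npr I) 0) (%t. fst (P t)) t" for t
  proof (induction t)
    case (Suc t)
    then show ?case using nx(4)[of "P t" "w (Suc t)"] P_inv[of t] e[of t] by (simp add: uinv_def P_Suc)
  qed (simp only: W0 cnt.simps snd_conv)
  moreover have "snd (P t) \<in> counts (npr I) K" for t
    using P_inv[of t] W(1) unfolding uinv_def bsafe_def by (metis (no_types, lifting) mem_Sigma_iff prod.collapse subsetD)
  ultimately have "streett (npr I) (ured I) (ugreen I) (%t. fst (P t))"
    by (intro bounded_streett[where c = "replicate (npr I) 0" and K = K]) simp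
  moreover have "us (fst (P 0)) = map (%ka. tab_init (aut_tab I ka)) [0..<num_aut I]"
    using u0 by (simp only: W0 fst_conv uinit_def)
  moreover have "us (fst (P (Suc t))) = unext I (fst (P t))" for t using P_step[of t] by (simp add: ustep_def)
  ultimately show ?thesis
    using streett_pay_iff[OF w(1), of "%t. fst (P t)"] P_inv(2) assms by simp
qed

lemma P_joint: "joint G prof (prefix (Suc t) w) = uw (fst (P t))"
  unfolding P_def by (rule joint_pos[OF play_Hist[OF w]])

lemma P_follow:
  assumes "w (Suc t) = joint G prof (prefix (Suc t) w)"
  shows "ux (fst (P (Suc t))) = ux (fst (P t))" "uS (fst (P (Suc t))) = uS (fst (P t))" "uf (fst (P (Suc t))) = 0"
  using P_step[of t] assms P_joint[of t] by (auto simp: ustep_def)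

lemma P_dev:
  assumes "w (Suc t) ~= joint G prof (prefix (Suc t) w)" "owner G (w t) = i"
  shows "ka < num_aut I ==> aut_pl I ka = i ==> uS (fst (P t)) ! ka ==> uS (fst (P (Suc t))) ! ka"
    "uf (fst (P (Suc t))) = Suc i"
  using P_step[of t] assms P_joint[of t] P_inv(2)[of t] owner(1)[OF play_lt[OF w(1)], of t]
  by (auto simp: ustep_def)

lemma P_deviates:
  assumes d: "deviates G prof {i} t w" and i: "i < np"
    and ka: "ka < num_aut I" "aut_pl I ka = i" "aut_py I ka = pay G i w"
  shows "~ uS (fst (P t)) ! ka"
proof
  assume S: "uS (fst (P t)) ! ka"
  have mono: "uS (fst (P n)) ! ka" if "t <= n" for n using that
  proof (induction n rule: dec_induct)
    case (step n)
    show ?case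
    proof (cases "w (Suc n) = joint G prof (prefix (Suc n) w)")
      case True
      then show ?thesis using step.IH P_follow(2)[OF True] by (simp only:)
    next
      case False
      then have "owner G (w n) = i" using d step.hyps by (auto simp: deviates_def)
      then show ?thesis using P_dev(1)[OF False _ ka(1)] ka(2) step.IH by blast
    qed
  qed (rule S)
  obtain n where n: "n >= Suc t" "fgreen I ka (fst (P n))"
    using P_green[OF ka(1)] ka(2,3) unfolding INFM_nat_le by auto
  then obtain m where m: "n = Suc m" "t <= m" by (cases n) auto
  have Sn: "uS (fst (P n)) ! ka" using mono n(1) by simp
  have "uf (fst (P n)) = 0 \<or> uf (fst (P n)) = Suc i"
    using P_follow(3)[of m] P_dev(2)[of m i] d m unfolding deviates_def by blast
  then have "aut_py I ka = ux (fst (P n)) ! aut_pl I ka"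
    using n(2) Sn ka(2) by (auto simp: fgreen_def split: if_splits)
  then show False using P_inv(1)[of n] Sn ka(1) unfolding uinv_def by blast
qed

text \<open>Once the profile is followed for good, labels are frozen and the flag stays 0. The
  automaton of the payoff obtained accepts, so its \<open>fgreen\<close> recurs, and with flag 0
  this identifies the payoff with the label.\<close>

lemma P_pay:
  assumes d: "deviates G prof {} t w" and i: "i < np"
  shows "pay G i w = ux (fst (P t)) ! i"
proof -
  obtain ka where ka: "ka < num_aut I" "aut_pl I ka = i" "aut_py I ka = pay G i w"
    using aut_index[OF i pay_lt[OF play_words[OF w(1)] i]] by blast
  have fl: "w (Suc n) = joint G prof (prefix (Suc n) w)" if "t <= n" for n using d that by (simp add: deviates_def)
  have const: "ux (fst (P n)) = ux (fst (P t))" if "t <= n" for n using that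
  proof (induction n rule: dec_induct)
    case (step n)
    then show ?case using P_follow(1)[OF fl[of n]] by simp
  qed simp
  obtain n where n: "n >= Suc t" "fgreen I ka (fst (P n))"
    using P_green[OF ka(1)] ka(2,3) unfolding INFM_nat_le by auto
  then obtain m where m: "n = Suc m" "t <= m" by (cases n) auto
  have "uf (fst (P n)) = 0" using P_follow(3)[OF fl[OF m(2)]] m(1) by simp
  then show ?thesis using n ka const[of n] by (simp add: fgreen_def)
qed

end

theorem bsafe_SPE: "constrained_SPE_exists G (inp_start I) (%i. inp_constr I ! i)"
proof -
  have start': "inp_start I \<in> verts G" using start by (simp add: verts)
  have "subgame_perfect_equilibrium G prof (inp_start I)"
    unfolding SPE_iff_plays[OF arena prof_profile start']
  proof (intro allI ballI impI)
    fix w w' t i assume *: "i \<in> players G" "play G w" "play G w'" "w 0 = inp_start I"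
      "w' [0 \<rightarrow> Suc t] = prefix (Suc t) w" "deviates G prof {} t w" "deviates G prof {i} t w'"
    have i: "i < np" using *(1) by (simp add: players)
    have w'0: "w' 0 = inp_start I" using prefix_eq_mono(1)[OF *(5), of 0] *(4) by simp
    obtain ka where ka: "ka < num_aut I" "aut_pl I ka = i" "aut_py I ka = pay G i w'"
      using aut_index[OF i pay_lt[OF play_words[OF *(3)] i]] by blast
    have "~ uS (fst (P w t)) ! ka"
      using P_deviates[OF *(3) w'0 *(7) i ka] *(5) unfolding P_def[OF *(3) w'0] P_def[OF *(2,4)] by metis
    then have "~ udev I (ux (fst (P w t))) ka"
      using P_inv(1)[OF *(2,4), of t] ka(1) unfolding uinv_def by blast
    then show "(pay G i w, pay G i w') \<notin> pref G i"
      using P_pay[OF *(2,4,6) i] ka pref[OF i] by (simp add: udev_def)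
  qed
  moreover have "inp_constr I ! i = pay G i (outcome G prof (inp_start I)) \<or>
      (inp_constr I ! i, pay G i (outcome G prof (inp_start I))) \<in> pref G i" if "i \<in> players G" for i
  proof -
    have i: "i < np" using that by (simp add: players)
    have "history G ([] @ [inp_start I])" using start' by (simp add: history_def)
    then obtain w where w: "play G w" "w [0 \<rightarrow> Suc 0] = [inp_start I]" "deviates G prof {} 0 w"
      using follow_exists[OF arena prof_profile, of "[]" "inp_start I"] by auto
    have w0: "w 0 = inp_start I" using w(2) by (simp add: subsequence_def)
    have "outcome G prof (inp_start I) = w" using outcome_deviates[OF arena prof_profile w(1,3)] w0 by simp
    moreover have "pay G i w = ux u0 ! i"
      using P_pay[OF w(1) w0 w(3) i] by (simp add: P_def[OF w(1) w0] pos_def)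
    ultimately show ?thesis using u0 i pref[OF i] by (simp add: uinit_def)
  qed
  ultimately show ?thesis unfolding constrained_SPE_exists_def by blast
qed

end

section \<open>From an equilibrium to a winning region of Prover\<close>

context
  fixes \<sigma>
  assumes prof: "is_profile G \<sigma>" and spe: "subgame_perfect_equilibrium G \<sigma> (inp_start I)"
begin

definition cont :: "nat list => nat word" where
  "cont h = (SOME w. play G w & w [0 \<rightarrow> length h] = h & deviates G \<sigma> {} (length h - 1) w)"

text \<open>Prover's truthful announcements for an equilibrium: the labels are the payoffs of the
  plays that the profile generates, and a recorded entry is witnessed by a position
  \<open>t'\<close> since which only its player has deviated.\<close>

definition spos :: "nat word => nat => ustate" where
  "spos w t = (w t, joint G \<sigma> (prefix (Suc t) w),
     map (%ka. dpa_run (dpa_of_table (aut_tab I ka)) w t) [0..<num_aut I],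
     map (%i. pay G i (cont (prefix (Suc t) w))) [0..<np],
     map (%ka. EX t'<=t. (ALL n. t' <= n --> n < t --> owner G (w n) = aut_pl I ka \<or> w (Suc n) = joint G \<sigma> (prefix (Suc n) w)) &
        (pay G (aut_pl I ka) (cont (prefix (Suc t') w)), aut_py I ka) \<in> pref G (aut_pl I ka)) [0..<num_aut I],
     (case t of 0 => 0 | Suc t => if w (Suc t) = joint G \<sigma> (prefix (Suc t) w) then 0 else Suc (owner G (w t))))"

lemma cont_ex:
  assumes "history G h" "h ~= []"
  shows "play G (cont h)" "cont h [0 \<rightarrow> length h] = h" "deviates G \<sigma> {} (length h - 1) (cont h)"
proof -
  have bl: "history G (butlast h @ [last h])" using assms by simp
  obtain w where "play G w" "w [0 \<rightarrow> Suc (length (butlast h))] = butlast h @ [last h]"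
    "deviates G \<sigma> {} (length (butlast h)) w"
    using follow_exists[OF arena prof bl] by blast
  then have "EX w. play G w & w [0 \<rightarrow> length h] = h & deviates G \<sigma> {} (length h - 1) w"
    using assms(2) by (intro exI[of _ w]) (simp del: upt_Suc)
  from someI_ex[OF this, folded cont_def]
  show "play G (cont h)" "cont h [0 \<rightarrow> length h] = h" "deviates G \<sigma> {} (length h - 1) (cont h)"
    by blast+
qed

lemma cont_play:
  assumes "play G w"
  shows "play G (cont (prefix (Suc t) w))" "cont (prefix (Suc t) w) [0 \<rightarrow> Suc t] = prefix (Suc t) w"
    "deviates G \<sigma> {} t (cont (prefix (Suc t) w))"
  using cont_ex[OF play_history[OF assms, of "Suc t"]] by (simp_all del: subsequence_def upt_Suc add: subsequence_length)

lemma cont_unique: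
  assumes "play G w" "deviates G \<sigma> {} t w"
  shows "cont (prefix (Suc t) w) = w"
  by (rule deviates_unique[OF cont_play(3)[OF assms(1)] assms(2) cont_play(2)[OF assms(1)]])

lemma cont_follow:
  assumes "play G w" "w (Suc t) = joint G \<sigma> (prefix (Suc t) w)"
  shows "cont (prefix (Suc (Suc t)) w) = cont (prefix (Suc t) w)"
proof (rule deviates_unique)
  note c = cont_play[OF assms(1), of t] and c' = cont_play[OF assms(1), of "Suc t"]
  show "deviates G \<sigma> {} (Suc t) (cont (prefix (Suc (Suc t)) w))" by (rule c'(3))
  show "deviates G \<sigma> {} (Suc t) (cont (prefix (Suc t) w))" using c(3) by (simp add: deviates_def)
  have "cont (prefix (Suc t) w) (Suc t) = w (Suc t)"
    using c(2,3) assms(2) by (simp add: deviates_def)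
  then have "cont (prefix (Suc t) w) [0 \<rightarrow> Suc (Suc t)] = prefix (Suc (Suc t)) w" using c(2) by simp
  then show "cont (prefix (Suc (Suc t)) w) [0 \<rightarrow> Suc (Suc t)] = cont (prefix (Suc t) w) [0 \<rightarrow> Suc (Suc t)]"
    using c'(2) by simp
qed

lemma dev_bad:
  assumes "play G w" "play G w'" "w 0 = inp_start I" "i < np" "w' [0 \<rightarrow> Suc t'] = prefix (Suc t') w" "deviates G \<sigma> {i} t' w'"
  shows "(pay G i (cont (prefix (Suc t') w)), pay G i w') \<notin> pref G i"
proof -
  have start': "inp_start I \<in> verts G" using start by (simp add: verts)
  note c = cont_play[OF assms(1), of t']
  have "cont (prefix (Suc t') w) 0 = inp_start I" using prefix_eq_mono(1)[OF c(2), of 0] assms(3) by simp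
  then show ?thesis
    using spe[unfolded SPE_iff_plays[OF arena prof start'], rule_format, of i "cont (prefix (Suc t') w)" w' t']
      assms c players by simp
qed

text \<open>Although \<open>spos\<close> takes an infinite word, its value uses the past only. This
  makes the announcements usable against a Challenger who reacts to them.\<close>

lemma spos_cong:
  assumes "w [0 \<rightarrow> Suc t] = prefix (Suc t) w'"
  shows "spos w t = spos w' t"
proof -
  have e: "w n = w' n" "w [0 \<rightarrow> n] = prefix n w'" if "n <= t" for n
    using prefix_eq_mono[OF assms that] by blast+
  have pre: "w [0 \<rightarrow> Suc n] = prefix (Suc n) w'" if "n <= t" for n using e[OF that] by simp
  have run: "dpa_run D w t = dpa_run D w' t" for D :: "(nat, nat) dpa" using e(2)[of t] by (simp add: dpa_run_foldl)
  show ?thesis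
    unfolding spos_def run by (simp add: e cong: conj_cong imp_cong split: nat.splits)
qed

context
  fixes w
  assumes w: "play G w" "w 0 = inp_start I"
begin

lemma spos_simps: "uv (spos w t) = w t" "uw (spos w t) = joint G \<sigma> (prefix (Suc t) w)"
  "us (spos w t) = map (%ka. dpa_run (dpa_of_table (aut_tab I ka)) w t) [0..<num_aut I]"
  "ux (spos w t) = map (%i. pay G i (cont (prefix (Suc t) w))) [0..<np]"
  "length (uS (spos w t)) = num_aut I"
  by (simp_all add: spos_def)

lemma spos_S: "ka < num_aut I ==> uS (spos w t) ! ka <-> (EX t'<=t. (ALL n. t' <= n --> n < t --> owner G (w n) = aut_pl I ka \<or> w (Suc n) = joint G \<sigma> (prefix (Suc n) w)) &
        (pay G (aut_pl I ka) (cont (prefix (Suc t') w)), aut_py I ka) \<in> pref G (aut_pl I ka))"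
  by (simp add: spos_def)

lemma spos_f: "uf (spos w 0) = 0"
  "uf (spos w (Suc t)) = (if w (Suc t) = joint G \<sigma> (prefix (Suc t) w) then 0 else Suc (owner G (w t)))"
  by (simp_all add: spos_def)

lemma joint_edge: "(w t, joint G \<sigma> (prefix (Suc t) w)) \<in> set (inp_edges I)"
proof -
  have h: "history G (prefix t w @ [w t])" by (rule play_hist[OF w(1)])
  note o = owner_owned[OF arena play_verts[OF w(1), of t]]
  then show ?thesis
    using prof h unfolding is_profile_def is_strategy_def joint_def edges by simp
qed

lemma udev_spos: "ka < num_aut I ==> udev I (ux (spos w t)) ka <->
    (pay G (aut_pl I ka) (cont (prefix (Suc t) w)), aut_py I ka) \<in> pref G (aut_pl I ka)"
  using aut_props(1)[of ka I] pref[of "aut_pl I ka"] by (simp add: udev_def spos_simps)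

lemma spos_dev_S: "ka < num_aut I ==> udev I (ux (spos w t)) ka ==> uS (spos w t) ! ka"
  unfolding spos_S udev_spos by (intro exI[of _ t]) simp

lemma spos_S_Suc: "ka < num_aut I ==> uS (spos w (Suc t)) ! ka <->
    (owner G (w t) = aut_pl I ka \<or> w (Suc t) = joint G \<sigma> (prefix (Suc t) w)) & uS (spos w t) ! ka \<or> udev I (ux (spos w (Suc t))) ka"
  unfolding spos_S udev_spos since_Suc ..

lemma spos_state: "spos w t \<in> ustates I"
proof -
  have "w t < nv" "joint G \<sigma> (prefix (Suc t) w) < nv" using edge_verts[OF joint_edge[of t]] by auto
  moreover have "uf (spos w t) <= np"
    using owner[OF play_lt[OF w(1)]] by (cases t) (auto simp: spos_f Suc_le_eq)
  moreover have "dpa_run (dpa_of_table (aut_tab I ka)) w t < length (tab_prio (aut_tab I ka))" if "ka < num_aut I" for ka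
    using run_range[OF auts that play_words[OF w(1)]] by auto
  ultimately show ?thesis
    using pay_lt[OF play_words[OF cont_play(1)[OF w(1)]]] by (simp add: ustates_def spos_simps del: subsequence_append)
qed

lemma uok_spos: "uok I (ux (spos w t))"
  unfolding uok_def
proof (intro allI impI)
  fix i assume i: "i < np"
  note c = cont_play[OF w(1), of t]
  have "deviates G \<sigma> {i} t (cont (prefix (Suc t) w))" using c(3) by (simp add: deviates_def)
  from dev_bad[OF w(1) c(1) w(2) i c(2) this]
  show "(ux (spos w t) ! i, ux (spos w t) ! i) \<notin> set (inp_prefs I ! i)" using i pref[OF i] by (simp add: spos_simps)
qed

lemma spos_step: "ustep I (spos w t) (w (Suc t)) (spos w (Suc t))"
proof -
  let ?c = "%t. w (Suc t) = joint G \<sigma> (prefix (Suc t) w)"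
  have ow: "owner G (w t) = inp_owner I ! w t" by (rule owner(1)[OF play_lt[OF w(1)]])
  have "us (spos w (Suc t)) = unext I (spos w t)"
    by (auto simp: spos_simps unext_def dpa_of_table_def intro!: map_cong)
  moreover have "ux (spos w (Suc t)) = ux (spos w t) & uS (spos w (Suc t)) = uS (spos w t)" if f: "?c t"
  proof
    note cf = cont_follow[OF w(1) f]
    show "ux (spos w (Suc t)) = ux (spos w t)" unfolding spos_simps cf ..
    show "uS (spos w (Suc t)) = uS (spos w t)"
    proof (rule nth_equalityI)
      fix ka assume "ka < length (uS (spos w (Suc t)))"
      then have ka: "ka < num_aut I" by (simp add: spos_simps)
      show "uS (spos w (Suc t)) ! ka = uS (spos w t) ! ka"
        using spos_S_Suc[OF ka, of t] udev_spos[OF ka, of t] udev_spos[OF ka, of "Suc t"] spos_dev_S[OF ka, of t] f cf by auto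
    qed (simp add: spos_simps)
  qed
  moreover have "uS (spos w (Suc t)) = map (%ka. aut_pl I ka = inp_owner I ! w t & uS (spos w t) ! ka \<or> udev I (ux (spos w (Suc t))) ka) [0..<num_aut I]"
    if f: "~ ?c t"
  proof (rule nth_equalityI)
    fix ka assume "ka < length (uS (spos w (Suc t)))"
    then have ka: "ka < num_aut I" by (simp add: spos_simps)
    have "uS (spos w (Suc t)) ! ka <-> aut_pl I ka = inp_owner I ! w t & uS (spos w t) ! ka \<or> udev I (ux (spos w (Suc t))) ka"
      using spos_S_Suc[OF ka, of t] f ow by auto
    then show "uS (spos w (Suc t)) ! ka = map (%ka. aut_pl I ka = inp_owner I ! w t & uS (spos w t) ! ka \<or> udev I (ux (spos w (Suc t))) ka) [0..<num_aut I] ! ka"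
      using ka by simp
  qed (simp add: spos_simps)
  moreover have "~ uS (spos w t) ! ka" if f: "~ ?c t" and ka: "ka < num_aut I" "aut_pl I ka = inp_owner I ! w t"
    "aut_py I ka = ux (spos w (Suc t)) ! (inp_owner I ! w t)" for ka
  proof
    assume "uS (spos w t) ! ka"
    then obtain t' where t': "t' <= t" "!!n. t' <= n ==> n < t ==> owner G (w n) = aut_pl I ka \<or> ?c n"
      "(pay G (aut_pl I ka) (cont (prefix (Suc t') w)), aut_py I ka) \<in> pref G (aut_pl I ka)"
      unfolding spos_S[OF ka(1)] by blast
    let ?w' = "cont (prefix (Suc (Suc t)) w)"
    note c = cont_play[OF w(1), of "Suc t"]
    have e: "?w' n = w n" "?w' [0 \<rightarrow> n] = prefix n w" if "n <= Suc t" for n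
      using prefix_eq_mono[OF c(2) that] by blast+
    \<comment> \<open>By the choice of \<open>t'\<close> only this player deviates before time t,
      the step at t is a deviation of the same player, and the continuation follows the profile
      afterwards. The new label is thus the result of a deviation by one player from
      \<open>t'\<close>.\<close>
    have "deviates G \<sigma> {aut_pl I ka} t' ?w'"
      unfolding deviates_def
    proof (intro allI impI)
      fix n assume n: "t' <= n" "owner G (?w' n) \<notin> {aut_pl I ka}"
      consider "n < t" | "n = t" | "n >= Suc t" by linarith
      then show "?w' (Suc n) = joint G \<sigma> (prefix (Suc n) ?w')"
      proof cases
        case 1
        then show ?thesis using t'(2)[OF n(1)] n(2) e[of n] e[of "Suc n"] by simp
      next
        case 2
        then show ?thesis using n(2) ka(2) ow e(1)[of n] by simp
      next
        case 3
        then show ?thesis using c(3) by (simp add: deviates_def)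
      qed
    qed
    moreover have "?w' [0 \<rightarrow> Suc t'] = prefix (Suc t') w" using e(2)[of "Suc t'"] t'(1) by simp
    moreover note pl = aut_props(1)[OF ka(1)]
    ultimately have "(pay G (aut_pl I ka) (cont (prefix (Suc t') w)), pay G (aut_pl I ka) ?w') \<notin> pref G (aut_pl I ka)"
      using dev_bad[OF w(1) c(1) w(2)] by blast
    then show False using t'(3) ka pl by (simp add: spos_simps)
  qed
  ultimately show ?thesis
    using joint_edge[of "Suc t"] uok_spos[of "Suc t"] ow unfolding ustep_def spos_simps(1,2) spos_f by auto
qed

text \<open>Let a payoff be obtained whose \<open>fgreen\<close> stops. Either its player deviates
  at a later time with the payoff recorded: then, from the witness of that record onwards, only this
  player deviates, and profitably, against the equilibrium. Or the profile is followed from some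
  time on, and the payoff is the announced one.\<close>

lemma spos_streett: "streett (npr I) (ured I) (ugreen I) (spos w)"
proof -
  have "us (spos w 0) = map (%ka. tab_init (aut_tab I ka)) [0..<num_aut I]"
    by (simp add: spos_simps dpa_of_table_def)
  moreover have "us (spos w (Suc t)) = unext I (spos w t)" for t using spos_step[of t] by (simp add: ustep_def)
  moreover have "INFM t. fgreen I ka (spos w t)" if ka: "ka < num_aut I" "pay G (aut_pl I ka) w = aut_py I ka" for ka
  proof (rule ccontr)
    assume "~ ?thesis"
    then obtain T where T: "!!t. T <= t ==> ~ fgreen I ka (spos w t)" by (auto simp: INFM_nat_le)
    note pl = aut_props(1)[OF ka(1)]
    let ?c = "%t. w (Suc t) = joint G \<sigma> (prefix (Suc t) w)"
    have fl: "uf (spos w t) = 0 \<or> uf (spos w t) = Suc (aut_pl I ka) & uS (spos w t) ! ka" if "T <= t" for t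
      using T[OF that] by (auto simp: fgreen_def split: if_splits)
    have dv: "?c t \<or> owner G (w t) = aut_pl I ka" if "T <= t" for t
      using fl[of "Suc t"] that by (auto simp: spos_f split: if_splits)
    show False
    proof (cases "EX t>=T. uf (spos w t) ~= 0")
      case True
      then obtain t where "t >= T" "uf (spos w t) ~= 0" by (elim exE conjE)
      then have t: "t >= T" "uS (spos w t) ! ka" using fl[of t] by simp_all
      then obtain t' where t': "t' <= t" "!!n. t' <= n ==> n < t ==> owner G (w n) = aut_pl I ka \<or> ?c n"
        "(pay G (aut_pl I ka) (cont (prefix (Suc t') w)), aut_py I ka) \<in> pref G (aut_pl I ka)"
        unfolding spos_S[OF ka(1)] by blast
      have "?c n \<or> owner G (w n) = aut_pl I ka" if "t' <= n" for n
        using t'(2)[OF that] dv[of n] t(1) by (cases "n < t") auto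
      then have "deviates G \<sigma> {aut_pl I ka} t' w" by (auto simp: deviates_def)
      then show False using dev_bad[OF w(1) w(1) w(2) pl refl] t'(3) ka(2) by simp
    next
      case False
      then have c: "?c t" if "T <= t" for t using that spos_f(2)[of t] by (metis le_SucI nat.distinct(1))
      then have "deviates G \<sigma> {} T w" by (simp add: deviates_def)
      then have "cont (prefix (Suc T) w) = w" by (rule cont_unique[OF w(1)])
      then have "ux (spos w T) ! aut_pl I ka = aut_py I ka" using ka(2) pl by (simp add: spos_simps)
      moreover have "uf (spos w T) = 0" using False by auto
      ultimately show False using T[of T] by (simp add: fgreen_def)
    qed
  qed
  ultimately show ?thesis using streett_pay_iff[OF w(1), of "spos w"] spos_simps(1) by simp
qed

end

lemma spos_win:
  assumes \<tau>: "!!h u. u \<in> ustates I ==> \<tau> (h @ [u]) \<in> umoves I u"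
  shows "EX w. play G w & w 0 = inp_start I & (ALL n. w (Suc n) = \<tau> (map (spos w) [0..<Suc n]))"
proof -
  \<comment> \<open>Play and replies of Challenger determine each other, so finite histories are
    extended step by step. Reading a history by \<open>!\<close> as an infinite word is arbitrary
    beyond its end, which does no harm by \<open>spos_cong\<close>.\<close>
  define H where "H = rec_nat [inp_start I] (%n h. h @ [\<tau> (map (spos (%j. h ! j)) [0..<Suc n])])"
  have H: "H 0 = [inp_start I]" "H (Suc n) = H n @ [\<tau> (map (spos (%j. H n ! j)) [0..<Suc n])]" for n
    by (simp_all add: H_def)
  define w where "w n = last (H n)" for n
  have len: "length (H n) = Suc n" for n by (induction n) (simp_all add: H)
  have pre: "H n = prefix (Suc n) w" for n
    by (induction n) (simp_all add: H w_def)
  have sp: "map (spos (%j. H n ! j)) [0..<Suc n] = map (spos w) [0..<Suc n]" for n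
  proof (rule map_cong[OF refl])
    fix j assume j: "j \<in> set [0..<Suc n]"
    show "spos (%j. H n ! j) j = spos w j"
    proof (rule spos_cong, rule nth_equalityI)
      fix l assume "l < length ((%j. H n ! j) [0 \<rightarrow> Suc j])"
      then show "(%j. H n ! j) [0 \<rightarrow> Suc j] ! l = prefix (Suc j) w ! l"
        using j by (auto simp: pre subsequence_def simp del: upt_Suc)
    qed simp
  qed
  have st: "w (Suc n) = \<tau> (map (spos w) [0..<Suc n])" for n
    unfolding sp[of n, symmetric] w_def[of "Suc n"] H(2)[of n] by (rule last_snoc)
  have hist: "history G (prefix (Suc n) w)" for n
  proof (induction n)
    case 0
    then show ?case using start by (simp add: history_def verts w_def H)
  next
    case (Suc n)
    note c = cont_ex[OF Suc]
    let ?w = "cont (prefix (Suc n) w)"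
    have pw: "?w [0 \<rightarrow> Suc n] = prefix (Suc n) w" using c(2) by simp
    have p: "play G ?w" using c(1) by simp
    have w0: "?w 0 = inp_start I" using prefix_eq_mono(1)[OF pw, of 0] by (simp add: w_def H)
    have "spos w n \<in> ustates I" "uv (spos w n) = w n"
      using spos_state[OF p w0, of n] spos_simps(1)[OF p w0, of n] spos_cong[OF pw] prefix_eq_mono(1)[OF pw, of n] by simp_all
    then have "(w n, w (Suc n)) \<in> set (inp_edges I)"
      using \<tau>[of "spos w n" "map (spos w) [0..<n]"] unfolding st by (simp add: umoves_def)
    then show ?case using Suc edge_verts[of "w n" "w (Suc n)"]
      by (auto simp: history_def successively_append_iff verts edges)
  qed
  have "w n \<in> verts G & (w n, w (Suc n)) \<in> edges G" for n
    using hist[of "Suc n"] by (auto simp: history_def successively_append_iff)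
  then have "play G w" by (auto simp: play_def omega_words_def)
  moreover have "w 0 = inp_start I" by (simp add: w_def H)
  ultimately show ?thesis using st by blast
qed

end

theorem SPE_iff_bsafe:
  assumes K: "card (ustates I) * 2 ^ (npr I * npr I) <= K"
  shows "constrained_SPE_exists G (inp_start I) (%i. inp_constr I ! i) <->
    (EX u W. uinit I u & uwin I K W & (u, replicate (npr I) 0) \<in> W)"
proof
  assume "constrained_SPE_exists G (inp_start I) (%i. inp_constr I ! i)"
  then obtain \<sigma> where spe: "subgame_perfect_equilibrium G \<sigma> (inp_start I)"
    and con: "!!i. i < np ==> inp_constr I ! i = pay G i (outcome G \<sigma> (inp_start I)) \<or>
      (inp_constr I ! i, pay G i (outcome G \<sigma> (inp_start I))) \<in> pref G i"
    by (auto simp: constrained_SPE_exists_def players)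
  then have prof: "is_profile G \<sigma>" by (simp add: subgame_perfect_equilibrium_def)
  note ps = prof spe
  have "history G [inp_start I]" using start by (simp add: history_def verts)
  note c = cont_ex[OF ps this, simplified]
  let ?w = "cont \<sigma> [inp_start I]"
  have w0: "?w 0 = inp_start I" using c(2) by (simp add: subsequence_def)
  have out: "outcome G \<sigma> (inp_start I) = ?w" using outcome_deviates[OF arena prof c(1,3)] w0 by simp
  let ?u = "spos \<sigma> ?w 0"
  note s = spos_simps[OF ps c(1) w0] and dev = udev_spos[OF ps c(1) w0]
  have x0: "ux ?u ! i = pay G i ?w" if "i < np" for i
    using that w0 by (simp add: s)
  have "uS ?u = map (udev I (ux ?u)) [0..<num_aut I]"
    by (rule nth_equalityI) (simp_all add: s(5) spos_S[OF ps c(1) w0] dev)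
  moreover have "inp_constr I ! i = ux ?u ! i \<or> (inp_constr I ! i, ux ?u ! i) \<in> set (inp_prefs I ! i)" if "i < np" for i
    using con[OF that] x0[OF that] pref[OF that] out by simp
  moreover have "(inp_start I, uw ?u) \<in> set (inp_edges I)" using joint_edge[OF ps c(1) w0, of 0] w0 by (simp add: s)
  moreover have "us ?u = map (%ka. tab_init (aut_tab I ka)) [0..<num_aut I]" by (simp add: s dpa_of_table_def)
  ultimately have init: "uinit I ?u"
    using uok_spos[OF ps c(1) w0, of 0] spos_f(1)[OF ps c(1) w0] s(1)[of 0] w0 by (simp only: uinit_def) simp
  have "EX W. uwin I K W & (?u, replicate (npr I) 0) \<in> W"
  proof (rule bsafe_exists[OF finite_ustates _ _ _ _ K])
    fix u assume u: "u \<in> ustates I"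
    then show "umoves I u ~= {}" using total[of "uv u"] by (auto simp: umoves_def ustates_def)
    have "umoves I u \<subseteq> snd ` set (inp_edges I)" by (force simp: umoves_def)
    then show "finite (umoves I u)" by (rule finite_subset) simp
  next
    show "spos \<sigma> ?w 0 \<in> ustates I" by (rule spos_state[OF ps c(1) w0])
  next
    fix \<tau> assume "!!h u. u \<in> ustates I ==> \<tau> (h @ [u]) \<in> umoves I u"
    then obtain w where w: "play G w" "w 0 = inp_start I" "!!n. w (Suc n) = \<tau> (map (spos \<sigma> w) [0..<Suc n])"
      using spos_win[OF ps, of \<tau>] by blast
    have "spos \<sigma> w 0 = ?u" by (rule spos_cong[OF ps]) (simp add: w(2) w0)
    moreover have "spos \<sigma> w (Suc n) \<in> uresp I (spos \<sigma> w n) (\<tau> (map (spos \<sigma> w) [0..<Suc n]))" for n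
      using spos_step[OF ps w(1,2), of n] spos_state[OF ps w(1,2), of "Suc n"] w(3)[of n] by (simp add: uresp_def)
    moreover note spos_streett[OF ps w(1,2)]
    ultimately show "\<exists>\<rho>. \<rho> 0 = spos \<sigma> ?w 0 & (ALL n. \<rho> (Suc n) \<in> uresp I (\<rho> n) (\<tau> (map \<rho> [0..<Suc n]))) &
        streett (npr I) (ured I) (ugreen I) \<rho>"
      by (intro exI[of _ "spos \<sigma> w"] conjI allI)
  qed (auto simp: uresp_def)
  then show "EX u W. uinit I u & uwin I K W & (u, replicate (npr I) 0) \<in> W" using init by blast
next
  assume "EX u W. uinit I u & uwin I K W & (u, replicate (npr I) 0) \<in> W"
  then show "constrained_SPE_exists G (inp_start I) (%i. inp_constr I ! i)" using bsafe_SPE by blast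
qed

end

section \<open>Membership: recognising inputs and the decision procedure\<close>

section \<open>Recognising instances\<close>

definition wf_input :: "rp_input => bool" where
  "wf_input I <->
     (\<forall>e\<in>set (inp_edges I). fst e < nve I & snd e < nve I) &
     (\<forall>u<nve I. \<exists>e\<in>set (inp_edges I). fst e = u) &
     (\<forall>i\<in>set (inp_owner I). i < npl I) & length (inp_prefs I) = npl I &
     (\<forall>i<npl I. \<forall>e\<in>set (inp_prefs I ! i). fst e < length (inp_auts I ! i) & snd e < length (inp_auts I ! i)) &
     (\<forall>ka<num_aut I. wf_table (nve I) (aut_tab I ka)) &
     inp_start I < nve I & length (inp_constr I) = npl I &
     (\<forall>i<npl I. inp_constr I ! i < length (inp_auts I ! i))"

text \<open>An input contains automata but no payoff functions. These exist iff, for each player,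
  every word accepted or not by a play is classified by exactly one automaton; words that are not
  plays count as well.\<close>

definition unambiguous :: "rp_input => bool" where
  "unambiguous I <-> (\<forall>w\<in>omega_words {..<nve I}. \<forall>i<npl I.
     EX! p. p < length (inp_auts I ! i) & w \<in> dpa_lang {..<nve I} (dpa_of_table (inp_auts I ! i ! p)))"

lemma instance_wf:
  assumes "is_instance I G"
  shows "wf_input I & unambiguous I"
proof -
  interpret spe_instance I G by standard (rule assms)
  have "\<forall>i\<in>set (inp_owner I). i < np" using owner(2) by (metis in_set_conv_nth)
  moreover have "fst e < length (inp_auts I ! i) & snd e < length (inp_auts I ! i)" if "i < np" "e \<in> set (inp_prefs I ! i)" for i e
  proof -
    have "pref G i \<subseteq> payoffs G i \<times> payoffs G i"
      using inst that(1) by (auto simp: is_instance_def rp_game_def is_game_def players)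
    then show ?thesis using that(2) unfolding pref[OF that(1)] payoffs[OF that(1)] by auto
  qed
  moreover have "EX! p. p < length (inp_auts I ! i) & w \<in> dpa_lang {..<nv} (dpa_of_table (inp_auts I ! i ! p))"
    if w: "w \<in> omega_words {..<nv}" and i: "i < np" for w i
  proof (rule ex1I[of _ "pay G i w"])
    have *: "w \<in> dpa_lang {..<nv} (dpa_of_table (inp_auts I ! i ! p)) <-> pay G i w = p" if "p < length (inp_auts I ! i)" for p
      using pay_iff[OF w] aut_index[OF i that] aut_props by metis
    show "pay G i w < length (inp_auts I ! i) & w \<in> dpa_lang {..<nv} (dpa_of_table (inp_auts I ! i ! pay G i w))"
      using * pay_lt[OF w i] by blast
    show "p = pay G i w" if "p < length (inp_auts I ! i) & w \<in> dpa_lang {..<nv} (dpa_of_table (inp_auts I ! i ! p))" for p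
      using * that by blast
  qed
  moreover have "\<forall>u<nv. \<exists>e\<in>set (inp_edges I). fst e = u" using total by (metis fst_conv)
  moreover have "\<forall>e\<in>set (inp_edges I). fst e < nv & snd e < nv" using edge_verts by auto
  moreover have "length (inp_prefs I) = np" "length (inp_constr I) = np" "\<forall>i<np. inp_constr I ! i < length (inp_auts I ! i)"
    using inst payoffs by (auto simp: is_instance_def represents_def)
  ultimately show ?thesis
    using auts start unfolding wf_input_def unambiguous_def aut_ok_def by (intro conjI ballI allI impI) simp_all
qed

lemma wf_instance:
  assumes wf: "wf_input I" and un: "unambiguous I"
  shows "EX G. is_instance I G"
proof -
  let ?n = "nve I" and ?k = "npl I"
  define acc where "acc i w p <-> p < length (inp_auts I ! i) & w \<in> dpa_lang {..<?n} (dpa_of_table (inp_auts I ! i ! p))" for i w p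
  define G :: "(nat, nat, nat) game" where "G = \<lparr>verts = {..<?n}, edges = set (inp_edges I), players = {..<?k},
     owned = (%i. {v. v < ?n & inp_owner I ! v = i}), payoffs = (%i. {..<length (inp_auts I ! i)}),
     pref = (%i. set (inp_prefs I ! i)), pay = (%i w. THE p. acc i w p)\<rparr>"
  have pay: "acc i w (pay G i w)" "acc i w p <-> pay G i w = p" if "w \<in> omega_words {..<?n}" "i < ?k" for i w p
  proof -
    have "EX! p. acc i w p"
      using bspec[OF un[unfolded unambiguous_def] that(1)] that(2) unfolding acc_def by simp
    note t = theI'[OF this] the1_equality[OF this]
    show a: "acc i w (pay G i w)" using t(1) by (simp add: G_def)
    show "acc i w p <-> pay G i w = p" using a t(2)[of p] by (auto simp: G_def)
  qed
  have tab: "wf_table ?n (inp_auts I ! i ! p)" if "i < ?k" "p < length (inp_auts I ! i)" for i p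
    using aut_index[OF that] aut_props(3) wf unfolding wf_input_def by metis
  have lang: "dpa_lang {..<?n} (dpa_of_table (inp_auts I ! i ! p)) = pay_preimage G i p"
    if "i < ?k" "p < length (inp_auts I ! i)" for i p
  proof -
    have "w \<in> dpa_lang {..<?n} (dpa_of_table (inp_auts I ! i ! p)) <-> pay G i w = p" if "w \<in> omega_words {..<?n}" for w
      using pay(2)[OF that \<open>i < ?k\<close>, of p] \<open>p < _\<close> by (simp add: acc_def)
    then show ?thesis by (auto simp: pay_preimage_def G_def dpa_lang_def)
  qed
  have "is_arena G"
    using wf by (auto simp: is_arena_def G_def wf_input_def disjoint_family_on_def) (metis prod.collapse)
  moreover have "\<forall>i\<in>players G. pref G i \<subseteq> payoffs G i \<times> payoffs G i"
    using wf by (fastforce simp: G_def wf_input_def)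
  moreover have "\<forall>i\<in>players G. \<forall>w\<in>omega_words (verts G). pay G i w \<in> payoffs G i"
    using pay(1) by (auto simp: G_def acc_def)
  moreover have "omega_regular (verts G) (pay_preimage G i p)" if "i \<in> players G" "p \<in> payoffs G i" for i p
  proof -
    have "i < ?k" "p < length (inp_auts I ! i)" using that by (simp_all add: G_def)
    from lang[OF this] tab[OF this] show ?thesis unfolding omega_regular_def wf_table_def
      by (intro exI[of _ "dpa_of_table (inp_auts I ! i ! p)"]) (simp add: G_def)
  qed
  moreover have "finite (payoffs G i)" for i by (simp add: G_def)
  ultimately have "rp_game G" unfolding rp_game_def is_game_def by blast
  moreover have "represents I G"
    using lang tab wf by (simp add: represents_def G_def wf_input_def)
  ultimately show ?thesis using wf by (auto simp: is_instance_def wf_input_def G_def)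
qed

text \<open>
  An input is ambiguous iff Prover wins the game in which she alone chooses a word, having announced
  in \<open>uf\<close> a player and in \<open>uS\<close> the automata that accept it.
\<close>

definition vstep :: "rp_input => ustate => nat => ustate => bool" where
  "vstep I u a u' <-> us u' = unext I u & uS u' = uS u & uf u' = uf u"

text \<open>A state is red if its parity contradicts the announced verdict: an even state where
  rejection is announced, an odd one where acceptance is.\<close>

definition vred :: "rp_input => nat => ustate => bool" where
  "vred I r u <-> aut_pl I (fst (pairs I ! r)) = uf u & us u ! fst (pairs I ! r) = snd (pairs I ! r) &
     even (upri I r (snd (pairs I ! r))) = (~ uS u ! fst (pairs I ! r))"

definition vgreen :: "rp_input => nat => ustate => bool" where
  "vgreen I r u <-> upri I r (us u ! fst (pairs I ! r)) > upri I r (snd (pairs I ! r))"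

definition vinit :: "rp_input => ustate => bool" where
  "vinit I u <-> us u = map (%ka. tab_init (aut_tab I ka)) [0..<num_aut I] & uf u < npl I &
     ~ (\<exists>ka<num_aut I. (aut_pl I ka = uf u & uS u ! ka) &
         (\<forall>ka'<num_aut I. aut_pl I ka' = uf u & uS u ! ka' --> aut_py I ka' = aut_py I ka))"

definition vresp :: "rp_input => ustate => nat => ustate set" where
  "vresp I u a = {u' \<in> ustates I. vstep I u a u'}"

definition vmoves :: "rp_input => ustate => nat set" where
  "vmoves I u = {..<nve I}"

abbreviation "vwin I K W \<equiv> bsafe (npr I) (vred I) (vgreen I) (ustates I) (vmoves I) (vresp I) K W"

lemma vstreett_iff:
  assumes "aut_ok I" "w \<in> omega_words {..<nve I}"
    and run: "!!ka t. ka < num_aut I ==> us (u t) ! ka = dpa_run (dpa_of_table (aut_tab I ka)) w t"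
    and const: "!!t. uS (u t) = S" "!!t. uf (u t) = i"
  shows "streett (npr I) (vred I) (vgreen I) u <->
    (\<forall>ka<num_aut I. aut_pl I ka = i -->
      (w \<in> dpa_lang {..<nve I} (dpa_of_table (aut_tab I ka))) = S ! ka)" (is "?l <-> ?r")
proof -
  note L = lang_iff[OF assms(1) _ assms(2) run]
  have red: "(INFM t. vred I r (u t)) <-> aut_pl I (fst (pairs I ! r)) = i & even (upri I r (snd (pairs I ! r))) ~= S ! fst (pairs I ! r) &
      (INFM t. us (u t) ! fst (pairs I ! r) = snd (pairs I ! r))" for r
    by (auto simp: vred_def const)
  show ?thesis
  proof
    assume l: ?l
    show ?r
    proof (intro allI impI)
      fix ka assume k: "ka < num_aut I" "aut_pl I ka = i"
      show "(w \<in> dpa_lang {..<nve I} (dpa_of_table (aut_tab I ka))) = S ! ka"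
        unfolding L[OF k(1) k(1)]
        using l red unfolding streett_def vgreen_def using k(2) by auto
    qed
  next
    assume r: ?r
    show ?l
      unfolding streett_def red
    proof (intro allI impI)
      fix j assume j: "j < npr I" "aut_pl I (fst (pairs I ! j)) = i & even (upri I j (snd (pairs I ! j))) ~= S ! fst (pairs I ! j) &
        (INFM t. us (u t) ! fst (pairs I ! j) = snd (pairs I ! j))"
      note k = pairs_nth(1)[OF j(1)]
      have "(w \<in> dpa_lang {..<nve I} (dpa_of_table (aut_tab I (fst (pairs I ! j))))) = S ! fst (pairs I ! j)"
        using r j k by blast
      then show "INFM t. vgreen I j (u t)" using L[OF k k, of "S ! fst (pairs I ! j)"] j by (simp add: vgreen_def)
    qed
  qed
qed

text \<open>\<open>vstep\<close> does not look at Challenger's move, so a region of Prover contains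
  an infinite path, which is found by always answering the move 0. The vertices along this path
  spell the word whose verdicts Prover has announced.\<close>

theorem unambiguous_iff:
  assumes wf: "wf_input I" and K: "card (ustates I) * 2 ^ (npr I * npr I) <= K"
  shows "~ unambiguous I <-> (EX u W. vinit I u & vwin I K W & (u, replicate (npr I) 0) \<in> W)"
proof -
  let ?n = "nve I" and ?k = "npr I" and ?np = "npl I"
  have ok: "aut_ok I" using wf by (simp add: wf_input_def aut_ok_def)
  have n0: "0 < ?n" using wf by (auto simp: wf_input_def)
  let ?acc = "%w ka. w \<in> dpa_lang {..<?n} (dpa_of_table (aut_tab I ka))"
  have ex1: "(EX! p. p < length (inp_auts I ! i) & w \<in> dpa_lang {..<?n} (dpa_of_table (inp_auts I ! i ! p))) <->
      (\<exists>ka<num_aut I. (aut_pl I ka = i & ?acc w ka) & (\<forall>ka'<num_aut I. aut_pl I ka' = i & ?acc w ka' --> aut_py I ka' = aut_py I ka))"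
    if "i < ?np" for w i
  proof -
    define Q where "Q p <-> p < length (inp_auts I ! i) & w \<in> dpa_lang {..<?n} (dpa_of_table (inp_auts I ! i ! p))" for p
    have Q: "Q p <-> (\<exists>ka<num_aut I. aut_pl I ka = i & ?acc w ka & aut_py I ka = p)" for p
      using aut_index[OF that, of p] aut_props unfolding Q_def by metis
    have "(EX! p. Q p) <-> (\<exists>ka<num_aut I. (aut_pl I ka = i & ?acc w ka) & (\<forall>ka'<num_aut I. aut_pl I ka' = i & ?acc w ka' --> aut_py I ka' = aut_py I ka))"
      unfolding Ex1_def Q by blast
    then show ?thesis by (simp only: Q_def)
  qed
  show ?thesis
  proof
    assume "~ unambiguous I"
    then obtain w i where w: "w \<in> omega_words {..<?n}" and i: "i < ?np"
      and ne: "~ (EX! p. p < length (inp_auts I ! i) & w \<in> dpa_lang {..<?n} (dpa_of_table (inp_auts I ! i ! p)))"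
      unfolding unambiguous_def by blast
    \<comment> \<open>The second and fourth components are filled with values that
      \<open>wf_input\<close> guarantees to be in range.\<close>
    define u :: "nat => ustate" where "u t = (w t, 0, map (%ka. dpa_run (dpa_of_table (aut_tab I ka)) w t) [0..<num_aut I],
      inp_constr I, map (?acc w) [0..<num_aut I], i)" for t
    have wn: "w t < ?n" for t using w by (auto simp: omega_words_def)
    have run: "dpa_run (dpa_of_table (aut_tab I ka)) w t < length (tab_prio (aut_tab I ka))" if "ka < num_aut I" for ka t
      using run_range[OF ok that w] by auto
    have U: "u t \<in> ustates I" for t
      using wf wn n0 run i by (simp add: u_def ustates_def wf_input_def)
    have "streett ?k (vred I) (vgreen I) u"
      by (subst vstreett_iff[OF ok w, of u "map (?acc w) [0..<num_aut I]" i]) (simp_all add: u_def)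
    moreover have "u (Suc t) \<in> vresp I (u t) a" for t a
    proof -
      have "vstep I (u t) a (u (Suc t))" by (simp add: vstep_def u_def unext_def dpa_of_table_def)
      then show ?thesis using U by (simp add: vresp_def)
    qed
    ultimately have "EX W. vwin I K W & (u 0, replicate ?k 0) \<in> W"
      by (intro bsafe_exists[OF finite_ustates _ _ _ _ K]) (use n0 U in \<open>auto simp: vmoves_def vresp_def\<close>)
    moreover have "vinit I (u 0)"
    proof -
      have S: "uS (u 0) ! ka <-> ?acc w ka" if "ka < num_aut I" for ka using that by (simp add: u_def)
      have f: "uf (u 0) = i" "us (u 0) = map (%ka. tab_init (aut_tab I ka)) [0..<num_aut I]"
        by (simp_all add: u_def dpa_of_table_def)
      show ?thesis using ne i S unfolding ex1[OF i] vinit_def f by (metis (no_types, lifting))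
    qed
    ultimately show "EX u W. vinit I u & vwin I K W & (u, replicate ?k 0) \<in> W" by blast
  next
    assume "EX u W. vinit I u & vwin I K W & (u, replicate ?k 0) \<in> W"
    then obtain u W where uW: "vinit I u" "vwin I K W" "(u, replicate ?k 0) \<in> W" by blast
    have "EX y'. y' \<in> W & vstep I (fst y) 0 (fst y') & snd y' = upc ?k (vred I) (vgreen I) (snd y) (fst y')" if "y \<in> W" for y
    proof -
      have "\<forall>a\<in>vmoves I (fst y). \<exists>u'\<in>vresp I (fst y) a. (u', upc ?k (vred I) (vgreen I) (snd y) u') \<in> W"
        using uW(2) that unfolding bsafe_def by (cases y) auto
      then obtain u' where "vstep I (fst y) 0 u'" "(u', upc ?k (vred I) (vgreen I) (snd y) u') \<in> W"
        using n0 unfolding vmoves_def vresp_def by blast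
      then show ?thesis by (intro exI[of _ "(u', upc ?k (vred I) (vgreen I) (snd y) u')"]) simp
    qed
    then obtain g where g: "!!y. y \<in> W ==> g y \<in> W & vstep I (fst y) 0 (fst (g y)) &
        snd (g y) = upc ?k (vred I) (vgreen I) (snd y) (fst (g y))" by metis
    define f where "f t = (g ^^ t) (u, replicate ?k 0)" for t
    have fW: "f t \<in> W" for t by (induction t) (use uW(3) g in \<open>simp_all add: f_def\<close>)
    have f: "ALL t. f t \<in> W" "f 0 = (u, replicate ?k 0)" "!!t. vstep I (fst (f t)) 0 (fst (f (Suc t)))"
      "!!t. snd (f (Suc t)) = upc ?k (vred I) (vgreen I) (snd (f t)) (fst (f (Suc t)))"
      using fW g[OF fW] by (simp_all add: f_def)
    let ?u = "%t. fst (f t)"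
    define w where "w t = uv (?u t)" for t
    have sub: "f t \<in> ustates I \<times> counts ?k K" for t using f(1) uW(2) unfolding bsafe_def by blast
    have "snd (f t) = cnt ?k (vred I) (vgreen I) (replicate ?k 0) ?u t" for t
      by (induction t) (simp_all add: f)
    then have st: "streett ?k (vred I) (vgreen I) ?u"
      using sub by (intro bounded_streett[where c = "replicate ?k 0" and K = K]) (metis mem_Times_iff)
    have wo: "w \<in> omega_words {..<?n}" using sub by (auto simp: omega_words_def w_def ustates_def mem_Times_iff)
    have const: "uS (?u t) = uS u" "uf (?u t) = uf u" for t
      by (induction t) (use f in \<open>simp_all add: vstep_def\<close>)
    have run: "us (?u t) ! ka = dpa_run (dpa_of_table (aut_tab I ka)) w t" if "ka < num_aut I" for ka t
      by (rule unext_run[OF _ _ _ that]) (use f uW(1) in \<open>simp_all add: vstep_def vinit_def w_def\<close>)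
    have S: "?acc w ka <-> uS u ! ka" if "ka < num_aut I" "aut_pl I ka = uf u" for ka
      using vstreett_iff[OF ok wo run const] st that by simp
    have i: "uf u < ?np" using uW(1) by (simp add: vinit_def)
    have "~ (\<exists>ka<num_aut I. (aut_pl I ka = uf u & ?acc w ka) & (\<forall>ka'<num_aut I. aut_pl I ka' = uf u & ?acc w ka' --> aut_py I ka' = aut_py I ka))"
      using uW(1) S unfolding vinit_def by (metis (no_types, lifting))
    then show "~ unambiguous I" using wo i unfolding ex1[OF i, symmetric] unambiguous_def by blast
  qed
qed

theorem SPE_problem_iff:
  assumes K: "wf_input I ==> card (ustates I) * 2 ^ (npr I * npr I) <= K"
  shows "enc_input I \<in> constrained_SPE_problem <-> wf_input I &
    ~ (EX u W. vinit I u & vwin I K W & (u, replicate (npr I) 0) \<in> W) &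
    (EX u W. uinit I u & uwin I K W & (u, replicate (npr I) 0) \<in> W)"
proof -
  have "enc_input I \<in> constrained_SPE_problem <->
      (EX G. is_instance I G & constrained_SPE_exists G (inp_start I) (%i. inp_constr I ! i))"
    using inj_enc_input by (auto simp: constrained_SPE_problem_def inj_def)
  also have "\<dots> <-> (EX G. is_instance I G) & wf_input I & (EX u W. uinit I u & uwin I K W & (u, replicate (npr I) 0) \<in> W)"
    using spe_instance.SPE_iff_bsafe[of I _ K] K instance_wf unfolding spe_instance_def by meson
  finally show ?thesis using instance_wf wf_instance unambiguous_iff[OF _ K] by blast
qed

section \<open>Greatest fixpoints by iterated filtering\<close>

text \<open>A round that changes the list shortens it, so as many rounds as the list has entries
  reach the fixpoint.\<close>

definition gfp_list :: "'a list => ('q => 'a => 'q => bool) => 'q list => 'q list" where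
  "gfp_list As R P = ((%W. filter (%q. \<forall>a\<in>set As. \<exists>q'\<in>set W. R q a q') W) ^^ length P) P"

lemma funpow_filter_sub:
  "set (((%W. filter (Q W) W) ^^ n) P) \<subseteq> set P & length (((%W. filter (Q W) W) ^^ n) P) <= length P"
proof (induction n)
  case (Suc n)
  then show ?case using le_trans[OF length_filter_le] by fastforce
qed simp

lemma funpow_filter_fixed:
  assumes "length P <= n"
  shows "filter (Q (((%W. filter (Q W) W) ^^ n) P)) (((%W. filter (Q W) W) ^^ n) P) = ((%W. filter (Q W) W) ^^ n) P"
proof -
  let ?f = "%W. filter (Q W) W"
  have "?f ((?f ^^ n) P) = (?f ^^ n) P \<or> length ((?f ^^ n) P) + n <= length P" for n
  proof (induction n)
    case (Suc n)
    show ?case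
    proof (cases "?f ((?f ^^ n) P) = (?f ^^ n) P")
      case False
      then have "length (?f ((?f ^^ n) P)) < length ((?f ^^ n) P)"
        unfolding filter_id_conv by (auto intro: length_filter_less)
      then show ?thesis using Suc False by auto
    qed simp
  qed simp
  from this[of n] show ?thesis
  proof
    assume "length ((?f ^^ n) P) + n <= length P"
    then have "length ((?f ^^ n) P) = 0" using assms by linarith
    then show ?thesis by simp
  qed
qed

lemma gfp_list_iff:
  "q \<in> set (gfp_list As R P) <-> (EX W. q \<in> W & W \<subseteq> set P & (\<forall>q\<in>W. \<forall>a\<in>set As. \<exists>q'\<in>W. R q a q'))"
proof
  let ?Q = "%W q. \<forall>a\<in>set As. \<exists>q'\<in>set W. R q a q'"
  let ?f = "%W. filter (?Q W) W"
  {
    assume q: "q \<in> set (gfp_list As R P)"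
    have fx: "?f (gfp_list As R P) = gfp_list As R P"
      unfolding gfp_list_def by (rule funpow_filter_fixed) simp
    have "?Q (gfp_list As R P) q" if "q \<in> set (gfp_list As R P)" for q
    proof -
      have "q \<in> set (?f (gfp_list As R P))" unfolding fx by (rule that)
      then show ?thesis by simp
    qed
    moreover have "set (gfp_list As R P) \<subseteq> set P"
      unfolding gfp_list_def using funpow_filter_sub[where Q = ?Q] by (rule conjunct1)
    ultimately show "EX W. q \<in> W & W \<subseteq> set P & (\<forall>q\<in>W. \<forall>a\<in>set As. \<exists>q'\<in>W. R q a q')"
      using q by (intro exI[of _ "set (gfp_list As R P)"] conjI ballI) blast+
  next
    assume "EX W. q \<in> W & W \<subseteq> set P & (\<forall>q\<in>W. \<forall>a\<in>set As. \<exists>q'\<in>W. R q a q')"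
    then obtain W where W: "q \<in> W" "W \<subseteq> set P" "\<forall>q\<in>W. \<forall>a\<in>set As. \<exists>q'\<in>W. R q a q'" by blast
    have "W \<subseteq> set ((?f ^^ n) P)" for n
    proof (induction n)
      case (Suc n)
      then have "\<forall>q\<in>W. \<forall>a\<in>set As. \<exists>q'\<in>set ((?f ^^ n) P). R q a q'" using W(3) by blast
      then show ?case using Suc by auto
    qed (simp add: W(2))
    then show "q \<in> set (gfp_list As R P)" using W(1) unfolding gfp_list_def by blast
  }
qed

lemma pf_gfp_list:
  assumes "pf As" "pf P" "pf (%z. R (fst z) (fst (snd z)) (fst (snd (snd z))) (snd (snd (snd z))))"
  shows "pf (%x. gfp_list (As x) (R x) (P x))"
proof -
  have *: "pf (%z. filter (%q. \<forall>a\<in>set (As (fst z)). \<exists>q'\<in>set (snd z). R (fst z) q a q') (snd z))"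
  proof (intro pf_filter pf_Ball_set pf_Bex_set)
    show "pf (%z. As (fst (fst z)))" by (rule pf_comp[OF assms(1)]) (intro pf_intros)
    show "pf (%z. R (fst (fst (fst (fst z)))) (snd (fst (fst z))) (snd (fst z)) (snd z))"
    proof -
      have "pf (%z. (%z. R (fst z) (fst (snd z)) (fst (snd (snd z))) (snd (snd (snd z))))
          (fst (fst (fst (fst z))), snd (fst (fst z)), snd (fst z), snd z))"
        by (rule pf_comp[OF assms(3)]) (intro pf_intros)
      then show ?thesis by simp
    qed
  qed (intro pf_intros)+
  have fil: "esize (filter Q W) <= esize W" for Q and W :: "'c list"
    by (induction W) (auto simp: le_SucI trans_le_add2)
  obtain p where p: "!!x. esize (P x) <= poly p (esize x)" using pf_size[OF assms(2)] by blast
  show ?thesis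
    unfolding gfp_list_def
  proof (rule pf_funpow[of "%x W. filter (%q. \<forall>a\<in>set (As x). \<exists>q'\<in>set W. R x q a q') W" _ _ "poly p"])
    fix x k
    have "esize (((%W. filter (%q. \<forall>a\<in>set (As x). \<exists>q'\<in>set W. R x q a q') W) ^^ k) (P x)) <= esize (P x)"
    proof (induction k)
      case (Suc k)
      show ?case using le_trans[OF fil Suc] by simp
    qed simp
    then show "esize (((%W. filter (%q. \<forall>a\<in>set (As x). \<exists>q'\<in>set W. R x q a q') W) ^^ k) (P x)) <= poly p (esize x)"
      using p le_trans by blast
  qed (intro * pf_intros assms pbd_intros)+
qed

text \<open>The caps \<open>M\<close> and \<open>n\<close> below keep the size of the result polynomial for all arguments.\<close>

definition words_upto :: "nat => nat => nat => nat list list" where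
  "words_upto M B k = ((%L. take M (concat (map (%x. map (%l. x # l) L) [0..<B]))) ^^ k) [[]]"

lemma set_words_upto:
  assumes "B ^ k <= M"
  shows "set (words_upto M B k) = {l. length l = k & set l \<subseteq> {..<B}}"
proof -
  have "length (words_upto M B j) = B ^ j & set (words_upto M B j) = {l. length l = j & set l \<subseteq> {..<B}}" if "j <= k" for j
    using that
  proof (induction j)
    case (Suc j)
    let ?L = "words_upto M B j"
    let ?C = "concat (map (%x. map (%l. x # l) ?L) [0..<B])"
    have ih: "length ?L = B ^ j" "set ?L = {l. length l = j & set l \<subseteq> {..<B}}" using Suc by auto
    have len: "length ?C = B ^ Suc j" by (simp add: length_concat o_def ih(1) sum_list_triv)
    have "B ^ Suc j <= M"
    proof (cases "B = 0")
      case False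
      then have "B ^ Suc j <= B ^ k" using Suc.prems by (intro power_increasing) auto
      then show ?thesis using assms by simp
    qed simp
    then have w: "words_upto M B (Suc j) = ?C" using len by (simp add: words_upto_def)
    have "set ?C = {l. length l = Suc j & set l \<subseteq> {..<B}}"
    proof
      show "{l. length l = Suc j & set l \<subseteq> {..<B}} \<subseteq> set ?C"
      proof
        fix l assume "l \<in> {l. length l = Suc j & set l \<subseteq> {..<B}}"
        then obtain x l' where "l = x # l'" "x < B" "l' \<in> set ?L" by (cases l) (auto simp: ih(2))
        then show "l \<in> set ?C" by auto
      qed
    qed (auto simp: ih(2))
    then show ?case using w len by simp
  qed (auto simp: words_upto_def)
  then show ?thesis by simp
qed

lemma pf_words_upto [pf_intros]:
  assumes "pf M" "pf B" "pf k"
  shows "pf (%x. words_upto (M x) (B x) (k x))"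
proof -
  define g where "g z L = take (fst z) (concat (map (%x. map (%l. x # l) L) [0..<fst (snd z)]))"
    for z :: "nat \<times> nat \<times> nat" and L
  have "pf (%z. (g z ^^ snd (snd z)) [[]])"
  proof (rule pf_funpow[of _ _ _ "%n. n * ((n * (2 * n + 2) + 1) + 1) + 3"])
    show "pf (%z. g (fst z) (snd z))" unfolding g_def by (intro pf_intros)
    fix z :: "nat \<times> nat \<times> nat" and j assume j: "j <= snd (snd z)"
    let ?n = "esize z"
    have z: "fst z <= ?n" "fst (snd z) <= ?n" "snd (snd z) <= ?n" by (cases z, auto)+
    have mem: "length l = j & set l \<subseteq> {..<fst (snd z)}" if "l \<in> set ((g z ^^ j) [[]])" for l j
      using that
    proof (induction j arbitrary: l)
      case (Suc j)
      then obtain x l' where "x < fst (snd z)" "l' \<in> set ((g z ^^ j) [[]])" "l = x # l'"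
        by (auto simp: g_def[of z "(g z ^^ j) [[]]"] dest!: in_set_takeD)
      then show ?case using Suc.IH[of l'] by auto
    qed simp
    have "esize l <= ?n * (2 * ?n + 2) + 1" if "l \<in> set ((g z ^^ j) [[]])" for l
      using esize_list_le[of l ?n "2 * ?n + 1"] mem[OF that] z j by force
    moreover have "length ((g z ^^ j) [[]]) <= ?n" if "0 < j" for j
      using that z(1) by (cases j) (auto simp: g_def)
    ultimately have "esize ((g z ^^ j) [[]]) <= ?n * ((?n * (2 * ?n + 2) + 1) + 1) + 1" if "0 < j"
      using esize_list_le[of "(g z ^^ j) [[]]" ?n] that by blast
    then show "esize ((g z ^^ j) [[]]) <= ?n * ((?n * (2 * ?n + 2) + 1) + 1) + 3"
      by (cases j) auto
  qed (intro pf_intros pbd_intros)+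
  then have "pf (%z. words_upto (fst z) (fst (snd z)) (snd (snd z)))" 
    by (simp add: g_def[abs_def] words_upto_def)
  from pf_comp[OF this, of "%x. (M x, B x, k x)"] show ?thesis by (simp add: pf_intros assms)
qed

definition prod_list2 :: "'a list => 'b list => ('a \<times> 'b) list" where
  "prod_list2 xs ys = concat (map (%x. map (Pair x) ys) xs)"

lemma set_prod_list2 [simp]: "set (prod_list2 xs ys) = set xs \<times> set ys"
  by (auto simp: prod_list2_def)

lemma pf_prod_list2 [pf_intros]:
  assumes "pf f" "pf g"
  shows "pf (%x. prod_list2 (f x) (g x))"
  unfolding prod_list2_def by (intro pf_intros assms pf_comp[OF assms(2)])

definition cap_pow2 :: "nat => nat => nat" where
  "cap_pow2 n m = ((%y. min n (2 * y)) ^^ m) 1"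

lemma cap_pow2: "2 ^ m <= n ==> cap_pow2 n m = 2 ^ m"
proof (induction m)
  case (Suc m)
  then have "2 ^ m <= n" by simp
  then show ?case using Suc by (simp add: cap_pow2_def)
qed (simp add: cap_pow2_def)

lemma pf_cap_pow2 [pf_intros]:
  assumes "pf f" "pf g"
  shows "pf (%x. cap_pow2 (f x) (g x))"
proof -
  have "pf (%z::nat \<times> nat. ((%y. min (fst z) (2 * y)) ^^ snd z) 1)"
  proof (rule pf_funpow[of _ _ _ "%n. 2 * n + 3"])
    fix z :: "nat \<times> nat" and k
    have "((%y. min (fst z) (2 * y)) ^^ k) 1 <= fst z + 1" by (induction k) auto
    moreover have "fst z <= esize z" by (cases z) auto
    ultimately show "esize (((%y. min (fst z) (2 * y)) ^^ k) 1) <= 2 * esize z + 3" by simp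
  qed (intro pf_intros pbd_intros)+
  from pf_comp[OF this, of "%x. (f x, g x)"] show ?thesis
    by (simp add: pf_intros assms cap_pow2_def)
qed

section \<open>The decision procedure\<close>

instantiation dpa_table_ext :: (treelike) treelike begin
definition tre_dpa_table_ext :: "'a dpa_table_ext => val" where
  "tre_dpa_table_ext T = tre (tab_init T, tab_prio T, tab_trans T, dpa_table.more T)"
instance ..
end

instantiation rp_input_ext :: (treelike) treelike begin
definition tre_rp_input_ext :: "'a rp_input_ext => val" where
  "tre_rp_input_ext I = tre (inp_edges I, inp_owner I, inp_prefs I, inp_auts I, inp_start I, inp_constr I, rp_input.more I)"
instance ..
end

lemma pf_tab [pf_intros]:
  fixes f :: "'x::treelike => dpa_table"
  assumes "pf f"
  shows "pf (%x. tab_init (f x))" "pf (%x. tab_prio (f x))" "pf (%x. tab_trans (f x))"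
proof -
  let ?t = "%x. (tab_init (f x), tab_prio (f x), tab_trans (f x), dpa_table.more (f x))"
  have t: "pf ?t" by (rule pf_recode[OF assms]) (simp add: tre_dpa_table_ext_def)
  show "pf (%x. tab_init (f x))" using pf_fst[OF t] by simp
  show "pf (%x. tab_prio (f x))" using pf_fst[OF pf_snd[OF t]] by simp
  show "pf (%x. tab_trans (f x))" using pf_fst[OF pf_snd[OF pf_snd[OF t]]] by simp
qed

lemma pf_inp [pf_intros]:
  fixes f :: "'x::treelike => rp_input"
  assumes "pf f"
  shows "pf (%x. inp_edges (f x))" "pf (%x. inp_owner (f x))" "pf (%x. inp_prefs (f x))"
    "pf (%x. inp_auts (f x))" "pf (%x. inp_start (f x))" "pf (%x. inp_constr (f x))"
proof -
  let ?t = "%x. (inp_edges (f x), inp_owner (f x), inp_prefs (f x), inp_auts (f x), inp_start (f x),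
    inp_constr (f x), rp_input.more (f x))"
  have t: "pf ?t" by (rule pf_recode[OF assms]) (simp add: tre_rp_input_ext_def)
  note s = pf_snd[OF t] note s2 = pf_snd[OF s] note s3 = pf_snd[OF s2] note s4 = pf_snd[OF s3] note s5 = pf_snd[OF s4]
  show "pf (%x. inp_edges (f x))" "pf (%x. inp_owner (f x))" "pf (%x. inp_prefs (f x))"
    "pf (%x. inp_auts (f x))" "pf (%x. inp_start (f x))" "pf (%x. inp_constr (f x))"
    using pf_fst[OF t] pf_fst[OF s] pf_fst[OF s2] pf_fst[OF s3] pf_fst[OF s4] pf_fst[OF s5] by simp_all
qed

lemma pf_table_make [pf_intros]:
  assumes "pf a" "pf b" "pf c"
  shows "pf (%x. \<lparr>tab_init = a x, tab_prio = b x, tab_trans = c x\<rparr>)"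
  by (rule pf_recode[of "%x. (a x, b x, c x, ())"]) (intro pf_intros assms, simp add: tre_dpa_table_ext_def)

lemma pf_input_make [pf_intros]:
  assumes "pf a" "pf b" "pf c" "pf d" "pf e" "pf g"
  shows "pf (%x. \<lparr>inp_edges = a x, inp_owner = b x, inp_prefs = c x, inp_auts = d x, inp_start = e x, inp_constr = g x\<rparr>)"
  by (rule pf_recode[of "%x. (a x, b x, c x, d x, e x, g x, ())"]) (intro pf_intros assms, simp add: tre_rp_input_ext_def)

lemma pf_u [pf_intros]:
  assumes "pf f"
  shows "pf (%x. uv (f x))" "pf (%x. uw (f x))" "pf (%x. us (f x))" "pf (%x. ux (f x))" "pf (%x. uS (f x))" "pf (%x. uf (f x))"
  unfolding uv_def uw_def us_def ux_def uS_def uf_def by (intro pf_intros assms)+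


text \<open>
  The definitions above select list entries by \<open>!\<close>, which is unspecified out of range; the procedure
  evaluates the following total variants, which agree with them on well-formed inputs.
\<close>

definition "xpl I ka = fst (nth_default undefined (autos I) ka)"
definition "xpy I ka = fst (snd (nth_default undefined (autos I) ka))"
definition "xtab I ka = snd (snd (nth_default undefined (autos I) ka))"
definition "xk I r = fst (nth_default undefined (pairs I) r)"
definition "xq I r = snd (nth_default undefined (pairs I) r)"
definition "xedge (I :: rp_input) a b <-> (\<exists>e\<in>set (inp_edges I). fst e = a & snd e = b)"
definition "xpref (I :: rp_input) i p q <-> (\<exists>e\<in>set (nth_default [] (inp_prefs I) i). fst e = p & snd e = q)"
definition "xown (I :: rp_input) v = nth_default 0 (inp_owner I) v"
definition "xat xs i = nth_default (0::nat) xs i"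
definition "xon xs i = nth_default False xs i"

definition "xnext I u = map (%ka. xat (nth_default [] (tab_trans (xtab I ka)) (xat (us u) ka)) (uv u)) [0..<num_aut I]"
definition "xok I x <-> (\<forall>i<npl I. ~ xpref I i (xat x i) (xat x i))"
definition "xdev I x ka <-> xpref I (xpl I ka) (xat x (xpl I ka)) (xpy I ka)"

definition "xstep I u a u' <-> uv u' = a & xedge I a (uw u') & us u' = xnext I u &
     (if a = uw u then ux u' = ux u & uS u' = uS u & uf u' = 0
      else xok I (ux u') & uf u' = Suc (xown I (uv u)) &
        (\<forall>ka<num_aut I. xpl I ka = xown I (uv u) --> xpy I ka = xat (ux u') (xown I (uv u)) --> ~ xon (uS u) ka) &
        uS u' = map (%ka. xpl I ka = xown I (uv u) & xon (uS u) ka \<or> xdev I (ux u') ka) [0..<num_aut I])"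

definition "xpri I r q = xat (tab_prio (xtab I (xk I r))) q"
definition "xfgreen I ka u <-> (if uf u = 0 then xpy I ka = xat (ux u) (xpl I ka)
     else uf u = Suc (xpl I ka) --> ~ xon (uS u) ka)"
definition "xeven n <-> n mod 2 = (0::nat)"
definition "xured I r u <-> xat (us u) (xk I r) = xq I r & xeven (xpri I r (xq I r))"
definition "xvgreen I r u <-> xpri I r (xq I r) < xpri I r (xat (us u) (xk I r))"
definition "xugreen I r u <-> xvgreen I r u \<or> xfgreen I (xk I r) u"
definition "xvred I r u <-> xpl I (xk I r) = uf u & xat (us u) (xk I r) = xq I r &
     xeven (xpri I r (xq I r)) = (~ xon (uS u) (xk I r))"

definition "xupc I c u = map (%r. if xugreen I r u then 0 else if xured I r u then Suc (xat c r) else xat c r) [0..<npr I]"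
definition "xvpc I c u = map (%r. if xvgreen I r u then 0 else if xvred I r u then Suc (xat c r) else xat c r) [0..<npr I]"
definition "xinits I = map (%ka. tab_init (xtab I ka)) [0..<num_aut I]"
definition "xuinit I u <-> uv u = inp_start I & xedge I (inp_start I) (uw u) &
     us u = xinits I & xok I (ux u) &
     (\<forall>i<npl I. xat (inp_constr I) i = xat (ux u) i \<or> xpref I i (xat (inp_constr I) i) (xat (ux u) i)) &
     uS u = map (%ka. xdev I (ux u) ka) [0..<num_aut I] & uf u = 0"
definition "xvinit I u <-> us u = xinits I & uf u < npl I &
     ~ (\<exists>ka<num_aut I. (xpl I ka = uf u & xon (uS u) ka) &
         (\<forall>ka'<num_aut I. xpl I ka' = uf u & xon (uS u) ka' --> xpy I ka' = xpy I ka))"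
definition "xstate I u <-> uv u < nve I & uw u < nve I &
     length (us u) = num_aut I & (\<forall>ka<num_aut I. xat (us u) ka < length (tab_prio (xtab I ka))) &
     length (ux u) = npl I & (\<forall>i<npl I. xat (ux u) i < length (nth_default [] (inp_auts I) i)) &
     length (uS u) = num_aut I & uf u <= npl I"

text \<open>\<open>gfp_list\<close> offers the same challenges at every position, namely all
  vertices. A vertex that is not a successor is made a challenge that any answer meets.\<close>

definition "xustep I q a q' <-> (xedge I (uv (fst q)) a --> xstep I (fst q) a (fst q') & snd q' = xupc I (snd q) (fst q'))"
definition "xvstep I q (a :: nat) q' <-> us (fst q') = xnext I (fst q) & uS (fst q') = uS (fst q) & uf (fst q') = uf (fst q) &
   snd q' = xvpc I (snd q) (fst q')"

text \<open>A product of full enumerations, filtered afterwards by \<open>xstate\<close>. Boolean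
  lists arise from words over the letters 0 and 1; \<open>B\<close> bounds the states and payoffs,
  \<open>K\<close> the counters, and \<open>N\<close> caps the enumerations.\<close>

definition xpositions :: "nat => nat => nat => rp_input => (ustate \<times> nat list) list" where
  "xpositions N B K I = filter (%q. xstate I (fst q)) (prod_list2
     (prod_list2 [0..<nve I] (prod_list2 [0..<nve I]
       (prod_list2 (words_upto N (Suc B) (num_aut I)) (prod_list2 (words_upto N (Suc B) (npl I))
         (prod_list2 (map (%l. map (%n. n = 1) l) (words_upto N 2 (num_aut I))) [0..<Suc (npl I)])))))
     (words_upto N (Suc K) (npr I)))"

definition "xzero I q <-> snd q = map (%r. 0::nat) [0..<npr I]"

definition "xuwin N B K I <-> (\<exists>q\<in>set (gfp_list [0..<nve I] (xustep I) (xpositions N B K I)). xuinit I (fst q) & xzero I q)"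
definition "xvwin N B K I <-> (\<exists>q\<in>set (gfp_list [0..<nve I] (xvstep I) (xpositions N B K I)). xvinit I (fst q) & xzero I q)"

definition "xtable n (T :: dpa_table) <-> length (tab_trans T) = length (tab_prio T) & tab_init T < length (tab_prio T) &
  (\<forall>row\<in>set (tab_trans T). length row = n & (\<forall>q\<in>set row. q < length (tab_prio T)))"

definition "xwf I <->
     (\<forall>e\<in>set (inp_edges I). fst e < nve I & snd e < nve I) &
     (\<forall>u<nve I. \<exists>e\<in>set (inp_edges I). fst e = u) &
     (\<forall>i\<in>set (inp_owner I). i < npl I) & length (inp_prefs I) = npl I &
     (\<forall>i<npl I. \<forall>e\<in>set (nth_default [] (inp_prefs I) i).
        fst e < length (nth_default [] (inp_auts I) i) & snd e < length (nth_default [] (inp_auts I) i)) &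
     (\<forall>ka<num_aut I. xtable (nve I) (xtab I ka)) &
     inp_start I < nve I & length (inp_constr I) = npl I &
     (\<forall>i<npl I. xat (inp_constr I) i < length (nth_default [] (inp_auts I) i))"

named_theorems x_intros

lemma pf_autos [x_intros]: "pf f ==> pf (%x. autos (f x))"
proof -
  assume f: "pf f"
  have "pf (%I::rp_input. concat (map (%i. map (%p. (i, p, nth_default undefined (nth_default [] (inp_auts I) i) p)) [0..<length (nth_default [] (inp_auts I) i)])
     [0..<npl I]))" by (intro pf_intros)
  then have "pf autos" by (rule pf_cong) (auto simp: autos_def nth_default_nth intro!: arg_cong[of _ _ concat] map_cong)
  then show ?thesis using f by (rule pf_comp)
qed

lemma xaut_eq: "ka < num_aut I ==> xpl I ka = aut_pl I ka" "ka < num_aut I ==> xpy I ka = aut_py I ka"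
  "ka < num_aut I ==> xtab I ka = aut_tab I ka"
  by (simp_all add: xpl_def xpy_def xtab_def aut_pl_def aut_py_def aut_tab_def nth_default_nth)

lemma pf_xaut [x_intros]: "pf f ==> pf g ==> pf (%x. xpl (f x) (g x))" "pf f ==> pf g ==> pf (%x. xpy (f x) (g x))"
  "pf f ==> pf g ==> pf (%x. xtab (f x) (g x))"
  unfolding xpl_def xpy_def xtab_def by (intro pf_intros x_intros; assumption)+

lemma pf_pairs [x_intros]: "pf f ==> pf (%x. pairs (f x))"
proof -
  assume f: "pf f"
  have "pf (%I. concat (map (%ka. map (%q. (ka, q)) [0..<length (tab_prio (xtab I ka))]) [0..<num_aut I]))"
    by (intro pf_intros x_intros)
  then have "pf pairs" by (rule pf_cong) (auto simp: pairs_def xaut_eq intro!: arg_cong[of _ _ concat] map_cong)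
  then show ?thesis using f by (rule pf_comp)
qed

lemma pf_x1 [x_intros]:
  "pf f ==> pf g ==> pf (%x. xk (f x) (g x))" "pf f ==> pf g ==> pf (%x. xq (f x) (g x))"
  "pf f ==> pf g ==> pf (%x. xown (f x) (g x))"
  "pf h ==> pf g ==> pf (%x. xat (h x) (g x))" "pf h' ==> pf g ==> pf (%x. xon (h' x) (g x))"
  "pf g ==> pf (%x. xeven (g x))"
  unfolding xk_def xq_def xown_def xat_def xon_def xeven_def by (intro pf_intros x_intros; assumption)+

lemma pf_xrel [x_intros]:
  "pf f ==> pf g ==> pf h ==> pf (%x. xedge (f x) (g x) (h x))"
  "pf f ==> pf g ==> pf h ==> pf k ==> pf (%x. xpref (f x) (g x) (h x) (k x))"
proof -
  have "pf (%z. xedge (fst z) (fst (snd z)) (snd (snd z)))"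
    "pf (%z. xpref (fst z) (fst (snd z)) (fst (snd (snd z))) (snd (snd (snd z))))"
    unfolding xedge_def xpref_def by (intro pf_intros)+
  note p = this
  show "pf f ==> pf g ==> pf h ==> pf (%x. xedge (f x) (g x) (h x))"
    using pf_comp[OF p(1), of "%x. (f x, g x, h x)"] by (simp add: pf_intros)
  show "pf f ==> pf g ==> pf h ==> pf k ==> pf (%x. xpref (f x) (g x) (h x) (k x))"
    using pf_comp[OF p(2), of "%x. (f x, g x, h x, k x)"] by (simp add: pf_intros)
qed

lemma pf_xvec [x_intros]:
  "pf f ==> pf u ==> pf (%x. xnext (f x) (u x))"
  "pf f ==> pf g ==> pf (%x. xok (f x) (g x))"
  "pf f ==> pf g ==> pf h ==> pf (%x. xdev (f x) (g x) (h x))"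
  "pf f ==> pf (%x. xinits (f x))"
proof -
  have "pf (%z. xnext (fst z) (snd z))" "pf (%z. xok (fst z) (snd z))" "pf xinits"
    unfolding xnext_def xok_def xinits_def by (intro pf_intros x_intros)+
  note p = this
  show "pf f ==> pf u ==> pf (%x. xnext (f x) (u x))"
    using pf_comp[OF p(1), of "%x. (f x, u x)"] by (simp add: pf_intros)
  show "pf f ==> pf g ==> pf (%x. xok (f x) (g x))"
    using pf_comp[OF p(2), of "%x. (f x, g x)"] by (simp add: pf_intros)
  show "pf f ==> pf (%x. xinits (f x))" by (rule pf_comp[OF p(3)])
  show "pf f ==> pf g ==> pf h ==> pf (%x. xdev (f x) (g x) (h x))"
    unfolding xdev_def by (intro pf_intros x_intros; assumption)
qed

lemma pf_xpri [x_intros]: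
  "pf f ==> pf g ==> pf h ==> pf (%x. xpri (f x) (g x) (h x))"
  "pf f ==> pf g ==> pf u ==> pf (%x. xfgreen (f x) (g x) (u x))"
  unfolding xpri_def xfgreen_def by (intro pf_intros x_intros; assumption)+

lemma pf_xred [x_intros]:
  "pf f ==> pf g ==> pf u ==> pf (%x. xured (f x) (g x) (u x))"
  "pf f ==> pf g ==> pf u ==> pf (%x. xvgreen (f x) (g x) (u x))"
  "pf f ==> pf g ==> pf u ==> pf (%x. xvred (f x) (g x) (u x))"
  unfolding xured_def xvgreen_def xvred_def by (intro pf_intros x_intros; assumption)+

lemma pf_xugreen [x_intros]:
  "pf f ==> pf g ==> pf u ==> pf (%x. xugreen (f x) (g x) (u x))"
  unfolding xugreen_def by (intro pf_intros x_intros)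

lemma pf_xupc: "pf (%z. xupc (fst z) (fst (snd z)) (snd (snd z)))" "pf (%z. xvpc (fst z) (fst (snd z)) (snd (snd z)))"
  unfolding xupc_def xvpc_def by (intro pf_intros x_intros)+

lemma pf_xupc' [x_intros]:
  "pf f ==> pf c ==> pf u ==> pf (%x. xupc (f x) (c x) (u x))"
  "pf f ==> pf c ==> pf u ==> pf (%x. xvpc (f x) (c x) (u x))"
  using pf_comp[OF pf_xupc(1), of "%x. (f x, c x, u x)"] pf_comp[OF pf_xupc(2), of "%x. (f x, c x, u x)"]
  by (simp_all add: pf_intros)

lemma pf_xsteps:
  "pf (%z. xustep (fst z) (fst (snd z)) (fst (snd (snd z))) (snd (snd (snd z))))"
  "pf (%z. xvstep (fst z) (fst (snd z)) (fst (snd (snd z))) (snd (snd (snd z))))"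
  unfolding xustep_def xstep_def xvstep_def by (intro pf_intros x_intros)+

lemma pf_xinit: "pf (%z. xuinit (fst z) (snd z))" "pf (%z. xvinit (fst z) (snd z))" "pf (%z. xstate (fst z) (snd z))"
  "pf (%z. xzero (fst z) (snd z))"
  unfolding xuinit_def xvinit_def xstate_def xzero_def by (intro pf_intros x_intros)+

lemma pf_xinit' [x_intros]:
  "pf f ==> pf u ==> pf (%x. xuinit (f x) (u x))" "pf f ==> pf u ==> pf (%x. xvinit (f x) (u x))"
  "pf f ==> pf u ==> pf (%x. xstate (f x) (u x))" "pf f ==> pf q ==> pf (%x. xzero (f x) (q x))"
  using pf_comp[OF pf_xinit(1), of "%x. (f x, u x)"] pf_comp[OF pf_xinit(2), of "%x. (f x, u x)"]
    pf_comp[OF pf_xinit(3), of "%x. (f x, u x)"] pf_comp[OF pf_xinit(4), of "%x. (f x, q x)"]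
  by (simp_all add: pf_intros)

lemma pf_xwin:
  "pf (%z. xuwin (fst z) (fst (snd z)) (fst (snd (snd z))) (snd (snd (snd z))))"
  "pf (%z. xvwin (fst z) (fst (snd z)) (fst (snd (snd z))) (snd (snd (snd z))))"
proof -
  have P: "pf (%z. xpositions (fst z) (fst (snd z)) (fst (snd (snd z))) (snd (snd (snd z))))"
    unfolding xpositions_def by (intro pf_intros x_intros)
  have R: "pf (%z. xustep (snd (snd (snd (fst z)))) (fst (snd z)) (fst (snd (snd z))) (snd (snd (snd z))))"
    "pf (%z. xvstep (snd (snd (snd (fst z)))) (fst (snd z)) (fst (snd (snd z))) (snd (snd (snd z))))"
    using pf_comp[OF pf_xsteps(1), of "%z. (snd (snd (snd (fst z))), snd z)"] pf_comp[OF pf_xsteps(2), of "%z. (snd (snd (snd (fst z))), snd z)"]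
    by (simp_all add: pf_intros)
  show "pf (%z. xuwin (fst z) (fst (snd z)) (fst (snd (snd z))) (snd (snd (snd z))))"
    unfolding xuwin_def by (intro pf_Bex_set pf_gfp_list P R; intro pf_intros x_intros)
  show "pf (%z. xvwin (fst z) (fst (snd z)) (fst (snd (snd z))) (snd (snd (snd z))))"
    unfolding xvwin_def by (intro pf_Bex_set pf_gfp_list P R; intro pf_intros x_intros)
qed

lemma pf_xwf: "pf xwf"
  unfolding xwf_def xtable_def by (intro pf_intros x_intros)

lemma xtable_iff: "xtable n T <-> wf_table n T"
proof
  assume x: "xtable n T"
  have "tab_trans T ! q ! a < length (tab_prio T)" if "q < length (tab_prio T)" "a < n" for q a
  proof -
    have "tab_trans T ! q \<in> set (tab_trans T)" using x that(1) by (simp add: xtable_def)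
    then show ?thesis using x that(2) by (simp add: xtable_def)
  qed
  then show "wf_table n T" using x by (simp add: xtable_def wf_table_def is_dpa_def dpa_of_table_def)
next
  assume w: "wf_table n T"
  have "q < length (tab_prio T)" if rq: "row \<in> set (tab_trans T)" "q \<in> set row" for row q
  proof -
    obtain i where i: "i < length (tab_trans T)" "tab_trans T ! i = row" using rq(1) by (auto simp: in_set_conv_nth)
    obtain j where j: "j < length row" "row ! j = q" using rq(2) by (auto simp: in_set_conv_nth)
    have "length row = n" using w rq(1) by (simp add: wf_table_def)
    then show ?thesis using w i j by (auto simp: wf_table_def is_dpa_def dpa_of_table_def)
  qed
  then show "xtable n T" using w by (simp add: xtable_def wf_table_def is_dpa_def dpa_of_table_def)
qed

text \<open>The two length conditions are split off first, because \<open>!\<close> and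
  \<open>nth_default\<close> agree only within the range of a list.\<close>

lemma xwf_iff: "xwf I <-> wf_input I"
proof -
  have "xwf I <-> (length (inp_prefs I) = npl I & length (inp_constr I) = npl I) & xwf I"
    by (auto simp: xwf_def)
  also have "\<dots> <-> (length (inp_prefs I) = npl I & length (inp_constr I) = npl I) & wf_input I"
    by (rule conj_cong[OF refl]) (simp add: xwf_def wf_input_def xtable_iff xaut_eq xat_def nth_default_nth cong: conj_cong)
  finally show ?thesis by (auto simp: wf_input_def)
qed

context
  fixes I
  assumes wf: "wf_input I"
begin

lemma xaccess:
  "xedge I a b <-> (a, b) \<in> set (inp_edges I)"
  "i < npl I ==> xpref I i p q <-> (p, q) \<in> set (inp_prefs I ! i)"
  "v < nve I ==> xown I v = inp_owner I ! v"
  "i < length xs ==> xat xs i = xs ! i" "i < length ys ==> xon ys i = ys ! i"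
  "r < npr I ==> xk I r = fst (pairs I ! r)" "r < npr I ==> xq I r = snd (pairs I ! r)"
  "xeven n <-> even n"
proof -
  have bex: "(\<exists>e\<in>set es. fst e = x & snd e = y) <-> (x, y) \<in> set es" for es :: "(nat \<times> nat) list" and x y
    by (metis fst_conv snd_conv prod.collapse)
  have lp: "length (inp_prefs I) = npl I" using wf by (simp add: wf_input_def)
  show "xedge I a b <-> (a, b) \<in> set (inp_edges I)" by (simp add: xedge_def bex)
  show "i < npl I ==> xpref I i p q <-> (p, q) \<in> set (inp_prefs I ! i)"
    by (simp add: xpref_def bex nth_default_nth lp)
qed (simp_all add: xown_def xat_def xon_def xk_def xq_def xeven_def nth_default_nth even_iff_mod_2_eq_zero)

lemma owner_lt: "v < nve I ==> inp_owner I ! v < npl I"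
  using wf by (auto simp: wf_input_def)

lemma tab_lengths:
  assumes "ka < num_aut I"
  shows "length (tab_trans (aut_tab I ka)) = length (tab_prio (aut_tab I ka))"
    "q < length (tab_prio (aut_tab I ka)) ==> length (tab_trans (aut_tab I ka) ! q) = nve I"
  using wf assms by (auto simp: wf_input_def wf_table_def)

lemma xok_eq: "length x = npl I ==> xok I x <-> uok I x"
  by (simp add: xok_def uok_def xaccess)

lemma xdev_eq: "ka < num_aut I ==> length x = npl I ==> xdev I x ka <-> udev I x ka"
  using aut_props(1)[of ka I] by (simp add: xdev_def udev_def xaut_eq xaccess)

context
  fixes u
  assumes u: "u \<in> ustates I"
begin

lemma xnext_eq: "xnext I u = unext I u"
  using u by (auto simp: xnext_def unext_def ustates_def xaut_eq xaccess tab_lengths nth_default_nth intro!: map_cong)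

lemma xstep_eq: "u' \<in> ustates I ==> xstep I u a u' <-> ustep I u a u'"
proof -
  assume u': "u' \<in> ustates I"
  have m: "map (%ka. xpl I ka = xown I (uv u) & xon (uS u) ka \<or> xdev I (ux u') ka) [0..<num_aut I] =
      map (%ka. aut_pl I ka = inp_owner I ! uv u & uS u ! ka \<or> udev I (ux u') ka) [0..<num_aut I]"
    using u u' by (auto simp: ustates_def xaut_eq xaccess xdev_eq)
  show ?thesis
    using u u' owner_lt[of "uv u"] unfolding xstep_def ustep_def xnext_eq m
    by (simp add: ustates_def xaut_eq xaccess xok_eq)
qed

lemma xfgreen_eq: "ka < num_aut I ==> xfgreen I ka u <-> fgreen I ka u"
  using u aut_props(1)[of ka I] by (simp add: xfgreen_def fgreen_def ustates_def xaut_eq xaccess)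

lemma xcolours:
  assumes r: "r < npr I"
  shows "xured I r u <-> ured I r u" "xugreen I r u <-> ugreen I r u" "xvred I r u <-> vred I r u" "xvgreen I r u <-> vgreen I r u"
proof -
  note k = pairs_nth[OF r]
  have s: "us u ! fst (pairs I ! r) < length (tab_prio (aut_tab I (fst (pairs I ! r))))" and l: "length (us u) = num_aut I" "length (uS u) = num_aut I"
    using u k by (simp_all add: ustates_def)
  have p: "xpri I r q = upri I r q" if "q < length (tab_prio (aut_tab I (fst (pairs I ! r))))" for q
    using that k r by (simp add: xpri_def upri_def xaccess xaut_eq)
  show "xured I r u <-> ured I r u" "xugreen I r u <-> ugreen I r u" "xvred I r u <-> vred I r u" "xvgreen I r u <-> vgreen I r u"
    using k l s r by (simp_all add: xured_def ured_def xugreen_def xvgreen_def ugreen_def vgreen_def xvred_def vred_def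
        xaccess p xfgreen_eq xaut_eq)
qed

lemma xupc_eq:
  assumes "length c = npr I"
  shows "xupc I c u = upc (npr I) (ured I) (ugreen I) c u" "xvpc I c u = upc (npr I) (vred I) (vgreen I) c u"
  using assms by (auto simp: xupc_def xvpc_def upc_def xcolours xaccess intro!: map_cong)

lemma xinits_eq: "xuinit I u <-> uinit I u" "xvinit I u <-> vinit I u"
proof -
  have i: "xinits I = map (%ka. tab_init (aut_tab I ka)) [0..<num_aut I]" by (auto simp: xinits_def xaut_eq)
  have d: "map (xdev I (ux u)) [0..<num_aut I] = map (udev I (ux u)) [0..<num_aut I]"
    using u by (auto simp: ustates_def xdev_eq)
  show "xuinit I u <-> uinit I u" unfolding xuinit_def uinit_def i d
    using u wf by (simp add: ustates_def wf_input_def xaccess xok_eq)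
  show "xvinit I u <-> vinit I u" unfolding xvinit_def vinit_def i
    using u by (simp add: ustates_def xaccess xaut_eq cong: conj_cong imp_cong)
qed

end

lemma xstate_eq: "xstate I u <-> u \<in> ustates I"
proof -
  have "xstate I u <-> (length (us u) = num_aut I & length (ux u) = npl I) & xstate I u"
    by (auto simp: xstate_def)
  also have "\<dots> <-> (length (us u) = num_aut I & length (ux u) = npl I) & u \<in> ustates I"
    by (rule conj_cong[OF refl]) (simp add: xstate_def ustates_def xaut_eq xaccess nth_default_nth cong: conj_cong)
  finally show ?thesis by (auto simp: ustates_def)
qed

lemma set_xpositions:
  assumes B: "!!ka. ka < num_aut I ==> length (tab_prio (aut_tab I ka)) <= B" "!!i. i < npl I ==> length (inp_auts I ! i) <= B"
    and N: "Suc B ^ num_aut I <= N" "Suc B ^ npl I <= N" "2 ^ num_aut I <= N" "Suc K ^ npr I <= N"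
  shows "set (xpositions N B K I) = ustates I \<times> counts (npr I) K"
proof -
  have b: "(%l. map (%n. n = 1) l) ` {l. length l = k & set l \<subseteq> {..<2::nat}} = {l. length l = k}" for k
  proof
    show "{l. length l = k} \<subseteq> (%l. map (%n. n = 1) l) ` {l. length l = k & set l \<subseteq> {..<2::nat}}"
    proof
      fix l :: "bool list" assume "l \<in> {l. length l = k}"
      then show "l \<in> (%l. map (%n. n = 1) l) ` {l. length l = k & set l \<subseteq> {..<2::nat}}"
        by (intro image_eqI[of _ _ "map (%b. if b then 1 else 0) l"]) (auto simp: o_def intro!: map_idI[symmetric])
    qed
  qed auto
  let ?P = "{..<nve I} \<times> {..<nve I} \<times> {l. length l = num_aut I & set l \<subseteq> {..<Suc B}} \<times>
    {l. length l = npl I & set l \<subseteq> {..<Suc B}} \<times> {l :: bool list. length l = num_aut I} \<times> {..<Suc (npl I)}"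
  have sub: "ustates I \<subseteq> ?P"
  proof
    fix u assume u: "u \<in> ustates I"
    obtain v w s x S f where u': "u = (v, w, s, x, S, f)" by (metis prod.exhaust)
    have "set s \<subseteq> {..<Suc B}" "set x \<subseteq> {..<Suc B}"
      using u B unfolding u' ustates_def by (auto simp: in_set_conv_nth less_Suc_eq_le) (meson less_imp_le less_le_trans)+
    then show "u \<in> ?P" using u unfolding u' ustates_def by simp
  qed
  have "set (xpositions N B K I) = {q. fst q \<in> ustates I} \<inter> (?P \<times> {l. length l = npr I & set l \<subseteq> {..<Suc K}})"
    using N b by (auto simp: xpositions_def set_words_upto xstate_eq atLeast0LessThan simp del: upt_Suc)
  also have "\<dots> = ustates I \<times> counts (npr I) K"
    using sub by (auto simp: counts_def lessThan_Suc_atMost)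
  finally show ?thesis .
qed

context
  fixes N B K
  assumes P: "set (xpositions N B K I) = ustates I \<times> counts (npr I) K"
begin

lemma xzero_eq: "xzero I q <-> snd q = replicate (npr I) 0"
  by (simp add: xzero_def map_replicate_const)

lemma xuwin_iff: "xuwin N B K I <-> (EX u W. uinit I u & uwin I K W & (u, replicate (npr I) 0) \<in> W)"
proof -
  let ?V = "{0..<nve I}"
  have bs: "uwin I K W <-> W \<subseteq> set (xpositions N B K I) & (\<forall>q\<in>W. \<forall>a\<in>?V. \<exists>q'\<in>W. xustep I q a q')" for W
  proof (cases "W \<subseteq> set (xpositions N B K I)")
    case sub: True
    have "(\<forall>a\<in>umoves I u. \<exists>u'\<in>uresp I u a. (u', upc (npr I) (ured I) (ugreen I) c u') \<in> W) <->
        (\<forall>a\<in>?V. \<exists>q'\<in>W. xustep I (u, c) a q')" if uc: "(u, c) \<in> W" for u c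
    proof -
      have u: "u \<in> ustates I" and c: "length c = npr I" using uc sub P by (auto simp: counts_def)
      have st: "(\<exists>u'\<in>uresp I u a. (u', upc (npr I) (ured I) (ugreen I) c u') \<in> W) <->
          (\<exists>q'\<in>W. xstep I u a (fst q') & snd q' = xupc I c (fst q'))" (is "?l <-> ?r") for a
      proof
        assume ?l
        then obtain u' where "u' \<in> ustates I" "ustep I u a u'" "(u', upc (npr I) (ured I) (ugreen I) c u') \<in> W"
          by (auto simp: uresp_def)
        then show ?r using xstep_eq[OF u] xupc_eq(1)[of u' c, OF _ c]
          by (intro bexI[of _ "(u', upc (npr I) (ured I) (ugreen I) c u')"]) simp_all
      next
        assume ?r
        then obtain q' where q: "q' \<in> W" "xstep I u a (fst q')" "snd q' = xupc I c (fst q')" by blast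
        then have "fst q' \<in> ustates I" using sub P by (cases q') auto
        then show ?l using q xstep_eq[OF u] xupc_eq(1)[of "fst q'" c, OF _ c]
          by (intro bexI[of _ "fst q'"]) (simp_all add: uresp_def, metis prod.collapse)
      qed
      have "a \<in> umoves I u <-> xedge I (uv u) a" for a by (simp add: umoves_def xaccess)
      moreover have "xedge I (uv u) a ==> a \<in> ?V" for a using wf by (force simp: xaccess wf_input_def)
      \<comment> \<open>For a vertex that is not a successor some answer in \<open>W\<close> is
        still needed; the position \<open>(u, c)\<close> itself provides one.\<close>
      moreover have "(\<exists>q'\<in>W. xustep I (u, c) a q') <-> (xedge I (uv u) a --> (\<exists>q'\<in>W. xstep I u a (fst q') & snd q' = xupc I c (fst q')))" for a
        unfolding xustep_def fst_conv snd_conv using uc by metis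
      ultimately show ?thesis unfolding st by (metis atLeastLessThan_iff)
    qed
    then show ?thesis using sub P unfolding bsafe_def by fastforce
  next
    case False
    then show ?thesis using P unfolding bsafe_def by blast
  qed
  have "xuwin N B K I <-> (EX q. (EX W. q \<in> W & uwin I K W) & xuinit I (fst q) & xzero I q)"
    unfolding xuwin_def Bex_def gfp_list_iff bs set_upt ..
  also have "\<dots> <-> (EX q W. q \<in> W & uwin I K W & uinit I (fst q) & xzero I q)"
  proof -
    have "fst q \<in> ustates I" if "q \<in> W" "uwin I K W" for q W using that P unfolding bs by auto
    then show ?thesis using xinits_eq(1) by blast
  qed
  also have "\<dots> <-> (EX u W. uinit I u & uwin I K W & (u, replicate (npr I) 0) \<in> W)"
    unfolding xzero_eq by (metis fst_conv prod.collapse snd_conv)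
  finally show ?thesis .
qed

lemma xvwin_iff: "xvwin N B K I <-> (EX u W. vinit I u & vwin I K W & (u, replicate (npr I) 0) \<in> W)"
proof -
  let ?V = "{0..<nve I}"
  have bs: "vwin I K W <-> W \<subseteq> set (xpositions N B K I) & (\<forall>q\<in>W. \<forall>a\<in>?V. \<exists>q'\<in>W. xvstep I q a q')" for W
  proof (cases "W \<subseteq> set (xpositions N B K I)")
    case sub: True
    have st: "(\<exists>u'\<in>vresp I u a. (u', upc (npr I) (vred I) (vgreen I) c u') \<in> W) <->
        (\<exists>q'\<in>W. xvstep I (u, c) a q')" (is "?l <-> ?r") if uc: "(u, c) \<in> W" for u c a
    proof -
      have u: "u \<in> ustates I" and c: "length c = npr I" using uc sub P by (auto simp: counts_def)
      show ?thesis
      proof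
        assume ?l
        then obtain u' where "u' \<in> ustates I" "vstep I u a u'" "(u', upc (npr I) (vred I) (vgreen I) c u') \<in> W"
          by (auto simp: vresp_def)
        then show ?r using xnext_eq[OF u] xupc_eq(2)[of u' c, OF _ c]
          by (intro bexI[of _ "(u', upc (npr I) (vred I) (vgreen I) c u')"]) (simp_all add: xvstep_def vstep_def)
      next
        assume ?r
        then obtain q' where q: "q' \<in> W" "xvstep I (u, c) a q'" by blast
        then have "fst q' \<in> ustates I" using sub P by (cases q') auto
        then show ?l using q xnext_eq[OF u] xupc_eq(2)[of "fst q'" c, OF _ c]
          by (intro bexI[of _ "fst q'"]) (simp_all add: vresp_def xvstep_def vstep_def, metis prod.collapse)
      qed
    qed
    then show ?thesis using sub P unfolding bsafe_def vmoves_def atLeast0LessThan by fastforce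
  next
    case False
    then show ?thesis using P unfolding bsafe_def by blast
  qed
  have "xvwin N B K I <-> (EX q. (EX W. q \<in> W & vwin I K W) & xvinit I (fst q) & xzero I q)"
    unfolding xvwin_def Bex_def gfp_list_iff bs set_upt ..
  also have "\<dots> <-> (EX q W. q \<in> W & vwin I K W & vinit I (fst q) & xzero I q)"
  proof -
    have "fst q \<in> ustates I" if "q \<in> W" "vwin I K W" for q W using that P unfolding bs by auto
    then show ?thesis using xinits_eq(2) by blast
  qed
  also have "\<dots> <-> (EX u W. vinit I u & vwin I K W & (u, replicate (npr I) 0) \<in> W)"
    unfolding xzero_eq by (metis fst_conv prod.collapse snd_conv)
  finally show ?thesis .
qed

end

end

section \<open>Decoding inputs\<close>

type_synonym token = "bool \<times> bool"

definition tok :: "bool list => token list" where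
  "tok x = map (%i. (nth_default False x (2 * i), nth_default False x (2 * i + 1))) [0..<length x div 2]"

lemma tok_Cons2: "tok (a # b # x) = (a, b) # tok x"
  by (simp add: tok_def upt_conv_Cons map_Suc_upt[symmetric] o_def del: upt_Suc)

lemma tok_Nil [simp]: "tok [] = []"
  by (simp add: tok_def)

lemma tok_append: "even (length x) ==> tok (x @ y) = tok x @ tok y"
proof (induction x rule: induct_list012)
  case (3 a b x)
  then show ?case by (simp add: tok_Cons2)
qed auto

text \<open>The state consists of the bracket depth, the current group in reverse and the finished
  groups in reverse. The outermost brackets are dropped. A closing bracket at depth 0, possible only
  in malformed text, is treated as one at depth 1.\<close>

definition gstep :: "token => nat \<times> token list \<times> token list list => nat \<times> token list \<times> token list list" where
  "gstep t s = (if fst t & ~ snd t then (Suc (fst s), if fst s = 0 then [] else t # fst (snd s), snd (snd s))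
     else if fst t & snd t then
       (if fst s <= 1 then (0, [], rev (fst (snd s)) # snd (snd s)) else (fst s - 1, t # fst (snd s), snd (snd s)))
     else (fst s, t # fst (snd s), snd (snd s)))"

definition groups :: "token list => token list list" where
  "groups ts = rev (snd (snd (fold gstep ts (0, [], []))))"

definition balanced :: "bool list => bool" where
  "balanced x <-> even (length x) &
     (ALL d c out. fold gstep (tok x) (Suc d, c, out) = (Suc d, rev (tok x) @ c, out))"

lemma balanced_Nil: "balanced []"
  by (simp add: balanced_def)

lemma balanced_digit: "balanced [False, b]"
  by (simp add: balanced_def tok_Cons2 gstep_def)

lemma balanced_append: "balanced x ==> balanced y ==> balanced (x @ y)"
  by (simp add: balanced_def tok_append)

lemma balanced_group: "balanced x ==> balanced (enc_group x)"
  by (simp add: balanced_def enc_group_def tok_append tok_Cons2 gstep_def)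

lemma balanced_concat: "\<forall>y\<in>set ys. balanced y ==> balanced (concat ys)"
  by (induction ys) (simp_all add: balanced_Nil balanced_append)

lemma balanced_digits: "balanced (enc_digits n)"
proof (induction n rule: less_induct)
  case (less n)
  show ?case
  proof (cases "n = 0")
    case False
    then show ?thesis
      using balanced_append[OF balanced_digit[of "odd n"] less[of "n div 2"]] by (simp add: enc_digits.simps[of n])
  qed (simp add: enc_digits.simps balanced_Nil)
qed

lemma groups_concat:
  assumes "\<forall>g\<in>set gs. balanced g"
  shows "groups (tok (concat (map enc_group gs))) = map tok gs"
proof -
  have "EX c'. fold gstep (tok (concat (map enc_group gs))) (0, c, out) = (0, c', rev (map tok gs) @ out)" for c out
    using assms
  proof (induction gs arbitrary: c out)
    case (Cons g gs)
    have "even (length (enc_group g))" using balanced_group[of g] Cons.prems by (simp add: balanced_def)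
    moreover have "fold gstep (tok (enc_group g)) (0, c, out) = (0, [], tok g # out)"
      using Cons.prems by (simp add: balanced_def enc_group_def tok_append tok_Cons2 gstep_def)
    ultimately show ?case using Cons by (simp add: tok_append)
  qed simp
  from this[of "[]" "[]"] show ?thesis by (auto simp: groups_def)
qed

definition dec_nat :: "nat => token list => nat" where
  "dec_nat N ts = fold (%t v. min N (2 * v + (if snd t then 1 else 0))) (rev ts) 0"

text \<open>A decoded number is unary and may be exponential in the length of its code, so decoding
  is capped by \<open>N\<close> to stay polynomial. It is exact for codes whose length is at most
  the binary logarithm of \<open>N\<close>, a condition that passes to all parts of a code.\<close>

definition dec_ok :: "nat => (token list => 'a) => ('a => bool list) => bool" where
  "dec_ok N D f <-> (ALL x. 2 ^ length (f x) <= N --> (EX g. f x = enc_group g & balanced g & D (tok g) = x))"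

lemma nat_less_digits: "n < 2 ^ length (enc_digits n)"
proof (induction n rule: less_induct)
  case (less n)
  show ?case
  proof (cases "n = 0")
    case False
    then have "n div 2 < 2 ^ length (enc_digits (n div 2))" by (intro less) auto
    then have "n < 2 * 2 ^ length (enc_digits (n div 2))" by linarith
    also have "\<dots> <= 2 ^ length (enc_digits n)" using False by (subst (2) enc_digits.simps) simp
    finally show ?thesis .
  qed simp
qed

lemma dec_nat_digits: "n <= N ==> dec_nat N (tok (enc_digits n)) = n"
proof (induction n rule: less_induct)
  case (less n)
  show ?case
  proof (cases "n = 0")
    case False
    then have "dec_nat N (tok (enc_digits (n div 2))) = n div 2" using less by auto
    moreover have "min N (2 * (n div 2) + (if odd n then 1 else 0)) = n" using less.prems by simp
    ultimately show ?thesis using False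
      by (simp add: enc_digits.simps[of n] tok_Cons2 dec_nat_def)
  qed (simp add: enc_digits.simps dec_nat_def)
qed

lemma dec_ok_nat: "dec_ok N (dec_nat N) enc_nat"
  unfolding dec_ok_def
proof (intro allI impI exI conjI)
  fix n assume *: "2 ^ length (enc_nat n) <= N"
  show "enc_nat n = enc_group (enc_digits n)" by (simp add: enc_nat_def)
  show "balanced (enc_digits n)" by (rule balanced_digits)
  have "(2::nat) ^ length (enc_digits n) <= 2 ^ length (enc_nat n)"
    by (intro power_increasing) (simp_all add: enc_nat_def enc_group_def)
  then show "dec_nat N (tok (enc_digits n)) = n" 
    using nat_less_digits[of n] * by (intro dec_nat_digits) (meson le_trans less_imp_le)
qed

lemma dec_ok_part:
  assumes "dec_ok N D f" "2 ^ m <= N" "length (f x) <= m"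
  shows "EX g. f x = enc_group g & balanced g & D (tok g) = x"
proof -
  have "(2::nat) ^ length (f x) <= 2 ^ m" using assms(3) by (intro power_increasing) auto
  then have "2 ^ length (f x) <= N" using assms(2) by (rule le_trans)
  then show ?thesis using assms(1) unfolding dec_ok_def by blast
qed

lemma dec_ok_list:
  assumes D: "dec_ok N D f"
  shows "dec_ok N (%ts. map D (groups ts)) (enc_list f)"
  unfolding dec_ok_def
proof (intro allI impI)
  fix xs assume N: "2 ^ length (enc_list f xs) <= N"
  have "length (f x) <= length (enc_list f xs)" if "x \<in> set xs" for x
    using that member_le_sum_list[of "length (f x)" "map length (map f xs)"]
    by (simp add: enc_list_def enc_group_def length_concat image_image)
  then have "\<forall>x\<in>set xs. EX g. f x = enc_group g & balanced g & D (tok g) = x" using dec_ok_part[OF D N] by blast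
  then obtain g where g: "\<forall>x\<in>set xs. f x = enc_group (g x) & balanced (g x) & D (tok (g x)) = x" by metis
  then have m: "map f xs = map enc_group (map g xs)" "\<forall>y\<in>set (map g xs). balanced y" by auto
  have "groups (tok (concat (map f xs))) = map tok (map g xs)"
    unfolding m(1) by (rule groups_concat[OF m(2)])
  then have "map D (groups (tok (concat (map f xs)))) = xs" using g by (simp add: map_idI)
  moreover have "balanced (concat (map f xs))"
    unfolding m(1) by (rule balanced_concat) (use m(2) balanced_group in auto)
  ultimately show "EX h. enc_list f xs = enc_group h & balanced h & map D (groups (tok h)) = xs"
    by (auto simp: enc_list_def)
qed

abbreviation "grp ts i \<equiv> nth_default [] (groups ts) i"

definition dec_pair :: "nat => token list => nat \<times> nat" where
  "dec_pair N ts = (dec_nat N (grp ts 0), dec_nat N (grp ts 1))"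

definition dec_table :: "nat => token list => dpa_table" where
  "dec_table N ts = \<lparr>tab_init = dec_nat N (grp ts 0), tab_prio = map (dec_nat N) (groups (grp ts 1)),
     tab_trans = map (%t. map (dec_nat N) (groups t)) (groups (grp ts 2))\<rparr>"

definition dec_input :: "nat => token list => rp_input" where
  "dec_input N ts = \<lparr>inp_edges = map (dec_pair N) (groups (grp ts 0)), inp_owner = map (dec_nat N) (groups (grp ts 1)),
     inp_prefs = map (%t. map (dec_pair N) (groups t)) (groups (grp ts 2)),
     inp_auts = map (%t. map (dec_table N) (groups t)) (groups (grp ts 3)),
     inp_start = dec_nat N (grp ts 4), inp_constr = map (dec_nat N) (groups (grp ts 5))\<rparr>"

lemma dec_ok_pair: "dec_ok N (dec_pair N) enc_pair"
  unfolding dec_ok_def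
proof (intro allI impI)
  fix e assume N: "2 ^ length (enc_pair e) <= N"
  have l: "length (enc_nat (fst e)) <= length (enc_pair e)" "length (enc_nat (snd e)) <= length (enc_pair e)"
    by (simp_all add: enc_pair_def enc_group_def)
  obtain g where g: "enc_nat (fst e) = enc_group g" "balanced g" "dec_nat N (tok g) = fst e"
    using dec_ok_part[OF dec_ok_nat N l(1)] by blast
  obtain h where h: "enc_nat (snd e) = enc_group h" "balanced h" "dec_nat N (tok h) = snd e"
    using dec_ok_part[OF dec_ok_nat N l(2)] by blast
  have "groups (tok (enc_group g @ enc_group h)) = [tok g, tok h]" using groups_concat[of "[g, h]"] g h by simp
  then show "EX k. enc_pair e = enc_group k & balanced k & dec_pair N (tok k) = e"
    using g h by (intro exI[of _ "enc_group g @ enc_group h"])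
      (simp add: enc_pair_def dec_pair_def balanced_append balanced_group nth_default_Cons)
qed

lemma dec_ok_table: "dec_ok N (dec_table N) enc_table"
  unfolding dec_ok_def
proof (intro allI impI)
  fix T assume N: "2 ^ length (enc_table T) <= N"
  have l: "length (enc_nat (tab_init T)) <= length (enc_table T)" "length (enc_list enc_nat (tab_prio T)) <= length (enc_table T)"
    "length (enc_list (enc_list enc_nat) (tab_trans T)) <= length (enc_table T)"
    by (simp_all add: enc_table_def enc_group_def)
  note D = dec_ok_nat[of N] dec_ok_list[OF dec_ok_nat[of N]] dec_ok_list[OF dec_ok_list[OF dec_ok_nat[of N]]]
  obtain g where g: "enc_nat (tab_init T) = enc_group g" "balanced g" "dec_nat N (tok g) = tab_init T"
    using dec_ok_part[OF D(1) N l(1)] by blast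
  obtain h where h: "enc_list enc_nat (tab_prio T) = enc_group h" "balanced h" "map (dec_nat N) (groups (tok h)) = tab_prio T"
    using dec_ok_part[OF D(2) N l(2)] by blast
  obtain k where k: "enc_list (enc_list enc_nat) (tab_trans T) = enc_group k" "balanced k"
    "map (%ts. map (dec_nat N) (groups ts)) (groups (tok k)) = tab_trans T"
    using dec_ok_part[OF D(3) N l(3)] by blast
  have "groups (tok (enc_group g @ enc_group h @ enc_group k)) = [tok g, tok h, tok k]"
    using groups_concat[of "[g, h, k]"] g h k by simp
  then show "EX k. enc_table T = enc_group k & balanced k & dec_table N (tok k) = T"
    using g h k by (intro exI[of _ "enc_group g @ enc_group h @ enc_group k"])
      (simp add: enc_table_def dec_table_def balanced_append balanced_group nth_default_Cons numeral_2_eq_2)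
qed

lemma dec_input_enc:
  assumes N: "2 ^ length (enc_input I) <= N"
  shows "dec_input N (grp (tok (enc_input I)) 0) = I"
proof -
  have l: "length (enc_list enc_pair (inp_edges I)) <= length (enc_input I)" "length (enc_list enc_nat (inp_owner I)) <= length (enc_input I)"
    "length (enc_list (enc_list enc_pair) (inp_prefs I)) <= length (enc_input I)"
    "length (enc_list (enc_list enc_table) (inp_auts I)) <= length (enc_input I)"
    "length (enc_nat (inp_start I)) <= length (enc_input I)" "length (enc_list enc_nat (inp_constr I)) <= length (enc_input I)"
    by (simp_all add: enc_input_def enc_group_def)
  note D = dec_ok_nat[of N] dec_ok_list[OF dec_ok_nat[of N]] dec_ok_list[OF dec_ok_pair[of N]] dec_ok_list[OF dec_ok_list[OF dec_ok_pair[of N]]]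
    dec_ok_list[OF dec_ok_list[OF dec_ok_table[of N]]]
  obtain a where a: "enc_list enc_pair (inp_edges I) = enc_group a" "balanced a" "map (dec_pair N) (groups (tok a)) = inp_edges I"
    using dec_ok_part[OF D(3) N l(1)] by blast
  obtain b where b: "enc_list enc_nat (inp_owner I) = enc_group b" "balanced b" "map (dec_nat N) (groups (tok b)) = inp_owner I"
    using dec_ok_part[OF D(2) N l(2)] by blast
  obtain c where c: "enc_list (enc_list enc_pair) (inp_prefs I) = enc_group c" "balanced c"
    "map (%t. map (dec_pair N) (groups t)) (groups (tok c)) = inp_prefs I"
    using dec_ok_part[OF D(4) N l(3)] by blast
  obtain d where d: "enc_list (enc_list enc_table) (inp_auts I) = enc_group d" "balanced d"
    "map (%t. map (dec_table N) (groups t)) (groups (tok d)) = inp_auts I"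
    using dec_ok_part[OF D(5) N l(4)] by blast
  obtain e where e: "enc_nat (inp_start I) = enc_group e" "balanced e" "dec_nat N (tok e) = inp_start I"
    using dec_ok_part[OF D(1) N l(5)] by blast
  obtain f where f: "enc_list enc_nat (inp_constr I) = enc_group f" "balanced f" "map (dec_nat N) (groups (tok f)) = inp_constr I"
    using dec_ok_part[OF D(2) N l(6)] by blast
  let ?x = "enc_group a @ enc_group b @ enc_group c @ enc_group d @ enc_group e @ enc_group f"
  have x: "enc_input I = enc_group ?x" unfolding enc_input_def a(1) b(1) c(1) d(1) e(1) f(1) ..
  have "balanced ?x" using a b c d e f by (simp add: balanced_append balanced_group)
  then have "grp (tok (enc_input I)) 0 = tok ?x" using groups_concat[of "[?x]"] by (simp add: x nth_default_Cons)
  moreover have "groups (tok ?x) = [tok a, tok b, tok c, tok d, tok e, tok f]"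
    using groups_concat[of "[a, b, c, d, e, f]"] a b c d e f by simp
  ultimately show ?thesis using a(3) b(3) c(3) d(3) e(3) f(3)
    by (simp add: dec_input_def nth_default_Cons eval_nat_numeral)
qed

lemma pf_tok [pf_intros]: "pf f ==> pf (%x. tok (f x))"
proof -
  assume "pf f"
  moreover have "pf tok" unfolding tok_def by (intro pf_intros)
  ultimately show ?thesis by (rule pf_comp[rotated])
qed

lemma pf_groups [pf_intros]: "pf f ==> pf (%x. groups (f x))"
proof -
  have t: "esize t <= 7" for t :: token by (cases t; cases "fst t"; cases "snd t") auto
  have one: "esize (gstep t s) <= esize s + 12" for t s
    using t[of t] esize_pos[of "fst (snd s)"] by (cases s) (auto simp: gstep_def esize_rev)
  have B: "esize (fold gstep ts s) <= esize s + 12 * length ts" for ts s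
  proof (induction ts arbitrary: s)
    case (Cons a ts)
    show ?case using Cons[of "gstep a s"] one[of a s] by simp
  qed simp
  have "pf (%ts. fold gstep ts (0, [], []))"
  proof (rule pf_fold[of "%_. gstep" _ _ "%n. 12 * n + 5"])
    show "pf (%z. gstep (fst (snd z)) (snd (snd z)))" unfolding gstep_def by (intro pf_intros)
    fix ts :: "token list" and k
    have "length (take k ts) <= esize ts" using length_le_esize[of ts] by simp
    then show "esize (fold gstep (take k ts) (0, [], [])) <= 12 * esize ts + 5"
      using B[of "take k ts" "(0, [], [])"] by simp
  qed (intro pf_intros pbd_intros)+
  then have "pf groups" unfolding groups_def by (intro pf_intros)
  then show "pf f ==> ?thesis" by (rule pf_comp)
qed

lemma pf_dec_nat [pf_intros]: "pf n ==> pf f ==> pf (%x. dec_nat (n x) (f x))"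
proof -
  have "pf (%z::nat \<times> token list. fold (%t v. min (fst z) (2 * v + (if snd t then 1 else 0))) (rev (snd z)) 0)"
  proof (rule pf_fold[of _ _ _ "%n. 2 * n + 1"])
    fix z :: "nat \<times> token list" and k
    have le: "fold (%t v. min (fst z) (2 * v + (if snd t then 1 else 0))) ts 0 <= fst z" for ts :: "token list"
      by (induction ts rule: rev_induct) auto
    have "fst z <= esize z" by (cases z) auto
    from le_trans[OF le this] show "esize (fold (%t v. min (fst z) (2 * v + (if snd t then 1 else 0))) (take k (rev (snd z))) 0) <= 2 * esize z + 1"
      by simp
  qed (intro pf_intros pbd_intros)+
  from pf_comp[OF this, of "%x. (n x, f x)"] show "pf n ==> pf f ==> ?thesis"
    by (simp add: pf_intros dec_nat_def)
qed

lemma pf_dec [pf_intros]: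
  "pf n ==> pf f ==> pf (%x. dec_pair (n x) (f x))" "pf n ==> pf f ==> pf (%x. dec_table (n x) (f x))"
proof -
  have "pf (%z. dec_pair (fst z) (snd z))" "pf (%z. dec_table (fst z) (snd z))"
    unfolding dec_pair_def dec_table_def by (intro pf_intros)+
  note p = this
  show "pf n ==> pf f ==> pf (%x. dec_pair (n x) (f x))" "pf n ==> pf f ==> pf (%x. dec_table (n x) (f x))"
    using pf_comp[OF p(1), of "%x. (n x, f x)"] pf_comp[OF p(2), of "%x. (n x, f x)"] by (simp_all add: pf_intros)
qed

lemma pf_dec_input: "pf (%z. dec_input (fst z) (snd z))"
  unfolding dec_input_def by (intro pf_intros)

lemma pf_enc_table [pf_intros]: "pf f ==> pf (%x. enc_table (f x))"
proof -
  have "pf enc_table" unfolding enc_table_def by (intro pf_intros)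
  then show "pf f ==> ?thesis" by (rule pf_comp)
qed

lemma pf_enc_input: "pf enc_input"
  unfolding enc_input_def by (intro pf_intros)

section \<open>Membership in EXPTIME\<close>

lemma length_enc_list: "length (enc_list f xs) = 4 + sum_list (map (%x. length (f x)) xs)"
  by (simp add: enc_list_def enc_group_def length_concat o_def)

lemma length_le_enc_list: "(!!x. 0 < length (f x)) ==> length xs <= length (enc_list f xs)"
proof -
  assume f: "!!x. 0 < length (f x)"
  have "length xs <= sum_list (map (%x. length (f x)) xs)"
    using sum_list_mono[of xs "%_. 1" "%x. length (f x)"] f by (simp add: sum_list_triv Suc_le_eq)
  then show ?thesis by (simp add: length_enc_list)
qed

lemma length_enc_pos [simp]: "0 < length (enc_nat n)" "0 < length (enc_list f xs)" "0 < length (enc_table T)"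
  by (simp_all add: enc_nat_def enc_list_def enc_table_def enc_group_def)

lemma map_nth_upt: "map (%i. f (xs ! i)) [0..<length xs] = map f xs"
  by (rule nth_equalityI) simp_all

lemma sum_list_concat_map: "sum_list (concat xss :: nat list) = sum_list (map sum_list xss)"
  by (induction xss) simp_all

text \<open>Every entry of an encoded list takes at least one bit, so the length of a list is
  bounded by the length of its code. The totals over nested lists are bounded by summing this over
  the entries.\<close>

lemma input_size:
  fixes I
  defines "L \<equiv> length (enc_input I)"
  shows "nve I <= L" "npl I <= L" "num_aut I <= L" "npr I <= L"
    "ka < num_aut I ==> length (tab_prio (aut_tab I ka)) <= L" "i < npl I ==> length (inp_auts I ! i) <= L"
proof -
  have auts: "length (enc_list (enc_list enc_table) (inp_auts I)) <= L" and own: "length (enc_list enc_nat (inp_owner I)) <= L"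
    by (simp_all add: L_def enc_input_def enc_group_def)
  show "nve I <= L" using length_le_enc_list[where f = enc_nat, OF length_enc_pos(1), of "inp_owner I"] own by simp
  show "npl I <= L" using length_le_enc_list[where f = "enc_list enc_table", OF length_enc_pos(2), of "inp_auts I"] auts by simp
  have prio: "length (tab_prio T) <= length (enc_table T)" for T
    using length_le_enc_list[where f = enc_nat, OF length_enc_pos(1), of "tab_prio T"] by (simp add: enc_table_def enc_group_def)
  have "num_aut I = sum_list (map (%i. length (inp_auts I ! i)) [0..<npl I])"
    by (simp add: autos_def length_concat o_def)
  also have "\<dots> = sum_list (map length (inp_auts I))" by (simp only: map_nth_upt)
  finally have nA: "num_aut I = sum_list (map length (inp_auts I))" .
  also have "\<dots> <= sum_list (map (%x. length (enc_list enc_table x)) (inp_auts I))"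
    by (intro sum_list_mono length_le_enc_list length_enc_pos)
  finally show "num_aut I <= L" using auts by (simp add: length_enc_list)
  have "npr I = sum_list (map (%ka. length (tab_prio (aut_tab I ka))) [0..<num_aut I])"
    by (simp add: pairs_def length_concat o_def)
  also have "\<dots> = sum_list (map (%y. length (tab_prio (snd (snd y)))) (autos I))"
    unfolding aut_tab_def by (simp only: map_nth_upt[of "%y. length (tab_prio (snd (snd y)))"])
  also have "\<dots> = sum_list (map (%i. sum_list (map (%p. length (tab_prio (inp_auts I ! i ! p))) [0..<length (inp_auts I ! i)])) [0..<npl I])"
    by (simp add: autos_def map_concat o_def sum_list_concat_map)
  also have "\<dots> = sum_list (map (%x. sum_list (map (%T. length (tab_prio T)) x)) (inp_auts I))"
    by (simp only: map_nth_upt[of "%T. length (tab_prio T)"] map_nth_upt[of "%x. sum_list (map (%T. length (tab_prio T)) x)"])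
  also have "\<dots> <= sum_list (map (%x. length (enc_list enc_table x)) (inp_auts I))"
    by (intro sum_list_mono) (simp add: length_enc_list le_SucI trans_le_add2 sum_list_mono prio)
  finally show "npr I <= L" using auts by (simp add: length_enc_list)
  have el: "length (enc_list enc_table (inp_auts I ! i)) <= L" if "i < npl I" for i
    using auts that member_le_sum_list[of "length (enc_list enc_table (inp_auts I ! i))" "map (%x. length (enc_list enc_table x)) (inp_auts I)"]
    by (simp add: length_enc_list)
  show "length (inp_auts I ! i) <= L" if "i < npl I"
    using el[OF that] length_le_enc_list[where f = enc_table, OF length_enc_pos(3), of "inp_auts I ! i"] by simp
  show "length (tab_prio (aut_tab I ka)) <= L" if "ka < num_aut I"
  proof -
    note a = aut_props[OF that]
    have "length (enc_table (aut_tab I ka)) <= length (enc_list enc_table (inp_auts I ! aut_pl I ka))"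
      using a member_le_sum_list[of "length (enc_table (aut_tab I ka))" "map (%x. length (enc_table x)) (inp_auts I ! aut_pl I ka)"]
      by (simp add: length_enc_list)
    then show ?thesis using prio[of "aut_tab I ka"] el[OF a(1)] by simp
  qed
qed

text \<open>With L the input length, a state has four components with at most \<open>2 ^ L\<close>
  values each and two with at most \<open>2 ^ (L * L)\<close>; the memory adds another
  \<open>2 ^ (L * L)\<close>, which gives the exponent \<open>3 * L * L + 4 * L\<close> for the
  counter bound. In \<open>time_exp\<close>, one more than this is multiplied by
  \<open>L + 1\<close>, because up to L counters are enumerated together.\<close>

definition card_exp :: "nat poly" where "card_exp = [:0, 4, 3:]"
definition time_exp :: "nat poly" where "time_exp = [:1, 4, 3:] * [:1, 1:]"

lemma exps: "poly card_exp L = 3 * L * L + 4 * L" "poly time_exp L = (3 * L * L + 4 * L + 1) * (L + 1)"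
  by (simp_all add: card_exp_def time_exp_def algebra_simps)

lemma states_bound:
  "card (ustates I) * 2 ^ (npr I * npr I) <= 2 ^ poly card_exp (length (enc_input I))"
proof -
  let ?L = "length (enc_input I)"
  note s = input_size[where I = I]
  have S: "Suc ?L <= 2 ^ ?L" by (simp add: Suc_leI)
  have P: "Suc ?L ^ m <= 2 ^ (?L * ?L)" if "m <= ?L" for m
  proof -
    have "Suc ?L ^ m <= Suc ?L ^ ?L" using that by (intro power_increasing) auto
    also have "\<dots> <= (2 ^ ?L) ^ ?L" using S by (intro power_mono) auto
    finally show ?thesis by (simp add: power_mult)
  qed
  have "card (ustates I) <= Suc ?L * (Suc ?L * (Suc ?L ^ num_aut I * (Suc ?L ^ npl I * (2 ^ num_aut I * Suc ?L))))"
    by (rule ustates_bound(2)) (use s in auto)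
  also have "\<dots> <= 2 ^ ?L * (2 ^ ?L * (2 ^ (?L * ?L) * (2 ^ (?L * ?L) * (2 ^ ?L * 2 ^ ?L))))"
    by (intro mult_mono S P s(2,3) power_increasing) (auto simp: s)
  finally have "card (ustates I) * 2 ^ (npr I * npr I) <=
      2 ^ ?L * (2 ^ ?L * (2 ^ (?L * ?L) * (2 ^ (?L * ?L) * (2 ^ ?L * 2 ^ ?L)))) * 2 ^ (?L * ?L)"
    by (intro mult_mono power_increasing mult_le_mono s(4)) auto
  also have "\<dots> = 2 ^ poly card_exp ?L"
    unfolding exps power_add[symmetric] by (rule arg_cong[of _ _ "(^) 2"]) (simp add: algebra_simps)
  finally show ?thesis .
qed

text \<open>The decoder is total and returns some input for any bit string. Encoding the result
  again and comparing it with the given string rejects everything that is not an encoding.\<close>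

definition decide :: "bool list \<times> nat => bool" where
  "decide z <-> (let I = dec_input (snd z) (grp (tok (fst z)) 0); L = length (fst z);
      K = cap_pow2 (snd z) (poly card_exp L) in
    enc_input I = fst z & xwf I & ~ xvwin (snd z) L K I & xuwin (snd z) L K I)"

lemma decide_correct: "x \<in> constrained_SPE_problem <-> decide (x, 2 ^ poly time_exp (length x))"
proof (cases "EX I. x = enc_input I")
  case True
  then obtain I where x: "x = enc_input I" by blast
  let ?L = "length x"
  let ?N = "2 ^ poly time_exp ?L" and ?K = "2 ^ poly card_exp ?L"
  note s = input_size[where I = I, folded x]
  have le: "(2::nat) ^ m <= ?N" if "m <= poly time_exp ?L" for m using that by (intro power_increasing) auto
  have "?L <= poly time_exp ?L" "poly card_exp ?L <= poly time_exp ?L" "?L * ?L <= poly time_exp ?L"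
    by (simp_all add: exps algebra_simps)
  note N = le[OF this(1)] le[OF this(2)] le[OF this(3)]
  have dec: "dec_input ?N (grp (tok x) 0) = I" using dec_input_enc[of I] N(1) x by simp
  have K: "cap_pow2 ?N (poly card_exp ?L) = ?K" using N(2) by (rule cap_pow2)
  have S: "Suc ?L ^ m <= ?N" if "m <= ?L" for m
  proof -
    have "Suc ?L ^ m <= (2 ^ ?L) ^ m" by (intro power_mono) (simp_all add: Suc_leI)
    also have "\<dots> <= 2 ^ (?L * ?L)" unfolding power_mult[symmetric] using that by (intro power_increasing) auto
    finally show ?thesis using N(3) by (rule le_trans)
  qed
  have "Suc ?K ^ npr I <= ?N"
  proof -
    have "Suc ?K <= 2 ^ (poly card_exp ?L + 1)" by (simp add: Suc_leI)
    then have "Suc ?K ^ npr I <= (2 ^ (poly card_exp ?L + 1)) ^ npr I" by (intro power_mono) auto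
    also have "\<dots> <= 2 ^ ((poly card_exp ?L + 1) * ?L)"
      unfolding power_mult[symmetric] using s(4) by (intro power_increasing mult_le_mono) auto
    also have "\<dots> <= ?N" by (intro power_increasing) (simp_all add: exps)
    finally show ?thesis .
  qed
  moreover have "(2::nat) ^ num_aut I <= 2 ^ ?L" using s(3) by (intro power_increasing) auto
  then have "(2::nat) ^ num_aut I <= ?N" using N(1) by (rule le_trans)
  ultimately have P: "wf_input I ==> set (xpositions ?N ?L ?K I) = ustates I \<times> counts (npr I) ?K"
    by (intro set_xpositions S s) simp_all
  have "decide (x, ?N) <-> wf_input I & ~ xvwin ?N ?L ?K I & xuwin ?N ?L ?K I"
    unfolding decide_def Let_def fst_conv snd_conv dec K xwf_iff using x by simp
  also have "\<dots> <-> x \<in> constrained_SPE_problem"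
    unfolding x SPE_problem_iff[OF states_bound]
    using xuwin_iff[OF _ P] xvwin_iff[OF _ P] unfolding x by blast
  finally show ?thesis ..
next
  case False
  then have "x \<notin> constrained_SPE_problem" by (auto simp: constrained_SPE_problem_def)
  moreover have "~ decide (x, 2 ^ poly time_exp (length x))"
    using False unfolding decide_def Let_def fst_conv by metis
  ultimately show ?thesis by simp
qed

lemma pf_decide: "pf decide"
proof -
  have I: "pf (%z::bool list \<times> nat. dec_input (snd z) (grp (tok (fst z)) 0))"
    using pf_comp[OF pf_dec_input, of "%z. (snd z, grp (tok (fst z)) 0)"] by (simp add: pf_intros)
  have "pf (%z::bool list \<times> nat. (snd z, length (fst z), cap_pow2 (snd z) (poly card_exp (length (fst z))), dec_input (snd z) (grp (tok (fst z)) 0)))"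
    by (intro pf_intros I)
  note w = pf_comp[OF pf_xwin(1) this, unfolded fst_conv snd_conv] pf_comp[OF pf_xwin(2) this, unfolded fst_conv snd_conv]
  show ?thesis
    unfolding decide_def Let_def by (intro pf_conj pf_Not pf_eq_bool_list pf_fst[OF pf_ident] w pf_comp[OF pf_enc_input I] pf_comp[OF pf_xwf I])
qed

theorem constrained_SPE_in_EXPTIME: "constrained_SPE_problem \<in> EXPTIME"
proof -
  have "constrained_SPE_problem = {x. decide (x, 2 ^ poly time_exp (length x))}" using decide_correct by blast
  then show ?thesis using pf_EXPTIME[OF pf_decide, of time_exp] by (simp only:)
qed

theorem theorem5:
  shows "EXPTIME_complete constrained_SPE_problem \<and>
         EXPTIME_hard_on three_payoff_instances constrained_SPE_problem"
proof -
  have "EXPTIME_hard_on UNIV L" if "EXPTIME_hard_on X L" for X L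
    unfolding EXPTIME_hard_on_def
  proof
    fix K assume K: "K \<in> EXPTIME"
    from bspec[OF that[unfolded EXPTIME_hard_on_def] K]
    obtain f where "polytime_computable f" "\<forall>x. f x \<in> X \<and> (x \<in> K \<longleftrightarrow> f x \<in> L)" by (elim exE conjE)
    then show "\<exists>f. polytime_computable f \<and> (\<forall>x. f x \<in> UNIV \<and> (x \<in> K \<longleftrightarrow> f x \<in> L))"
      by (intro exI[of _ f]) simp
  qed
  from this[OF EXPTIME_hard_three_payoffs] show ?thesis
    unfolding EXPTIME_complete_def
    by (intro conjI constrained_SPE_in_EXPTIME EXPTIME_hard_three_payoffs)
qed

end
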